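(* Let $n\ge1$. For all $k\in\mathbb N=\{0,1,2,\dots\}$, all $f\in\mathcal H^k(\mathbb R^n,\gamma_n)$ and all $q\in[1,2)$, $$\big\||\nabla^kf|\big\|_{L^2}^{2}\ \ge\ W^{\ge k}(f)\left[1+\frac{q}{2k(2-q)}\ln^+\left(\frac{W^{\ge k}(f)}{\sum_{\kappa\in\mathbb N^n:|\kappa|=k}\|D^\kappa f\|_{L^q}^2}\right)\right]^k,$$ and further, if $\|f\|_{L^\infty}\le1$ and $q\le p<2$, $$\big\||\nabla^kf|\big\|_{L^p}^{p}\ \ge\ C(p,q)^k\,W^{\ge k}(f)\left[1+\frac{q}{2k(2-q)}\ln^+\left(\frac{1}{\sum_{\kappa\in\mathbb N^n:|\kappa|=k}\|D^\kappa f\|_{L^q}^2}\right)\right]^{\frac{kp}{2}},$$ where $$C(p,q)=\Big(\frac{2}{2-q}M(p)^{-\frac2p}+\frac{pq}{2e(2-p)(2-q)}\Big)^{-\frac p2},\qquad M(p):=p\,2^{-\frac p2}\max_{x\ge0}\frac{1-e^{-x}}{x^{p/2}}.$$ Moreover there is an absolute constant $c>0$ with $C(p,q)\ge c\,(2-p)(2-q)$ for all $1\le q\le p<2$.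
   Context: $\gamma_n$ is the standard Gaussian measure on $\mathbb R^n$, with density $\varphi_n(x)=(2\pi)^{-n/2}e^{-|x|^2/2}$; all norms and inner products are with respect to $\gamma_n$. For $\kappa\in\mathbb N^n$, $|\kappa|=\sum_i\kappa_i$ and $D^\kappa:=\prod_{i=1}^n\frac{1}{\sqrt{\kappa_i!}}\partial_i^{\kappa_i}$ is the normalized weak partial derivative ($D^{0}$ is the identity). $\mathcal H^k(\mathbb R^n,\gamma_n):=\{f\in L^2(\gamma_n): D^\kappa f\in L^2(\gamma_n)\text{ for all }|\kappa|\le k\}$. $\nabla^kf:=(D^\kappa f)_{|\kappa|=k}$ and $|\nabla^kf|^2:=\sum_{|\kappa|=k}|D^\kappa f|^2$ (pointwise). For $f\in L^2(\gamma_n)$, $f^{\ge k}$ is the component of $f$ orthogonal in $L^2(\gamma_n)$ to the null space of $\nabla^k$ (polynomials of degree less than $k$), and $W^{\ge k}(f):=\|f^{\ge k}\|_{L^2}^2$; equivalently $W^{\ge k}(f)=\sum_{|\alpha|\ge k}\widehat f(\alpha)^2$, $\widehat f(\alpha)=\langle f,h_\alpha\rangle_{L^2}$, with $h_\alpha=(-1)^{|\alpha|}\varphi_n^{-1}D^\alpha\varphi_n$ the normalized Hermite polynomials. $\ln^+(x)=\max\{\ln x,0\}$. Conventions: the right-hand sides are $0$ if $W^{\ge k}(f)=0$; for $k=0$ a bracket raised to the power $0$ equals $1$. *)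

theory Defs
  imports "HOL-Analysis.Analysis"
begin

definition gauss :: "(real^'n) measure" where
  "gauss = density lborel
     (\<lambda>x. ennreal ((2 * pi) powr (- real CARD('n) / 2) * exp (- (norm x)\<^sup>2 / 2)))"

definition L2_gauss :: "(real^'n \<Rightarrow> real) set" where
  "L2_gauss = {f. f \<in> borel_measurable gauss \<and> integrable gauss (\<lambda>x. (f x)\<^sup>2)}"

text \<open>The integral is a Bochner integral, so this is the norm only for functions that do lie
  in the corresponding space (it is \<open>0\<close> otherwise). As \<^const>\<open>gauss\<close> is a probability measure, this
  covers all functions in \<^const>\<open>L2_gauss\<close> when \<open>1 \<le> p \<le> 2\<close>.\<close>

definition Lp_norm :: "real \<Rightarrow> (real^'n \<Rightarrow> real) \<Rightarrow> real" where
  "Lp_norm p f = (LINT x|gauss. \<bar>f x\<bar> powr p) powr (1 / p)"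

definition mi_size :: "('n::finite \<Rightarrow> nat) \<Rightarrow> nat" where
  "mi_size \<kappa> = (\<Sum>i\<in>UNIV. \<kappa> i)"

definition partial_deriv :: "'n \<Rightarrow> (real^'n \<Rightarrow> real) \<Rightarrow> real^'n \<Rightarrow> real" where
  "partial_deriv i f x = frechet_derivative f (at x) (axis i 1)"

text \<open>Infinitely differentiable with compact support: every iterated partial derivative exists
  and is (totally) differentiable, hence continuous.\<close>

definition test_function :: "(real^'n \<Rightarrow> real) \<Rightarrow> bool" where
  "test_function \<phi> \<longleftrightarrow>
     (\<forall>is. foldr partial_deriv is \<phi> differentiable_on UNIV) \<and> compact (closure {x. \<phi> x \<noteq> 0})"

definition locally_integrable :: "(real^'n \<Rightarrow> real) \<Rightarrow> bool" where
  "locally_integrable f \<longleftrightarrow>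
     f \<in> borel_measurable lborel \<and> (\<forall>K. compact K \<longrightarrow> set_integrable lborel K f)"

text \<open>The unnormalized weak derivative for the multi-index \<open>\<kappa>\<close>. The index type carries no order, so
  the classical derivative of the test function is taken along every list \<open>is\<close> of directions
  in which each \<open>i\<close> occurs \<open>\<kappa> i\<close> times; the result does not depend on the list, by the symmetry of
  mixed partial derivatives.\<close>

definition has_weak_deriv ::
    "('n::finite \<Rightarrow> nat) \<Rightarrow> (real^'n \<Rightarrow> real) \<Rightarrow> (real^'n \<Rightarrow> real) \<Rightarrow> bool" where
  "has_weak_deriv \<kappa> f g \<longleftrightarrow>
     locally_integrable f \<and> locally_integrable g \<and>
     (\<forall>\<phi> is. test_function \<phi> \<longrightarrow> (\<forall>i. count_list is i = \<kappa> i) \<longrightarrow>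
        (LINT x|lborel. f x * foldr partial_deriv is \<phi> x) =
        (-1) ^ mi_size \<kappa> * (LINT x|lborel. g x * \<phi> x))"

text \<open>The normalized weak derivative. Weak derivatives are determined only almost everywhere; for
  \<open>\<kappa> = 0\<close> the chosen representative is the function itself.\<close>

definition weak_D :: "('n::finite \<Rightarrow> nat) \<Rightarrow> (real^'n \<Rightarrow> real) \<Rightarrow> real^'n \<Rightarrow> real" where
  "weak_D \<kappa> f =
     (if \<kappa> = (\<lambda>i. 0) then f
      else (\<lambda>x. (\<Prod>i\<in>UNIV. 1 / sqrt (fact (\<kappa> i))) * (SOME g. has_weak_deriv \<kappa> f g) x))"

definition gauss_sobolev :: "nat \<Rightarrow> (real^'n \<Rightarrow> real) set" where
  "gauss_sobolev k =
     {f \<in> L2_gauss. \<forall>\<kappa>. mi_size \<kappa> \<le> k \<longrightarrow> (\<exists>g. has_weak_deriv \<kappa> f g) \<and> weak_D \<kappa> f \<in> L2_gauss}"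

definition grad_norm :: "nat \<Rightarrow> (real^'n \<Rightarrow> real) \<Rightarrow> real^'n \<Rightarrow> real" where
  "grad_norm k f x = sqrt (\<Sum>\<kappa> | mi_size \<kappa> = k. (weak_D \<kappa> f x)\<^sup>2)"

definition grad_null_space :: "nat \<Rightarrow> (real^'n \<Rightarrow> real) set" where
  "grad_null_space k =
     {g \<in> gauss_sobolev k. \<forall>\<kappa>. mi_size \<kappa> = k \<longrightarrow> (AE x in gauss. weak_D \<kappa> g x = 0)}"

text \<open>The component of \<open>f\<close> orthogonal to \<^const>\<open>grad_null_space\<close>, unique up to null sets.\<close>

definition high_part :: "nat \<Rightarrow> (real^'n \<Rightarrow> real) \<Rightarrow> real^'n \<Rightarrow> real" where
  "high_part k f =
     (SOME h. h \<in> L2_gauss \<and> (\<lambda>x. f x - h x) \<in> grad_null_space k \<and>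
        (\<forall>g\<in>grad_null_space k. (LINT x|gauss. h x * g x) = 0))"

definition high_weight :: "nat \<Rightarrow> (real^'n \<Rightarrow> real) \<Rightarrow> real" where
  "high_weight k f = (Lp_norm 2 (high_part k f))\<^sup>2"

definition ln_plus :: "real \<Rightarrow> real" where
  "ln_plus x = max (ln x) 0"

text \<open>For \<open>1 \<le> p < 2\<close> the supremum is a maximum: the quotient is continuous on the positive reals and
  tends to \<open>0\<close> at both ends. At \<open>x = 0\<close> it evaluates to \<open>0 / 0 = 0\<close>, its continuous extension.\<close>

definition M_const :: "real \<Rightarrow> real" where
  "M_const p = p * 2 powr (- p / 2) * (SUP x\<in>{0..}. (1 - exp (- x)) / x powr (p / 2))"

definition C_const :: "real \<Rightarrow> real \<Rightarrow> real" where
  "C_const p q =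
     (2 / (2 - q) * M_const p powr (- 2 / p) + p * q / (2 * exp 1 * (2 - p) * (2 - q))) powr (- p / 2)"

end

theory Submission
  imports Defs "HOL-Probability.Probability"
begin

text \<open>
  Write \<open>a\<^sub>m\<close> for the energy of \<open>f\<close> on level \<open>m\<close> of its Hermite expansion, that is, the sum of the squared
  coefficients with indices of size \<open>m\<close>. The derivatives of order \<open>k\<close> shift the coefficients, and their
  total energy on level \<open>l\<close> is \<open>(l + k choose k) * a\<^sub>l\<^sub>+\<^sub>k\<close> (\<open>sobolev_energy\<close>). Hence the weight of \<open>f\<close> from
  level \<open>k\<close> on is \<open>W = (\<Sum>l. a\<^sub>l\<^sub>+\<^sub>k)\<close>, and the squared norm of the gradient is \<open>\<Phi> 1\<close>, where
  \<open>\<Phi> s = (\<Sum>l. (l + k choose k) * s ^ l * a\<^sub>l\<^sub>+\<^sub>k)\<close> is at the same time the sum over \<open>\<kappa>\<close> of the inner products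
  of \<open>D\<^sup>\<kappa> f\<close> with \<open>T\<^sub>s (D\<^sup>\<kappa> f)\<close>, for the Ornstein--Uhlenbeck operators \<open>T\<^sub>s\<close>.

  For the first inequality, Gaussian hypercontractivity, interpolation between \<open>L\<^sup>q\<close> and \<open>L\<^sup>2\<close>, and the
  inequality of weighted means give, for all \<open>R > 0\<close>, the bound
  \<open>\<Phi> (z * s) \<le> R powr (- \<theta>) * (\<theta> * R * Q + (1 - \<theta>) * \<Phi> s)\<close> with \<open>\<theta> = q / (2 - q) * (1 - z) / (1 + z)\<close> and \<open>Q\<close> the
  sum of the squared \<open>L\<^sup>q\<close> norms of the derivatives (\<open>deriv_hyper\<close>). This is affine in \<open>\<Phi>\<close>, so it can be
  integrated against \<open>k * (1 - s) ^ (k - 1)\<close>, which turns all binomial coefficients into \<open>1\<close>. With \<open>R = W / Q\<close> the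
  result is the decay estimate \<open>(\<Sum>l. a\<^sub>l\<^sub>+\<^sub>k * z ^ l) \<le> W * (W / Q) powr (- \<theta>)\<close> (\<open>decay\<close>). Its derivative at \<open>z = 1\<close>
  bounds the mean level from below, and since \<open>(l + k choose k) \<ge> (1 + l / k) ^ k\<close>, Jensen's inequality
  yields the claim (\<open>L2_lower_bound\<close>). Taking the powers only after averaging over the levels is what produces the
  bracket to the power \<open>k\<close>.

  For the second inequality, let \<open>\<bar>f\<bar> \<le> 1\<close>. Then \<open>T\<^sub>s (D\<^sup>\<kappa> f)\<close> at \<open>x\<close> is \<open>(1 - s\<^sup>2) powr (- k / 2)\<close> times a
  Hermite coefficient of the function \<open>y \<mapsto> f (s x + sqrt (1 - s\<^sup>2) y)\<close>, so by Bessel's inequality the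
  vector of these values has norm at most \<open>(1 - s\<^sup>2) powr (- k / 2)\<close>. Therefore
  \<open>\<Phi> s \<le> P * (1 - s\<^sup>2) powr (- k * (1 - p / 2))\<close>, where \<open>P\<close> is the \<open>p\<close>-th power of the \<open>L\<^sup>p\<close> norm of the gradient
  (\<open>Phi_bound\<close>). Integrating this over \<open>[u, 1]\<close> turns the binomial coefficients into binomial tails
  (\<open>tail_upper_bound\<close>), and these are large enough on the levels that carry the weight, by
  \<open>binom_tail_ge\<close>, the decay estimate and Jensen's inequality (\<open>level_lower_bound\<close>). The optimal \<open>u\<close> brings in the
  constant \<open>M p\<close>. Finally \<open>W\<close> is removed from the logarithm by using the result for both exponents
  \<open>q\<close> and \<open>p\<close> and Minkowski's inequality (\<open>Lp_lower_bound\<close>, \<open>minkowski_grad\<close>).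

  Hypercontractivity itself is the two-point inequality (\<open>two_point\<close>), tensorized along
  correlated random walks (\<open>walk2_hypercontractive\<close>). For trigonometric polynomials the limit of these
  walks is computed explicitly on cosines (\<open>bilinear_limit\<close>); they are dense in \<open>L\<^sup>2\<close> (\<open>trig_dense\<close>), and
  Bessel's and Parseval's formulas come out of the same limit at \<open>s = 1\<close>. Weak derivatives enter only
  through integration by parts against Hermite functions with arbitrary centre and scale
  (\<open>weak_deriv_hermite\<close>).
\<close>

section \<open>Tangents and weighted means\<close>

lemma weighted_am_gm:
  fixes x y \<theta> :: real
  assumes "0 \<le> x" "0 \<le> y" "0 \<le> \<theta>" "\<theta> \<le> 1"
  shows "x powr \<theta> * y powr (1 - \<theta>) \<le> \<theta> * x + (1 - \<theta>) * y"
proof (cases "x = 0 \<or> y = 0")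
  case True
  then show ?thesis using assms by auto
next
  case False
  then show ?thesis using Youngs_inequality_0[of \<theta> "1 - \<theta>" x y] assms by auto
qed

lemma powr_ge_tangent:
  fixes x c p :: real
  assumes "1 \<le> p" "0 < c" "0 \<le> x"
  shows "c powr p + p * c powr (p - 1) * (x - c) \<le> x powr p"
proof (cases "x = 0")
  case True
  have "c powr (p - 1) * c = c powr p" using assms by (simp add: powr_mult_base[symmetric] powr_diff)
  then have "c powr p + p * c powr (p - 1) * (x - c) = (1 - p) * c powr p"
    using True by (simp add: algebra_simps)
  then show ?thesis using assms True by (simp add: mult_nonpos_nonneg)
next
  case False
  have "x powr p - c powr p \<ge> p * c powr (p - 1) * (x - c)"
  proof (rule convex_on_imp_above_tangent[of "{0<..}"])
    show "convex_on {0<..} (\<lambda>x. x powr p)" using assms by (intro powr_convex)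
    show "((\<lambda>x. x powr p) has_real_derivative p * c powr (p - 1)) (at c within {0<..})"
      using has_field_derivative_at_within[OF has_real_derivative_powr[OF assms(2)]] .
    show "connected {0::real<..}" by simp
  qed (use assms False in \<open>auto simp: interior_open\<close>)
  then show ?thesis by simp
qed

text \<open>With \<open>c\<close> the mean of \<open>x\<close> this is Jensen's inequality for a power; in the tangent form it can be
summed against any weights, whatever their total mass.\<close>

lemma power_ge_tangent:
  fixes x c :: real
  assumes "0 < c" "0 \<le> x"
  shows "c ^ k + real k * c ^ (k - 1) * (x - c) \<le> x ^ k"
proof (cases "k = 0 \<or> x = 0")
  case True
  then show ?thesis
  proof
    assume x: "x = 0"
    have "c ^ k + real k * c ^ (k - 1) * (x - c) = (1 - real k) * c ^ k"
      using x by (cases k) (auto simp: algebra_simps)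
    then show ?thesis using x assms by (cases k) (auto simp: mult_nonpos_nonneg)
  qed simp
next
  case False
  then obtain j where j: "k = Suc j" by (cases k) auto
  have "c powr real k + real k * c powr real j * (x - c) \<le> x powr real k"
    using powr_ge_tangent[of "real k" c x] assms j by simp
  moreover have "c powr real k = c ^ k" "c powr real j = c ^ j" "x powr real k = x ^ k"
    using False assms powr_realpow[of c] powr_realpow[of x] by auto
  ultimately show ?thesis using j by simp
qed

section \<open>The two-point inequality\<close>

text \<open>Both sides agree to second order at \<open>b = 0\<close>. The derivative of the right-hand side is controlled by
the increment of \<open>t powr s\<close> from \<open>1 - b\<close> to \<open>1 + b\<close>, which is at least \<open>2 * s * b\<close> because
the values of \<open>t powr (s - 1)\<close> at \<open>1 + x\<close> and \<open>1 - x\<close>, for \<open>0 \<le> x < 1\<close>, have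
product at least \<open>1\<close>, hence sum at least \<open>2\<close>.\<close>

lemma two_point_unit:
  fixes b s :: real
  assumes s: "0 \<le> s" "s \<le> 1" and b: "0 \<le> b" "b \<le> 1"
  shows "1 + (1 + s) * s / 2 * b\<^sup>2 \<le> ((1 + b) powr (1 + s) + (1 - b) powr (1 + s)) / 2"
proof -
  have chi: "2 * s * b \<le> (1 + b) powr s - (1 - b) powr s" if "0 \<le> b" "b < 1" for b :: real
  proof -
    have "(\<lambda>b. (1 + b) powr s - (1 - b) powr s - 2 * s * b) 0
        \<le> (\<lambda>b. (1 + b) powr s - (1 - b) powr s - 2 * s * b) b"
    proof (rule DERIV_nonneg_imp_nondecreasing[where f = "\<lambda>b. (1 + b) powr s - (1 - b) powr s - 2 * s * b"])
      fix x assume x: "0 \<le> x" "x \<le> b"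
      let ?u = "(1 + x) powr (s - 1)" and ?v = "(1 - x) powr (s - 1)"
      have "?u * ?v = (1 - x\<^sup>2) powr (s - 1)"
        using x that by (subst powr_mult[symmetric]) (auto simp: algebra_simps power2_eq_square)
      also have "\<dots> \<ge> 1"
      proof -
        have "1 - x\<^sup>2 > 0" using x that by (simp add: power_strict_mono abs_square_less_1)
        then show ?thesis using s powr_mono'[of "s - 1" 0 "1 - x\<^sup>2"] by auto
      qed
      finally have "1 \<le> ?u * ?v" .
      then have "4 \<le> (?u + ?v)\<^sup>2"
        using sum_squares_ge_zero[of "?u - ?v" 0] by (simp add: power2_eq_square algebra_simps)
      then have "2 \<le> ?u + ?v"
        using power2_le_imp_le[of 2 "?u + ?v"] by simp
      then have ge: "0 \<le> s * (?u + ?v - 2)" using s by simp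
      have "((\<lambda>b. (1 + b) powr s - (1 - b) powr s - 2 * s * b) has_real_derivative
          s * ?u * 1 - s * ?v * (-1) - 2 * s) (at x)"
        using x that by (auto intro!: derivative_eq_intros)
      also have "s * ?u * 1 - s * ?v * (-1) - 2 * s = s * (?u + ?v - 2)" by algebra
      finally show "\<exists>y. ((\<lambda>b. (1 + b) powr s - (1 - b) powr s - 2 * s * b) has_real_derivative y) (at x) \<and> 0 \<le> y"
        using ge by blast
    qed (use that in auto)
    then show ?thesis by simp
  qed
  let ?f = "\<lambda>b. ((1 + b) powr (1 + s) + (1 - b) powr (1 + s)) / 2 - (1 + (1 + s) * s / 2 * b\<^sup>2)"
  have "?f 0 \<le> ?f b"
  proof (rule DERIV_nonneg_imp_increasing_open[OF b(1), where f = ?f])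
    fix x assume x: "0 < x" "x < b"
    have "(?f has_real_derivative ((1 + s) * (1 + x) powr s + (1 + s) * (1 - x) powr s * (-1)) / 2
        - (1 + s) * s / 2 * (2 * x)) (at x)"
      using x b by (auto intro!: derivative_eq_intros)
    also have "((1 + s) * (1 + x) powr s + (1 + s) * (1 - x) powr s * (-1)) / 2
        - (1 + s) * s / 2 * (2 * x) = (1 + s) / 2 * ((1 + x) powr s - (1 - x) powr s - 2 * s * x)"
      by (simp add: field_simps)
    finally have d: "(?f has_real_derivative (1 + s) / 2 * ((1 + x) powr s - (1 - x) powr s - 2 * s * x)) (at x)" .
    have "0 \<le> (1 + s) / 2 * ((1 + x) powr s - (1 - x) powr s - 2 * s * x)"
      using chi[of x] x b s by auto
    with d show "\<exists>y. (?f has_real_derivative y) (at x) \<and> 0 \<le> y" by blast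
  next
    show "continuous_on {0..b} ?f"
      using b s by (intro continuous_intros continuous_on_powr') auto
  qed
  then show ?thesis by simp
qed

text \<open>The hypercontractive inequality of Bonami on the two-point space, for a function with values
\<open>a + b\<close> and \<open>a - b\<close> and the noise parameter \<open>sqrt s\<close>, from exponent \<open>1 + s\<close> to exponent \<open>2\<close>. By
symmetry and homogeneity it reduces to \<open>0 \<le> b \<le> a = 1\<close>.\<close>

lemma two_point:
  fixes a b s :: real
  assumes s: "0 \<le> s" "s \<le> 1"
  shows "a\<^sup>2 + s * b\<^sup>2 \<le> ((\<bar>a + b\<bar> powr (1 + s) + \<bar>a - b\<bar> powr (1 + s)) / 2) powr (2 / (1 + s))"
proof -
  have main: "a\<^sup>2 + s * b\<^sup>2 \<le> ((\<bar>a + b\<bar> powr (1 + s) + \<bar>a - b\<bar> powr (1 + s)) / 2) powr (2 / (1 + s))"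
    if ab: "0 \<le> b" "b \<le> a" for a b :: real
  proof (cases "a = 0")
    case True
    then show ?thesis using ab s by simp
  next
    case False
    then have a: "a > 0" using ab by simp
    define t where "t = b / a"
    have t: "0 \<le> t" "t \<le> 1" "b = a * t" using a ab by (auto simp: t_def)
    let ?r = "1 + s"
    have "1 + s * t\<^sup>2 \<le> (1 + ?r * s / 2 * t\<^sup>2) powr (2 / ?r)"
    proof -
      have "1 powr (2/?r) + 2/?r * 1 powr (2/?r - 1) * (1 + ?r * s / 2 * t\<^sup>2 - 1) \<le> (1 + ?r * s / 2 * t\<^sup>2) powr (2 / ?r)"
        using s t by (intro powr_ge_tangent) (auto simp: field_simps)
      moreover have "2/?r * (1 + ?r * s / 2 * t\<^sup>2 - 1) = s * t\<^sup>2" using s by (simp add: field_simps)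
      ultimately show ?thesis by simp
    qed
    also have "\<dots> \<le> (((1 + t) powr ?r + (1 - t) powr ?r) / 2) powr (2 / ?r)"
      using two_point_unit[OF s t(1,2)] s t by (intro powr_mono2) auto
    finally have *: "1 + s * t\<^sup>2 \<le> (((1 + t) powr ?r + (1 - t) powr ?r) / 2) powr (2 / ?r)" .
    have "\<bar>a + b\<bar> powr ?r = a powr ?r * (1 + t) powr ?r"
      using a t by (subst powr_mult[symmetric]) (auto simp: algebra_simps)
    moreover have "\<bar>a - b\<bar> powr ?r = a powr ?r * (1 - t) powr ?r"
    proof -
      have "\<bar>a - b\<bar> = a * (1 - t)" using a t by (simp add: algebra_simps mult_left_le)
      then show ?thesis using a t by (simp add: powr_mult)
    qed
    ultimately have "((\<bar>a + b\<bar> powr ?r + \<bar>a - b\<bar> powr ?r) / 2) powr (2 / ?r)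
       = (a powr ?r * (((1 + t) powr ?r + (1 - t) powr ?r) / 2)) powr (2 / ?r)"
      by (simp add: algebra_simps add_divide_distrib)
    also have "\<dots> = a\<^sup>2 * (((1 + t) powr ?r + (1 - t) powr ?r) / 2) powr (2 / ?r)"
    proof -
      have "(1 + s) * (2 / (1 + s)) = 2" using s by (simp add: field_simps)
      then have "(a powr ?r) powr (2 / ?r) = a\<^sup>2" using a by (simp only: powr_powr) simp
      then show ?thesis using a s t by (subst powr_mult) auto
    qed
    also have "\<dots> \<ge> a\<^sup>2 * (1 + s * t\<^sup>2)"
      using * by (intro mult_left_mono) auto
    also have "a\<^sup>2 * (1 + s * t\<^sup>2) = a\<^sup>2 + s * b\<^sup>2" using t by (simp add: algebra_simps power2_eq_square)
    finally show ?thesis .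
  qed
  have m2: "a\<^sup>2 + s * b\<^sup>2 \<le> ((\<bar>a + b\<bar> powr (1 + s) + \<bar>a - b\<bar> powr (1 + s)) / 2) powr (2 / (1 + s))"
    if ab: "0 \<le> a" "0 \<le> b" for a b :: real
  proof (cases "b \<le> a")
    case True
    then show ?thesis using main ab by auto
  next
    case False
    have "(1 - s) * a\<^sup>2 \<le> (1 - s) * b\<^sup>2"
      using False ab s by (intro mult_left_mono power_mono) auto
    then have "a\<^sup>2 + s * b\<^sup>2 \<le> b\<^sup>2 + s * a\<^sup>2" by (simp add: algebra_simps)
    also have "\<dots> \<le> ((\<bar>b + a\<bar> powr (1 + s) + \<bar>b - a\<bar> powr (1 + s)) / 2) powr (2 / (1 + s))"
      using main[of a b] False ab by auto
    finally show ?thesis by (simp add: add.commute abs_minus_commute)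
  qed
  have "\<bar>\<bar>a\<bar> + \<bar>b\<bar>\<bar> powr (1 + s) + \<bar>\<bar>a\<bar> - \<bar>b\<bar>\<bar> powr (1 + s) = \<bar>a + b\<bar> powr (1 + s) + \<bar>a - b\<bar> powr (1 + s)"
  proof -
    have "(\<bar>\<bar>a\<bar> + \<bar>b\<bar>\<bar> = \<bar>a + b\<bar> \<and> \<bar>\<bar>a\<bar> - \<bar>b\<bar>\<bar> = \<bar>a - b\<bar>) \<or> (\<bar>\<bar>a\<bar> + \<bar>b\<bar>\<bar> = \<bar>a - b\<bar> \<and> \<bar>\<bar>a\<bar> - \<bar>b\<bar>\<bar> = \<bar>a + b\<bar>)"
      by arith
    then show ?thesis by (elim disjE conjE) simp_all
  qed
  then show ?thesis using m2[of "\<bar>a\<bar>" "\<bar>b\<bar>"] by simp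
qed

section \<open>Binomial tails\<close>

text \<open>The probability that a binomial variable with parameters \<open>m\<close> and \<open>t\<close> is at least \<open>k\<close>.\<close>

definition binom_tail :: "nat \<Rightarrow> nat \<Rightarrow> real \<Rightarrow> real" where
  "binom_tail m k t = 1 - (\<Sum>j<k. real (m choose j) * t ^ j * (1 - t) ^ (m - j))"

lemma binom_tail_0: "1 \<le> k \<Longrightarrow> binom_tail m k 0 = 0"
proof -
  assume "1 \<le> k"
  then have "(\<Sum>j<k. real (m choose j) * 0 ^ j * (1 - 0) ^ (m - j)) = (\<Sum>j\<in>{0}. real (m choose j) * 0 ^ j * (1 - 0) ^ (m - j))"
    by (intro sum.mono_neutral_right) (auto simp: power_0_left)
  then show ?thesis by (simp add: binom_tail_def)
qed

lemma binom_tail_1: "k \<le> m \<Longrightarrow> binom_tail m k 1 = 1"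
  by (auto simp: binom_tail_def power_0_left intro!: sum.neutral)

text \<open>The sum of derivatives telescopes. This is why binomial tails occur here: integrating
\<open>(m choose k) * s ^ (m - k)\<close> against \<open>k * (1 - s) ^ (k - 1)\<close> over \<open>[u, 1]\<close> gives
\<open>binom_tail m k (1 - u)\<close>.\<close>

lemma has_derivative_binom_tail:
  assumes "1 \<le> k" "k \<le> m"
  shows "(binom_tail m k has_real_derivative
    real k * real (m choose k) * t ^ (k - 1) * (1 - t) ^ (m - k)) (at t)"
  using assms
proof (induction k)
  case 0
  then show ?case by simp
next
  case (Suc k)
  show ?case
  proof (cases "k = 0")
    case True
    have "binom_tail m (Suc k) = (\<lambda>t. 1 - (1 - t) ^ m)" using True by (auto simp: binom_tail_def)
    then show ?thesis using True by (auto intro!: derivative_eq_intros)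
  next
    case False
    then have IH: "(binom_tail m k has_real_derivative
      real k * real (m choose k) * t ^ (k - 1) * (1 - t) ^ (m - k)) (at t)" using Suc by auto
    have eq: "binom_tail m (Suc k) = (\<lambda>t. binom_tail m k t - real (m choose k) * t ^ k * (1 - t) ^ (m - k))"
      by (auto simp: binom_tail_def)
    have b: "Suc k * (m choose Suc k) = (m - k) * (m choose k)"
      by (simp only: binomial_absorb_comp binomial_absorption)
    have b': "real (Suc k) * real (m choose Suc k) = real (m - k) * real (m choose k)"
      using b by (metis of_nat_mult)
    have pw: "(1 - t) ^ (m - k - 1) = (1 - t) ^ (m - Suc k)" by simp
    have d1: "((\<lambda>t. t ^ k) has_real_derivative real k * t ^ (k - 1)) (at t)"
      using DERIV_pow[of k t UNIV] by simp
    have d2: "((\<lambda>t. (1 - t) ^ (m - k)) has_real_derivative real (m - k) * (1 - t) ^ (m - k - 1) * (- 1)) (at t)"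
      by (auto intro!: derivative_eq_intros)
    have "((\<lambda>t. binom_tail m k t - real (m choose k) * t ^ k * (1 - t) ^ (m - k)) has_real_derivative
      real k * real (m choose k) * t ^ (k - 1) * (1 - t) ^ (m - k) -
      (real (m choose k) * (real k * t ^ (k - 1)) * (1 - t) ^ (m - k) +
       (real (m - k) * (1 - t) ^ (m - k - 1) * (- 1)) * (real (m choose k) * t ^ k))) (at t)"
      by (rule DERIV_diff[OF IH DERIV_mult[OF DERIV_cmult[OF d1] d2]])
    also have "real k * real (m choose k) * t ^ (k - 1) * (1 - t) ^ (m - k) -
      (real (m choose k) * (real k * t ^ (k - 1)) * (1 - t) ^ (m - k) +
       (real (m - k) * (1 - t) ^ (m - k - 1) * (- 1)) * (real (m choose k) * t ^ k))
      = (real (m - k) * real (m choose k)) * t ^ k * (1 - t) ^ (m - Suc k)"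
      unfolding pw by algebra
    finally show ?thesis unfolding eq b'[symmetric] diff_Suc_1 .
  qed
qed

lemma power_chord_mono:
  fixes z w r :: real
  assumes "1 < z" "z \<le> w" "1 \<le> r"
  shows "(z powr r - 1) * (w - 1) \<le> (w powr r - 1) * (z - 1)"
proof -
  define l where "l = (z - 1) / (w - 1)"
  have l: "0 \<le> l" "l \<le> 1" "l * (w - 1) = z - 1" using assms by (auto simp: l_def field_simps)
  have "((1 - l) *\<^sub>R 1 + l *\<^sub>R w) powr r \<le> (1 - l) * 1 powr r + l * w powr r"
    using powr_convex[OF assms(3)] l assms by (intro convex_onD) auto
  moreover have "(1 - l) *\<^sub>R 1 + l *\<^sub>R w = z" using l by (simp add: algebra_simps)
  ultimately have "z powr r - 1 \<le> l * (w powr r - 1)" by (simp add: algebra_simps)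
  then have "(z powr r - 1) * (w - 1) \<le> l * (w powr r - 1) * (w - 1)"
    using assms by (intro mult_right_mono) auto
  also have "\<dots> = (w powr r - 1) * (l * (w - 1))" by (simp add: algebra_simps)
  finally show ?thesis using l by simp
qed

text \<open>Both sides agree at \<open>t = 0\<close> and \<open>t = 1\<close>, and the quotient of their derivatives is decreasing. So if the
inequality failed at \<open>t\<close>, the mean value theorem on \<open>[0, t]\<close> would give a quotient less than \<open>1\<close>
there, and on \<open>[t, 1]\<close> a quotient greater than \<open>1\<close>.\<close>

lemma binom_tail_ge:
  assumes k: "1 \<le> k" "k \<le> m" and t: "0 < t" "t < 1"
  shows "(1 - (1 - t) powr (real m / real k)) ^ k \<le> binom_tail m k t"
proof -
  define r where "r = real m / real k"
  have r: "1 \<le> r" using k by (simp add: r_def)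
  have rk: "r * real k = real m" using k by (simp add: r_def)
  define f where "f = binom_tail m k"
  define g where "g t = (1 - (1 - t) powr r) ^ k" for t :: real
  define f' where "f' t = real k * real (m choose k) * t ^ (k - 1) * (1 - t) ^ (m - k)" for t :: real
  define g' where "g' t = real m * (1 - t) powr (r - 1) * (1 - (1 - t) powr r) ^ (k - 1)" for t :: real
  define c where "c = real k * real (m choose k) / real m"
  define h where "h t = t * (1 - t) powr (r - 1) / (1 - (1 - t) powr r)" for t :: real
  have m: "real m > 0" using k by simp
  have c: "c > 0" using k m by (simp add: c_def zero_less_binomial)
  have f: "(f has_real_derivative f' t) (at t)" for t
    unfolding f_def f'_def by (rule has_derivative_binom_tail[OF k])
  have g: "(g has_real_derivative g' t) (at t)" if "0 < t" "t < 1" for t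
  proof -
    have d: "((\<lambda>t. 1 - (1 - t) powr r) has_real_derivative r * (1 - t) powr (r - 1)) (at t)"
      using that by (auto intro!: derivative_eq_intros)
    have "((\<lambda>t. (1 - (1 - t) powr r) ^ k) has_real_derivative
       of_nat k * (r * (1 - t) powr (r - 1) * (1 - (1 - t) powr r) ^ (k - Suc 0))) (at t)"
      by (rule DERIV_power[OF d])
    also have "of_nat k * (r * (1 - t) powr (r - 1) * (1 - (1 - t) powr r) ^ (k - Suc 0)) = (r * real k) * (1 - t) powr (r - 1) * (1 - (1 - t) powr r) ^ (k - 1)"
      by simp
    finally show ?thesis unfolding g_def[abs_def] g'_def rk .
  qed
  have lt1: "0 < (1 - t) powr r" "(1 - t) powr r < 1" if "0 < t" "t < 1" for t :: real
    using that r powr_less_mono2[of r "1 - t" 1] by auto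
  have g'pos: "g' t > 0" if "0 < t" "t < 1" for t
    unfolding g'_def using lt1[OF that] that m by (intro mult_pos_pos zero_less_power) auto
  have hpos: "h t > 0" if "0 < t" "t < 1" for t
    unfolding h_def using lt1[OF that] that by auto
  have fg: "f' t = c * h t ^ (k - 1) * g' t" if "0 < t" "t < 1" for t
  proof -
    have "(1 - t) ^ (m - k) = (1 - t) powr (r - 1) * ((1 - t) powr (r - 1)) ^ (k - 1)"
    proof -
      have "(1 - t) powr (r - 1) * ((1 - t) powr (r - 1)) ^ (k - 1) = ((1 - t) powr (r - 1)) ^ k"
        using k by (cases k) auto
      also have "\<dots> = (1 - t) powr ((r - 1) * real k)"
        using that by (subst powr_realpow[symmetric]) (auto simp: powr_powr)
      also have "(r - 1) * real k = real (m - k)" using k rk by (simp add: algebra_simps of_nat_diff)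
      also have "(1 - t) powr real (m - k) = (1 - t) ^ (m - k)" using that by (intro powr_realpow) auto
      finally show ?thesis ..
    qed
    moreover have "(1 - (1 - t) powr r) ^ (k - 1) \<noteq> 0" "(1 - t) powr r \<noteq> 1" using lt1[OF that] by auto
    ultimately show ?thesis using m
      unfolding f'_def c_def g'_def h_def by (simp add: power_divide power_mult_distrib)
  qed
  have hmono: "h t2 \<le> h t1" if "0 < t1" "t1 \<le> t2" "t2 < 1" for t1 t2
  proof -
    \<comment> \<open>in the variable \<open>z\<close> the function \<open>h\<close> is the reciprocal of the slope of a chord of \<open>z powr r\<close>\<close>
    have *: "h t = (z - 1) / (z powr r - 1)" if "0 < t" "t < 1" "z = 1 / (1 - t)" for t z
    proof -
      have z: "z powr r = 1 / (1 - t) powr r" using that by (simp add: powr_divide)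
      have "(1 - t) powr r = (1 - t) powr (r - 1) * (1 - t)" using that
        by (simp add: powr_mult_base[symmetric] powr_diff)
      then have "h t = (t / (1 - t)) * (1 - t) powr r / (1 - (1 - t) powr r)"
        using that by (simp add: h_def)
      also have "t / (1 - t) = z - 1" using that by (simp add: field_simps)
      also have "(z - 1) * (1 - t) powr r / (1 - (1 - t) powr r) = (z - 1) / (z powr r - 1)"
        using lt1[of t] that(1,2) unfolding z by (simp add: field_simps)
      finally show ?thesis .
    qed
    define z1 z2 where "z1 = 1 / (1 - t1)" and "z2 = 1 / (1 - t2)"
    have z: "1 < z1" "z1 \<le> z2" using that by (auto simp: z1_def z2_def field_simps)
    have zr: "z1 powr r > 1" "z2 powr r > 1"
      using z r powr_less_mono2[of r 1 z1] powr_less_mono2[of r 1 z2] by auto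
    have "h t1 = (z1 - 1) / (z1 powr r - 1)" "h t2 = (z2 - 1) / (z2 powr r - 1)"
      using *[of t1 z1] *[of t2 z2] that by (auto simp: z1_def z2_def)
    moreover have "(z2 - 1) / (z2 powr r - 1) \<le> (z1 - 1) / (z1 powr r - 1)"
      using power_chord_mono[OF z r] zr by (simp add: divide_simps mult.commute)
    ultimately show ?thesis by simp
  qed
  have cf: "continuous_on {a..b} f" for a b
    using f by (meson DERIV_isCont continuous_at_imp_continuous_on)
  have cg: "continuous_on {a..b} g" if "0 \<le> a" "b \<le> 1" for a b
    unfolding g_def[abs_def] using that r by (intro continuous_intros continuous_on_powr') auto
  have cauchy: "\<exists>x. a < x \<and> x < b \<and> f b - f a = (g b - g a) * (c * h x ^ (k - 1))"
    if ab: "0 \<le> a" "a < b" "b \<le> 1" for a b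
  proof -
    let ?F = "\<lambda>x. (f b - f a) * g x - (g b - g a) * f x"
    have "\<exists>z>a. z < b \<and> (?F has_real_derivative 0) (at z)"
    proof (rule Rolle[where f = ?F])
      show "continuous_on {a..b} ?F" using ab cf cg by (intro continuous_intros) auto
      show "?F differentiable at x" if "a < x" "x < b" for x
        unfolding real_differentiable_def
        using DERIV_diff[OF DERIV_cmult[OF g[of x]] DERIV_cmult[OF f[of x]]] that ab by fastforce
    qed (use ab in \<open>auto simp: algebra_simps\<close>)
    then obtain z where z: "a < z" "z < b" "(?F has_real_derivative 0) (at z)" by auto
    have "(?F has_real_derivative (f b - f a) * g' z - (g b - g a) * f' z) (at z)"
      using z ab by (intro DERIV_diff DERIV_cmult f g) auto
    then have "(f b - f a) * g' z - (g b - g a) * f' z = 0" using z DERIV_unique by blast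
    then have "(f b - f a) * g' z = (g b - g a) * (c * h z ^ (k - 1)) * g' z"
      using fg[of z] z ab by simp
    then have "f b - f a = (g b - g a) * (c * h z ^ (k - 1))"
      using g'pos[of z] z ab by simp
    then show ?thesis using z by blast
  qed
  have f01: "f 0 = 0" "f 1 = 1" using k binom_tail_0 binom_tail_1 by (auto simp: f_def)
  have g01: "g 0 = 0" "g 1 = 1" using k r by (auto simp: g_def)
  obtain x where x: "0 < x" "x < t" "f t = g t * (c * h x ^ (k - 1))"
    using cauchy[of 0 t] t f01 g01 by auto
  obtain y where y: "t < y" "y < 1" "1 - f t = (1 - g t) * (c * h y ^ (k - 1))"
    using cauchy[of t 1] t f01 g01 by auto
  have "h y ^ (k - 1) \<le> h x ^ (k - 1)"
    using hmono[of x y] hpos[of y] x y t by (intro power_mono) auto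
  then have le: "c * h y ^ (k - 1) \<le> c * h x ^ (k - 1)" using c by simp
  have gt: "0 < g t" "g t < 1"
    using lt1[OF t] k by (auto simp: g_def power_less_one_iff)
  have "g t \<le> f t"
  proof (rule ccontr)
    assume "\<not> g t \<le> f t"
    then have "g t * (c * h x ^ (k - 1)) < g t * 1" using x by simp
    then have "c * h x ^ (k - 1) < 1" using gt mult_less_cancel_left_pos by blast
    then have "c * h y ^ (k - 1) \<le> 1" using le by simp
    then have "(1 - g t) * (c * h y ^ (k - 1)) \<le> (1 - g t) * 1" using gt by (intro mult_left_mono) auto
    then show False using y \<open>\<not> g t \<le> f t\<close> by simp
  qed
  then show ?thesis by (simp add: f_def g_def r_def)
qed

section \<open>Weights on the levels: the quadratic bound\<close>

text \<open>This is the exponent that results from interpolating between the exponents \<open>q\<close> and \<open>2\<close> at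
\<open>1 + z\<close>, the exponent at which hypercontractivity controls \<open>\<Sum>m. z ^ m * a\<^sub>m\<close> (here \<open>a\<^sub>m\<close> is the
energy on level \<open>m\<close>).\<close>

definition rate :: "real \<Rightarrow> real \<Rightarrow> real" where
  "rate q z = q / (2 - q) * ((1 - z) / (1 + z))"

text \<open>The part of the argument that no longer sees the function: \<open>b l\<close> stands for the energy of \<open>f\<close> on the
level \<open>l + k\<close> of its Hermite expansion. Then \<open>W\<close> is the weight of the levels from \<open>k\<close> on,
\<open>Phi 1\<close> is the squared \<open>L\<^sup>2\<close> norm of the \<open>k\<close>-th gradient, and \<open>Phi s\<close> is the same quantity after
level \<open>l\<close> of each derivative has been damped by \<open>s ^ l\<close>.\<close>

locale level_weights =
  fixes k :: nat and b :: "nat \<Rightarrow> real"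
  assumes k: "1 \<le> k" and b: "\<And>l. 0 \<le> b l"
    and summable_top: "summable (\<lambda>l. real ((l + k) choose k) * b l)"
begin

definition W :: real where "W = (\<Sum>l. b l)"

definition Phi :: "real \<Rightarrow> real" where "Phi s = (\<Sum>l. real ((l + k) choose k) * s ^ l * b l)"

text \<open>What hypercontractivity of the derivatives amounts to, with \<open>Q\<close> the sum of their squared \<open>L\<^sup>q\<close> norms.
The free parameter \<open>R\<close> linearizes the product \<open>Q powr \<theta> * Phi s powr (1 - \<theta>)\<close>; being affine in \<open>Phi\<close>,
the bound can be integrated over \<open>s\<close>.\<close>

definition hyper :: "real \<Rightarrow> real \<Rightarrow> bool" where
  "hyper q Q \<longleftrightarrow> (\<forall>z s R. 0 < z \<longrightarrow> z < 1 \<longrightarrow> 0 < s \<longrightarrow> s < 1 \<longrightarrow> 0 < R \<longrightarrow> rate q z \<le> 1 \<longrightarrow>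
     Phi (z * s) \<le> R powr (- rate q z) * (rate q z * R * Q + (1 - rate q z) * Phi s))"

lemma binom_ge: "(1 + real l / real k) ^ k \<le> real ((l + k) choose k)"
proof -
  have "(real (l + k) / real k) ^ k \<le> real ((l + k) choose k)"
    by (rule binomial_ge_n_over_k_pow_k) simp
  then show ?thesis using k by (simp add: add_divide_distrib add.commute)
qed

lemma binom_ge1: "1 \<le> real ((l + k) choose k)"
proof -
  have "1 \<le> ((l + k) choose k)" by (simp add: Suc_le_eq)
  then show ?thesis by linarith
qed

lemma summable_b: "summable b"
  by (rule summable_comparison_test'[OF summable_top, of 0])
    (use b binom_ge1 mult_right_mono[OF binom_ge1 b] in auto)

lemma summable_geo: "0 \<le> z \<Longrightarrow> z \<le> 1 \<Longrightarrow> summable (\<lambda>l. b l * z ^ l)"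
  by (rule summable_comparison_test'[OF summable_b, of 0])
    (use b in \<open>auto intro!: mult_left_le power_le_one simp: abs_mult\<close>)

lemma summable_Phi: "0 \<le> s \<Longrightarrow> s \<le> 1 \<Longrightarrow> summable (\<lambda>l. real ((l + k) choose k) * s ^ l * b l)"
  by (rule summable_comparison_test'[OF summable_top, of 0])
    (use b in \<open>auto intro!: mult_right_mono mult_left_le mult_left_le_one_le power_le_one simp: abs_mult\<close>)

lemma summable_first: "summable (\<lambda>l. real l * b l)"
proof (rule summable_comparison_test'[OF summable_mult[OF summable_top, of "real k"], of 0])
  fix l
  have "1 + real l / real k \<le> (1 + real l / real k) ^ k"
    using k by (intro self_le_power) auto
  also note binom_ge
  finally have "real l / real k \<le> real ((l + k) choose k)" by simp
  then have "real l \<le> real k * real ((l + k) choose k)" using k by (simp add: field_simps)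
  then have "real l * b l \<le> real k * real ((l + k) choose k) * b l" using b by (rule mult_right_mono)
  then show "norm (real l * b l) \<le> real k * (real ((l + k) choose k) * b l)" using b by (simp add: mult.assoc)
qed

lemma W_nonneg: "0 \<le> W" unfolding W_def by (rule suminf_nonneg[OF summable_b b])

lemma sum_le_W: "(\<Sum>l<N. b l) \<le> W"
  unfolding W_def using summable_b b by (intro sum_le_suminf) auto

lemma sum_le_Phi: "0 \<le> s \<Longrightarrow> s \<le> 1 \<Longrightarrow> (\<Sum>l<N. real ((l + k) choose k) * s ^ l * b l) \<le> Phi s"
  unfolding Phi_def using summable_Phi b by (intro sum_le_suminf) auto

lemma tail_deriv:
  "((\<lambda>s. binom_tail (l + k) k (1 - s)) has_real_derivative
     - (real k * (1 - s) ^ (k - 1) * (real ((l + k) choose k) * s ^ l))) (at s)"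
proof -
  have "((\<lambda>s. binom_tail (l + k) k (1 - s)) has_real_derivative
     real k * real ((l + k) choose k) * (1 - s) ^ (k - 1) * (1 - (1 - s)) ^ (l + k - k) * (0 - 1)) (at s)"
    using k by (intro DERIV_chain2[OF has_derivative_binom_tail]) (auto intro!: derivative_eq_intros)
  then show ?thesis by (simp add: algebra_simps)
qed

text \<open>Integration of the hypothesis against \<open>k * (1 - s) ^ (k - 1)\<close> over \<open>[0, 1]\<close> removes the binomial
coefficients from both sides. In place of an integral, the proof uses the antiderivatives
\<open>binom_tail\<close> and monotonicity.\<close>

lemma mixed_decay:
  assumes z: "0 \<le> z" "z \<le> 1" and AB: "0 \<le> A" "0 \<le> B"
    and H: "\<And>s. 0 < s \<Longrightarrow> s < 1 \<Longrightarrow> Phi (z * s) \<le> A + B * Phi s"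
  shows "(\<Sum>l. b l * z ^ l) \<le> A + B * W"
proof (rule suminf_le_const[OF summable_geo[OF z]])
  fix N
  have "(\<Sum>l<N. b l * z ^ l) \<le> A + B * W + e" if e: "e > 0" for e
  proof -
    define e' where "e' = e / (B + 1)"
    have e': "e' > 0" using e AB by (simp add: e'_def)
    have "B * e' \<le> e" using e AB by (simp add: e'_def field_simps)
    have "(\<lambda>n. \<Sum>l<n. real ((l + k) choose k) * b l) \<longlonglongrightarrow> (\<Sum>l. real ((l + k) choose k) * b l)"
      using summable_top by (rule summable_LIMSEQ)
    then obtain N' where N': "\<bar>(\<Sum>l<N'. real ((l + k) choose k) * b l) - (\<Sum>l. real ((l + k) choose k) * b l)\<bar> < e'"
      using e' LIMSEQ_D[of _ _ e'] by (metis order_refl real_norm_def)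
    \<comment> \<open>a partial sum of \<open>Phi\<close> serves for all \<open>s\<close>, so that only finitely many terms have to be integrated\<close>
    have Phi_le: "Phi s \<le> (\<Sum>l<N'. real ((l + k) choose k) * s ^ l * b l) + e'" if s: "0 \<le> s" "s \<le> 1" for s
    proof -
      have "Phi s = (\<Sum>l. real ((l + N' + k) choose k) * s ^ (l + N') * b (l + N')) + (\<Sum>l<N'. real ((l + k) choose k) * s ^ l * b l)"
        unfolding Phi_def by (rule suminf_split_initial_segment[OF summable_Phi[OF s]])
      moreover have "(\<Sum>l. real ((l + N' + k) choose k) * s ^ (l + N') * b (l + N')) \<le> (\<Sum>l. real ((l + N' + k) choose k) * b (l + N'))"
      proof (rule suminf_le)
        show "summable (\<lambda>l. real ((l + N' + k) choose k) * s ^ (l + N') * b (l + N'))"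
          using summable_ignore_initial_segment[OF summable_Phi[OF s], of N'] .
        show "summable (\<lambda>l. real ((l + N' + k) choose k) * b (l + N'))"
          using summable_ignore_initial_segment[OF summable_top, of N'] .
      qed (use s b in \<open>auto intro!: mult_right_mono mult_left_le mult_left_le_one_le power_le_one\<close>)
      moreover have "(\<Sum>l. real ((l + k) choose k) * b l) = (\<Sum>l. real ((l + N' + k) choose k) * b (l + N')) + (\<Sum>l<N'. real ((l + k) choose k) * b l)"
        by (rule suminf_split_initial_segment[OF summable_top])
      ultimately show ?thesis using N' by linarith
    qed
    let ?T = "\<lambda>l s. binom_tail (l + k) k (1 - s)"
    let ?D = "\<lambda>s. (\<Sum>l<N. b l * z ^ l * ?T l s) - (A + B * e') * (1 - s) ^ k - B * (\<Sum>l<N'. b l * ?T l s)"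
    let ?D' = "\<lambda>s. real k * (1 - s) ^ (k - 1) * ((A + B * e') + B * (\<Sum>l<N'. real ((l + k) choose k) * s ^ l * b l)
                - (\<Sum>l<N. real ((l + k) choose k) * (z * s) ^ l * b l))"
    have D: "(?D has_real_derivative ?D' s) (at s)" for s
    proof -
      have "(?D has_real_derivative (\<Sum>l<N. b l * z ^ l * (- (real k * (1 - s) ^ (k - 1) * (real ((l + k) choose k) * s ^ l))))
          - (A + B * e') * (of_nat k * ((0 - 1) * (1 - s) ^ (k - Suc 0)))
          - B * (\<Sum>l<N'. b l * (- (real k * (1 - s) ^ (k - 1) * (real ((l + k) choose k) * s ^ l))))) (at s)"
        by (intro DERIV_diff DERIV_sum DERIV_cmult DERIV_power tail_deriv DERIV_const DERIV_ident)
      also have "(\<Sum>l<N. b l * z ^ l * (- (real k * (1 - s) ^ (k - 1) * (real ((l + k) choose k) * s ^ l))))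
          = - (real k * (1 - s) ^ (k - 1)) * (\<Sum>l<N. real ((l + k) choose k) * (z * s) ^ l * b l)"
        unfolding sum_distrib_left by (intro sum.cong) (auto simp: power_mult_distrib)
      also have "(\<Sum>l<N'. b l * (- (real k * (1 - s) ^ (k - 1) * (real ((l + k) choose k) * s ^ l))))
          = - (real k * (1 - s) ^ (k - 1)) * (\<Sum>l<N'. real ((l + k) choose k) * s ^ l * b l)"
        unfolding sum_distrib_left by (intro sum.cong) auto
      finally show ?thesis by (rule DERIV_cong) (simp add: algebra_simps)
    qed
    have "?D 0 \<le> ?D 1"
    proof (rule DERIV_nonneg_imp_increasing_open[where f = ?D])
      show "continuous_on {0..1} ?D"
        using D by (meson DERIV_isCont continuous_at_imp_continuous_on)
      fix s :: real assume s: "0 < s" "s < 1"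
      have "(\<Sum>l<N. real ((l + k) choose k) * (z * s) ^ l * b l) \<le> Phi (z * s)"
        using z s by (intro sum_le_Phi) (auto intro: mult_le_one)
      also have "\<dots> \<le> A + B * Phi s" by (rule H[OF s])
      also have "\<dots> \<le> A + B * ((\<Sum>l<N'. real ((l + k) choose k) * s ^ l * b l) + e')"
        using Phi_le[of s] s AB by (intro add_left_mono mult_left_mono) auto
      finally have "0 \<le> ?D' s" using s by (intro mult_nonneg_nonneg) (auto simp: algebra_simps)
      then show "\<exists>y. (?D has_real_derivative y) (at s) \<and> 0 \<le> y" using D by blast
    qed simp
    moreover have "?T l 0 = 1" "?T l 1 = 0" for l using k by (auto simp: binom_tail_0 binom_tail_1)
    ultimately have "(\<Sum>l<N. b l * z ^ l) \<le> A + B * e' + B * (\<Sum>l<N'. b l)"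
      using k by (simp add: power_0_left)
    also have "\<dots> \<le> A + e + B * W"
      using \<open>B * e' \<le> e\<close> sum_le_W[of N'] AB by (intro add_mono mult_left_mono) auto
    finally show ?thesis by simp
  qed
  then show "(\<Sum>l<N. b l * z ^ l) \<le> A + B * W" by (rule field_le_epsilon)
qed

lemma rate_nonneg: "1 \<le> q \<Longrightarrow> q < 2 \<Longrightarrow> 0 \<le> z \<Longrightarrow> z \<le> 1 \<Longrightarrow> 0 \<le> rate q z"
  by (auto simp: rate_def)

text \<open>With \<open>R = W / Q\<close> the two terms of the integrated bound combine to \<open>W * R powr (- \<theta>)\<close>. If \<open>W < Q\<close> the
logarithm is truncated and the bound is trivial.\<close>

lemma decay:
  assumes h: "hyper q Q" and q: "1 \<le> q" "q < 2" and Q: "0 < Q" and W: "0 < W"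
    and z: "0 < z" "z < 1" "rate q z \<le> 1"
  shows "(\<Sum>l. b l * z ^ l) \<le> W * exp (- (rate q z * ln_plus (W / Q)))"
proof (cases "Q \<le> W")
  case False
  then have "ln_plus (W / Q) = 0" using W Q by (auto simp: ln_plus_def max_def)
  moreover have "(\<Sum>l. b l * z ^ l) \<le> W" unfolding W_def
    using z b by (intro suminf_le summable_geo summable_b) (auto intro!: mult_left_le power_le_one)
  ultimately show ?thesis by simp
next
  case True
  define t where "t = rate q z"
  define R where "R = W / Q"
  have t: "0 \<le> t" "t \<le> 1" using z rate_nonneg[OF q, of z] by (auto simp: t_def)
  have R: "R > 0" "R * Q = W" using W Q by (auto simp: R_def)
  have "(\<Sum>l. b l * z ^ l) \<le> R powr (- t) * (t * W) + (R powr (- t) * (1 - t)) * W"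
  proof (rule mixed_decay)
    fix s :: real assume s: "0 < s" "s < 1"
    have "Phi (z * s) \<le> R powr (- t) * (t * R * Q + (1 - t) * Phi s)"
      using h z s R unfolding hyper_def t_def by blast
    also have "t * R * Q = t * W" using R by (simp add: mult.assoc)
    finally show "Phi (z * s) \<le> R powr (- t) * (t * W) + (R powr (- t) * (1 - t)) * Phi s"
      by (simp add: algebra_simps)
  qed (use z t W in auto)
  also have "\<dots> = W * R powr (- t)" by (simp add: algebra_simps)
  also have "R powr (- t) = exp (- (t * ln R))" using R by (simp add: powr_def)
  also have "ln R = ln_plus (W / Q)" using True W Q by (simp add: ln_plus_def R_def ln_div)
  finally show ?thesis by (simp add: t_def)
qed

text \<open>Expanding the decay estimate at \<open>z = 1\<close> bounds the mean level \<open>(\<Sum>l. l * b l) / W\<close> from below by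
\<open>c * L / 2\<close>, where \<open>c = q / (2 - q)\<close> and \<open>L = ln_plus (W / Q)\<close>. The binomial coefficients in \<open>Phi 1\<close> dominate \<open>(1 + l / k) ^ k\<close>, and
Jensen's inequality for the \<open>k\<close>-th power finishes the proof.\<close>

lemma L2_lower_bound:
  assumes h: "hyper q Q" and q: "1 \<le> q" "q < 2" and Q: "0 < Q" and W: "0 < W"
  shows "W * (1 + q / (2 * real k * (2 - q)) * ln_plus (W / Q)) ^ k \<le> Phi 1"
proof -
  define L where "L = ln_plus (W / Q)"
  define c where "c = q / (2 - q)"
  have L: "L \<ge> 0" by (simp add: L_def ln_plus_def)
  have c: "c \<ge> 1" using q by (simp add: c_def)
  let ?E = "\<Sum>l. real l * b l"
  \<comment> \<open>the decay estimate at \<open>z = 1 - u\<close>, divided by \<open>u\<close>\<close>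
  have bound: "W * (c * L) / ((2 - u) + c * L * u) \<le> ?E" if u: "0 < u" "u < 1 / (c + 1)" for u
  proof -
    define z where "z = 1 - u"
    have "u * 1 \<le> u * (c + 1)" using u c by (intro mult_left_mono) auto
    moreover have "u * (c + 1) < 1" using u c by (simp add: field_simps)
    ultimately have "u < 1" by linarith
    then have z: "0 < z" "z < 1" using u by (auto simp: z_def)
    have rz: "rate q z = c * u / (2 - u)" by (simp add: rate_def c_def z_def)
    have "c * u \<le> 2 - u" using u c by (simp add: field_simps)
    then have "rate q z \<le> 1" using \<open>u < 1\<close> by (simp add: rz)
    note dec = decay[OF h q Q W z this, folded L_def]
    define y where "y = rate q z * L"
    have y: "y \<ge> 0" using L rate_nonneg[OF q, of z] z by (simp add: y_def)
    have "exp (- y) \<le> 1 / (1 + y)"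
      using exp_ge_add_one_self[of y] y by (simp add: exp_minus field_simps)
    then have "y / (1 + y) \<le> 1 - exp (- y)" using y by (simp add: field_simps)
    then have "W * (y / (1 + y)) \<le> W * (1 - exp (- y))" using W by (intro mult_left_mono) auto
    also have "\<dots> = W - W * exp (- y)" by (simp add: algebra_simps)
    also have "\<dots> \<le> W - (\<Sum>l. b l * z ^ l)" using dec by (simp add: y_def)
    also have "\<dots> = (\<Sum>l. b l - b l * z ^ l)"
      unfolding W_def using z by (intro suminf_diff summable_b summable_geo) auto
    also have "\<dots> \<le> (\<Sum>l. u * (real l * b l))"
    proof (intro suminf_le summable_diff summable_b summable_geo summable_mult summable_first)
      fix l
      have "1 + real l * (- u) \<le> (1 + (- u)) ^ l" using \<open>u < 1\<close> by (intro Bernoulli_inequality) auto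
      then have "1 - z ^ l \<le> u * real l" by (simp add: z_def mult.commute)
      then have "b l * (1 - z ^ l) \<le> b l * (u * real l)" using b by (intro mult_left_mono) auto
      then show "b l - b l * z ^ l \<le> u * (real l * b l)" by (simp add: algebra_simps)
    qed (use z in auto)
    also have "\<dots> = u * ?E" by (intro suminf_mult summable_first)
    finally have *: "W * (y / (1 + y)) \<le> u * ?E" .
    have "y / (1 + y) = u * (c * L / ((2 - u) + c * L * u))"
    proof -
      have d: "2 - u > 0" "2 - u + c * L * u > 0" using \<open>u < 1\<close> u c L by (auto intro!: add_pos_nonneg)
      have "1 + y = (2 - u + c * L * u) / (2 - u)" using d by (simp add: y_def rz field_simps)
      then show ?thesis using d by (simp add: y_def rz)
    qed
    then have "u * (W * (c * L) / ((2 - u) + c * L * u)) \<le> u * ?E" using * by (simp add: ac_simps)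
    then show ?thesis using mult_le_cancel_left_pos[OF u(1)] by blast
  qed
  have "((\<lambda>u. W * (c * L) / ((2 - u) + c * L * u)) \<longlongrightarrow> W * (c * L) / ((2 - 0) + c * L * 0)) (at_right 0)"
    by (intro tendsto_intros) auto
  moreover have "\<forall>\<^sub>F u in at_right 0. W * (c * L) / ((2 - u) + c * L * u) \<le> ?E"
    unfolding eventually_at_right_field using bound c by (intro exI[of _ "1 / (c + 1)"]) auto
  ultimately have E: "W * (c * L) / 2 \<le> ?E"
    using tendsto_upperbound[of _ _ "at_right (0::real)" ?E] by fastforce
  define d where "d = 1 + c / (2 * real k) * L"
  have d: "d \<ge> 1" using c L by (simp add: d_def)
  have F: "b l * (d ^ k + real k * d ^ (k - 1) * ((1 + real l / real k) - d))
      = b l * (d ^ k - real k * d ^ (k - 1) * (d - 1)) + d ^ (k - 1) * (real l * b l)" for l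
  proof -
    have B: "real k * (real l / real k) = real l" using k by simp
    have "b l * (d ^ k + real k * d ^ (k - 1) * ((1 + x) - d))
      = b l * (d ^ k - real k * d ^ (k - 1) * (d - 1)) + d ^ (k - 1) * ((real k * x) * b l)" for x
      by algebra
    from this[of "real l / real k"] show ?thesis unfolding B .
  qed
  have "W * d ^ k \<le> W * d ^ k + real k * d ^ (k - 1) * ((?E / real k + W) - d * W)"
  proof -
    have "d * W = W + W * (c * L) / 2 / real k" using k by (simp add: d_def field_simps)
    also have "\<dots> \<le> ?E / real k + W" using divide_right_mono[OF E, of "real k"] by simp
    finally show ?thesis using d by simp
  qed
  also have "\<dots> = (\<Sum>l. b l * (d ^ k + real k * d ^ (k - 1) * ((1 + real l / real k) - d)))"
  proof -
    have "(\<lambda>l. b l * (d ^ k - real k * d ^ (k - 1) * (d - 1))) sums (W * (d ^ k - real k * d ^ (k - 1) * (d - 1)))"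
      unfolding W_def by (intro sums_mult2 summable_sums summable_b)
    from sums_add[OF this sums_mult[OF summable_sums[OF summable_first], of "d ^ (k - 1)"]]
    have A: "(\<Sum>l. b l * (d ^ k + real k * d ^ (k - 1) * ((1 + real l / real k) - d)))
       = W * (d ^ k - real k * d ^ (k - 1) * (d - 1)) + d ^ (k - 1) * ?E"
      unfolding F by (rule sums_unique[symmetric])
    have B: "real k * (?E / real k) = ?E" using k by simp
    have C: "W * (d ^ k - real k * d ^ (k - 1) * (d - 1)) + d ^ (k - 1) * (real k * x)
       = W * d ^ k + real k * d ^ (k - 1) * ((x + W) - d * W)" for x
      by algebra
    show ?thesis using A C[of "?E / real k"] unfolding B by (rule trans[THEN sym])
  qed
  also have "\<dots> \<le> (\<Sum>l. real ((l + k) choose k) * b l)"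
  proof (rule suminf_le)
    fix l
    have "d ^ k + real k * d ^ (k - 1) * ((1 + real l / real k) - d) \<le> (1 + real l / real k) ^ k"
      using d k by (intro power_ge_tangent) auto
    also note binom_ge
    finally show "b l * (d ^ k + real k * d ^ (k - 1) * ((1 + real l / real k) - d)) \<le> real ((l + k) choose k) * b l"
      using b by (subst mult.commute) (intro mult_right_mono)
  next
    show "summable (\<lambda>l. b l * (d ^ k + real k * d ^ (k - 1) * ((1 + real l / real k) - d)))"
      unfolding F by (intro summable_add summable_mult2 summable_b summable_mult summable_first)
  qed (rule summable_top)
  finally show ?thesis unfolding Phi_def d_def c_def L_def using k by (simp add: ac_simps)
qed

end

section \<open>Weights on the levels: small exponents\<close>

context level_weights
begin

text \<open>Integrating the bound on \<open>Phi\<close> against \<open>k * (1 - s) ^ (k - 1)\<close> over \<open>[u, 1]\<close> turns its left-hand side into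
binomial tails. The right-hand side is not an exact derivative, but \<open>1 + s \<le> 2\<close> makes it smaller
than the derivative of a power of \<open>2 * (1 - s) / (1 + s)\<close>, the variable in which \<open>rate\<close> is linear.\<close>

lemma tail_upper_bound:
  assumes p: "1 \<le> p" "p < 2" and P: "0 \<le> P"
    and HP: "\<And>s. 0 < s \<Longrightarrow> s < 1 \<Longrightarrow> Phi s \<le> P * (1 - s\<^sup>2) powr (- (real k * (1 - p / 2)))"
    and u: "0 \<le> u" "u < 1"
  shows "(\<Sum>l<N. b l * binom_tail (l + k) k (1 - u)) \<le>
    P * (2 / p) * 2 powr (- (real k * (1 - p / 2))) * (2 * (1 - u) / (1 + u)) powr (real k * p / 2)"
proof -
  define e where "e = real k * p / 2"
  define f where "f = real k * (1 - p / 2)"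
  have e: "e > 0" using k p by (simp add: e_def)
  have ef: "e + f = real k" by (simp add: e_def f_def field_simps)
  let ?H = "\<lambda>s. P * (2 / p) * 2 powr (- f) * (2 * (1 - s) / (1 + s)) powr e"
  let ?T = "\<lambda>s. \<Sum>l<N. b l * binom_tail (l + k) k (1 - s)"
  let ?D = "\<lambda>s. ?T s - ?H s"
  let ?h = "\<lambda>s. P * (2 / p) * 2 powr (- f) * (e * (2 * (1 - s) / (1 + s)) powr (e - 1) * (4 / (1 + s)\<^sup>2))"
  let ?t = "\<lambda>s. real k * (1 - s) ^ (k - 1) * (\<Sum>l<N. real ((l + k) choose k) * s ^ l * b l)"
  have T: "(?T has_real_derivative - ?t s) (at s)" for s
  proof -
    have "(?T has_real_derivative (\<Sum>l<N. b l * (- (real k * (1 - s) ^ (k - 1) * (real ((l + k) choose k) * s ^ l))))) (at s)"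
      by (intro DERIV_sum DERIV_cmult tail_deriv)
    also have "(\<Sum>l<N. b l * (- (real k * (1 - s) ^ (k - 1) * (real ((l + k) choose k) * s ^ l)))) = - ?t s"
      unfolding sum_distrib_left sum_negf[symmetric] by (intro sum.cong) auto
    finally show ?thesis .
  qed
  have H: "(?H has_real_derivative - ?h s) (at s)" if s: "0 \<le> s" "s < 1" for s
  proof -
    have "((\<lambda>s. 2 * (1 - s) / (1 + s)) has_real_derivative (2 * (0 - 1) * (1 + s) - 2 * (1 - s) * (0 + 1)) / ((1 + s) * (1 + s))) (at s)"
      by (intro DERIV_divide DERIV_cmult DERIV_diff DERIV_add DERIV_const DERIV_ident) (use s in auto)
    moreover have "(2 * (0 - 1) * (1 + s) - 2 * (1 - s) * (0 + 1)) / ((1 + s) * (1 + s)) = - (4 / (1 + s)\<^sup>2)"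
      by (simp add: power2_eq_square)
    ultimately have "((\<lambda>s. 2 * (1 - s) / (1 + s)) has_real_derivative - (4 / (1 + s)\<^sup>2)) (at s)" by simp
    from DERIV_fun_powr[OF this, of e] s
    have "((\<lambda>s. (2 * (1 - s) / (1 + s)) powr e) has_real_derivative e * (2 * (1 - s) / (1 + s)) powr (e - 1) * - (4 / (1 + s)\<^sup>2)) (at s)"
      by simp
    from DERIV_cmult[OF this, of "P * (2 / p) * 2 powr (- f)"] show ?thesis by simp
  qed
  have th: "?t s \<le> ?h s" if s: "0 < s" "s < 1" for s
  proof -
    have "?t s \<le> real k * (1 - s) ^ (k - 1) * (P * (1 - s\<^sup>2) powr (- f))"
      using sum_le_Phi[of s N] HP[OF s] s unfolding f_def by (intro mult_left_mono) auto
    also have "\<dots> = P * (real k * ((1 - s) powr (real k - 1) * ((1 - s) powr (- f) * (1 + s) powr (- f))))"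
    proof -
      have "(1 - s\<^sup>2) powr (- f) = (1 - s) powr (- f) * (1 + s) powr (- f)"
        using s by (subst powr_mult[symmetric]) (auto simp: power2_eq_square algebra_simps)
      moreover have "(1 - s) ^ (k - 1) = (1 - s) powr (real k - 1)"
        using s k powr_realpow[of "1 - s" "k - 1"] by (simp add: of_nat_diff)
      ultimately show ?thesis by simp
    qed
    also have "\<dots> = P * (real k * (1 - s) powr (e - 1) * (1 + s) powr (- f))"
    proof -
      have "(1 - s) powr (real k - 1) * (1 - s) powr (- f) = (1 - s) powr (e - 1)"
      proof -
        have "real k - 1 + - f = e - 1" using ef by simp
        then show ?thesis by (simp only: powr_add[symmetric])
      qed
      then show ?thesis by (simp add: ac_simps)
    qed
    also have "\<dots> \<le> P * (real k * (1 - s) powr (e - 1) * (2 powr (1 - f + e) * (1 + s) powr (- (1 + e))))"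
    proof -
      have "1 \<le> 1 - f + e"
      proof -
        have "e - f = real k * (p - 1)" by (simp add: e_def f_def field_simps)
        then show ?thesis using p by simp
      qed
      then have "(1 + s) powr (1 - f + e) \<le> 2 powr (1 - f + e)" using s by (intro powr_mono2) auto
      then have "(1 + s) powr (1 - f + e) * (1 + s) powr (- (1 + e)) \<le> 2 powr (1 - f + e) * (1 + s) powr (- (1 + e))"
        by (intro mult_right_mono) auto
      moreover have "(1 + s) powr (1 - f + e) * (1 + s) powr (- (1 + e)) = (1 + s) powr (- f)"
        by (simp add: powr_add[symmetric])
      ultimately show ?thesis using P by (intro mult_left_mono) auto
    qed
    also have "\<dots> = ?h s"
    proof -
      have "(2 * (1 - s) / (1 + s)) powr (e - 1) = 2 powr (e - 1) * (1 - s) powr (e - 1) * (1 + s) powr (- (e - 1))"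
        using s powr_divide[of "2 * (1 - s)" "1 + s" "e - 1"] powr_mult[of 2 "1 - s" "e - 1"]
          powr_minus_divide[of "1 + s" "e - 1"] by simp
      moreover have "4 / (1 + s)\<^sup>2 = 2 powr 2 * (1 + s) powr (- 2)"
        using s by (simp add: powr_minus_divide powr_numeral)
      ultimately have "?h s = P * ((2 / p) * e) * (2 powr (- f) * 2 powr (e - 1) * 2 powr 2) * (1 - s) powr (e - 1) * ((1 + s) powr (- (e - 1)) * (1 + s) powr (- 2))"
        by (simp only: ac_simps)
      also have "2 powr (- f) * 2 powr (e - 1) * 2 powr 2 = (2::real) powr (1 - f + e)"
        by (simp only: powr_add[symmetric]) (simp add: algebra_simps)
      also have "(1 + s) powr (- (e - 1)) * (1 + s) powr (- 2) = (1 + s) powr (- (1 + e))"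
        by (simp only: powr_add[symmetric]) (simp add: algebra_simps)
      also have "(2 / p) * e = real k" using p by (simp add: e_def)
      finally show ?thesis by (simp only: ac_simps)
    qed
    finally show ?thesis .
  qed
  have "?D u \<le> ?D 1"
  proof (rule DERIV_nonneg_imp_increasing_open[where f = ?D])
    show "continuous_on {u..1} ?D"
    proof (intro continuous_on_diff)
      show "continuous_on {u..1} ?T"
        using T by (meson DERIV_isCont continuous_at_imp_continuous_on)
      show "continuous_on {u..1} ?H"
        using u e by (intro continuous_intros continuous_on_powr') auto
    qed
    fix s :: real assume s: "u < s" "s < 1"
    have "(?D has_real_derivative - ?t s - (- ?h s)) (at s)"
      using s u by (intro DERIV_diff T H) auto
    moreover have "0 \<le> - ?t s - (- ?h s)" using th[of s] s u by simp
    ultimately show "\<exists>y. (?D has_real_derivative y) (at s) \<and> 0 \<le> y" by blast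
  qed (use u in auto)
  also have "?D 1 = 0" using k e by (simp add: binom_tail_0)
  finally show ?thesis by (simp add: e_def f_def)
qed

text \<open>The decay estimate is used at \<open>z\<close> with \<open>z ^ k = u\<close>. Passing to the \<open>k\<close>-th root costs at most a
factor \<open>k\<close> in the rate, since \<open>z ^ j + z ^ (k - j) \<le> 1 + z ^ k\<close>.\<close>

lemma rate_root:
  assumes u: "0 < u" "u < 1" and q: "1 \<le> q" "q < 2"
  shows "rate q u / real k \<le> rate q (u powr (1 / real k))" "rate q (u powr (1 / real k)) \<le> rate q u"
proof -
  define z where "z = u powr (1 / real k)"
  have zk: "z ^ k = u" using u k by (simp add: z_def powr_power)
  have z: "0 < z" "z < 1" using u k powr_less_mono2[of "1 / real k" u 1] by (auto simp: z_def)
  have le: "(1 - z ^ k) / (1 + z ^ k) \<le> real k * ((1 - z) / (1 + z))"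
  proof -
    have g: "1 - z ^ k = (1 - z) * (\<Sum>j<k. z ^ j)" by (rule one_diff_power_eq)
    have "(1 + z) * (\<Sum>j<k. z ^ j) = (\<Sum>j<k. z ^ j) + (\<Sum>j<k. z ^ Suc j)"
      by (simp add: sum_distrib_left sum.distrib algebra_simps)
    also have "(\<Sum>j<k. z ^ Suc j) = (\<Sum>j<k. z ^ (k - j))"
      by (rule sum.reindex_bij_witness[of _ "\<lambda>j. k - Suc j" "\<lambda>j. k - Suc j"]) auto
    also have "(\<Sum>j<k. z ^ j) + (\<Sum>j<k. z ^ (k - j)) = (\<Sum>j<k. z ^ j + z ^ (k - j))"
      by (simp add: sum.distrib)
    also have "\<dots> \<le> (\<Sum>j<k. 1 + z ^ k)"
    proof (rule sum_mono)
      fix j assume "j \<in> {..<k}"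
      then have "z ^ k = z ^ j * z ^ (k - j)" by (simp add: power_add[symmetric])
      moreover have "0 \<le> (1 - z ^ j) * (1 - z ^ (k - j))"
        using z by (intro mult_nonneg_nonneg) (auto simp: power_le_one)
      ultimately show "z ^ j + z ^ (k - j) \<le> 1 + z ^ k" by (simp add: algebra_simps)
    qed
    finally have "(1 + z) * (\<Sum>j<k. z ^ j) \<le> real k * (1 + z ^ k)" by simp
    then have "(1 - z) * ((1 + z) * (\<Sum>j<k. z ^ j)) \<le> (1 - z) * (real k * (1 + z ^ k))"
      using z by (intro mult_left_mono) auto
    then have "(1 - z ^ k) * (1 + z) \<le> real k * (1 - z) * (1 + z ^ k)"
      unfolding g by (simp add: ac_simps)
    moreover have "0 < 1 + z ^ k" using z by (simp add: add_pos_pos)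
    ultimately show ?thesis using z by (simp add: divide_simps)
  qed
  have c: "0 \<le> q / (2 - q)" using q by simp
  have "rate q u \<le> real k * rate q z"
    unfolding rate_def zk[symmetric] using mult_left_mono[OF le c] by (simp add: ac_simps)
  then show "rate q u / real k \<le> rate q (u powr (1 / real k))"
    using k by (simp add: z_def field_simps)
  have "u \<le> z" unfolding zk[symmetric] using z k power_decreasing[of 1 k z] by simp
  then have "(1 - z) / (1 + z) \<le> (1 - u) / (1 + u)" using u z by (simp add: divide_simps) (simp add: algebra_simps)
  then show "rate q (u powr (1 / real k)) \<le> rate q u"
    unfolding rate_def z_def[symmetric] by (rule mult_left_mono[OF _ c])
qed

text \<open>The bracket of the inequalities, with the weight \<open>W\<close> inside the logarithm.\<close>

definition growth :: "real \<Rightarrow> real \<Rightarrow> real" where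
  "growth q Q = 1 + q / (2 * real k * (2 - q)) * ln_plus (W / Q)"

text \<open>The binomial tail of level \<open>l + k\<close> at \<open>1 - u\<close> is at least \<open>(1 - z ^ (l + k)) ^ k\<close> with \<open>z ^ k = u\<close>.
By Jensen's inequality the sum over the levels is at least \<open>W * (1 - E) ^ k\<close>, with \<open>E\<close> the mean of
\<open>z ^ (l + k)\<close>; the decay estimate together with \<open>ln u \<le> - 2 * (1 - u) / (1 + u)\<close> gives \<open>E \<le> exp (- x)\<close>.\<close>

lemma level_lower_bound:
  assumes h: "hyper q Q" and q: "1 \<le> q" "q < 2" and Q: "0 < Q" and W: "0 < W"
    and p: "1 \<le> p" "p < 2" and P: "0 \<le> P"
    and HP: "\<And>s. 0 < s \<Longrightarrow> s < 1 \<Longrightarrow> Phi s \<le> P * (1 - s\<^sup>2) powr (- (real k * (1 - p / 2)))"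
    and u: "0 < u" "u < 1" "rate q u \<le> 1"
    and x: "x = growth q Q * (2 * (1 - u) / (1 + u))"
  shows "W * (1 - exp (- x)) ^ k \<le>
    P * (2 / p) * 2 powr (- (real k * (1 - p / 2))) * (2 * (1 - u) / (1 + u)) powr (real k * p / 2)" (is "_ \<le> ?B")
proof -
  define z where "z = u powr (1 / real k)"
  have zk: "z ^ k = u" using u k by (simp add: z_def powr_power)
  have z: "0 < z" "z < 1" using u k powr_less_mono2[of "1 / real k" u 1] by (auto simp: z_def)
  define L where "L = ln_plus (W / Q)"
  have L: "L \<ge> 0" by (simp add: L_def ln_plus_def)
  define y where "y = 2 * (1 - u) / (1 + u)"
  have y: "y > 0" using u by (simp add: y_def)
  have rz: "rate q u / real k \<le> rate q z" "rate q z \<le> rate q u"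
    using rate_root[OF u(1,2) q] by (simp_all add: z_def)
  have "growth q Q \<ge> 1" using L q by (simp add: growth_def L_def)
  then have xpos: "x > 0" unfolding x y_def[symmetric] using y by (intro mult_pos_pos) auto
  have "(\<Sum>l. b l * z ^ l) \<le> W * exp (- (rate q z * L))"
    unfolding L_def using rz u by (intro decay[OF h q Q W z]) auto
  then have "z ^ k * (\<Sum>l. b l * z ^ l) \<le> u * (W * exp (- (rate q z * L)))"
    using u unfolding zk by (intro mult_left_mono) auto
  also have "u * (W * exp (- (rate q z * L))) = W * exp (ln u - rate q z * L)"
    using u by (simp add: exp_diff exp_minus field_simps)
  also have "\<dots> \<le> W * exp (- x)"
  proof -
    have "ln u \<le> - y"
    proof -
      have "(\<lambda>u. ln u + 2 * (1 - u) / (1 + u)) u \<le> (\<lambda>u. ln u + 2 * (1 - u) / (1 + u)) 1"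
      proof (rule DERIV_nonneg_imp_nondecreasing[where f = "\<lambda>u. ln u + 2 * (1 - u) / (1 + u)"])
        fix v :: real assume v: "u \<le> v" "v \<le> 1"
        have "((\<lambda>u. ln u + 2 * (1 - u) / (1 + u)) has_real_derivative 1 / v + (2 * (0 - 1) * (1 + v) - 2 * (1 - v) * (0 + 1)) / ((1 + v) * (1 + v))) (at v)"
          using v u by (intro DERIV_divide DERIV_cmult DERIV_diff DERIV_add DERIV_const DERIV_ident DERIV_ln_divide) auto
        moreover have "1 / v + (2 * (0 - 1) * (1 + v) - 2 * (1 - v) * (0 + 1)) / ((1 + v) * (1 + v)) = (1 - v)\<^sup>2 / (v * (1 + v)\<^sup>2)"
          using v u by (simp add: divide_simps) (simp add: power2_eq_square algebra_simps)
        moreover have "0 \<le> (1 - v)\<^sup>2 / (v * (1 + v)\<^sup>2)" using v u by simp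
        ultimately show "\<exists>d. ((\<lambda>u. ln u + 2 * (1 - u) / (1 + u)) has_real_derivative d) (at v) \<and> 0 \<le> d" by auto
      qed (use u in auto)
      then show ?thesis by (simp add: y_def)
    qed
    moreover have "x - y \<le> rate q z * L"
    proof -
      have "x - y = rate q u / real k * L"
        unfolding x growth_def y_def[symmetric] rate_def L_def[symmetric]
        using k q u by (simp add: y_def divide_simps) (simp add: algebra_simps)
      also have "\<dots> \<le> rate q z * L" using rz L by (intro mult_right_mono)
      finally show ?thesis .
    qed
    ultimately show ?thesis using W by simp
  qed
  finally have dec: "z ^ k * (\<Sum>l. b l * z ^ l) \<le> W * exp (- x)" .
  \<comment> \<open>the point at which the tangent to the \<open>k\<close>-th power is taken\<close>
  define c where "c = 1 - exp (- x)"
  have c: "c > 0" using xpos by (simp add: c_def)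
  have "W * c ^ k \<le> W * c ^ k + real k * c ^ (k - 1) * (W * (1 - c) - z ^ k * (\<Sum>l. b l * z ^ l))"
    using dec c by (simp add: c_def)
  also have "(\<lambda>l. b l * (c ^ k + real k * c ^ (k - 1) * (1 - z ^ (l + k) - c))) sums
     (W * c ^ k + real k * c ^ (k - 1) * (W * (1 - c) - z ^ k * (\<Sum>l. b l * z ^ l)))"
  proof -
    have s1: "(\<lambda>l. b l * (c ^ k + real k * c ^ (k - 1) * (1 - c))) sums (W * (c ^ k + real k * c ^ (k - 1) * (1 - c)))"
      unfolding W_def by (intro sums_mult2 summable_sums summable_b)
    have s2: "(\<lambda>l. (real k * c ^ (k - 1) * z ^ k) * (b l * z ^ l)) sums ((real k * c ^ (k - 1) * z ^ k) * (\<Sum>l. b l * z ^ l))"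
      using z by (intro sums_mult summable_sums summable_geo) auto
    show ?thesis using sums_diff[OF s1 s2]
      by (simp add: algebra_simps power_add)
  qed
  then have "W * c ^ k + real k * c ^ (k - 1) * (W * (1 - c) - z ^ k * (\<Sum>l. b l * z ^ l)) \<le> ?B"
  proof (rule LIMSEQ_le_const2[OF sums_def[THEN iffD1]], intro exI allI impI)
    fix N :: nat
    have "(\<Sum>l<N. b l * (c ^ k + real k * c ^ (k - 1) * (1 - z ^ (l + k) - c))) \<le> (\<Sum>l<N. b l * binom_tail (l + k) k (1 - u))"
    proof (rule sum_mono)
      fix l
      have "c ^ k + real k * c ^ (k - 1) * (1 - z ^ (l + k) - c) \<le> (1 - z ^ (l + k)) ^ k"
        using c z by (intro power_ge_tangent) (auto simp: power_le_one)
      also have "(1 - z ^ (l + k)) ^ k = (1 - u powr (real (l + k) / real k)) ^ k"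
        using u by (simp add: z_def powr_power)
      also have "(1 - u powr (real (l + k) / real k)) ^ k \<le> binom_tail (l + k) k (1 - u)"
        using binom_tail_ge[of k "l + k" "1 - u"] k u by simp
      finally show "b l * (c ^ k + real k * c ^ (k - 1) * (1 - z ^ (l + k) - c)) \<le> b l * binom_tail (l + k) k (1 - u)"
        using b by (intro mult_left_mono)
    qed
    also have "\<dots> \<le> ?B" using u by (intro tail_upper_bound p P HP) auto
    finally show "(\<Sum>l<N. b l * (c ^ k + real k * c ^ (k - 1) * (1 - z ^ (l + k) - c))) \<le> ?B" .
  qed
  finally show ?thesis by (simp add: c_def)
qed

end

section \<open>The constants\<close>

text \<open>The function whose maximum defines \<^const>\<open>M_const\<close>.\<close>

definition slope :: "real \<Rightarrow> real \<Rightarrow> real" where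
  "slope p x = (1 - exp (- x)) / x powr (p / 2)"

lemma slope_le_1:
  assumes "1 \<le> p" "p < 2" "0 \<le> x"
  shows "slope p x \<le> 1"
proof (cases "x = 0")
  case False
  then have x: "x > 0" using assms by simp
  have "1 - exp (- x) \<le> x powr (p / 2)"
  proof (cases "x \<le> 1")
    case True
    have "1 - exp (- x) \<le> x" using exp_ge_add_one_self[of "- x"] by simp
    also have "x = x powr 1" using x by simp
    also have "\<dots> \<le> x powr (p / 2)" using x True assms by (intro powr_mono') auto
    finally show ?thesis .
  next
    case False
    have "1 - exp (- x) \<le> 1" by simp
    also have "1 \<le> x powr (p / 2)" using False assms by (intro ge_one_powr_ge_zero) auto
    finally show ?thesis .
  qed
  then show ?thesis using x by (simp add: slope_def)
qed (simp add: slope_def)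

lemma slope_nonneg: "0 \<le> x \<Longrightarrow> 0 \<le> slope p x"
  by (simp add: slope_def)

text \<open>The level estimate is available only for \<open>x\<close> up to \<open>2 * (2 - p) / p\<close>, where the rate stays below \<open>1\<close>.
Beyond this point \<open>slope\<close> decreases, so nothing is lost for its supremum.\<close>

lemma slope_antimono:
  assumes p: "1 \<le> p" "p < 2" and x: "2 * (2 - p) / p \<le> x" "x \<le> y"
  shows "slope p y \<le> slope p x"
proof (rule DERIV_nonpos_imp_nonincreasing[OF x(2)])
  fix t assume t: "x \<le> t" "t \<le> y"
  have t0: "t > 0" using p x t by (intro less_le_trans[OF _ order_trans[OF x(1) t(1)]]) auto
  have "2 * t / p \<le> exp t - 1"
  proof -
    have "2 * t / p = t + t * ((2 - p) / p)" using p by (simp add: field_simps)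
    also have "\<dots> \<le> t + t * (t / 2)"
    proof -
      have "(2 - p) / p \<le> t / 2" using order_trans[OF x(1) t(1)] p by (simp add: field_simps)
      then show ?thesis using t0 by (intro add_left_mono mult_left_mono) auto
    qed
    also have "\<dots> \<le> exp t - 1"
      using exp_lower_Taylor_quadratic[of t] t0 by (simp add: power2_eq_square)
    finally show ?thesis .
  qed
  then have "(2 * t / p) * exp (- t) \<le> (exp t - 1) * exp (- t)" by (intro mult_right_mono) auto
  also have "(exp t - 1) * exp (- t) = 1 - exp (- t)" by (simp add: left_diff_distrib exp_minus)
  finally have ineq: "t * exp (- t) \<le> (p / 2) * (1 - exp (- t))" using p by (simp add: field_simps)
  let ?d = "(exp (- t) * t powr (p / 2) - (1 - exp (- t)) * (p / 2 * t powr (p / 2 - 1))) / (t powr (p / 2) * t powr (p / 2))"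
  have "(slope p has_real_derivative ?d) (at t)"
    unfolding slope_def[abs_def] using t0
    by (auto intro!: derivative_eq_intros)
  moreover have "?d \<le> 0"
  proof -
    have "t powr (p / 2) = t powr (p / 2 - 1) * t" using t0 by (simp add: powr_diff)
    then have "exp (- t) * t powr (p / 2) - (1 - exp (- t)) * (p / 2 * t powr (p / 2 - 1))
      = t powr (p / 2 - 1) * (t * exp (- t) - (p / 2) * (1 - exp (- t)))" by (simp add: algebra_simps)
    also have "\<dots> \<le> 0" using ineq by (intro mult_nonneg_nonpos) auto
    finally show ?thesis using t0 by (simp add: divide_nonpos_pos)
  qed
  ultimately show "\<exists>d. (slope p has_real_derivative d) (at t) \<and> d \<le> 0" by blast
qed

lemma M_const_slope: "M_const p = p * 2 powr (- p / 2) * (SUP x\<in>{0..}. slope p x)"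
  by (simp add: M_const_def slope_def)

lemma bdd_slope: "1 \<le> p \<Longrightarrow> p < 2 \<Longrightarrow> bdd_above (slope p ` {0..})"
  using slope_le_1 by (intro bdd_aboveI[of _ 1]) auto

text \<open>The value of \<open>slope\<close> at \<open>1\<close> is enough.\<close>

lemma M_const_ge:
  assumes p: "1 \<le> p" "p < 2"
  shows "1 / 4 \<le> M_const p"
proof -
  have "exp (- 1) \<le> (1 / 2 :: real)" using exp_ge_add_one_self[of 1] by (simp add: exp_minus field_simps)
  then have "1 / 2 \<le> slope p 1" by (simp add: slope_def)
  also have "\<dots> \<le> (SUP x\<in>{0..}. slope p x)" using bdd_slope[OF p] by (intro cSUP_upper) auto
  finally have S: "1 / 2 \<le> (SUP x\<in>{0..}. slope p x)" .
  have "(2::real) powr - 1 \<le> 2 powr (- p / 2)" using p by (intro powr_mono) auto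
  then have "1 / 2 \<le> 2 powr (- p / 2)" by (simp add: powr_minus_divide)
  then have "1 * (1 / 2) \<le> p * 2 powr (- p / 2)" using p by (intro mult_mono) auto
  then have "(1 / 2) * (1 / 2) \<le> p * 2 powr (- p / 2) * (SUP x\<in>{0..}. slope p x)"
    using S by (intro mult_mono) auto
  then show ?thesis by (simp add: M_const_slope)
qed

text \<open>Both summands in the definition of \<^const>\<open>C_const\<close> are at most a constant divided by
\<open>(2 - p) * (2 - q)\<close>, and the outer exponent \<open>- p / 2\<close> is at least \<open>- 1\<close>.\<close>

lemma C_const_lower_bound:
  assumes "1 \<le> q" "q \<le> p" "p < 2"
  shows "1 / 33 * (2 - p) * (2 - q) \<le> C_const p q"
proof -
  define D where "D = 2 / (2 - q) * M_const p powr (- 2 / p) + p * q / (2 * exp 1 * (2 - p) * (2 - q))"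
  define m where "m = (2 - p) * (2 - q)"
  have m: "0 < m" "m \<le> 1" using assms by (auto simp: m_def intro: mult_le_one)
  have M: "1 / 4 \<le> M_const p" using assms by (intro M_const_ge) auto
  have "M_const p powr (- 2 / p) \<le> (1 / 4) powr (- 2 / p)"
    using M assms by (intro powr_mono2') auto
  also have "\<dots> \<le> (1 / 4) powr (- 2)"
    using assms by (intro powr_mono') (auto simp: field_simps)
  also have "\<dots> = 16" by (simp add: powr_minus_divide powr_divide)
  finally have 1: "M_const p powr (- 2 / p) \<le> 16" .
  have "2 / (2 - q) * M_const p powr (- 2 / p) \<le> 2 / (2 - q) * 16"
    using 1 assms by (intro mult_left_mono) auto
  also have "\<dots> \<le> 32 / m"
  proof -
    have "m \<le> 1 * (2 - q)" unfolding m_def using assms by (intro mult_right_mono) auto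
    then show ?thesis using assms m by (simp add: divide_simps)
  qed
  finally have A: "2 / (2 - q) * M_const p powr (- 2 / p) \<le> 32 / m" .
  have "p * q \<le> 2 * 2" using assms by (intro mult_mono) auto
  also have "\<dots> \<le> 2 * exp 1" using exp_ge_add_one_self[of 1] by simp
  finally have "p * q / (2 * exp 1) \<le> 1" by (simp add: divide_simps)
  then have "p * q / (2 * exp 1) / m \<le> 1 / m" using m by (intro divide_right_mono) auto
  then have B: "p * q / (2 * exp 1 * (2 - p) * (2 - q)) \<le> 1 / m" by (simp add: m_def mult.assoc)
  have D: "D \<le> 33 / m" using add_mono[OF A B] by (simp add: D_def)
  have Dpos: "0 < D" unfolding D_def
    using M assms by (intro add_pos_pos divide_pos_pos mult_pos_pos) auto
  have "1 / 33 * m = (m / 33) powr 1" using m by simp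
  also have "\<dots> \<le> (m / 33) powr (p / 2)" using m assms by (intro powr_mono') auto
  also have "\<dots> = (33 / m) powr (- p / 2)" using m by (simp add: powr_divide powr_minus_divide)
  also have "\<dots> \<le> D powr (- p / 2)" using D Dpos assms by (intro powr_mono2') auto
  finally show ?thesis by (simp add: C_const_def D_def m_def mult.assoc)
qed

section \<open>The optimal level\<close>

context level_weights
begin

lemma growth_ge_1: "1 \<le> q \<Longrightarrow> q < 2 \<Longrightarrow> 1 \<le> growth q Q"
  by (simp add: growth_def ln_plus_def)

text \<open>The level estimate with \<open>u\<close> chosen such that \<open>2 * (1 - u) / (1 + u) = x / D\<close>, where \<open>D\<close> is the growth
factor. Then the powers of \<open>x\<close> and \<open>D\<close> separate.\<close>

lemma slope_lower_bound:
  assumes h: "hyper q Q" and q: "1 \<le> q" "q \<le> p" "p < 2" and Q: "0 < Q" and W: "0 < W"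
    and P: "0 \<le> P"
    and HP: "\<And>s. 0 < s \<Longrightarrow> s < 1 \<Longrightarrow> Phi s \<le> P * (1 - s\<^sup>2) powr (- (real k * (1 - p / 2)))"
    and x: "0 \<le> x"
  shows "W * (p * 2 powr (- p / 2) * slope p x) ^ k * growth q Q powr (real k * p / 2) \<le> P"
proof -
  define D where "D = growth q Q"
  have D: "D \<ge> 1" using q by (simp add: D_def growth_ge_1)
  define e where "e = real k * p / 2"
  have main: "W * (p * 2 powr (- p / 2) * slope p x) ^ k * D powr e \<le> P"
    if x: "0 < x" "x \<le> 2 * (2 - p) / p" for x
  proof -
    define y where "y = x / D"
    have y0: "0 < y" using x D by (simp add: y_def)
    have "y \<le> x" using x D by (simp add: y_def divide_le_eq mult_le_cancel_left1)
    then have y1: "y \<le> 2 * (2 - p) / p" using x by simp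
    have "2 * (2 - p) / p \<le> 2" using q by (simp add: field_simps)
    then have y2: "y \<le> 2" using y1 by simp
    have bd: "W * (1 - exp (- x)) ^ k \<le> P * (2 / p) * 2 powr (- (real k * (1 - p / 2))) * y powr e"
    \<comment> \<open>\<open>y = 2\<close> means \<open>u = 0\<close>, possible only for \<open>p = 1\<close>; there all binomial tails equal \<open>1\<close>\<close>
    proof (cases "y = 2")
      case True
      have "W * (1 - exp (- x)) ^ k \<le> W" using W x by (intro mult_left_le power_le_one) auto
      also have "W \<le> P * (2 / p) * 2 powr (- (real k * (1 - p / 2))) * y powr e"
        unfolding W_def
      proof (rule suminf_le_const[OF summable_b])
        fix N
        have "(\<Sum>l<N. b l) = (\<Sum>l<N. b l * binom_tail (l + k) k (1 - 0))" by (simp add: binom_tail_1)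
        also have "\<dots> \<le> P * (2 / p) * 2 powr (- (real k * (1 - p / 2))) * (2 * (1 - 0) / (1 + 0)) powr (real k * p / 2)"
          using q by (intro tail_upper_bound P HP) auto
        finally show "(\<Sum>l<N. b l) \<le> P * (2 / p) * 2 powr (- (real k * (1 - p / 2))) * y powr e"
          using True by (simp add: e_def)
      qed
      finally show ?thesis .
    next
      case False
      define u where "u = (2 - y) / (2 + y)"
      have u: "0 < u" "u < 1" using y0 y2 False by (auto simp: u_def)
      have uy: "2 * (1 - u) / (1 + u) = y" using y0 by (simp add: u_def divide_simps)
      have "(1 - u) / (1 + u) = y / 2" using y0 by (simp add: u_def divide_simps)
      then have "rate q u = q / (2 - q) * (y / 2)" unfolding rate_def by (simp only:)
      also have "\<dots> \<le> q / (2 - q) * ((2 - p) / p)"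
      proof (rule mult_left_mono)
        show "y / 2 \<le> (2 - p) / p" using y1 q by (simp add: field_simps)
      qed (use q in auto)
      also have "\<dots> \<le> 1"
      proof -
        have "q * (2 - p) \<le> p * (2 - q)" using q by (simp add: algebra_simps)
        then show ?thesis using q by (simp add: divide_simps mult.commute)
      qed
      finally have r: "rate q u \<le> 1" .
      have xx: "x = growth q Q * (2 * (1 - u) / (1 + u))"
        unfolding uy D_def[symmetric] using D by (simp add: y_def)
      have "W * (1 - exp (- x)) ^ k \<le>
        P * (2 / p) * 2 powr (- (real k * (1 - p / 2))) * (2 * (1 - u) / (1 + u)) powr (real k * p / 2)"
        by (rule level_lower_bound[OF h _ _ Q W _ _ P HP u r xx]) (use q in auto)
      then show ?thesis unfolding uy e_def .
    qed
    have "(p * 2 powr (- p / 2) * slope p x) ^ k = p ^ k * 2 powr (- e) * ((1 - exp (- x)) ^ k * x powr (- e))"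
    proof -
      have "(2 powr (- p / 2)) ^ k = (2::real) powr (- e)" by (simp add: powr_power e_def mult.commute)
      moreover have "(x powr (p / 2)) ^ k = x powr e" using x by (simp add: powr_power e_def mult.commute)
      ultimately show ?thesis
        by (simp add: slope_def power_mult_distrib power_divide powr_minus_divide)
    qed
    then have "W * (p * 2 powr (- p / 2) * slope p x) ^ k * D powr e
      = W * (1 - exp (- x)) ^ k * (p ^ k * 2 powr (- e) * (x powr (- e) * D powr e))"
      by (simp only: ac_simps)
    also have "x powr (- e) * D powr e = y powr (- e)"
      using x D by (simp add: y_def powr_divide powr_minus_divide)
    also have "W * (1 - exp (- x)) ^ k * (p ^ k * 2 powr (- e) * y powr (- e))
        \<le> (P * (2 / p) * 2 powr (- (real k * (1 - p / 2))) * y powr e) * (p ^ k * 2 powr (- e) * y powr (- e))"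
      using q by (intro mult_right_mono[OF bd]) auto
    also have "\<dots> = P * (2 / p) * p ^ k * (2 powr (- (real k * (1 - p / 2))) * 2 powr (- e)) * (y powr e * y powr (- e))"
      by (simp only: ac_simps)
    also have "y powr e * y powr (- e) = 1" using y0 by (simp add: powr_minus_divide)
    also have "2 powr (- (real k * (1 - p / 2))) * 2 powr (- e) = (1 / 2 :: real) ^ k"
    proof -
      have "- (real k * (1 - p / 2)) + - e = - real k" by (simp add: e_def algebra_simps)
      then have "2 powr (- (real k * (1 - p / 2))) * 2 powr (- e) = (2::real) powr (- real k)"
        by (simp only: powr_add[symmetric])
      also have "\<dots> = (1 / 2) ^ k" by (simp add: powr_minus_divide powr_realpow power_one_over)
      finally show ?thesis .
    qed
    also have "P * (2 / p) * p ^ k * (1 / 2) ^ k * 1 = P * (p / 2) ^ (k - 1)"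
      using q k by (cases k) (auto simp: power_divide field_simps)
    also have "\<dots> \<le> P" using P q by (intro mult_left_le power_le_one) auto
    finally show ?thesis .
  qed
  have "W * (p * 2 powr (- p / 2) * slope p x) ^ k * D powr e \<le> P"
  proof (cases "x = 0")
    case True
    then show ?thesis using P k by (simp add: slope_def power_0_left)
  next
    case False
    define x0 where "x0 = 2 * (2 - p) / p"
    have x0: "0 < x0" using q by (simp add: x0_def)
    show ?thesis
    proof (cases "x \<le> x0")
      case True
      then show ?thesis using main[of x] x False by (simp add: x0_def)
    next
      case F: False
      have "slope p x \<le> slope p x0" using F q by (intro slope_antimono) (auto simp: x0_def)
      then have "W * (p * 2 powr (- p / 2) * slope p x) ^ k * D powr e
          \<le> W * (p * 2 powr (- p / 2) * slope p x0) ^ k * D powr e"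
        using W q x slope_nonneg[OF x] by (intro mult_right_mono mult_left_mono power_mono mult_nonneg_nonneg) auto
      also have "\<dots> \<le> P" using main[of x0] x0 by (simp add: x0_def)
      finally show ?thesis .
    qed
  qed
  then show ?thesis by (simp add: D_def e_def)
qed

text \<open>The supremum over \<open>x\<close> of the previous estimate.\<close>

lemma M_lower_bound:
  assumes h: "hyper q Q" and q: "1 \<le> q" "q \<le> p" "p < 2" and Q: "0 < Q" and W: "0 < W"
    and P: "0 \<le> P"
    and HP: "\<And>s. 0 < s \<Longrightarrow> s < 1 \<Longrightarrow> Phi s \<le> P * (1 - s\<^sup>2) powr (- (real k * (1 - p / 2)))"
  shows "W * M_const p ^ k * growth q Q powr (real k * p / 2) \<le> P"
proof -
  define D where "D = growth q Q powr (real k * p / 2)"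
  have D: "D > 0" using growth_ge_1[of q Q] q by (simp add: D_def)
  define c where "c = p * 2 powr (- p / 2)"
  have c: "c > 0" using q by (simp add: c_def)
  define R where "R = (P / (W * D)) powr (1 / real k)"
  have Rk: "R ^ k = P / (W * D)"
  proof (cases "P = 0")
    case True
    then show ?thesis using k by (simp add: R_def power_0_left)
  next
    case False
    then show ?thesis using P W D k by (simp add: R_def powr_power)
  qed
  have R: "R \<ge> 0" by (simp add: R_def)
  have "slope p x \<le> R / c" if "x \<ge> 0" for x
  proof -
    have "W * (c * slope p x) ^ k * D \<le> P"
      unfolding c_def D_def by (rule slope_lower_bound[OF h q Q W P HP that])
    then have "(c * slope p x) ^ k \<le> R ^ k" unfolding Rk using W D by (simp add: field_simps)
    then have "c * slope p x \<le> R" using power_le_imp_le_base[of _ "k - 1" R] k R by simp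
    then show ?thesis using c by (simp add: field_simps)
  qed
  then have "(SUP x\<in>{0..}. slope p x) \<le> R / c" by (intro cSUP_least) auto
  then have "M_const p \<le> R" unfolding M_const_slope c_def[symmetric] using c by (simp add: field_simps)
  then have "M_const p ^ k \<le> R ^ k" using M_const_ge[of p] q by (intro power_mono) auto
  then show ?thesis unfolding Rk D_def[symmetric] using W D by (simp add: field_simps)
qed

text \<open>The estimate with \<open>M_const\<close> still has \<open>W\<close> in its logarithm. With \<open>X = (P / W) powr (2 / (k * p))\<close> it
bounds \<open>ln_plus (W / Q)\<close> and, used with the exponent \<open>p\<close> in place of \<open>q\<close>, \<open>ln_plus (W / Q')\<close> by
multiples of \<open>X\<close>. Since \<open>Q' powr (p / 2) \<le> P\<close>, also \<open>ln (1 / W)\<close> is bounded by \<open>ln X\<close> and \<open>ln_plus (W / Q')\<close>; with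
\<open>ln X \<le> X / e\<close> this leads to the two summands of \<^const>\<open>C_const\<close>.\<close>

lemma Lp_lower_bound:
  assumes h: "hyper q Q" and hp: "hyper p Q'" and q: "1 \<le> q" "q \<le> p" "p < 2"
    and Q: "0 < Q" "0 < Q'" and W: "0 < W"
    and P: "0 < P" and QP: "Q' powr (p / 2) \<le> P"
    and HP: "\<And>s. 0 < s \<Longrightarrow> s < 1 \<Longrightarrow> Phi s \<le> P * (1 - s\<^sup>2) powr (- (real k * (1 - p / 2)))"
  shows "C_const p q ^ k * W * (1 + q / (2 * real k * (2 - q)) * ln_plus (1 / Q)) powr (real k * p / 2) \<le> P"
proof -
  define e where "e = real k * p / 2"
  have e: "e > 0" using k q by (simp add: e_def)
  define X where "X = (P / W) powr (1 / e)"
  have X: "X > 0" using P W by (simp add: X_def)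
  have Xe: "X powr e = P / W" using P W e by (simp add: X_def powr_powr)
  define c where "c r = r / (2 * (2 - r))" for r :: real
  have c: "c q > 0" "c p > 0" using q by (auto simp: c_def)
  define M where "M = M_const p powr (- 2 / p)"
  have Mp: "M_const p > 0" using M_const_ge[of p] q by simp
  have Me: "M powr (- e) = M_const p ^ k"
  proof -
    have "- 2 / p * (- e) = real k" using q by (simp add: e_def)
    then show ?thesis using Mp by (simp only: M_def powr_powr powr_realpow)
  qed
  have M: "M > 0" using Mp by (simp add: M_def)
  have low: "1 + c r / real k * ln_plus (W / R) \<le> M * X"
    if "hyper r R" "1 \<le> r" "r \<le> p" "0 < R" for r R
  proof -
    have g: "growth r R = 1 + c r / real k * ln_plus (W / R)" by (simp add: growth_def c_def mult.commute mult.left_commute)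
    have "W * M_const p ^ k * growth r R powr e \<le> P"
      unfolding e_def using P by (intro M_lower_bound[OF that(1,2,3) q(3) that(4) W _ HP]) auto
    then have "growth r R powr e \<le> X powr e * M powr e"
      unfolding Xe Me[symmetric] using W M by (simp add: powr_minus_divide field_simps)
    also have "\<dots> = (M * X) powr e" using M X by (simp add: powr_mult)
    finally have "\<not> (M * X) powr e < growth r R powr e" by simp
    then have "growth r R \<le> M * X"
      using powr_less_mono2[OF e, of "M * X" "growth r R"] M X by fastforce
    then show ?thesis by (simp add: g)
  qed
  let ?Lq = "ln_plus (W / Q)" and ?Lp = "ln_plus (W / Q')"
  have lq: "1 + c q / real k * ?Lq \<le> M * X" by (rule low[OF h q(1,2) Q(1)])
  have lp: "1 + c p / real k * ?Lp \<le> M * X" by (rule low[OF hp _ _ Q(2)]) (use q in auto)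
  define A where "A = 2 / (2 - q) * M"
  define B where "B = p * q / (2 * exp 1 * (2 - p) * (2 - q))"
  have A: "A = (1 + 2 * c q) * M" using q by (simp add: A_def c_def divide_simps)
  have B: "B = 2 * c q * c p / exp 1 " using q by (simp add: B_def c_def divide_simps) (simp add: algebra_simps)
  have B0: "B > 0" using c by (simp add: B)
  have Lnn: "?Lq \<ge> 0" "?Lp \<ge> 0" by (auto simp: ln_plus_def)
  have goal: "1 + c q / real k * ln_plus (1 / Q) \<le> (A + B) * X"
  proof (cases "1 / Q \<le> 1")
    case True
    then have "ln_plus (1 / Q) = 0" using Q by (simp add: ln_plus_def max_def)
    moreover have "1 \<le> M * X" proof -
      have "0 \<le> c q / real k * ?Lq" using c Lnn by (intro mult_nonneg_nonneg divide_nonneg_nonneg) auto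
      then show ?thesis using lq by linarith
    qed
    moreover have "M * X \<le> A * X" using M X c by (simp add: A algebra_simps)
    moreover have "0 \<le> B * X" using B0 X by simp
    ultimately show ?thesis by (simp add: algebra_simps)
  next
    case False
    then have "ln_plus (1 / Q) = ln (1 / Q)" using Q by (simp add: ln_plus_def)
    also have "\<dots> = ln (W / Q) + ln (1 / W)" using Q W by (simp add: ln_div)
    also have "\<dots> \<le> ?Lq + 2 * c p * (real k * ln X + ?Lp)"
    proof -
      have "ln (Q' powr (p / 2)) \<le> ln P" using QP Q P by (subst ln_le_cancel_iff) auto
      then have "p / 2 * ln Q' \<le> ln P" using Q by (simp add: ln_powr)
      moreover have "e * ln X = ln P - ln W"
      proof -
        have "e * ln X = ln (X powr e)" using X by (simp add: ln_powr)
        also have "\<dots> = ln P - ln W" unfolding Xe using P W by (simp add: ln_div)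
        finally show ?thesis .
      qed
      moreover have "real k * p / 2 * ln X = e * ln X" by (simp add: e_def)
      ultimately have 1: "p / 2 * ln Q' - ln W \<le> real k * p / 2 * ln X" by linarith
      have "- ((1 - p / 2) * ln W) = (p / 2 * ln Q' - ln W) + p / 2 * (ln W - ln Q')" by (simp add: algebra_simps)
      also have "\<dots> \<le> real k * p / 2 * ln X + p / 2 * (ln W - ln Q')" using 1 by simp
      also have "\<dots> = p / 2 * (real k * ln X + (ln W - ln Q'))" by (simp add: algebra_simps)
      finally have "- ((1 - p / 2) * ln W) \<le> p / 2 * (real k * ln X + (ln W - ln Q'))" .
      then have "(1 - p / 2) * ln (1 / W) \<le> p / 2 * (real k * ln X + ln (W / Q'))"
        using W Q by (simp add: ln_div)
      also have "\<dots> \<le> p / 2 * (real k * ln X + ?Lp)"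
        using q by (intro mult_left_mono add_left_mono) (auto simp: ln_plus_def)
      finally have F: "(1 - p / 2) * ln (1 / W) \<le> p / 2 * (real k * ln X + ?Lp)" .
      have "0 < 1 - p / 2" using q by simp
      with F have "ln (1 / W) \<le> (p / 2 * (real k * ln X + ?Lp)) / (1 - p / 2)"
        by (subst pos_le_divide_eq, simp) (subst mult.commute)
      also have "\<dots> = 2 * c p * (real k * ln X + ?Lp)" using q by (simp add: c_def divide_simps)
      finally show ?thesis by (simp add: ln_plus_def)
    qed
    finally have "ln_plus (1 / Q) \<le> ?Lq + 2 * c p * (real k * ln X + ?Lp)" .
    then have "c q / real k * ln_plus (1 / Q) \<le> c q / real k * (?Lq + 2 * c p * (real k * ln X + ?Lp))"
      using c k by (intro mult_left_mono) auto
    also have "\<dots> = c q / real k * ?Lq + 2 * c q * c p * ln X + 2 * c q * (c p / real k * ?Lp)"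
      using k by (simp add: field_simps)
    also have "\<dots> \<le> (M * X - 1) + 2 * c q * c p * (X / exp 1) + 2 * c q * (M * X)"
    proof -
      have "ln X \<le> X / exp 1"
      proof -
        have "ln (X / exp 1) \<le> X / exp 1 - 1" using X by (intro ln_le_minus_one) auto
        then show ?thesis using X by (simp add: ln_div)
      qed
      then have "2 * c q * c p * ln X \<le> 2 * c q * c p * (X / exp 1)" using c by (intro mult_left_mono) auto
      moreover have "2 * c q * (c p / real k * ?Lp) \<le> 2 * c q * (M * X)" using c lp by (intro mult_left_mono) auto
      ultimately show ?thesis using lq by linarith
    qed
    finally show ?thesis unfolding A B by (simp add: algebra_simps)
  qed
  have base: "0 \<le> 1 + c q / real k * ln_plus (1 / Q)"
    using c k by (intro add_nonneg_nonneg mult_nonneg_nonneg) (auto simp: ln_plus_def)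
  have "(1 + c q / real k * ln_plus (1 / Q)) powr e \<le> ((A + B) * X) powr e"
    using goal base e by (intro powr_mono2) auto
  also have "\<dots> = (A + B) powr e * (P / W)"
    using A M c B0 X by (simp add: powr_mult Xe)
  finally have fin: "(1 + c q / real k * ln_plus (1 / Q)) powr e \<le> (A + B) powr e * (P / W)" .
  have AB: "A + B > 0" using A M c B0 by (simp add: add_pos_pos)
  have "C_const p q ^ k = (A + B) powr (- e)"
    using AB by (simp add: C_const_def A_def B_def M_def powr_power e_def mult.commute)
  then have "C_const p q ^ k * W * (1 + c q / real k * ln_plus (1 / Q)) powr e
     \<le> (A + B) powr (- e) * W * ((A + B) powr e * (P / W))"
    unfolding \<open>C_const p q ^ k = (A + B) powr (- e)\<close> using fin W
    by (intro mult_left_mono mult_nonneg_nonneg) auto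
  also have "\<dots> = P" using AB W by (simp add: powr_minus_divide)
  finally show ?thesis by (simp add: c_def e_def mult.commute mult.left_commute)
qed

end

section \<open>Sums over multi-indices\<close>

lemma finite_mi_size: "finite {\<kappa>::'n::finite \<Rightarrow> nat. mi_size \<kappa> = k}"
proof (rule finite_subset)
  show "{\<kappa>::'n \<Rightarrow> nat. mi_size \<kappa> = k} \<subseteq> PiE UNIV (\<lambda>_. {..k})"
    by (auto simp: mi_size_def intro: member_le_sum)
qed (auto intro: finite_PiE)

text \<open>A sum over multi-indices of given size is a coefficient of a product of power series; this is how
the multinomial and the Vandermonde identities below are obtained.\<close>

lemma prod_fps_nth:
  fixes F :: "'i \<Rightarrow> real fps"
  assumes "finite S"
  shows "fps_nth (\<Prod>i\<in>S. F i) m = (\<Sum>\<alpha> | (\<forall>i. i \<notin> S \<longrightarrow> \<alpha> i = 0) \<and> sum \<alpha> S = m. \<Prod>i\<in>S. fps_nth (F i) (\<alpha> i))"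
  using assms
proof (induction S arbitrary: m rule: finite_induct)
  case empty
  have "{\<alpha>::'i \<Rightarrow> nat. (\<forall>i. \<alpha> i = 0) \<and> 0 = m} = (if m = 0 then {\<lambda>_. 0} else {})" by auto
  then show ?case by simp
next
  case (insert x S)
  let ?A = "\<lambda>S m. {\<alpha>::'i \<Rightarrow> nat. (\<forall>i. i \<notin> S \<longrightarrow> \<alpha> i = 0) \<and> sum \<alpha> S = m}"
  have fin: "finite (?A T j)" if "finite T" for T j
  proof (rule finite_subset)
    show "?A T j \<subseteq> (\<lambda>f i. if i \<in> T then f i else 0) ` PiE T (\<lambda>_. {..j})"
    proof
      fix \<alpha> assume \<alpha>: "\<alpha> \<in> ?A T j"
      have "\<alpha> = (\<lambda>i. if i \<in> T then restrict \<alpha> T i else 0)" using \<alpha> by auto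
      moreover have "restrict \<alpha> T \<in> PiE T (\<lambda>_. {..j})"
        using \<alpha> that by (auto intro: member_le_sum)
      ultimately show "\<alpha> \<in> (\<lambda>f i. if i \<in> T then f i else 0) ` PiE T (\<lambda>_. {..j})" by (rule image_eqI)
    qed
    show "finite ((\<lambda>f i. if i \<in> T then f i else 0) ` PiE T (\<lambda>_. {..j}))"
      using that by (intro finite_imageI finite_PiE) auto
  qed
  have "fps_nth (\<Prod>i\<in>insert x S. F i) m
    = (\<Sum>j = 0..m. fps_nth (F x) j * (\<Sum>\<alpha>\<in>?A S (m - j). \<Prod>i\<in>S. fps_nth (F i) (\<alpha> i)))"
    using insert by (simp add: fps_mult_nth)
  also have "\<dots> = (\<Sum>(j, \<alpha>)\<in>(SIGMA j:{0..m}. ?A S (m - j)). fps_nth (F x) j * (\<Prod>i\<in>S. fps_nth (F i) (\<alpha> i)))"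
    unfolding sum_distrib_left using fin[OF insert(1)] by (subst sum.Sigma) auto
  also have "\<dots> = (\<Sum>\<alpha>\<in>?A (insert x S) m. \<Prod>i\<in>insert x S. fps_nth (F i) (\<alpha> i))"
  proof (rule sum.reindex_bij_witness[where i = "\<lambda>\<alpha>. (\<alpha> x, \<alpha>(x := 0))" and j = "\<lambda>(j, \<alpha>). \<alpha>(x := j)"], goal_cases)
    case (2 a)
    then obtain j \<alpha> where a: "a = (j, \<alpha>)" "j \<le> m" "\<alpha> \<in> ?A S (m - j)" by auto
    have "sum (\<alpha>(x := j)) S = sum \<alpha> S" using insert by (intro sum.cong) auto
    then show ?case using a insert by auto
  next
    case (4 \<alpha>)
    have "sum (\<alpha>(x := 0)) S = sum \<alpha> S" using insert by (intro sum.cong) auto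
    then show ?case using 4 insert by auto
  next
    case (5 a)
    then obtain j \<alpha> where a: "a = (j, \<alpha>)" by auto
    have "(\<Prod>i\<in>S. fps_nth (F i) ((\<alpha>(x := j)) i)) = (\<Prod>i\<in>S. fps_nth (F i) (\<alpha> i))"
      using insert by (intro prod.cong) auto
    then show ?case using a insert by simp
  qed (use insert in auto)
  finally show ?case .
qed

lemma prod_fps_nth_UNIV:
  fixes F :: "'n::finite \<Rightarrow> real fps"
  shows "(\<Sum>\<alpha> | mi_size \<alpha> = m. \<Prod>i\<in>UNIV. fps_nth (F i) (\<alpha> i)) = fps_nth (\<Prod>i\<in>UNIV. F i) m"
  by (subst prod_fps_nth) (auto simp: mi_size_def)

lemma multinomial_sum:
  fixes a :: "'n::finite \<Rightarrow> real"
  shows "(\<Sum>\<alpha> | mi_size \<alpha> = m. \<Prod>i\<in>UNIV. a i ^ \<alpha> i / fact (\<alpha> i)) = (\<Sum>i\<in>UNIV. a i) ^ m / fact m"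
proof -
  have "(\<Prod>i\<in>S. fps_exp (a i)) = fps_exp (\<Sum>i\<in>S. a i)" if "finite S" for S
    using that by (induction S) (auto simp: fps_exp_add_mult)
  then show ?thesis using prod_fps_nth_UNIV[of "\<lambda>i. fps_exp (a i)" m] by simp
qed

lemma vandermonde_multi:
  fixes \<alpha> :: "'n::finite \<Rightarrow> nat"
  shows "(\<Sum>\<kappa> | mi_size \<kappa> = k. \<Prod>i\<in>UNIV. real (\<alpha> i choose \<kappa> i)) = real (mi_size \<alpha> choose k)"
proof -
  have n: "fps_nth ((1 + fps_X) ^ m) j = real (m choose j)" for m j
    unfolding fps_binomial_of_nat[symmetric] by (simp add: binomial_gbinomial)
  have "(\<Prod>i\<in>UNIV. (1 + fps_X :: real fps) ^ \<alpha> i) = (1 + fps_X) ^ mi_size \<alpha>"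
    by (simp add: mi_size_def power_sum)
  then show ?thesis using prod_fps_nth_UNIV[of "\<lambda>i. (1 + fps_X) ^ \<alpha> i" k] by (simp only: n)
qed

section \<open>The Gaussian measure as a product\<close>

definition gdens :: "real^'n \<Rightarrow> real" where
  "gdens x = (2 * pi) powr (- real CARD('n) / 2) * exp (- (norm x)\<^sup>2 / 2)"

lemma gauss_gdens: "gauss = density lborel (\<lambda>x. ennreal (gdens x))"
  by (simp add: gauss_def gdens_def)

lemma gdens_pos: "0 < gdens x" by (simp add: gdens_def)

lemma borel_measurable_gdens[measurable]: "gdens \<in> borel_measurable borel"
  unfolding gdens_def[abs_def] by measurable

lemma space_gauss[simp]: "space gauss = UNIV" by (simp add: gauss_gdens)

lemma sets_gauss[simp, measurable_cong]: "sets gauss = sets borel" by (simp add: gauss_gdens)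

lemma norm_vec_sq: "(norm (x::real^'n))\<^sup>2 = (\<Sum>i\<in>UNIV. (x $ i)\<^sup>2)"
  unfolding power2_norm_eq_inner inner_vec_def by (simp add: power2_eq_square)

lemma gdens_prod: "gdens (x::real^'n) = (\<Prod>i\<in>UNIV. std_normal_density (x $ i))"
proof -
  have "(\<Prod>i\<in>UNIV. std_normal_density (x $ i)) = (1 / sqrt (2 * pi)) ^ CARD('n) * (\<Prod>i\<in>UNIV. exp (- (x $ i)\<^sup>2 / 2))"
    by (simp add: std_normal_density_def prod.distrib power_divide prod_dividef)
  also have "(\<Prod>i\<in>UNIV. exp (- (x $ i)\<^sup>2 / 2)) = exp (- (norm x)\<^sup>2 / 2)"
    by (simp add: norm_vec_sq exp_sum[symmetric] sum_negf[symmetric] sum_divide_distrib)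
  also have "(1 / sqrt (2 * pi)) ^ CARD('n) = (2 * pi) powr (- real CARD('n) / 2)"
  proof -
    have "1 / sqrt (2 * pi) = (2 * pi) powr (- 1 / 2)" by (simp add: powr_minus_divide powr_half_sqrt)
    then have "(1 / sqrt (2 * pi)) ^ CARD('n) = ((2 * pi) powr (- 1 / 2)) powr real CARD('n)"
      by (simp add: powr_realpow)
    then show ?thesis by (simp add: powr_powr)
  qed
  finally show ?thesis by (simp add: gdens_def)
qed

lemma nn_integral_lborel_prod_vec:
  fixes f :: "'n::finite \<Rightarrow> real \<Rightarrow> ennreal"
  assumes [measurable]: "\<And>i. f i \<in> borel_measurable borel"
  shows "(\<integral>\<^sup>+ x. (\<Prod>i\<in>UNIV. f i (x $ i)) \<partial>(lborel::(real^'n) measure)) = (\<Prod>i\<in>UNIV. integral\<^sup>N lborel (f i))"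
proof -
  define g where "g b = f (inv (\<lambda>i. axis i (1::real)) b)" for b :: "real^'n"
  have inj: "inj (\<lambda>i::'n. axis i (1::real))" by (auto simp: inj_on_def axis_eq_axis)
  have g: "g (axis i 1) = f i" for i by (simp add: g_def inv_f_f[OF inj])
  have B: "Basis = range (\<lambda>i::'n. axis i (1::real))" by (auto simp: Basis_vec_def)
  have P: "(\<Prod>b\<in>(Basis::(real^'n) set). h b) = (\<Prod>i\<in>UNIV. h (axis i 1))" for h :: "real^'n \<Rightarrow> ennreal"
    unfolding B by (subst prod.reindex[OF inj]) auto
  have "(\<integral>\<^sup>+ x. (\<Prod>b\<in>Basis. g b (x \<bullet> b)) \<partial>lborel) = (\<Prod>b\<in>Basis. integral\<^sup>N lborel (g b))"
    by (rule nn_integral_lborel_prod) (auto simp: g_def)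
  then show ?thesis unfolding P g by (simp add: inner_axis)
qed

lemma nn_integral_gauss_prod:
  fixes f :: "'n::finite \<Rightarrow> real \<Rightarrow> ennreal"
  assumes [measurable]: "\<And>i. f i \<in> borel_measurable borel"
  shows "(\<integral>\<^sup>+ x. (\<Prod>i\<in>UNIV. f i (x $ i)) \<partial>(gauss::(real^'n) measure)) = (\<Prod>i\<in>UNIV. integral\<^sup>N std_normal_distribution (f i))"
proof -
  have "(\<integral>\<^sup>+ x. (\<Prod>i\<in>UNIV. f i (x $ i)) \<partial>(gauss::(real^'n) measure))
     = (\<integral>\<^sup>+ x. (\<Prod>i\<in>UNIV. ennreal (std_normal_density (x $ i)) * f i (x $ i)) \<partial>(lborel::(real^'n) measure))"
    unfolding gauss_gdens
    by (subst nn_integral_density) (auto simp: gdens_prod prod.distrib prod_ennreal)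
  also have "\<dots> = (\<Prod>i\<in>UNIV. \<integral>\<^sup>+ x. ennreal (std_normal_density x) * f i x \<partial>lborel)"
    by (rule nn_integral_lborel_prod_vec) measurable
  also have "\<dots> = (\<Prod>i\<in>UNIV. integral\<^sup>N std_normal_distribution (f i))"
    by (intro prod.cong refl) (subst nn_integral_density, auto)
  finally show ?thesis .
qed

interpretation std: prob_space std_normal_distribution
  by (rule prob_space_normal_density) simp

interpretation gauss: prob_space "gauss :: (real^'n) measure"
proof
  have "emeasure std_normal_distribution UNIV = 1" using std.emeasure_space_1 by simp
  then show "emeasure (gauss :: (real^'n) measure) (space gauss) = 1"
    using nn_integral_gauss_prod[of "\<lambda>(i::'n) x. 1"] by simp
qed

lemma emeasure_gauss_UNIV: "emeasure (gauss :: (real^'n) measure) UNIV = 1"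
  using gauss.emeasure_space_1 by simp

lemma gauss_PiM:
  "distr (gauss::(real^'n) measure) (PiM UNIV (\<lambda>_. borel)) (\<lambda>x i. x $ i) = PiM UNIV (\<lambda>_. std_normal_distribution)"
proof -
  interpret product_sigma_finite "\<lambda>_::'n. std_normal_distribution"
    by standard
  have meas: "(\<lambda>(x::real^'n) i. x $ i) \<in> measurable borel (PiM UNIV (\<lambda>_. borel))"
    by (rule measurable_PiM_single') auto
  show ?thesis
  proof (rule PiM_eqI)
    show "sets (distr gauss (PiM UNIV (\<lambda>_. borel)) (\<lambda>(x::real^'n) i. x $ i)) = sets (PiM UNIV (\<lambda>_. std_normal_distribution))"
      by (simp cong: sets_PiM_cong)
    fix A :: "'n \<Rightarrow> real set"
    assume A: "\<And>i. i \<in> UNIV \<Longrightarrow> A i \<in> sets std_normal_distribution"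
    then have [measurable]: "A i \<in> sets borel" for i by simp
    have "emeasure (distr gauss (PiM UNIV (\<lambda>_. borel)) (\<lambda>(x::real^'n) i. x $ i)) (PiE UNIV A)
       = emeasure gauss ((\<lambda>(x::real^'n) i. x $ i) -` PiE UNIV A)"
      using meas by (subst emeasure_distr) (auto simp: measurable_cong_sets[OF sets_gauss refl] intro!: sets_PiM_I_finite)
    also have "\<dots> = (\<integral>\<^sup>+ x. indicator ((\<lambda>(x::real^'n) i. x $ i) -` PiE UNIV A) x \<partial>gauss)"
      using measurable_sets[OF meas, of "PiE UNIV A"] by (subst nn_integral_indicator) (auto intro!: sets_PiM_I_finite)
    also have "\<dots> = (\<integral>\<^sup>+ x. (\<Prod>i\<in>UNIV. indicator (A i) (x $ i)) \<partial>(gauss::(real^'n) measure))"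
      by (intro nn_integral_cong) (auto simp: indicator_def PiE_iff)
    also have "\<dots> = (\<Prod>i\<in>UNIV. emeasure std_normal_distribution (A i))"
      by (subst nn_integral_gauss_prod) (auto intro!: prod.cong)
    finally show "emeasure (distr gauss (PiM UNIV (\<lambda>_. borel)) (\<lambda>(x::real^'n) i. x $ i)) (PiE UNIV A)
       = (\<Prod>i\<in>UNIV. emeasure std_normal_distribution (A i))" .
  qed simp
qed

text \<open>Stated for complex integrands, as it is applied to characters.\<close>

lemma integral_gauss_prod:
  fixes f :: "'n::finite \<Rightarrow> real \<Rightarrow> complex"
  assumes int: "\<And>i. integrable std_normal_distribution (f i)"
  shows "(LINT x|(gauss::(real^'n) measure). (\<Prod>i\<in>UNIV. f i (x $ i))) = (\<Prod>i\<in>UNIV. LINT x|std_normal_distribution. f i x)"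
proof -
  interpret product_sigma_finite "\<lambda>_::'n. std_normal_distribution"
    by standard
  have [measurable]: "f i \<in> borel_measurable borel" for i using int[of i] by (auto dest: borel_measurable_integrable)
  have meas: "(\<lambda>(x::real^'n) i. x $ i) \<in> measurable gauss (PiM UNIV (\<lambda>_. borel))"
    by (rule measurable_PiM_single') auto
  have "(\<Prod>i\<in>UNIV. LINT x|std_normal_distribution. f i x) = (LINT x|PiM UNIV (\<lambda>_. std_normal_distribution). (\<Prod>i\<in>UNIV. f i (x i)))"
    using int by (subst product_integral_prod) auto
  also have "\<dots> = (LINT x|(gauss::(real^'n) measure). (\<Prod>i\<in>UNIV. f i (x $ i)))"
    unfolding gauss_PiM[symmetric] using meas by (subst integral_distr) auto
  finally show ?thesis ..
qed

lemma integral_gauss_cos: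
  fixes v :: "real^'n"
  shows "(LINT x|gauss. cos (v \<bullet> x + d)) = exp (- (norm v)\<^sup>2 / 2) * cos d"
proof -
  have int: "integrable std_normal_distribution (\<lambda>x. cis (t * x))" for t
    by (rule std.integrable_const_bound[of _ 1])
      (auto simp: norm_cis intro!: borel_measurable_continuous_onI continuous_intros)
  have ch: "(LINT x|std_normal_distribution. cis (t * x)) = complex_of_real (exp (- t\<^sup>2 / 2))" for t
    using fun_cong[OF char_std_normal_distribution, of t] by (simp add: char_def cis_conv_exp mult.commute)
  have "(LINT x|(gauss::(real^'n) measure). (\<Prod>i\<in>UNIV. cis (v $ i * x $ i))) = (\<Prod>i\<in>UNIV. complex_of_real (exp (- (v $ i)\<^sup>2 / 2)))"
    by (subst integral_gauss_prod[OF int]) (simp add: ch)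
  also have "\<dots> = complex_of_real (exp (- (norm v)\<^sup>2 / 2))"
    by (simp add: norm_vec_sq exp_sum[symmetric] sum_negf[symmetric] sum_divide_distrib flip: of_real_prod)
  also have "(\<lambda>x. \<Prod>i\<in>UNIV. cis (v $ i * x $ i)) = (\<lambda>x::real^'n. cis (v \<bullet> x))"
  proof
    fix x :: "real^'n"
    have "(\<Prod>i\<in>S. cis (v $ i * x $ i)) = cis (\<Sum>i\<in>S. v $ i * x $ i)" if "finite S" for S
      using that by (induction S) (auto simp: cis_mult)
    then show "(\<Prod>i\<in>UNIV. cis (v $ i * x $ i)) = cis (v \<bullet> x)" by (simp add: inner_vec_def)
  qed
  finally have I: "(LINT x|gauss. cis (v \<bullet> x)) = complex_of_real (exp (- (norm v)\<^sup>2 / 2))" .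
  have int2: "integrable gauss (\<lambda>x::real^'n. cis (v \<bullet> x))"
    by (rule gauss.integrable_const_bound[of _ 1])
      (auto simp: norm_cis measurable_cong_sets[OF sets_gauss refl]
        intro!: borel_measurable_continuous_onI continuous_intros)
  have "(LINT x|gauss. cos (v \<bullet> x + d)) = (LINT x|gauss. Re (cis d * cis (v \<bullet> x)))"
    by (intro Bochner_Integration.integral_cong) (auto simp: cis_mult add.commute)
  also have "\<dots> = Re (LINT x|gauss. cis d * cis (v \<bullet> x))"
    using int2 by (intro integral_Re) auto
  also have "\<dots> = Re (cis d * complex_of_real (exp (- (norm v)\<^sup>2 / 2)))" using I by simp
  finally show ?thesis by simp
qed

section \<open>Affine images and rotations\<close>

lemma distr_gauss_affine:
  fixes c :: "real^'n"
  assumes s: "0 < s"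
  shows "distr gauss borel (\<lambda>y. c + s *\<^sub>R y) = density lborel (\<lambda>z. ennreal (gdens ((1 / s) *\<^sub>R (z - c)) / s ^ CARD('n)))"
proof -
  let ?T = "\<lambda>y::real^'n. c + s *\<^sub>R y"
  let ?G = "\<lambda>z::real^'n. ennreal (gdens ((1 / s) *\<^sub>R (z - c)) / s ^ CARD('n))"
  have "density lborel ?G = density (density (distr lborel borel ?T) (\<lambda>_. ennreal (\<bar>s\<bar> ^ DIM(real^'n)))) ?G"
    using lborel_affine[of s c] s by simp
  also have "\<dots> = density (distr lborel borel ?T) (\<lambda>z. ennreal (\<bar>s\<bar> ^ DIM(real^'n)) * ?G z)"
    by (subst density_density_eq) auto
  also have "(\<lambda>z. ennreal (\<bar>s\<bar> ^ DIM(real^'n)) * ?G z) = (\<lambda>z. ennreal (gdens ((1 / s) *\<^sub>R (z - c))))"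
    using s by (auto simp: ennreal_mult'[symmetric] less_imp_le[OF gdens_pos])
  also have "density (distr lborel borel ?T) \<dots> = distr (density lborel (\<lambda>x. ennreal (gdens ((1 / s) *\<^sub>R (?T x - c))))) borel ?T"
    by (subst density_distr) auto
  also have "(\<lambda>x. ennreal (gdens ((1 / s) *\<^sub>R (?T x - c)))) = (\<lambda>x. ennreal (gdens x))" using s by auto
  finally show ?thesis by (simp add: gauss_gdens)
qed

lemma nn_integral_gauss_affine:
  fixes c :: "real^'n"
  assumes s: "0 < s" and [measurable]: "F \<in> borel_measurable borel"
  shows "(\<integral>\<^sup>+ y. F (c + s *\<^sub>R y) \<partial>gauss) = (\<integral>\<^sup>+ z. ennreal (gdens ((1 / s) *\<^sub>R (z - c)) / s ^ CARD('n)) * F z \<partial>lborel)"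
proof -
  have "(\<integral>\<^sup>+ y. F (c + s *\<^sub>R y) \<partial>gauss) = (\<integral>\<^sup>+ y. F y \<partial>distr gauss borel (\<lambda>y. c + s *\<^sub>R y))"
    by (subst nn_integral_distr) auto
  then show ?thesis unfolding distr_gauss_affine[OF s] by (subst (asm) nn_integral_density) auto
qed

lemma integral_gauss_affine:
  fixes c :: "real^'n" and F :: "real^'n \<Rightarrow> real"
  assumes s: "0 < s" and [measurable]: "F \<in> borel_measurable borel"
  shows "(LINT y|gauss. F (c + s *\<^sub>R y)) = (LINT z|lborel. gdens ((1 / s) *\<^sub>R (z - c)) / s ^ CARD('n) * F z)"
proof -
  have "(LINT y|gauss. F (c + s *\<^sub>R y)) = (LINT y|distr gauss borel (\<lambda>y. c + s *\<^sub>R y). F y)"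
    by (subst integral_distr) auto
  then show ?thesis unfolding distr_gauss_affine[OF s] using s
    by (subst (asm) integral_density) (auto simp: less_imp_le[OF gdens_pos])
qed

lemma nn_integral_gauss:
  fixes F :: "real^'n \<Rightarrow> ennreal"
  assumes [measurable]: "F \<in> borel_measurable borel"
  shows "(\<integral>\<^sup>+ y. F y \<partial>gauss) = (\<integral>\<^sup>+ z. ennreal (gdens z) * F z \<partial>lborel)"
  unfolding gauss_gdens by (subst nn_integral_density) auto

text \<open>Rotation invariance of the Gaussian measure in the form of reversibility: if \<open>z\<close> is obtained from \<open>x\<close>
by a noisy contraction, the joint density is symmetric in \<open>x\<close> and \<open>z\<close>.\<close>

lemma gdens_swap:
  fixes x z :: "real^'n"
  assumes r: "r\<^sup>2 + s\<^sup>2 = 1" "0 < s"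
  shows "gdens x * gdens ((1 / s) *\<^sub>R (z - r *\<^sub>R x)) = gdens z * gdens ((1 / s) *\<^sub>R (x - r *\<^sub>R z))"
proof -
  have *: "(norm x)\<^sup>2 + (norm ((1 / s) *\<^sub>R (z - r *\<^sub>R x)))\<^sup>2 = ((x \<bullet> x) + (z \<bullet> z) - 2 * r * (x \<bullet> z)) / s\<^sup>2" for x z :: "real^'n"
  proof -
    have "(norm ((1 / s) *\<^sub>R (z - r *\<^sub>R x)))\<^sup>2 = ((z - r *\<^sub>R x) \<bullet> (z - r *\<^sub>R x)) / s\<^sup>2"
      by (simp add: power_mult_distrib power_divide power2_norm_eq_inner)
    also have "(z - r *\<^sub>R x) \<bullet> (z - r *\<^sub>R x) = z \<bullet> z - 2 * r * (x \<bullet> z) + r\<^sup>2 * (x \<bullet> x)"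
      by (simp add: inner_diff_left inner_diff_right inner_commute power2_eq_square algebra_simps)
    also have "r\<^sup>2 = 1 - s\<^sup>2" using r by simp
    finally show ?thesis using r by (simp add: power2_norm_eq_inner field_simps)
  qed
  have **: "gdens x * gdens y = ((2 * pi) powr (- real CARD('n) / 2))\<^sup>2 * exp (- ((norm x)\<^sup>2 + (norm y)\<^sup>2) / 2)" for x y :: "real^'n"
    by (simp add: gdens_def power2_eq_square exp_add[symmetric] add_divide_distrib diff_divide_distrib)
  show ?thesis unfolding ** * by (simp add: inner_commute add.commute)
qed

lemma nn_integral_gauss_rotate:
  fixes \<phi> :: "real^'n \<Rightarrow> ennreal"
  assumes r: "r\<^sup>2 + s\<^sup>2 = 1" "0 < s" and [measurable]: "\<phi> \<in> borel_measurable borel"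
  shows "(\<integral>\<^sup>+ x. (\<integral>\<^sup>+ y. \<phi> (r *\<^sub>R x + s *\<^sub>R y) \<partial>gauss) \<partial>gauss) = (\<integral>\<^sup>+ x. \<phi> x \<partial>gauss)"
proof -
  have "(\<integral>\<^sup>+ x. (\<integral>\<^sup>+ y. \<phi> (r *\<^sub>R x + s *\<^sub>R y) \<partial>gauss) \<partial>gauss)
     = (\<integral>\<^sup>+ x. ennreal (gdens x) * (\<integral>\<^sup>+ z. ennreal (gdens ((1 / s) *\<^sub>R (z - r *\<^sub>R x)) / s ^ CARD('n)) * \<phi> z \<partial>lborel) \<partial>lborel)"
    by (subst nn_integral_gauss_affine[OF r(2)], measurable) (rule nn_integral_gauss, measurable)
  also have "\<dots> = (\<integral>\<^sup>+ x. (\<integral>\<^sup>+ z. ennreal (gdens x) * (ennreal (gdens ((1 / s) *\<^sub>R (z - r *\<^sub>R x)) / s ^ CARD('n)) * \<phi> z) \<partial>lborel) \<partial>lborel)"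
    by (intro nn_integral_cong nn_integral_cmult[symmetric]) measurable
  also have "\<dots> = (\<integral>\<^sup>+ x. (\<integral>\<^sup>+ z. ennreal (gdens z) * \<phi> z * ennreal (gdens ((1 / s) *\<^sub>R (x - r *\<^sub>R z)) / s ^ CARD('n)) \<partial>lborel) \<partial>lborel)"
  proof (intro nn_integral_cong)
    fix x z :: "real^'n"
    have "ennreal (gdens x) * ennreal (gdens ((1 / s) *\<^sub>R (z - r *\<^sub>R x)) / s ^ CARD('n))
       = ennreal (gdens z) * ennreal (gdens ((1 / s) *\<^sub>R (x - r *\<^sub>R z)) / s ^ CARD('n))"
    proof -
      have "ennreal (gdens x) * ennreal (gdens y / s ^ CARD('n)) = ennreal (gdens x * gdens y / s ^ CARD('n))" for x y :: "real^'n"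
        using r less_imp_le[OF gdens_pos] by (subst ennreal_mult[symmetric]) auto
      then show ?thesis using gdens_swap[OF r, of x z] by simp
    qed
    then show "ennreal (gdens x) * (ennreal (gdens ((1 / s) *\<^sub>R (z - r *\<^sub>R x)) / s ^ CARD('n)) * \<phi> z)
      = ennreal (gdens z) * \<phi> z * ennreal (gdens ((1 / s) *\<^sub>R (x - r *\<^sub>R z)) / s ^ CARD('n))"
      by (metis mult.assoc mult.commute)
  qed
  also have "\<dots> = (\<integral>\<^sup>+ z. (\<integral>\<^sup>+ x. ennreal (gdens z) * \<phi> z * ennreal (gdens ((1 / s) *\<^sub>R (x - r *\<^sub>R z)) / s ^ CARD('n)) \<partial>lborel) \<partial>lborel)"
    by (rule lborel_pair.Fubini') measurable
  also have "\<dots> = (\<integral>\<^sup>+ z. ennreal (gdens z) * \<phi> z * (\<integral>\<^sup>+ x. ennreal (gdens ((1 / s) *\<^sub>R (x - r *\<^sub>R z)) / s ^ CARD('n)) * 1 \<partial>lborel) \<partial>lborel)"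
    by (subst nn_integral_cmult[symmetric]) auto
  also have "\<dots> = (\<integral>\<^sup>+ z. ennreal (gdens z) * \<phi> z \<partial>lborel)"
    by (subst nn_integral_gauss_affine[OF r(2), symmetric])
      (auto simp: emeasure_gauss_UNIV)
  also have "\<dots> = (\<integral>\<^sup>+ x. \<phi> x \<partial>gauss)"
    by (rule nn_integral_gauss[symmetric]) measurable
  finally show ?thesis .
qed

section \<open>Smooth families and integration by parts\<close>

text \<open>A smooth function together with all its iterated partial derivatives, indexed by multi-indices.
Giving all derivatives at once makes \<open>foldr partial_deriv\<close> computable in closed form.\<close>

definition smooth_fam :: "(('n::finite \<Rightarrow> nat) \<Rightarrow> real^'n \<Rightarrow> real) \<Rightarrow> bool" where
  "smooth_fam U \<longleftrightarrow> (\<forall>a. U a differentiable_on UNIV \<and> (\<forall>i. partial_deriv i (U a) = U (a(i := Suc (a i)))))"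

lemma smooth_fam_foldr:
  assumes "smooth_fam U"
  shows "foldr partial_deriv is (U a) = U (\<lambda>i. a i + count_list is i)"
proof (induction "is")
  case (Cons j js)
  have "foldr partial_deriv (j # js) (U a) = partial_deriv j (U (\<lambda>i. a i + count_list js i))" using Cons by simp
  also have "\<dots> = U ((\<lambda>i. a i + count_list js i)(j := Suc (a j + count_list js j)))"
    using assms by (auto simp: smooth_fam_def)
  also have "(\<lambda>i. a i + count_list js i)(j := Suc (a j + count_list js j)) = (\<lambda>i. a i + count_list (j # js) i)"
    by auto
  finally show ?case .
qed simp

lemma smooth_fam_continuous: "smooth_fam U \<Longrightarrow> continuous_on UNIV (U a)"
  by (auto simp: smooth_fam_def differentiable_imp_continuous_on)

lemma smooth_fam_test_function:
  assumes "smooth_fam U" "compact (closure {x. U a x \<noteq> 0})"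
  shows "test_function (U a)"
  using assms smooth_fam_foldr[OF assms(1)] by (auto simp: test_function_def smooth_fam_def)

lemma partial_deriv_eq:
  assumes "(f has_derivative f') (at x)"
  shows "partial_deriv i f x = f' (axis i 1)"
  using frechet_derivative_at[OF assms] by (simp add: partial_deriv_def)

lemma partial_deriv_along:
  fixes f :: "real^'n \<Rightarrow> real"
  assumes "f differentiable (at (x + t *\<^sub>R axis i 1))"
  shows "((\<lambda>t. f (x + t *\<^sub>R axis i 1)) has_real_derivative partial_deriv i f (x + t *\<^sub>R axis i 1)) (at t)"
proof -
  let ?g = "\<lambda>t. x + t *\<^sub>R axis i (1::real)"
  have f: "(f has_derivative frechet_derivative f (at (?g t))) (at (?g t))"
    using assms by (simp add: frechet_derivative_works)
  have "(?g has_derivative (\<lambda>h. h *\<^sub>R axis i 1)) (at t)"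
    by (auto intro!: derivative_eq_intros)
  from diff_chain_at[OF this f]
  have "((\<lambda>t. f (?g t)) has_derivative (\<lambda>h. frechet_derivative f (at (?g t)) (h *\<^sub>R axis i 1))) (at t)"
    by (simp add: o_def)
  moreover have "frechet_derivative f (at (?g t)) (h *\<^sub>R axis i 1) = partial_deriv i f (?g t) * h" for h
    using linear_frechet_derivative[OF assms] by (simp add: linear_scale partial_deriv_def mult.commute)
  ultimately show ?thesis by (simp add: has_field_derivative_def mult_commute_abs)
qed

lemma partial_deriv_support:
  fixes f :: "real^'n \<Rightarrow> real"
  assumes "x \<notin> closure {x. f x \<noteq> 0}"
  shows "partial_deriv i f x = 0"
proof -
  have "(f has_derivative (\<lambda>_. 0)) (at x)"
  proof (rule has_derivative_transform_within_open[where f = "\<lambda>_. 0" and s = "- closure {x. f x \<noteq> 0}"])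
    show "0 = f y" if "y \<in> - closure {x. f x \<noteq> 0}" for y
      using that closure_subset[of "{x. f x \<noteq> 0}"] by auto
  qed (use assms in auto)
  then show ?thesis by (simp add: partial_deriv_eq)
qed

lemma compact_closure_mono:
  fixes A B :: "(real^'n) set"
  assumes "compact (closure B)" "closure A \<subseteq> closure B"
  shows "compact (closure A)"
  using compact_Int_closed[OF assms(1) closed_closure[of A]] assms(2) by (simp add: Int_absorb1)

lemma partial_deriv_compact_support:
  fixes f :: "real^'n \<Rightarrow> real"
  assumes "compact (closure {x. f x \<noteq> 0})"
  shows "compact (closure {x. partial_deriv i f x \<noteq> 0})"
proof -
  have "{x. partial_deriv i f x \<noteq> 0} \<subseteq> closure {x. f x \<noteq> 0}" using partial_deriv_support[of _ f i] by blast
  then have "closure {x. partial_deriv i f x \<noteq> 0} \<subseteq> closure {x. f x \<noteq> 0}"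
    by (rule closure_minimal) simp
  then show ?thesis by (rule compact_closure_mono[OF assms])
qed

lemma test_function_foldr:
  assumes "test_function \<phi>"
  shows "foldr partial_deriv is \<phi> differentiable_on UNIV" "compact (closure {x. foldr partial_deriv is \<phi> x \<noteq> 0})"
proof -
  show "foldr partial_deriv is \<phi> differentiable_on UNIV" using assms by (auto simp: test_function_def)
  show "compact (closure {x. foldr partial_deriv is \<phi> x \<noteq> 0})"
    by (induction "is") (use assms partial_deriv_compact_support in \<open>auto simp: test_function_def\<close>)
qed

lemma integrable_compact_support:
  fixes f :: "real^'n \<Rightarrow> real"
  assumes f: "continuous_on UNIV f" and K: "compact (closure {x. f x \<noteq> 0})"
  shows "integrable lborel f"
proof -
  have "integrable lborel (\<lambda>x. indicator (closure {x. f x \<noteq> 0}) x *\<^sub>R f x)"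
    by (rule borel_integrable_compact[OF K continuous_on_subset[OF f]]) auto
  also have "(\<lambda>x. indicator (closure {x. f x \<noteq> 0}) x *\<^sub>R f x) = f"
    using closure_subset[of "{x. f x \<noteq> 0}"] by (fastforce simp: indicator_def)
  finally show ?thesis .
qed

lemma bounded_compact_support:
  fixes f :: "real^'n \<Rightarrow> real"
  assumes f: "continuous_on UNIV f" and K: "compact (closure {x. f x \<noteq> 0})"
  obtains B where "\<And>x. \<bar>f x\<bar> \<le> B" "0 \<le> B"
proof -
  have "compact (f ` closure {x. f x \<noteq> 0})" using K continuous_on_subset[OF f] by (intro compact_continuous_image) auto
  from compact_imp_bounded[OF this, unfolded bounded_iff]
  obtain B where B: "\<forall>y\<in>f ` closure {x. f x \<noteq> 0}. norm y \<le> B" ..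
  have "\<bar>f x\<bar> \<le> max B 0" for x
  proof (cases "f x = 0")
    case False
    then have "x \<in> {x. f x \<noteq> 0}" by simp
    then have "x \<in> closure {x. f x \<noteq> 0}" by (rule closure_subset[THEN subsetD])
    then have "norm (f x) \<le> B" by (intro B[rule_format] imageI)
    then show ?thesis by simp
  qed simp
  then show ?thesis using that[of "max B 0"] by auto
qed

lemma lborel_integral_translate:
  fixes f :: "real^'n \<Rightarrow> real"
  assumes "f \<in> borel_measurable borel"
  shows "(LINT x|lborel. f (x + c)) = (LINT x|lborel. f x)"
proof -
  have "(LINT x|lborel. f x) = (LINT x|distr lborel borel ((+) c). f x)" by (simp add: lborel_distr_plus)
  also have "\<dots> = (LINT x|lborel. f (c + x))" using assms by (subst integral_distr) auto
  finally show ?thesis by (simp add: add.commute)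
qed

text \<open>The difference quotients have integral \<open>0\<close> by translation invariance and converge
dominatedly, the support being compact. This avoids iterated integrals.\<close>

lemma integral_partial_deriv_zero:
  fixes V :: "real^'n \<Rightarrow> real"
  assumes V: "V differentiable_on UNIV" and W: "continuous_on UNIV (partial_deriv i V)"
    and K: "compact (closure {x. V x \<noteq> 0})"
  shows "(LINT x|lborel. partial_deriv i V x) = 0"
proof -
  let ?e = "axis i (1::real) :: real^'n"
  have cV: "continuous_on UNIV V" using V by (rule differentiable_imp_continuous_on)
  have [measurable]: "V \<in> borel_measurable borel" using cV by (rule borel_measurable_continuous_onI)
  have dV: "V differentiable (at x)" for x using V by (auto simp: differentiable_on_def)
  obtain B where B: "\<And>x. \<bar>partial_deriv i V x\<bar> \<le> B" "0 \<le> B"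
    using bounded_compact_support[OF W partial_deriv_compact_support[OF K]] by blast
  from compact_imp_bounded[OF K, unfolded bounded_iff]
  obtain R where R: "\<forall>x\<in>closure {x. V x \<noteq> 0}. norm x \<le> R" ..
  have V0: "V x = 0" if "norm x > R" for x
  proof (rule ccontr)
    assume "V x \<noteq> 0"
    then have "x \<in> closure {x. V x \<noteq> 0}" by (intro closure_subset[THEN subsetD]) simp
    then show False using R that by fastforce
  qed
  \<comment> \<open>step sizes of the difference quotients \<open>?q n\<close>\<close>
  let ?t = "\<lambda>n. inverse (real (Suc n))"
  let ?q = "\<lambda>n x. (V (x + ?t n *\<^sub>R ?e) - V x) / ?t n"
  have lim: "(\<lambda>n. LINT x|lborel. ?q n x) \<longlonglongrightarrow> (LINT x|lborel. partial_deriv i V x)"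
  proof (rule integral_dominated_convergence[where w = "\<lambda>x. B * indicator (cball 0 (R + 1)) x"])
    show "partial_deriv i V \<in> borel_measurable lborel"
      using borel_measurable_continuous_onI[OF W] by simp
    show "integrable lborel (\<lambda>x::real^'n. B * indicator (cball 0 (R + 1)) x)"
      using emeasure_bounded_finite[of "cball (0::real^'n) (R+1)"] by (intro integrable_mult_right integrable_real_indicator) auto
    show "AE x in lborel. (\<lambda>n. ?q n x) \<longlonglongrightarrow> partial_deriv i V x"
    proof (rule AE_I2)
      fix x
      have "((\<lambda>t. V (x + t *\<^sub>R ?e)) has_real_derivative partial_deriv i V (x + 0 *\<^sub>R ?e)) (at 0)"
        by (rule partial_deriv_along[OF dV])
      then have "((\<lambda>h. (V (x + h *\<^sub>R ?e) - V x) / h) \<longlongrightarrow> partial_deriv i V x) (at 0)"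
        by (simp add: has_field_derivative_iff)
      moreover have "filterlim ?t (at 0) sequentially"
        unfolding filterlim_at using LIMSEQ_inverse_real_of_nat by auto
      ultimately show "(\<lambda>n. ?q n x) \<longlonglongrightarrow> partial_deriv i V x" by (rule filterlim_compose)
    qed
    fix n
    show "?q n \<in> borel_measurable lborel" by measurable
    show "AE x in lborel. norm (?q n x) \<le> B * indicator (cball 0 (R + 1)) x"
    proof (rule AE_I2)
      fix x :: "real^'n"
      have t: "0 < ?t n" "?t n \<le> 1" by (auto simp: field_simps)
      show "norm (?q n x) \<le> B * indicator (cball 0 (R + 1)) x"
      proof (cases "x \<in> cball 0 (R + 1)")
        case True
        have "\<exists>z. 0 < z \<and> z < ?t n \<and> V (x + ?t n *\<^sub>R ?e) - V (x + 0 *\<^sub>R ?e) = (?t n - 0) * partial_deriv i V (x + z *\<^sub>R ?e)"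
          using t by (intro MVT2 partial_deriv_along dV) auto
        then obtain z where "V (x + ?t n *\<^sub>R ?e) - V x = ?t n * partial_deriv i V (x + z *\<^sub>R ?e)" by auto
        then have "?q n x = partial_deriv i V (x + z *\<^sub>R ?e)" using t by simp
        then show ?thesis using B True by simp
      next
        case False
        then have n: "norm x > R + 1" by simp
        have "norm x \<le> norm (x + ?t n *\<^sub>R ?e) + norm (?t n *\<^sub>R ?e)"
          using norm_triangle_ineq4[of "x + ?t n *\<^sub>R ?e" "?t n *\<^sub>R ?e"] by simp
        moreover have "norm (?t n *\<^sub>R ?e) \<le> 1" using t by simp
        ultimately have "norm (x + ?t n *\<^sub>R ?e) > R" using n by linarith
        then show ?thesis using n V0[of x] V0[of "x + ?t n *\<^sub>R ?e"] False by simp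
      qed
    qed
  qed
  have iV: "integrable lborel V" by (rule integrable_compact_support[OF cV K])
  have iV': "integrable lborel (\<lambda>x. V (x + c))" for c
  proof -
    have "integrable (distr lborel borel ((+) c)) V" using iV by (simp add: lborel_distr_plus)
    then show ?thesis by (subst (asm) integrable_distr_eq) (auto simp: add.commute)
  qed
  have E: "(LINT x|lborel. ?q n x) = 0" for n
    using iV iV' by (simp add: lborel_integral_translate)
  show ?thesis using lim unfolding E by (simp add: LIMSEQ_const_iff)
qed

lemma partial_deriv_mult:
  fixes f g :: "real^'n \<Rightarrow> real"
  assumes "f differentiable (at x)" "g differentiable (at x)"
  shows "partial_deriv i (\<lambda>x. f x * g x) x = f x * partial_deriv i g x + partial_deriv i f x * g x"
  using partial_deriv_eq[OF has_derivative_mult[OF assms[unfolded frechet_derivative_works]]]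
  by (simp add: partial_deriv_def)

text \<open>Each partial derivative is moved by integrating the derivative of \<open>U a * \<psi>\<close>, where \<open>\<psi>\<close> is an iterated derivative of \<open>\<phi>\<close>.\<close>

lemma smooth_fam_parts:
  assumes U: "smooth_fam U" and \<phi>: "test_function \<phi>"
  shows "(LINT x|lborel. U a x * foldr partial_deriv is \<phi> x) = (-1) ^ length is * (LINT x|lborel. U (\<lambda>i. a i + count_list is i) x * \<phi> x)"
proof (induction "is" arbitrary: a)
  case (Cons i js)
  let ?\<psi> = "foldr partial_deriv js \<phi>"
  let ?a = "a(i := Suc (a i))"
  note psi = test_function_foldr[OF \<phi>, of js] test_function_foldr[OF \<phi>, of "i # js"]
  have dU: "U a differentiable (at x)" for a x using U by (auto simp: smooth_fam_def differentiable_on_def)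
  have dp: "?\<psi> differentiable (at x)" for x using psi by (auto simp: differentiable_on_def)
  have cp: "continuous_on UNIV ?\<psi>" "continuous_on UNIV (partial_deriv i ?\<psi>)"
    using psi by (auto dest: differentiable_imp_continuous_on)
  note cU = smooth_fam_continuous[OF U]
  have pd: "partial_deriv i (\<lambda>x. U a x * ?\<psi> x) = (\<lambda>x. U a x * partial_deriv i ?\<psi> x + U ?a x * ?\<psi> x)"
    using partial_deriv_mult[OF dU dp] U by (auto simp: smooth_fam_def)
  have cs: "compact (closure {x. f x * g x \<noteq> 0})" if "compact (closure {x. g x \<noteq> 0})" for f g :: "real^'a \<Rightarrow> real"
  proof -
    have "closure {x. f x * g x \<noteq> 0} \<subseteq> closure {x. g x \<noteq> 0}" by (rule closure_mono) auto
    then show ?thesis by (rule compact_closure_mono[OF that])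
  qed
  have i1: "integrable lborel (\<lambda>x. U a x * partial_deriv i ?\<psi> x)"
    using psi cp cU by (intro integrable_compact_support cs continuous_on_mult) auto
  have i2: "integrable lborel (\<lambda>x. U ?a x * ?\<psi> x)"
    using psi cp cU by (intro integrable_compact_support cs continuous_on_mult) auto
  have "(LINT x|lborel. partial_deriv i (\<lambda>x. U a x * ?\<psi> x) x) = 0"
  proof (rule integral_partial_deriv_zero)
    show "(\<lambda>x. U a x * ?\<psi> x) differentiable_on UNIV"
      using dU dp by (auto simp: differentiable_on_def intro!: differentiable_mult)
    show "continuous_on UNIV (partial_deriv i (\<lambda>x. U a x * ?\<psi> x))"
      unfolding pd using cp cU by (intro continuous_intros) auto
    show "compact (closure {x. U a x * ?\<psi> x \<noteq> 0})" using psi by (intro cs) auto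
  qed
  then have "(LINT x|lborel. U a x * partial_deriv i ?\<psi> x) = - (LINT x|lborel. U ?a x * ?\<psi> x)"
    unfolding pd using i1 i2 by simp
  also have "(LINT x|lborel. U ?a x * ?\<psi> x) = (-1) ^ length js * (LINT x|lborel. U (\<lambda>j. ?a j + count_list js j) x * \<phi> x)"
    by (rule Cons.IH)
  also have "(\<lambda>j. ?a j + count_list js j) = (\<lambda>j. a j + count_list (i # js) j)" by auto
  finally show ?case by simp
qed simp

lemma locally_integrable_continuous:
  fixes f :: "real^'n \<Rightarrow> real"
  assumes "continuous_on UNIV f" shows "locally_integrable f"
proof -
  have "set_integrable lborel K f" if "compact K" for K
    using borel_integrable_compact[OF that continuous_on_subset[OF assms]] by (simp add: set_integrable_def)
  then show ?thesis using borel_measurable_continuous_onI[OF assms] by (simp add: locally_integrable_def)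
qed

lemma length_count_list: "(\<forall>i. count_list is i = \<kappa> i) \<Longrightarrow> length is = mi_size (\<kappa> :: 'n::finite \<Rightarrow> nat)"
proof -
  assume "\<forall>i. count_list is i = \<kappa> i"
  then have "mi_size \<kappa> = (\<Sum>i\<in>UNIV. count_list is i)" by (simp add: mi_size_def)
  also have "\<dots> = (\<Sum>i\<in>set is. count_list is i)" by (rule sum.mono_neutral_right) (auto simp: count_list_0_iff)
  finally show ?thesis by (simp add: sum_count_set)
qed

lemma smooth_fam_weak_deriv:
  fixes U :: "('n::finite \<Rightarrow> nat) \<Rightarrow> real^'n \<Rightarrow> real"
  assumes U: "smooth_fam U"
  shows "has_weak_deriv \<kappa> (U (\<lambda>_. 0)) (U \<kappa>)"
  unfolding has_weak_deriv_def
proof (intro conjI allI impI)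
  fix \<phi> :: "real^'n \<Rightarrow> real" and "is" assume \<phi>: "test_function \<phi>" and c: "\<forall>i. count_list is i = \<kappa> i"
  show "(LINT x|lborel. U (\<lambda>_. 0) x * foldr partial_deriv is \<phi> x) = (-1) ^ mi_size \<kappa> * (LINT x|lborel. U \<kappa> x * \<phi> x)"
    using smooth_fam_parts[OF U \<phi>, of "\<lambda>_. 0" "is"] length_count_list[OF c] c by simp
qed (auto intro: locally_integrable_continuous smooth_fam_continuous[OF U])

lemma has_weak_deriv_sum:
  fixes F G :: "'b \<Rightarrow> real^'n \<Rightarrow> real"
  assumes S: "finite S" and FG: "\<And>b. b \<in> S \<Longrightarrow> has_weak_deriv \<kappa> (F b) (G b)"
    and c: "\<And>b. b \<in> S \<Longrightarrow> continuous_on UNIV (F b)" "\<And>b. b \<in> S \<Longrightarrow> continuous_on UNIV (G b)"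
  shows "has_weak_deriv \<kappa> (\<lambda>x. \<Sum>b\<in>S. F b x) (\<lambda>x. \<Sum>b\<in>S. G b x)"
  unfolding has_weak_deriv_def
proof (intro conjI allI impI)
  show "locally_integrable (\<lambda>x. \<Sum>b\<in>S. F b x)" "locally_integrable (\<lambda>x. \<Sum>b\<in>S. G b x)"
    using c by (auto intro!: locally_integrable_continuous continuous_on_sum)
  fix \<phi> :: "real^'n \<Rightarrow> real" and "is" assume \<phi>: "test_function \<phi>" and cnt: "\<forall>i. count_list is i = \<kappa> i"
  have cs: "compact (closure {x. f x * g x \<noteq> 0})" if "compact (closure {x. g x \<noteq> 0})" for f g :: "real^'n \<Rightarrow> real"
  proof -
    have "closure {x. f x * g x \<noteq> 0} \<subseteq> closure {x. g x \<noteq> 0}" by (rule closure_mono) auto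
    then show ?thesis by (rule compact_closure_mono[OF that])
  qed
  have int: "integrable lborel (\<lambda>x. H x * foldr partial_deriv js \<phi> x)" if "continuous_on UNIV H" for H js
    using test_function_foldr[OF \<phi>, of js]
    by (intro integrable_compact_support cs continuous_on_mult that differentiable_imp_continuous_on)
  have "(LINT x|lborel. (\<Sum>b\<in>S. F b x) * foldr partial_deriv is \<phi> x) = (\<Sum>b\<in>S. LINT x|lborel. F b x * foldr partial_deriv is \<phi> x)"
    unfolding sum_distrib_right using int c by (intro Bochner_Integration.integral_sum) auto
  also have "\<dots> = (\<Sum>b\<in>S. (-1) ^ mi_size \<kappa> * (LINT x|lborel. G b x * \<phi> x))"
    using FG \<phi> cnt by (intro sum.cong) (auto simp: has_weak_deriv_def)
  also have "\<dots> = (-1) ^ mi_size \<kappa> * (LINT x|lborel. (\<Sum>b\<in>S. G b x) * \<phi> x)"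
    unfolding sum_distrib_left[symmetric] sum_distrib_right using int[of _ "[]"] c
    by (subst Bochner_Integration.integral_sum) auto
  finally show "(LINT x|lborel. (\<Sum>b\<in>S. F b x) * foldr partial_deriv is \<phi> x) = (-1) ^ mi_size \<kappa> * (LINT x|lborel. (\<Sum>b\<in>S. G b x) * \<phi> x)" .
qed

section \<open>Products of one-variable functions\<close>

text \<open>The one-variable counterpart of \<open>smooth_fam\<close>: a function followed by its successive derivatives.\<close>

definition smooth_seq :: "(nat \<Rightarrow> real \<Rightarrow> real) \<Rightarrow> bool" where
  "smooth_seq u \<longleftrightarrow> (\<forall>j x. (u j has_real_derivative u (Suc j) x) (at x))"

definition pprod :: "('n::finite \<Rightarrow> nat \<Rightarrow> real \<Rightarrow> real) \<Rightarrow> ('n \<Rightarrow> nat) \<Rightarrow> real^'n \<Rightarrow> real" where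
  "pprod u a x = (\<Prod>i\<in>UNIV. u i (a i) (x $ i))"

lemma smooth_fam_pprod:
  assumes "\<And>i. smooth_seq (u i)"
  shows "smooth_fam (pprod u)"
proof -
  have d: "(pprod u a has_derivative (\<lambda>h. \<Sum>i\<in>UNIV. (u i (Suc (a i)) (x $ i) * h $ i) * (\<Prod>j\<in>UNIV - {i}. u j (a j) (x $ j)))) (at x)" for a x
    unfolding pprod_def[abs_def]
  proof (rule has_derivative_prod)
    fix i
    have "(u i (a i) has_derivative (*) (u i (Suc (a i)) (x $ i))) (at (x $ i))"
      using assms by (auto simp: smooth_seq_def has_field_derivative_def)
    moreover have "((\<lambda>x. x $ i) has_derivative (\<lambda>h. h $ i)) (at x)"
      by (rule bounded_linear_imp_has_derivative[OF bounded_linear_vec_nth])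
    ultimately show "((\<lambda>x. u i (a i) (x $ i)) has_derivative (\<lambda>h. u i (Suc (a i)) (x $ i) * h $ i)) (at x)"
      using diff_chain_at[of "\<lambda>x. x $ i" "\<lambda>h. h $ i" x "u i (a i)"] by (simp add: o_def)
  qed
  have "partial_deriv k (pprod u a) x = pprod u (a(k := Suc (a k))) x" for a x k
  proof -
    have "partial_deriv k (pprod u a) x = (\<Sum>i\<in>UNIV. (u i (Suc (a i)) (x $ i) * axis k 1 $ i) * (\<Prod>j\<in>UNIV - {i}. u j (a j) (x $ j)))"
      by (rule partial_deriv_eq[OF d])
    also have "\<dots> = (\<Sum>i\<in>UNIV. if i = k then u k (Suc (a k)) (x $ k) * (\<Prod>j\<in>UNIV - {k}. u j (a j) (x $ j)) else 0)"
      by (intro sum.cong) (auto simp: axis_def)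
    also have "\<dots> = u k (Suc (a k)) (x $ k) * (\<Prod>j\<in>UNIV - {k}. u j (a j) (x $ j))" by simp
    also have "\<dots> = pprod u (a(k := Suc (a k))) x"
      unfolding pprod_def by (subst prod.remove[of UNIV k]) (auto intro!: prod.cong)
    finally show ?thesis .
  qed
  moreover have "pprod u a differentiable (at x)" for a x
    using d[of a x] unfolding differentiable_def by blast
  ultimately show ?thesis unfolding smooth_fam_def by (auto simp: differentiable_on_def)
qed

lemma smooth_seq_continuous: "smooth_seq u \<Longrightarrow> continuous_on S (u j)"
  unfolding smooth_seq_def by (meson DERIV_isCont continuous_at_imp_continuous_on)

lemma pprod_test_function:
  fixes u :: "'n::finite \<Rightarrow> nat \<Rightarrow> real \<Rightarrow> real"
  assumes "\<And>i. smooth_seq (u i)" "\<And>i x. x \<notin> {l i..r i} \<Longrightarrow> u i (a i) x = 0"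
  shows "test_function (pprod u a)"
proof (rule smooth_fam_test_function[OF smooth_fam_pprod[OF assms(1)]])
  have "{x. pprod u a x \<noteq> 0} \<subseteq> cbox (\<chi> i. l i) (\<chi> i. r i)"
  proof
    fix x assume "x \<in> {x. pprod u a x \<noteq> 0}"
    then have "\<And>i. u i (a i) (x $ i) \<noteq> 0" by (auto simp: pprod_def)
    then have "\<And>i. x $ i \<in> {l i..r i}" using assms(2) by metis
    then show "x \<in> cbox (\<chi> i. l i) (\<chi> i. r i)" by (auto simp: mem_box_cart)
  qed
  then have "closure {x. pprod u a x \<noteq> 0} \<subseteq> cbox (\<chi> i. l i) (\<chi> i. r i)"
    by (rule closure_minimal[OF _ closed_cbox])
  then show "compact (closure {x. pprod u a x \<noteq> 0})"
    using compact_Int_closed[OF compact_cbox closed_closure] by (metis Int_absorb1)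
qed

section \<open>Bump functions\<close>

text \<open>The derivatives of \<open>exp (- c / x)\<close> on the positive axis have the form
\<open>poly (bump_poly c j) (1 / x) * exp (- c / x)\<close>.\<close>

fun bump_poly :: "real \<Rightarrow> nat \<Rightarrow> real poly" where
  "bump_poly c 0 = 1"
| "bump_poly c (Suc j) = [:0, 0, 1:] * (smult c (bump_poly c j) - pderiv (bump_poly c j))"

definition flat :: "real \<Rightarrow> nat \<Rightarrow> real \<Rightarrow> real" where
  "flat c j x = (if 0 < x then poly (bump_poly c j) (1 / x) * exp (- c / x) else 0)"

lemma poly_exp_tendsto_0:
  assumes "0 < (c::real)"
  shows "((\<lambda>y. poly q y * exp (- c * y)) \<longlongrightarrow> 0) at_top"
proof -
  have m: "((\<lambda>y. y ^ i * exp (- c * y)) \<longlongrightarrow> 0) at_top" for i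
  proof -
    have "((\<lambda>y. (1 / c) ^ i * ((c * y) ^ i / exp (c * y))) \<longlongrightarrow> (1 / c) ^ i * 0) at_top"
      using assms by (intro tendsto_intros filterlim_compose[OF tendsto_power_div_exp_0])
        (auto intro!: filterlim_tendsto_pos_mult_at_top[OF tendsto_const] filterlim_ident)
    moreover have "(1 / c) ^ i * ((c * y) ^ i / exp (c * y)) = y ^ i * exp (- c * y)" for y
      using assms by (simp add: power_mult_distrib power_one_over exp_minus field_simps)
    ultimately show ?thesis by simp
  qed
  have "((\<lambda>y. \<Sum>i\<le>degree q. coeff q i * (y ^ i * exp (- c * y))) \<longlongrightarrow> (\<Sum>i\<le>degree q. coeff q i * 0)) at_top"
    by (intro tendsto_intros m)
  then show ?thesis by (simp add: poly_altdef sum_distrib_right mult.assoc)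
qed

lemma smooth_seq_flat:
  assumes c: "0 < c"
  shows "smooth_seq (flat c)"
  unfolding smooth_seq_def
proof (intro allI)
  fix j and x :: real
  consider "x > 0" | "x < 0" | "x = 0" by linarith
  then show "(flat c j has_real_derivative flat c (Suc j) x) (at x)"
  proof cases
    case 1
    have "((\<lambda>x. poly (bump_poly c j) (1 / x) * exp (- c / x)) has_real_derivative
      poly (pderiv (bump_poly c j)) (1 / x) * (- (1 / x\<^sup>2)) * exp (- c / x) + poly (bump_poly c j) (1 / x) * (exp (- c / x) * (c / x\<^sup>2))) (at x)"
      using 1 by (auto intro!: derivative_eq_intros DERIV_chain2[OF poly_DERIV] simp: power2_eq_square field_simps)
    also have "poly (pderiv (bump_poly c j)) (1 / x) * (- (1 / x\<^sup>2)) * exp (- c / x) + poly (bump_poly c j) (1 / x) * (exp (- c / x) * (c / x\<^sup>2)) = flat c (Suc j) x"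
      using 1 by (simp add: flat_def power2_eq_square algebra_simps add_divide_distrib diff_divide_distrib)
    finally have d: "((\<lambda>x. poly (bump_poly c j) (1 / x) * exp (- c / x)) has_real_derivative flat c (Suc j) x) (at x)" .
    show ?thesis
      by (rule has_field_derivative_transform_within_open[OF d, of "{0<..}"]) (use 1 in \<open>auto simp: flat_def\<close>)
  next
    case 2
    have "((\<lambda>x. 0) has_real_derivative flat c (Suc j) x) (at x)" using 2 by (simp add: flat_def)
    then show ?thesis
      by (rule has_field_derivative_transform_within_open[of _ _ _ "{..<0}"]) (use 2 in \<open>auto simp: flat_def\<close>)
  next
    case 3
    have "((\<lambda>h. flat c j h / h) \<longlongrightarrow> 0) (at 0)"
    proof (rule filterlim_split_at)
      show "((\<lambda>h. flat c j h / h) \<longlongrightarrow> 0) (at_left 0)"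
        by (rule tendsto_eventually) (auto simp: eventually_at_left_field flat_def intro!: exI[of _ "-1"])
      have "((\<lambda>h. poly ([:0, 1:] * bump_poly c j) (inverse h) * exp (- c * inverse h)) \<longlongrightarrow> 0) (at_right 0)"
        by (rule filterlim_compose[OF poly_exp_tendsto_0[OF c] filterlim_inverse_at_top_right])
      then show "((\<lambda>h. flat c j h / h) \<longlongrightarrow> 0) (at_right 0)"
        by (rule Lim_transform_eventually)
          (auto simp: eventually_at_right_field flat_def field_simps intro!: exI[of _ 1])
    qed
    then show ?thesis using 3 by (simp add: has_field_derivative_iff flat_def)
  qed
qed

lemma smooth_seq_affine:
  assumes "smooth_seq u"
  shows "smooth_seq (\<lambda>j x. m ^ j * u j (m * x + b))"
  unfolding smooth_seq_def
proof (intro allI)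
  fix j and x :: real
  have "((\<lambda>x. u j (m * x + b)) has_real_derivative u (Suc j) (m * x + b) * (m * 1 + 0)) (at x)"
    using assms by (intro DERIV_chain2[of "u j"] DERIV_add DERIV_cmult DERIV_ident DERIV_const) (auto simp: smooth_seq_def)
  from DERIV_cmult[OF this, of "m ^ j"]
  show "((\<lambda>x. m ^ j * u j (m * x + b)) has_real_derivative m ^ Suc j * u (Suc j) (m * x + b)) (at x)"
    by (simp add: ac_simps)
qed

text \<open>The sequence of derivatives of a product.\<close>

definition leibniz :: "(nat \<Rightarrow> real \<Rightarrow> real) \<Rightarrow> (nat \<Rightarrow> real \<Rightarrow> real) \<Rightarrow> nat \<Rightarrow> real \<Rightarrow> real" where
  "leibniz u v j x = (\<Sum>i\<le>j. real (j choose i) * (u i x * v (j - i) x))"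

lemma leibniz_Suc: "leibniz u v (Suc j) x = leibniz (\<lambda>i. u (Suc i)) v j x + leibniz u (\<lambda>i. v (Suc i)) j x"
proof -
  let ?f = "\<lambda>i. u i x * v (Suc j - i) x"
  have "leibniz u v (Suc j) x = ?f 0 + (\<Sum>i\<le>j. real (Suc j choose Suc i) * ?f (Suc i))"
    unfolding leibniz_def by (subst sum.atMost_Suc_shift) simp
  also have "(\<Sum>i\<le>j. real (Suc j choose Suc i) * ?f (Suc i)) = leibniz (\<lambda>i. u (Suc i)) v j x + (\<Sum>i\<le>j. real (j choose Suc i) * ?f (Suc i))"
    by (simp add: leibniz_def sum.distrib algebra_simps)
  also have "(\<Sum>i\<le>j. real (j choose Suc i) * ?f (Suc i)) = (\<Sum>i<j. real (j choose Suc i) * ?f (Suc i))"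
    by (subst lessThan_Suc_atMost[symmetric]) simp
  also have "?f 0 + (a + (\<Sum>i<j. real (j choose Suc i) * ?f (Suc i))) = a + (\<Sum>i\<le>j. real (j choose i) * ?f i)" for a
    by (subst lessThan_Suc_atMost[symmetric], subst sum.lessThan_Suc_shift) simp
  also have "(\<Sum>i\<le>j. real (j choose i) * ?f i) = leibniz u (\<lambda>i. v (Suc i)) j x"
    unfolding leibniz_def by (intro sum.cong) (auto simp: Suc_diff_le)
  finally show ?thesis .
qed

lemma smooth_seq_leibniz:
  assumes "smooth_seq u" "smooth_seq v"
  shows "smooth_seq (leibniz u v)"
  unfolding smooth_seq_def
proof (intro allI)
  fix j and x :: real
  have "(leibniz u v j has_real_derivative (\<Sum>i\<le>j. real (j choose i) * (u (Suc i) x * v (j - i) x + v (Suc (j - i)) x * u i x))) (at x)"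
    unfolding leibniz_def[abs_def] using assms
    by (intro DERIV_sum DERIV_cmult DERIV_mult) (auto simp: smooth_seq_def)
  also have "(\<Sum>i\<le>j. real (j choose i) * (u (Suc i) x * v (j - i) x + v (Suc (j - i)) x * u i x)) = leibniz u v (Suc j) x"
    unfolding leibniz_Suc by (simp add: leibniz_def sum.distrib algebra_simps)
  finally show "(leibniz u v j has_real_derivative leibniz u v (Suc j) x) (at x)" .
qed

text \<open>The derivatives of \<open>exp (- c / (x - a) - c / (b - x))\<close> on the interval between \<open>a\<close> and \<open>b\<close>. As \<open>c\<close>
tends to \<open>0\<close>, the bump tends to the indicator function of the open interval.\<close>

definition bump :: "real \<Rightarrow> real \<Rightarrow> real \<Rightarrow> nat \<Rightarrow> real \<Rightarrow> real" where
  "bump c a b = leibniz (\<lambda>j x. flat c j (x - a)) (\<lambda>j x. (- 1) ^ j * flat c j (b - x))"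

lemma smooth_seq_bump: "0 < c \<Longrightarrow> smooth_seq (bump c a b)"
  unfolding bump_def
  using smooth_seq_affine[OF smooth_seq_flat, of c 1 "-a"] smooth_seq_affine[OF smooth_seq_flat, of c "-1" b]
  by (intro smooth_seq_leibniz) (auto simp: add.commute)

lemma bump_support: "x \<notin> {a<..<b} \<Longrightarrow> bump c a b j x = 0"
  by (auto simp: bump_def leibniz_def flat_def)

lemma bump_0: "bump c a b 0 x = (if x \<in> {a<..<b} then exp (- c / (x - a)) * exp (- c / (b - x)) else 0)"
  by (auto simp: bump_def leibniz_def flat_def)

lemma bump_bounded:
  assumes "0 < c"
  obtains K where "0 \<le> K" "\<And>x. \<bar>bump c a b j x\<bar> \<le> K"
proof -
  have "compact (bump c a b j ` {a..b})"
    by (intro compact_continuous_image smooth_seq_continuous smooth_seq_bump assms) auto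
  from compact_imp_bounded[OF this, unfolded bounded_iff]
  obtain K where K: "\<forall>y\<in>bump c a b j ` {a..b}. norm y \<le> K" ..
  have "\<bar>bump c a b j x\<bar> \<le> max K 0" for x
    using K bump_support[of x a b c j] by (cases "x \<in> {a..b}") (auto simp: le_max_iff_disj)
  then show ?thesis using that[of "max K 0"] by auto
qed

section \<open>Uniqueness of weak derivatives\<close>

lemma AE_zero_if_boxes:
  fixes h :: "real^'n \<Rightarrow> real"
  assumes h: "integrable lborel h" and box: "\<And>a b. (LINT x|lborel. indicator (box a b) x * h x) = 0"
  shows "AE x in lborel. h x = 0"
proof -
  let ?E = "range (\<lambda>(a, b). box a (b::real^'n))"
  have IS: "Int_stable ?E"
  proof (rule Int_stableI)
    fix A B assume "A \<in> ?E" "B \<in> ?E"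
    then obtain a b c d where "A = box a b" "B = box c d" by auto
    then have "A \<inter> B = (\<lambda>(a, b). box a b) (SOME p. A \<inter> B = (\<lambda>(a, b). box a b) p)"
      using box_Int_box[of a b c d] by (intro someI[of "\<lambda>p. A \<inter> B = (\<lambda>(a, b). box a b) p"]) auto
    then show "A \<inter> B \<in> ?E" by blast
  qed
  have CL: "?E \<subseteq> Pow UNIV" by simp
  have gen: "(LINT x|lborel. indicator A x * h x) = 0" if "A \<in> sigma_sets UNIV ?E" for A
    using IS CL that
  proof (induction A rule: sigma_sets_induct_disjoint)
    case (basic A)
    then show ?case using box by auto
  next
    case empty
    show ?case by simp
  next
    case (compl A)
    note A = compl
    have [measurable]: "A \<in> sets borel" using A(1) unfolding borel_eq_box by simp
    have tot: "(LINT x|lborel. h x) = 0"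
    proof -
      have "(\<lambda>n. LINT x|lborel. indicator (box (\<chi> i. - real n) (\<chi> i. real n)) x * h x) \<longlonglongrightarrow> (LINT x|lborel. h x)"
      proof (rule integral_dominated_convergence[where w = "\<lambda>x. \<bar>h x\<bar>"])
        show "AE x in lborel. (\<lambda>n. indicator (box (\<chi> i. - real n) (\<chi> i. real n)) x * h x) \<longlonglongrightarrow> h x"
        proof (rule AE_I2)
          fix x :: "real^'n"
          obtain N where N: "norm x < real N" using reals_Archimedean2 by blast
          have "x \<in> box (\<chi> i. - real n) (\<chi> i. real n)" if "n \<ge> N" for n
          proof -
            have "\<bar>x $ i\<bar> < real n" for i using component_le_norm_cart[of x i] N that by linarith
            then show ?thesis by (auto simp: mem_box_cart abs_less_iff minus_less_iff)
          qed
          then have "\<forall>\<^sub>F n in sequentially. indicator (box (\<chi> i. - real n) (\<chi> i. real n)) x * h x = h x"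
            by (auto simp: eventually_sequentially intro!: exI[of _ N])
          then show "(\<lambda>n. indicator (box (\<chi> i. - real n) (\<chi> i. real n)) x * h x) \<longlonglongrightarrow> h x" by (rule tendsto_eventually)
        qed
      qed (use h in \<open>auto simp: indicator_def\<close>)
      then show ?thesis unfolding box by (simp add: LIMSEQ_const_iff)
    qed
    have "integrable lborel (\<lambda>x. indicator A x * h x)"
      using integrable_mult_indicator[OF _ h, of A] by simp
    then have "(LINT x|lborel. h x - indicator A x * h x) = 0" using h A(2) tot by simp
    also have "(\<lambda>x. h x - indicator A x * h x) = (\<lambda>x. indicator (UNIV - A) x * h x)" by (auto simp: indicator_def)
    finally show ?case .
  next
    case (union A)
    note A = union
    have [measurable]: "A i \<in> sets borel" for i using A(2) unfolding borel_eq_box by auto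
    have "(LINT x:(\<Union>i. A i)|lborel. h x) = (\<Sum>i. LINT x:A i|lborel. h x)"
      using A(1) h integrable_mult_indicator[OF _ h, of "\<Union>i. A i"]
      by (intro lebesgue_integral_countable_add) (auto simp: disjoint_family_on_def set_integrable_def)
    then show ?case
      using A(3) by (simp add: set_lebesgue_integral_def)
  qed
  show ?thesis
  proof (rule density_unique_real[of _ _ "\<lambda>_. 0"])
    fix A assume "A \<in> sets (lborel :: (real^'n) measure)"
    then have "A \<in> sigma_sets UNIV ?E" unfolding sets_lborel borel_eq_box by simp
    from gen[OF this] show "set_lebesgue_integral lborel A h = set_lebesgue_integral lborel A (\<lambda>_. 0)"
      by (simp add: set_lebesgue_integral_def)
  qed (use h in auto)
qed

text \<open>Products of bumps with \<open>c\<close> tending to \<open>0\<close> tend boundedly to the indicator function of a box, so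
\<open>h\<close> integrates to \<open>0\<close> over every box.\<close>

lemma weak_zero:
  fixes h :: "real^'n \<Rightarrow> real"
  assumes h: "locally_integrable h" and z: "\<And>\<phi>. test_function \<phi> \<Longrightarrow> (LINT x|lborel. h x * \<phi> x) = 0"
  shows "AE x in lborel. h x = 0"
proof -
  have [measurable]: "h \<in> borel_measurable borel" using h by (simp add: locally_integrable_def)
  have int: "integrable lborel (\<lambda>x. indicator (cbox a b) x * h x)" for a b
    using h by (auto simp: locally_integrable_def set_integrable_def)
  have intb: "integrable lborel (\<lambda>x. indicator (box a b) x * h x)" for a b
    by (rule Bochner_Integration.integrable_bound[OF int[of a b]])
      (use box_subset_cbox[of a b] in \<open>auto simp: indicator_def\<close>)
  have box: "(LINT x|lborel. indicator (box a b) x * h x) = 0" for a b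
  proof -
    let ?\<phi> = "\<lambda>m. pprod (\<lambda>i. bump (inverse (real (Suc m))) (a $ i) (b $ i)) (\<lambda>_. 0)"
    have t: "test_function (?\<phi> m)" for m
      by (rule pprod_test_function[where l = "\<lambda>i. a $ i" and r = "\<lambda>i. b $ i"]) (auto intro!: smooth_seq_bump bump_support)
    then have [measurable]: "?\<phi> m \<in> borel_measurable borel" for m
      using test_function_foldr(1)[of "?\<phi> m" "[]"] by (auto dest: differentiable_imp_continuous_on borel_measurable_continuous_onI)
    have "(\<lambda>m. LINT x|lborel. h x * ?\<phi> m x) \<longlonglongrightarrow> (LINT x|lborel. indicator (box a b) x * h x)"
    proof (rule integral_dominated_convergence[where w = "\<lambda>x. \<bar>indicator (box a b) x * h x\<bar>"])
      show "AE x in lborel. (\<lambda>m. h x * ?\<phi> m x) \<longlonglongrightarrow> indicator (box a b) x * h x"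
      proof (rule AE_I2)
        fix x
        have "(\<lambda>m. bump (inverse (real (Suc m))) (a $ i) (b $ i) 0 (x $ i)) \<longlonglongrightarrow> (if x $ i \<in> {a $ i<..<b $ i} then exp (- 0 / (x $ i - a $ i)) * exp (- 0 / (b $ i - x $ i)) else 0)" for i
        proof (cases "x $ i \<in> {a $ i<..<b $ i}")
          case True
          then have "(\<lambda>m. exp (- inverse (real (Suc m)) / (x $ i - a $ i)) * exp (- inverse (real (Suc m)) / (b $ i - x $ i)))
            \<longlonglongrightarrow> exp (- 0 / (x $ i - a $ i)) * exp (- 0 / (b $ i - x $ i))"
            by (intro tendsto_intros LIMSEQ_inverse_real_of_nat) auto
          then show ?thesis using True unfolding bump_0 by (simp only: if_True)
        next
          case False
          then show ?thesis unfolding bump_0 by (simp only: if_False tendsto_const)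
        qed
        then have "(\<lambda>m. ?\<phi> m x) \<longlonglongrightarrow> (\<Prod>i\<in>UNIV. if x $ i \<in> {a $ i<..<b $ i} then exp (- 0 / (x $ i - a $ i)) * exp (- 0 / (b $ i - x $ i)) else 0)"
          unfolding pprod_def by (intro tendsto_prod)
        moreover have "(\<Prod>i\<in>UNIV. if x $ i \<in> {a $ i<..<b $ i} then exp (- 0 / (x $ i - a $ i)) * exp (- 0 / (b $ i - x $ i)) else 0) = (indicator (box a b) x :: real)"
          by (auto simp: indicator_def mem_box_cart)
        ultimately have T: "(\<lambda>m. ?\<phi> m x) \<longlonglongrightarrow> indicator (box a b) x" by simp
        show "(\<lambda>m. h x * ?\<phi> m x) \<longlonglongrightarrow> indicator (box a b) x * h x"
          using tendsto_mult[OF tendsto_const[of "h x"] T] unfolding mult.commute[of "h x" "indicator (box a b) x"] .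
      qed
      fix m
      show "(\<lambda>x. h x * ?\<phi> m x) \<in> borel_measurable lborel" by measurable
      show "AE x in lborel. norm (h x * ?\<phi> m x) \<le> \<bar>indicator (box a b) x * h x\<bar>"
      proof (rule AE_I2)
        fix x
        have "\<bar>?\<phi> m x\<bar> \<le> indicator (box a b) x"
        proof (cases "x \<in> box a b")
          case True
          have l: "a $ i < x $ i" "x $ i < b $ i" for i using True by (auto simp: mem_box_cart)
          have "0 \<le> bump (inverse (real (Suc m))) (a $ i) (b $ i) 0 (x $ i) \<and> bump (inverse (real (Suc m))) (a $ i) (b $ i) 0 (x $ i) \<le> 1" for i
            using l[of i] by (auto simp: bump_0 intro!: mult_le_one divide_nonneg_nonneg)
          then have "0 \<le> ?\<phi> m x" "?\<phi> m x \<le> 1" unfolding pprod_def by (auto intro!: prod_nonneg prod_le_1)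
          then show ?thesis using True by simp
        next
          case False
          then show ?thesis by (auto simp: pprod_def bump_0 mem_box_cart)
        qed
        then have "\<bar>h x\<bar> * \<bar>?\<phi> m x\<bar> \<le> \<bar>h x\<bar> * indicator (box a b) x" by (intro mult_left_mono) auto
        then show "norm (h x * ?\<phi> m x) \<le> \<bar>indicator (box a b) x * h x\<bar>" by (simp add: abs_mult mult.commute)
      qed
    qed (use intb in auto)
    then show ?thesis using z[OF t] by (simp add: LIMSEQ_const_iff)
  qed
  have "AE x in lborel. indicator (box (\<chi> i. - real n) (\<chi> i. real n)) x * h x = 0" for n
  proof (rule AE_zero_if_boxes[OF intb])
    fix a b :: "real^'n"
    obtain c d where cd: "box a b \<inter> box (\<chi> i. - real n) (\<chi> i. real n) = box c d"
      using box_Int_box[of a b "\<chi> i. - real n" "\<chi> i. real n"] by blast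
    have "(\<lambda>x. indicator (box a b) x * (indicator (box (\<chi> i. - real n) (\<chi> i. real n)) x * h x)) = (\<lambda>x. indicator (box c d) x * h x)"
      unfolding cd[symmetric] by (auto simp: indicator_def)
    then show "(LINT x|lborel. indicator (box a b) x * (indicator (box (\<chi> i. - real n) (\<chi> i. real n)) x * h x)) = 0"
      using box by simp
  qed
  then have "AE x in lborel. \<forall>n. indicator (box (\<chi> i. - real n) (\<chi> i. real n)) x * h x = 0"
    unfolding AE_all_countable by blast
  then show ?thesis
  proof eventually_elim
    case (elim x)
    obtain N where N: "norm x < real N" using reals_Archimedean2 by blast
    have "x \<in> box (\<chi> i. - real N) (\<chi> i. real N)"
    proof -
      have "\<bar>x $ i\<bar> < real N" for i using component_le_norm_cart[of x i] N by linarith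
      then show ?thesis by (auto simp: mem_box_cart abs_less_iff minus_less_iff)
    qed
    then show "h x = 0" using elim[rule_format, of N] by simp
  qed
qed

lemma ex_count_list: "\<exists>is. \<forall>i. count_list is i = (\<kappa> :: 'n::finite \<Rightarrow> nat) i"
proof -
  obtain xs where "mset xs = Abs_multiset \<kappa>" using ex_mset by blast
  then have "count (mset xs) i = \<kappa> i" for i by (simp add: count_Abs_multiset)
  then have "\<forall>i. count_list xs i = \<kappa> i" by (simp add: count_mset)
  then show ?thesis by blast
qed

lemma weak_deriv_unique:
  assumes "has_weak_deriv \<kappa> f g" "has_weak_deriv \<kappa> f g'"
  shows "AE x in lborel. g x = g' x"
proof -
  obtain "is" where c: "\<forall>i. count_list is i = \<kappa> i" using ex_count_list by blast
  have g: "locally_integrable g" "locally_integrable g'" using assms by (auto simp: has_weak_deriv_def)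
  have "AE x in lborel. g x - g' x = 0"
  proof (rule weak_zero)
    show "locally_integrable (\<lambda>x. g x - g' x)"
      using g by (auto simp: locally_integrable_def set_integrable_def right_diff_distrib)
    fix \<phi> :: "real^'a \<Rightarrow> real" assume t: "test_function \<phi>"
    note \<phi> = test_function_foldr[OF t, of "[]", unfolded foldr.simps id_apply]
    have c\<phi>: "continuous_on UNIV \<phi>" using \<phi> by (auto dest: differentiable_imp_continuous_on)
    obtain B where B: "\<And>x. \<bar>\<phi> x\<bar> \<le> B" "0 \<le> B" using bounded_compact_support[OF c\<phi> \<phi>(2)] by blast
    have int: "integrable lborel (\<lambda>x. h x * \<phi> x)" if h: "locally_integrable h" for h
    proof (rule Bochner_Integration.integrable_bound)
      show "integrable lborel (\<lambda>x. B * (indicator (closure {x. \<phi> x \<noteq> 0}) x *\<^sub>R h x))"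
        using h \<phi>(2) unfolding locally_integrable_def set_integrable_def by (intro integrable_mult_right) blast
      show "(\<lambda>x. h x * \<phi> x) \<in> borel_measurable lborel"
        using h borel_measurable_continuous_onI[OF c\<phi>] by (auto simp: locally_integrable_def)
      show "AE x in lborel. norm (h x * \<phi> x) \<le> norm (B * (indicator (closure {x. \<phi> x \<noteq> 0}) x *\<^sub>R h x))"
      proof (rule AE_I2)
        fix x
        show "norm (h x * \<phi> x) \<le> norm (B * (indicator (closure {x. \<phi> x \<noteq> 0}) x *\<^sub>R h x))"
        proof (cases "\<phi> x = 0")
          case False
          then have "x \<in> closure {x. \<phi> x \<noteq> 0}" by (intro closure_subset[THEN subsetD]) simp
          then show ?thesis using mult_right_mono[OF B(1)[of x], of "\<bar>h x\<bar>"] B(2)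
            by (simp add: abs_mult mult.commute)
        qed simp
      qed
    qed
    have "(LINT x|lborel. f x * foldr partial_deriv is \<phi> x) = (-1) ^ mi_size \<kappa> * (LINT x|lborel. g x * \<phi> x)"
      using assms(1) t c unfolding has_weak_deriv_def by blast
    moreover have "(LINT x|lborel. f x * foldr partial_deriv is \<phi> x) = (-1) ^ mi_size \<kappa> * (LINT x|lborel. g' x * \<phi> x)"
      using assms(2) t c unfolding has_weak_deriv_def by blast
    ultimately have "(-1) ^ mi_size \<kappa> * (LINT x|lborel. g x * \<phi> x) = (-1) ^ mi_size \<kappa> * (LINT x|lborel. g' x * \<phi> x)"
      by (rule trans[OF sym])
    then have "(LINT x|lborel. g x * \<phi> x) = (LINT x|lborel. g' x * \<phi> x)" by simp
    then show "(LINT x|lborel. (g x - g' x) * \<phi> x) = 0"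
      using int[OF g(1)] int[OF g(2)] by (simp add: left_diff_distrib)
  qed
  then show ?thesis by simp
qed

section \<open>Square integrable functions\<close>

lemma L2_meas: "f \<in> L2_gauss \<Longrightarrow> f \<in> borel_measurable borel"
  by (simp add: L2_gauss_def measurable_cong_sets[OF sets_gauss refl])

lemma L2_sq: "f \<in> L2_gauss \<Longrightarrow> integrable gauss (\<lambda>x. (f x)\<^sup>2)"
  by (simp add: L2_gauss_def)

lemma L2I: "f \<in> borel_measurable borel \<Longrightarrow> integrable gauss (\<lambda>x. (f x)\<^sup>2) \<Longrightarrow> f \<in> L2_gauss"
  by (simp add: L2_gauss_def measurable_cong_sets[OF sets_gauss refl])

lemma L2_prod_integrable:
  assumes "f \<in> L2_gauss" "g \<in> L2_gauss"
  shows "integrable gauss (\<lambda>x. f x * g x)"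
proof (rule Bochner_Integration.integrable_bound)
  show "integrable gauss (\<lambda>x. (f x)\<^sup>2 + (g x)\<^sup>2)" using assms by (auto dest: L2_sq)
  show "(\<lambda>x. f x * g x) \<in> borel_measurable gauss"
    using assms[THEN L2_meas] by (auto simp: measurable_cong_sets[OF sets_gauss refl])
  show "AE x in gauss. norm (f x * g x) \<le> norm ((f x)\<^sup>2 + (g x)\<^sup>2)"
  proof (rule AE_I2)
    fix x
    have "0 \<le> (\<bar>f x\<bar> - \<bar>g x\<bar>)\<^sup>2" by simp
    then have "2 * (\<bar>f x\<bar> * \<bar>g x\<bar>) \<le> (f x)\<^sup>2 + (g x)\<^sup>2" by (simp add: power2_diff)
    moreover have "0 \<le> \<bar>f x\<bar> * \<bar>g x\<bar>" by simp
    ultimately have "\<bar>f x * g x\<bar> \<le> (f x)\<^sup>2 + (g x)\<^sup>2" unfolding abs_mult by linarith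
    then show "norm (f x * g x) \<le> norm ((f x)\<^sup>2 + (g x)\<^sup>2)" by simp
  qed
qed

lemma L2_bounded:
  assumes "f \<in> borel_measurable borel" "\<And>x. \<bar>f x\<bar> \<le> B"
  shows "f \<in> L2_gauss"
proof (rule L2I[OF assms(1)])
  have "\<bar>(f x)\<^sup>2\<bar> \<le> B\<^sup>2" for x using assms(2)[of x] by (simp add: abs_le_square_iff[symmetric])
  then show "integrable gauss (\<lambda>x. (f x)\<^sup>2)"
    using assms(1) by (intro gauss.integrable_const_bound[of _ "B\<^sup>2"]) (auto simp: measurable_cong_sets[OF sets_gauss refl])
qed

lemma L2_const: "(\<lambda>x. c) \<in> L2_gauss" by (rule L2_bounded[of _ "\<bar>c\<bar>"]) auto

lemma L2_integrable: "f \<in> L2_gauss \<Longrightarrow> integrable gauss f"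
  using L2_prod_integrable[OF _ L2_const[of 1], of f] by simp

lemma L2_add:
  assumes "f \<in> L2_gauss" "g \<in> L2_gauss" shows "(\<lambda>x. f x + g x) \<in> L2_gauss"
proof (rule L2I)
  show "(\<lambda>x. f x + g x) \<in> borel_measurable borel" using assms[THEN L2_meas] by simp
  have "integrable gauss (\<lambda>x. (f x)\<^sup>2 + 2 * (f x * g x) + (g x)\<^sup>2)"
    using assms L2_prod_integrable[OF assms]
    by (intro Bochner_Integration.integrable_add integrable_mult_right L2_sq)
  then show "integrable gauss (\<lambda>x. (f x + g x)\<^sup>2)" by (simp add: power2_sum algebra_simps)
qed

lemma L2_cmult: assumes "f \<in> L2_gauss" shows "(\<lambda>x. c * f x) \<in> L2_gauss"
  using assms L2_meas[OF assms] L2_sq[OF assms] by (intro L2I) (auto simp: power_mult_distrib)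

lemma L2_diff:
  assumes "f \<in> L2_gauss" "g \<in> L2_gauss" shows "(\<lambda>x. f x - g x) \<in> L2_gauss"
  using L2_add[OF assms(1) L2_cmult[OF assms(2), of "-1"]] by simp

lemma L2_sum:
  assumes "finite S" "\<And>b. b \<in> S \<Longrightarrow> F b \<in> L2_gauss" shows "(\<lambda>x. \<Sum>b\<in>S. F b x) \<in> L2_gauss"
  using assms by (induction S) (auto intro: L2_add L2_const)

lemma L2_abs: "f \<in> L2_gauss \<Longrightarrow> (\<lambda>x. \<bar>f x\<bar>) \<in> L2_gauss"
  using L2_meas[of f] L2_sq[of f] by (intro L2I) auto

lemma L2_mono:
  assumes "g \<in> L2_gauss" "f \<in> borel_measurable borel" "\<And>x. \<bar>f x\<bar> \<le> \<bar>g x\<bar>"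
  shows "f \<in> L2_gauss"
proof (rule L2I[OF assms(2)])
  show "integrable gauss (\<lambda>x. (f x)\<^sup>2)"
    by (rule Bochner_Integration.integrable_bound[OF L2_sq[OF assms(1)]])
      (use assms in \<open>auto simp: measurable_cong_sets[OF sets_gauss refl] abs_le_square_iff[symmetric]\<close>)
qed

lemma L2_cong_AE:
  assumes "g \<in> L2_gauss" "f \<in> borel_measurable borel" "AE x in gauss. f x = g x"
  shows "f \<in> L2_gauss"
proof (rule L2I[OF assms(2)])
  show "integrable gauss (\<lambda>x. (f x)\<^sup>2)"
    by (rule Bochner_Integration.integrable_bound[OF L2_sq[OF assms(1)]])
      (use assms in \<open>auto simp: measurable_cong_sets[OF sets_gauss refl]\<close>)
qed

lemma AE_gauss_lborel: "AE x in lborel. P x \<Longrightarrow> AE x in (gauss :: (real^'n) measure). P x"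
  unfolding gauss_gdens by (subst AE_density) auto

text \<open>The quadratic \<open>\<integral> (f - t * g)\<^sup>2\<close> in \<open>t\<close> is nonnegative.\<close>

lemma cauchy_schwarz_gauss:
  assumes f: "f \<in> L2_gauss" and g: "g \<in> L2_gauss"
  shows "(LINT x|gauss. f x * g x)\<^sup>2 \<le> (LINT x|gauss. (f x)\<^sup>2) * (LINT x|gauss. (g x)\<^sup>2)"
proof -
  define A B C where "A = (LINT x|gauss. (f x)\<^sup>2)" and "B = (LINT x|gauss. f x * g x)" and "C = (LINT x|gauss. (g x)\<^sup>2)"
  note int = L2_sq[OF f] L2_sq[OF g] L2_prod_integrable[OF f g]
  have q: "0 \<le> A - 2 * t * B + t\<^sup>2 * C" for t
  proof -
    have "0 \<le> (LINT x|gauss. (f x - t * g x)\<^sup>2)" by simp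
    also have "\<dots> = (LINT x|gauss. (f x)\<^sup>2 - 2 * t * (f x * g x) + t\<^sup>2 * (g x)\<^sup>2)"
      by (intro Bochner_Integration.integral_cong) (auto simp: power2_diff power_mult_distrib)
    also have "\<dots> = A - 2 * t * B + t\<^sup>2 * C" unfolding A_def B_def C_def using int by simp
    finally show ?thesis .
  qed
  have C0: "0 \<le> C" unfolding C_def by simp
  have "B\<^sup>2 \<le> A * C"
  proof (cases "C = 0")
    case True
    have "B = 0"
    proof (rule ccontr)
      assume "B \<noteq> 0"
      then show False using q[of "(A + 1) / (2 * B)"] True by (simp add: field_simps)
    qed
    then show ?thesis using True by simp
  next
    case False
    then have "C > 0" using C0 by simp
    then show ?thesis using q[of "B / C"] by (simp add: field_simps power2_eq_square)
  qed
  then show ?thesis by (simp add: A_def B_def C_def)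
qed

section \<open>Gaussian weights\<close>

lemma gdens_exp: "gdens x * exp ((norm x)\<^sup>2 / 4) = gdens ((1 / sqrt 2) *\<^sub>R x)"
  by (simp add: gdens_def exp_add[symmetric] power_divide power_mult_distrib)

lemma integrable_gdens_scaled: "integrable lborel (\<lambda>x::real^'n. gdens ((1 / sqrt 2) *\<^sub>R x))"
proof -
  have "(\<integral>\<^sup>+ y. 1 \<partial>(gauss::(real^'n) measure)) = (\<integral>\<^sup>+ z. ennreal (gdens ((1 / sqrt 2) *\<^sub>R (z - 0)) / sqrt 2 ^ CARD('n)) * 1 \<partial>(lborel::(real^'n) measure))"
    using nn_integral_gauss_affine[of "sqrt 2" "\<lambda>_. 1" "0 :: real^'n"] by simp
  then have "integrable lborel (\<lambda>z::real^'n. gdens ((1 / sqrt 2) *\<^sub>R z) / sqrt 2 ^ CARD('n))"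
    by (intro integrableI_nonneg) (auto simp: less_imp_le[OF gdens_pos] emeasure_gauss_UNIV)
  then have "integrable lborel (\<lambda>z::real^'n. sqrt 2 ^ CARD('n) * (gdens ((1 / sqrt 2) *\<^sub>R z) / sqrt 2 ^ CARD('n)))"
    by (rule integrable_mult_right)
  then show ?thesis by simp
qed

lemma integrable_gauss_iff:
  fixes F :: "real^'n \<Rightarrow> real"
  assumes "F \<in> borel_measurable borel"
  shows "integrable gauss F \<longleftrightarrow> integrable lborel (\<lambda>x. gdens x * F x)"
  unfolding gauss_gdens using assms by (subst integrable_density) (auto simp: less_imp_le[OF gdens_pos])

text \<open>The density has exponent \<open>- |x|\<^sup>2 / 2\<close>, so the square of a function growing like
\<open>exp (|x|\<^sup>2 / 8)\<close> is integrable with room to spare.\<close>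

lemma L2_growth:
  fixes f :: "real^'n \<Rightarrow> real"
  assumes [measurable]: "f \<in> borel_measurable borel" and b: "\<And>x. \<bar>f x\<bar> \<le> C * exp ((norm x)\<^sup>2 / 8)"
  shows "f \<in> L2_gauss"
proof (rule L2_mono[OF _ assms(1), of "\<lambda>x. C * exp ((norm x)\<^sup>2 / 8)"])
  have [measurable]: "(\<lambda>x::real^'n. C * exp ((norm x)\<^sup>2 / 8)) \<in> borel_measurable borel" by measurable
  have "integrable gauss (\<lambda>x::real^'n. exp ((norm x)\<^sup>2 / 4))"
    using integrable_gdens_scaled by (subst integrable_gauss_iff) (auto simp: gdens_exp)
  moreover have "(C * exp ((norm x)\<^sup>2 / 8))\<^sup>2 = C\<^sup>2 * exp ((norm x)\<^sup>2 / 4)" for x :: "real^'n"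
    by (simp add: power_mult_distrib exp_double[symmetric])
  ultimately show "(\<lambda>x::real^'n. C * exp ((norm x)\<^sup>2 / 8)) \<in> L2_gauss" by (intro L2I) auto
  show "\<bar>f x\<bar> \<le> \<bar>C * exp ((norm x)\<^sup>2 / 8)\<bar>" for x using b[of x] by linarith
qed

text \<open>This makes \<open>exp (- 3 / 8 * |x|\<^sup>2)\<close> an admissible decay for functions tested against
\<open>f\<close> in \<open>L\<^sup>2\<close>. It is weaker than the decay of the Gaussian density, which leaves room for
polynomial factors and translations.\<close>

lemma integrable_L2_weight:
  fixes f :: "real^'n \<Rightarrow> real"
  assumes f: "f \<in> L2_gauss"
  shows "integrable lborel (\<lambda>x. \<bar>f x\<bar> * exp (- (3 / 8 * (norm x)\<^sup>2)))"
proof -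
  define k where "k = (2 * pi) powr (- real CARD('n) / 2)"
  have k: "k > 0" by (simp add: k_def)
  have [measurable]: "f \<in> borel_measurable borel" by (rule L2_meas[OF f])
  have "(\<lambda>x::real^'n. exp ((norm x)\<^sup>2 / 8)) \<in> L2_gauss"
    by (rule L2_growth[of _ 1]) auto
  from L2_prod_integrable[OF L2_abs[OF f] this]
  have "integrable lborel (\<lambda>x. gdens x * (\<bar>f x\<bar> * exp ((norm x)\<^sup>2 / 8)))"
    by (subst (asm) integrable_gauss_iff) auto
  then have "integrable lborel (\<lambda>x. (1 / k) * (gdens x * (\<bar>f x\<bar> * exp ((norm x)\<^sup>2 / 8))))"
    by (rule integrable_mult_right)
  moreover have "(1 / k) * (gdens x * (\<bar>f x\<bar> * exp ((norm x)\<^sup>2 / 8))) = \<bar>f x\<bar> * exp (- (3 / 8 * (norm x)\<^sup>2))" for x :: "real^'n"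
  proof -
    have "exp (- (norm x)\<^sup>2 / 2) * exp ((norm x)\<^sup>2 / 8) = exp (- (3 / 8 * (norm x)\<^sup>2))"
      by (simp add: exp_add[symmetric])
    moreover have "gdens x = k * exp (- (norm x)\<^sup>2 / 2)" by (simp add: gdens_def k_def)
    ultimately have "gdens x * exp ((norm x)\<^sup>2 / 8) = k * exp (- (3 / 8 * (norm x)\<^sup>2))" by (simp only: mult.assoc)
    then have E: "gdens x * (\<bar>f x\<bar> * exp ((norm x)\<^sup>2 / 8)) = k * (\<bar>f x\<bar> * exp (- (3 / 8 * (norm x)\<^sup>2)))"
      by (simp only: mult.left_commute[of _ "\<bar>f x\<bar>"])
    show ?thesis unfolding E using k by simp
  qed
  ultimately show ?thesis by simp
qed

section \<open>Integration by parts against Gaussian-type functions\<close>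

text \<open>Weak derivatives are defined with compactly supported test functions. Multiplying by cutoffs
\<open>\<eta> (x / n)\<close> and letting \<open>n\<close> grow extends the defining identity to functions with
Gaussian decay: every derivative falling on the cutoff brings a factor \<open>1 / n\<close>. The limit carries a
power of \<open>\<eta> 0\<close> on both sides, which cancels.\<close>

lemma weak_deriv_gaussian_type:
  fixes f g :: "real^'n \<Rightarrow> real"
  assumes f: "f \<in> L2_gauss" and g: "g \<in> L2_gauss" and w: "has_weak_deriv \<kappa> f g"
    and \<psi>: "\<And>i. smooth_seq (\<psi> i)"
    and dom: "\<And>i j. \<exists>C. \<forall>x. \<bar>\<psi> i j x\<bar> \<le> C * exp (- (3 / 8 * x\<^sup>2))"
  shows "(LINT x|lborel. f x * pprod \<psi> \<kappa> x) = (-1) ^ mi_size \<kappa> * (LINT x|lborel. g x * pprod \<psi> (\<lambda>_. 0) x)"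
proof -
  let ?\<eta> = "bump 1 (- 1) 1"
  have \<eta>: "smooth_seq ?\<eta>" by (rule smooth_seq_bump) simp
  let ?\<chi> = "\<lambda>n j x. (inverse (real (Suc n))) ^ j * ?\<eta> j (inverse (real (Suc n)) * x + 0)"
  let ?w = "\<lambda>n i. leibniz (?\<chi> n) (\<psi> i)"
  have w_smooth: "smooth_seq (?w n i)" for n i
    by (intro smooth_seq_leibniz smooth_seq_affine \<eta> \<psi>)
  have t: "test_function (pprod (?w n) (\<lambda>_. 0))" for n
  proof (rule pprod_test_function[where l = "\<lambda>_. - real (Suc n)" and r = "\<lambda>_. real (Suc n)"])
    fix i :: 'n and x :: real assume "x \<notin> {- real (Suc n)..real (Suc n)}"
    then have "inverse (real (Suc n)) * x + 0 \<notin> {-1<..<1}" by (auto simp: field_simps)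
    then have "?\<eta> 0 (inverse (real (Suc n)) * x + 0) = 0" by (rule bump_support)
    then show "?w n i 0 x = 0" by (simp add: leibniz_def)
  qed (rule w_smooth)
  obtain "is" where c: "\<forall>i. count_list is i = \<kappa> i" using ex_count_list by blast
  have fold: "foldr partial_deriv is (pprod (?w n) (\<lambda>_. 0)) = pprod (?w n) \<kappa>" for n
    by (simp only: smooth_fam_foldr[OF smooth_fam_pprod[OF w_smooth]] add_0 c[rule_format])
  have eq: "(LINT x|lborel. f x * pprod (?w n) \<kappa> x) = (-1) ^ mi_size \<kappa> * (LINT x|lborel. g x * pprod (?w n) (\<lambda>_. 0) x)" for n
    using w t[of n] c unfolding has_weak_deriv_def fold[symmetric] by blast
  have bound: "\<exists>C. \<forall>n x. \<bar>?w n i j x\<bar> \<le> C * exp (- (3 / 8 * x\<^sup>2))" for i j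
  proof -
    obtain K where K: "\<And>l. 0 \<le> K l" "\<And>l x. \<bar>?\<eta> l x\<bar> \<le> K l"
    proof -
      have "\<forall>l. \<exists>K. 0 \<le> K \<and> (\<forall>x. \<bar>?\<eta> l x\<bar> \<le> K)"
      proof
        fix l
        obtain K where "0 \<le> K" "\<And>x. \<bar>?\<eta> l x\<bar> \<le> K" using bump_bounded[of 1 "-1" 1 l] by auto
        then show "\<exists>K. 0 \<le> K \<and> (\<forall>x. \<bar>?\<eta> l x\<bar> \<le> K)" by blast
      qed
      from choice[OF this] show ?thesis using that by blast
    qed
    obtain C where C: "\<And>l x. \<bar>\<psi> i l x\<bar> \<le> C l * exp (- (3 / 8 * x\<^sup>2))"
    proof -
      have "\<forall>l. \<exists>C. \<forall>x. \<bar>\<psi> i l x\<bar> \<le> C * exp (- (3 / 8 * x\<^sup>2))" using dom[of i] by blast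
      from choice[OF this] show ?thesis using that by blast
    qed
    have "\<bar>?w n i j x\<bar> \<le> (\<Sum>l\<le>j. real (j choose l) * (K l * C (j - l))) * exp (- (3 / 8 * x\<^sup>2))" for n x
    proof -
      have "\<bar>?w n i j x\<bar> \<le> (\<Sum>l\<le>j. \<bar>real (j choose l) * (?\<chi> n l x * \<psi> i (j - l) x)\<bar>)"
        unfolding leibniz_def by (rule sum_abs)
      also have "\<dots> \<le> (\<Sum>l\<le>j. real (j choose l) * (K l * (C (j - l) * exp (- (3 / 8 * x\<^sup>2)))))"
      proof (rule sum_mono)
        fix l
        have "inverse (real (Suc n)) ^ l \<le> 1" by (intro power_le_one) (auto simp: field_simps)
        then have "\<bar>?\<chi> n l x\<bar> \<le> 1 * K l" unfolding abs_mult using K by (intro mult_mono) auto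
        then have "\<bar>?\<chi> n l x\<bar> * \<bar>\<psi> i (j - l) x\<bar> \<le> K l * (C (j - l) * exp (- (3 / 8 * x\<^sup>2)))"
          using K C by (intro mult_mono) auto
        then have "real (j choose l) * (\<bar>?\<chi> n l x\<bar> * \<bar>\<psi> i (j - l) x\<bar>) \<le> real (j choose l) * (K l * (C (j - l) * exp (- (3 / 8 * x\<^sup>2))))"
          by (intro mult_left_mono) auto
        then show "\<bar>real (j choose l) * (?\<chi> n l x * \<psi> i (j - l) x)\<bar> \<le> real (j choose l) * (K l * (C (j - l) * exp (- (3 / 8 * x\<^sup>2))))"
          by (simp add: abs_mult)
      qed
      also have "\<dots> = (\<Sum>l\<le>j. real (j choose l) * (K l * C (j - l))) * exp (- (3 / 8 * x\<^sup>2))"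
        by (simp add: sum_distrib_right mult.assoc)
      finally show ?thesis .
    qed
    then show ?thesis by blast
  qed
  define e where "e = ?\<eta> 0 0"
  have e: "e \<noteq> 0" by (simp add: e_def bump_0)
  have lim1: "(\<lambda>n. ?w n i j x) \<longlonglongrightarrow> e * \<psi> i j x" for i j x
  proof -
    have tm: "(\<lambda>n. real (j choose l) * (?\<chi> n l x * \<psi> i (j - l) x)) \<longlonglongrightarrow> real (j choose l) * ((0 ^ l * ?\<eta> l (0 * x + 0)) * \<psi> i (j - l) x)" for l
    proof (intro tendsto_intros LIMSEQ_inverse_real_of_nat)
      have "isCont (?\<eta> l) (0 * x + 0)" using \<eta> unfolding smooth_seq_def by (meson DERIV_isCont)
      then show "(\<lambda>n. ?\<eta> l (inverse (real (Suc n)) * x + 0)) \<longlonglongrightarrow> ?\<eta> l (0 * x + 0)"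
        by (rule isCont_tendsto_compose) (intro tendsto_intros LIMSEQ_inverse_real_of_nat)
    qed
    have "(\<lambda>n. ?w n i j x) \<longlonglongrightarrow> (\<Sum>l\<le>j. real (j choose l) * ((0 ^ l * ?\<eta> l (0 * x + 0)) * \<psi> i (j - l) x))"
      unfolding leibniz_def by (intro tendsto_sum tm)
    also have "(\<Sum>l\<le>j. real (j choose l) * ((0 ^ l * ?\<eta> l (0 * x + 0)) * \<psi> i (j - l) x)) = (\<Sum>l\<in>{0}. real (j choose l) * ((0 ^ l * ?\<eta> l (0 * x + 0)) * \<psi> i (j - l) x))"
      by (rule sum.mono_neutral_right) (auto simp: power_0_left)
    finally show ?thesis by (simp add: e_def)
  qed
  have lim: "(\<lambda>n. LINT x|lborel. h x * pprod (?w n) a x) \<longlonglongrightarrow> e ^ CARD('n) * (LINT x|lborel. h x * pprod \<psi> a x)"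
    if h: "h \<in> L2_gauss" for h and a :: "'n \<Rightarrow> nat"
  proof -
    have [measurable]: "h \<in> borel_measurable borel" by (rule L2_meas[OF h])
    have pm: "pprod u a \<in> borel_measurable borel" if "\<And>i. smooth_seq (u i)" for u :: "'n \<Rightarrow> nat \<Rightarrow> real \<Rightarrow> real"
      by (intro borel_measurable_continuous_onI smooth_fam_continuous smooth_fam_pprod that)
    have [measurable]: "pprod (?w n) a \<in> borel_measurable borel" for n by (rule pm[OF w_smooth])
    have [measurable]: "pprod \<psi> a \<in> borel_measurable borel" by (rule pm[OF \<psi>])
    obtain C where C: "\<And>i n x. \<bar>?w n i (a i) x\<bar> \<le> C i * exp (- (3 / 8 * x\<^sup>2))"
    proof -
      have "\<forall>i. \<exists>C. \<forall>n x. \<bar>?w n i (a i) x\<bar> \<le> C * exp (- (3 / 8 * x\<^sup>2))" using bound by blast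
      from choice[OF this] show ?thesis using that by blast
    qed
    have "(\<lambda>n. LINT x|lborel. h x * pprod (?w n) a x) \<longlonglongrightarrow> (LINT x|lborel. e ^ CARD('n) * (h x * pprod \<psi> a x))"
    proof (rule integral_dominated_convergence[where w = "\<lambda>x. (\<Prod>i\<in>UNIV. C i) * (\<bar>h x\<bar> * exp (- (3 / 8 * (norm x)\<^sup>2)))"])
      show "integrable lborel (\<lambda>x. (\<Prod>i\<in>UNIV. C i) * (\<bar>h x\<bar> * exp (- (3 / 8 * (norm x)\<^sup>2))))"
        by (intro integrable_mult_right integrable_L2_weight h)
      show "AE x in lborel. (\<lambda>n. h x * pprod (?w n) a x) \<longlonglongrightarrow> e ^ CARD('n) * (h x * pprod \<psi> a x)"
      proof (rule AE_I2)
        fix x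
        have "(\<lambda>n. pprod (?w n) a x) \<longlonglongrightarrow> (\<Prod>i\<in>UNIV. e * \<psi> i (a i) (x $ i))"
          unfolding pprod_def by (intro tendsto_prod lim1)
        from tendsto_mult[OF tendsto_const this, of "h x"]
        show "(\<lambda>n. h x * pprod (?w n) a x) \<longlonglongrightarrow> e ^ CARD('n) * (h x * pprod \<psi> a x)"
          by (simp add: prod.distrib pprod_def ac_simps)
      qed
      fix n
      show "(\<lambda>x. h x * pprod (?w n) a x) \<in> borel_measurable lborel" by measurable
      show "AE x in lborel. norm (h x * pprod (?w n) a x) \<le> (\<Prod>i\<in>UNIV. C i) * (\<bar>h x\<bar> * exp (- (3 / 8 * (norm x)\<^sup>2)))"
      proof (rule AE_I2)
        fix x
        have "\<bar>pprod (?w n) a x\<bar> = (\<Prod>i\<in>UNIV. \<bar>?w n i (a i) (x $ i)\<bar>)" by (simp add: pprod_def abs_prod)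
        also have "\<dots> \<le> (\<Prod>i\<in>UNIV. C i * exp (- (3 / 8 * (x $ i)\<^sup>2)))"
          using C by (intro prod_mono) auto
        also have "\<dots> = (\<Prod>i\<in>UNIV. C i) * exp (- (3 / 8 * (norm x)\<^sup>2))"
          by (simp add: prod.distrib norm_vec_sq exp_sum[symmetric] sum_negf[symmetric] sum_distrib_left)
        finally have "\<bar>h x\<bar> * \<bar>pprod (?w n) a x\<bar> \<le> \<bar>h x\<bar> * ((\<Prod>i\<in>UNIV. C i) * exp (- (3 / 8 * (norm x)\<^sup>2)))"
          by (intro mult_left_mono) auto
        then show "norm (h x * pprod (?w n) a x) \<le> (\<Prod>i\<in>UNIV. C i) * (\<bar>h x\<bar> * exp (- (3 / 8 * (norm x)\<^sup>2)))"
          by (simp add: abs_mult ac_simps)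
      qed
    qed auto
    then show ?thesis by simp
  qed
  have "(\<lambda>n. LINT x|lborel. f x * pprod (?w n) \<kappa> x) \<longlonglongrightarrow> (-1) ^ mi_size \<kappa> * (e ^ CARD('n) * (LINT x|lborel. g x * pprod \<psi> (\<lambda>_. 0) x))"
    unfolding eq by (intro tendsto_mult tendsto_const lim g)
  from LIMSEQ_unique[OF lim[OF f, of \<kappa>] this] show ?thesis using e by simp
qed

section \<open>Hermite polynomials\<close>

text \<open>The unnormalized Hermite polynomials of the weight \<open>exp (- x\<^sup>2 / 2)\<close>.\<close>

fun herm :: "nat \<Rightarrow> real \<Rightarrow> real" where
  "herm 0 x = 1"
| "herm (Suc 0) x = x"
| "herm (Suc (Suc n)) x = x * herm (Suc n) x - real (Suc n) * herm n x"

lemma has_derivative_herm: "(herm n has_real_derivative real n * herm (n - 1) x) (at x)"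
proof (induction n rule: induct_nat_012)
  case (ge2 n)
  have "((\<lambda>x. x * herm (Suc n) x - real (Suc n) * herm n x) has_real_derivative
     (1 * herm (Suc n) x + real (Suc n) * herm (Suc n - 1) x * x) - real (Suc n) * (real n * herm (n - 1) x)) (at x)"
    by (intro DERIV_diff DERIV_mult DERIV_cmult DERIV_ident ge2)
  also have "(1 * herm (Suc n) x + real (Suc n) * herm (Suc n - 1) x * x) - real (Suc n) * (real n * herm (n - 1) x)
     = real (Suc (Suc n)) * herm (Suc (Suc n) - 1) x"
    by (cases n) (auto simp: algebra_simps)
  finally show ?case by simp
qed auto

lemma herm_Suc: "herm (Suc n) x = x * herm n x - real n * herm (n - 1) x"
  by (cases n) auto

lemma herm_growth:
  assumes "0 < d"
  shows "\<exists>C\<ge>0. \<forall>x. \<bar>herm n x\<bar> \<le> C * exp (d * x\<^sup>2)"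
  using assms
proof (induction n arbitrary: d rule: less_induct)
  case (less n)
  have lin: "\<bar>x\<bar> \<le> (1 / (d / 2) + 1) * exp (d / 2 * x\<^sup>2)" for x :: real
  proof -
    have "0 \<le> (\<bar>x\<bar> - 1)\<^sup>2" by simp
    then have "2 * \<bar>x\<bar> \<le> 1 + x\<^sup>2" by (simp add: power2_diff)
    then have "\<bar>x\<bar> \<le> 1 + x\<^sup>2" by linarith
    also have "\<dots> \<le> exp (d / 2 * x\<^sup>2) + (1 / (d / 2)) * exp (d / 2 * x\<^sup>2)"
    proof (rule add_mono)
      show "1 \<le> exp (d / 2 * x\<^sup>2)" using less by simp
      have "d / 2 * x\<^sup>2 \<le> exp (d / 2 * x\<^sup>2)" using exp_ge_add_one_self[of "d / 2 * x\<^sup>2"] by linarith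
      then show "x\<^sup>2 \<le> (1 / (d / 2)) * exp (d / 2 * x\<^sup>2)" using less by (simp add: field_simps)
    qed
    finally show ?thesis by (simp add: algebra_simps)
  qed
  show ?case
  proof (cases n)
    case 0
    then show ?thesis using less by (intro exI[of _ 1]) auto
  next
    case (Suc m)
    obtain C where C: "0 \<le> C" "\<And>x. \<bar>herm m x\<bar> \<le> C * exp (d / 2 * x\<^sup>2)" using less.IH[of m "d / 2"] less.prems Suc by auto
    have "m - 1 < n" using Suc by simp
    from less.IH[OF this less.prems] obtain D where D: "0 \<le> D" "\<And>x. \<bar>herm (m - 1) x\<bar> \<le> D * exp (d * x\<^sup>2)" by blast
    let ?K = "(1 / (d / 2) + 1) * C + real m * D"
    have K: "0 \<le> ?K" using C D less.prems by simp
    have "\<bar>herm n x\<bar> \<le> ?K * exp (d * x\<^sup>2)" for x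
    proof -
      have "\<bar>herm n x\<bar> \<le> \<bar>x\<bar> * \<bar>herm m x\<bar> + real m * \<bar>herm (m - 1) x\<bar>"
        unfolding Suc herm_Suc by (rule order_trans[OF abs_triangle_ineq4]) (simp add: abs_mult)
      also have "\<dots> \<le> (1 / (d / 2) + 1) * exp (d / 2 * x\<^sup>2) * (C * exp (d / 2 * x\<^sup>2)) + real m * (D * exp (d * x\<^sup>2))"
        using lin C D less.prems by (intro add_mono mult_mono) auto
      also have "\<dots> = (1 / (d / 2) + 1) * C * (exp (d / 2 * x\<^sup>2) * exp (d / 2 * x\<^sup>2)) + real m * D * exp (d * x\<^sup>2)"
        by (simp only: ac_simps)
      also have "exp (d / 2 * x\<^sup>2) * exp (d / 2 * x\<^sup>2) = exp (d * x\<^sup>2)" by (simp add: exp_add[symmetric])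
      finally show ?thesis by (simp only: distrib_right)
    qed
    then show ?thesis using K by blast
  qed
qed

definition Herm :: "('n::finite \<Rightarrow> nat) \<Rightarrow> real^'n \<Rightarrow> real" where
  "Herm \<alpha> x = (\<Prod>i\<in>UNIV. herm (\<alpha> i) (x $ i))"

lemma continuous_herm: "continuous_on S (herm n)"
  by (meson DERIV_isCont continuous_at_imp_continuous_on has_derivative_herm)

lemma continuous_Herm: "continuous_on S (Herm \<alpha>)"
  unfolding Herm_def[abs_def]
  by (intro continuous_on_prod continuous_on_compose2[OF continuous_herm[of UNIV]] continuous_intros) auto

lemma Herm_meas[measurable]: "Herm \<alpha> \<in> borel_measurable borel"
  by (rule borel_measurable_continuous_onI[OF continuous_Herm])

lemma Herm_L2: "Herm (\<alpha> :: 'n::finite \<Rightarrow> nat) \<in> L2_gauss"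
proof -
  have "\<forall>i. \<exists>C\<ge>0. \<forall>x. \<bar>herm (\<alpha> i) x\<bar> \<le> C * exp (1 / 8 * x\<^sup>2)" using herm_growth[of "1 / 8"] by auto
  from choice[OF this] obtain C where C: "\<And>i x. \<bar>herm (\<alpha> i) x\<bar> \<le> C i * exp (1 / 8 * x\<^sup>2)" by blast
  show ?thesis
  proof (rule L2_growth[of _ "\<Prod>i\<in>UNIV. C i"])
    fix x :: "real^'n"
    have "\<bar>Herm \<alpha> x\<bar> = (\<Prod>i\<in>UNIV. \<bar>herm (\<alpha> i) (x $ i)\<bar>)" by (simp add: Herm_def abs_prod)
    also have "\<dots> \<le> (\<Prod>i\<in>UNIV. C i * exp (1 / 8 * (x $ i)\<^sup>2))" using C by (intro prod_mono) auto
    also have "\<dots> = (\<Prod>i\<in>UNIV. C i) * exp ((norm x)\<^sup>2 / 8)"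
      by (simp add: prod.distrib norm_vec_sq exp_sum[symmetric] sum_divide_distrib)
    finally show "\<bar>Herm \<alpha> x\<bar> \<le> (\<Prod>i\<in>UNIV. C i) * exp ((norm x)\<^sup>2 / 8)" .
  qed measurable
qed

text \<open>The derivatives of a Hermite polynomial times the Gaussian weight, translated by \<open>c\<close> and scaled by \<open>s\<close>.
By the Rodrigues formula each derivative just raises the index of the polynomial.\<close>

definition gherm :: "real \<Rightarrow> real \<Rightarrow> nat \<Rightarrow> nat \<Rightarrow> real \<Rightarrow> real" where
  "gherm s c b j x = (- 1 / s) ^ j * herm (b + j) ((x - c) / s) * exp (- (((x - c) / s)\<^sup>2 / 2))"

lemma smooth_seq_gherm:
  assumes "0 < s" shows "smooth_seq (gherm s c b)"
  unfolding smooth_seq_def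
proof (intro allI)
  fix j and x :: real
  let ?y = "(x - c) / s"
  have y: "((\<lambda>x. (x - c) / s) has_real_derivative 1 / s) (at x)"
    using DERIV_cdivide[OF DERIV_diff[OF DERIV_ident DERIV_const], of c s] by simp
  have h: "((\<lambda>x. herm (b + j) ((x - c) / s)) has_real_derivative real (b + j) * herm (b + j - 1) ?y * (1 / s)) (at x)"
    by (rule DERIV_chain2[OF has_derivative_herm y])
  have e: "((\<lambda>x. exp (- (((x - c) / s)\<^sup>2 / 2))) has_real_derivative exp (- (?y\<^sup>2 / 2)) * (- ?y * (1 / s))) (at x)"
  proof -
    have "((\<lambda>x. - (((x - c) / s)\<^sup>2 / 2)) has_real_derivative - (of_nat 2 * (1 / s * ?y ^ (2 - Suc 0)) / 2)) (at x)"
      by (rule DERIV_minus[OF DERIV_cdivide[OF DERIV_power[OF y]]])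
    moreover have "- (of_nat 2 * (1 / s * y ^ (2 - Suc 0)) / 2) = - y * (1 / s)" for y by simp
    ultimately have "((\<lambda>x. - (((x - c) / s)\<^sup>2 / 2)) has_real_derivative - ?y * (1 / s)) (at x)" by (simp only:)
    then show ?thesis by (rule DERIV_fun_exp)
  qed
  have "((\<lambda>x. (- 1 / s) ^ j * (herm (b + j) ((x - c) / s) * exp (- (((x - c) / s)\<^sup>2 / 2)))) has_real_derivative
     (- 1 / s) ^ j * (real (b + j) * herm (b + j - 1) ?y * (1 / s) * exp (- (?y\<^sup>2 / 2)) + exp (- (?y\<^sup>2 / 2)) * (- ?y * (1 / s)) * herm (b + j) ?y)) (at x)"
    by (intro DERIV_cmult DERIV_mult h e)
  also have "(- 1 / s) ^ j * (real (b + j) * herm (b + j - 1) ?y * (1 / s) * exp (- (?y\<^sup>2 / 2)) + exp (- (?y\<^sup>2 / 2)) * (- ?y * (1 / s)) * herm (b + j) ?y)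
    = gherm s c b (Suc j) x"
  proof -
    have gen: "P * (N * H' * u * E + E * (- y * u) * H) = (- u * P) * (y * H - N * H') * E" for P N H' u E y H :: real
      by algebra
    show ?thesis
      unfolding gherm_def add_Suc_right herm_Suc power_Suc
      using gen[of "(- 1 / s) ^ j" "real (b + j)" "herm (b + j - 1) ?y" "1 / s" "exp (- (?y\<^sup>2 / 2))" ?y "herm (b + j) ?y"]
      by (simp only: divide_minus_left)
  qed
  finally show "(gherm s c b j has_real_derivative gherm s c b (Suc j) x) (at x)"
    by (simp add: gherm_def[abs_def] mult.assoc)
qed

text \<open>The weight \<open>exp (- 7 / 16 * (x - c)\<^sup>2)\<close>, which remains after absorbing the polynomial, decays
faster than \<open>exp (- 3 / 8 * x\<^sup>2)\<close> up to a factor depending on \<open>c\<close>.\<close>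

lemma gherm_dom:
  assumes s: "0 < s" "s \<le> 1"
  shows "\<exists>C. \<forall>x. \<bar>gherm s c b j x\<bar> \<le> C * exp (- (3 / 8 * x\<^sup>2))"
proof -
  obtain C where C: "0 \<le> C" "\<And>x. \<bar>herm (b + j) x\<bar> \<le> C * exp (1 / 16 * x\<^sup>2)" using herm_growth[of "1 / 16" "b + j"] by auto
  have "\<bar>gherm s c b j x\<bar> \<le> (\<bar>(- 1 / s) ^ j\<bar> * C * exp (6 * c\<^sup>2)) * exp (- (3 / 8 * x\<^sup>2))" for x
  proof -
    let ?y = "(x - c) / s"
    have "\<bar>gherm s c b j x\<bar> = \<bar>(- 1 / s) ^ j\<bar> * \<bar>herm (b + j) ?y\<bar> * exp (- (?y\<^sup>2 / 2))"
      unfolding gherm_def by (simp only: abs_mult abs_exp_cancel)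
    also have "\<dots> \<le> \<bar>(- 1 / s) ^ j\<bar> * (C * exp (1 / 16 * ?y\<^sup>2)) * exp (- (?y\<^sup>2 / 2))"
      using C by (intro mult_right_mono mult_left_mono) auto
    also have "\<dots> = \<bar>(- 1 / s) ^ j\<bar> * C * exp (1 / 16 * ?y\<^sup>2 + - (?y\<^sup>2 / 2))"
      by (simp only: exp_add mult.assoc)
    also have "\<dots> \<le> \<bar>(- 1 / s) ^ j\<bar> * C * exp (6 * c\<^sup>2 + - (3 / 8 * x\<^sup>2))"
    proof -
      have "(x - c)\<^sup>2 \<le> ?y\<^sup>2"
        using s by (simp add: power_divide pos_le_divide_eq mult_left_le power_le_one)
      then have "1 / 16 * ?y\<^sup>2 + - (?y\<^sup>2 / 2) \<le> - (7 / 16 * (x - c)\<^sup>2)" by (simp add: field_simps)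
      also have "\<dots> \<le> 6 * c\<^sup>2 + - (3 / 8 * x\<^sup>2)"
      proof -
        have "0 \<le> (x - 7 * c)\<^sup>2" by simp
        then have "14 * (x * c) \<le> x\<^sup>2 + 49 * c\<^sup>2" by (simp add: power2_diff power_mult_distrib algebra_simps)
        moreover have "(x - c)\<^sup>2 = x\<^sup>2 - 2 * (x * c) + c\<^sup>2" by (simp add: power2_diff)
        moreover have "0 \<le> c\<^sup>2" by simp
        ultimately show ?thesis by linarith
      qed
      finally show ?thesis using C by (intro mult_left_mono) auto
    qed
    also have "\<dots> = (\<bar>(- 1 / s) ^ j\<bar> * C * exp (6 * c\<^sup>2)) * exp (- (3 / 8 * x\<^sup>2))"
      by (simp only: exp_add mult.assoc)
    finally show ?thesis .
  qed
  then show ?thesis by blast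
qed

lemma pprod_gherm:
  fixes z :: "real^'n"
  shows "pprod (\<lambda>i. gherm s (c $ i) (\<beta> i)) a z * (2 * pi) powr (- real CARD('n) / 2)
    = (- 1 / s) ^ mi_size a * Herm (\<lambda>i. \<beta> i + a i) ((1 / s) *\<^sub>R (z - c)) * gdens ((1 / s) *\<^sub>R (z - c))"
proof -
  have "pprod (\<lambda>i. gherm s (c $ i) (\<beta> i)) a z = (\<Prod>i\<in>UNIV. (- 1 / s) ^ a i) * Herm (\<lambda>i. \<beta> i + a i) ((1 / s) *\<^sub>R (z - c))
     * (\<Prod>i\<in>UNIV. exp (- (((z $ i - c $ i) / s)\<^sup>2 / 2)))"
    by (simp add: pprod_def gherm_def Herm_def prod.distrib)
  also have "(\<Prod>i\<in>UNIV. (- 1 / s) ^ a i) = (- 1 / s) ^ mi_size a" by (simp add: power_sum mi_size_def)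
  also have "(\<Prod>i\<in>UNIV. exp (- (((z $ i - c $ i) / s)\<^sup>2 / 2))) = exp (- (norm ((1 / s) *\<^sub>R (z - c)))\<^sup>2 / 2)"
    unfolding norm_vec_sq by (simp add: exp_sum[symmetric] sum_negf[symmetric] sum_divide_distrib)
  finally show ?thesis by (simp add: gdens_def ac_simps)
qed

text \<open>Integration by parts against Hermite functions. The centre \<open>c\<close> and the scale \<open>s\<close> are needed for two
purposes: with \<open>c = 0\<close> and \<open>s = 1\<close> it computes the Hermite coefficients of weak derivatives, and with
\<open>c = r *\<^sub>R x\<close>, \<open>s = sqrt (1 - r\<^sup>2)\<close> and \<open>\<beta> = 0\<close> it evaluates the Ornstein--Uhlenbeck operator on them
at a point.\<close>

lemma weak_deriv_hermite:
  fixes f g :: "real^'n \<Rightarrow> real"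
  assumes f: "f \<in> L2_gauss" and g: "g \<in> L2_gauss" and w: "has_weak_deriv \<kappa> f g" and s: "0 < s" "s \<le> 1"
  shows "(LINT y|gauss. g (c + s *\<^sub>R y) * Herm \<beta> y)
    = (1 / s) ^ mi_size \<kappa> * (LINT y|gauss. f (c + s *\<^sub>R y) * Herm (\<lambda>i. \<beta> i + \<kappa> i) y)"
proof -
  have [measurable]: "f \<in> borel_measurable borel" "g \<in> borel_measurable borel" using f g by (auto intro: L2_meas)
  define K where "K = (2 * pi) powr (- real CARD('n) / 2)"
  let ?\<psi> = "\<lambda>i. gherm s (c $ i) (\<beta> i)"
  have aff: "(LINT y|gauss. h (c + s *\<^sub>R y) * Herm (\<lambda>i. \<beta> i + a i) y) * ((- 1 / s) ^ mi_size a * s ^ CARD('n)) = K * (LINT z|lborel. h z * pprod ?\<psi> a z)"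
    if [measurable]: "h \<in> borel_measurable borel" for h :: "real^'n \<Rightarrow> real" and a
  proof -
    have "(LINT y|gauss. h (c + s *\<^sub>R y) * Herm (\<lambda>i. \<beta> i + a i) y)
      = (LINT y|gauss. (\<lambda>z. h z * Herm (\<lambda>i. \<beta> i + a i) ((1 / s) *\<^sub>R (z - c))) (c + s *\<^sub>R y))"
      using s by simp
    also have "\<dots> = (LINT z|lborel. gdens ((1 / s) *\<^sub>R (z - c)) / s ^ CARD('n) * (h z * Herm (\<lambda>i. \<beta> i + a i) ((1 / s) *\<^sub>R (z - c))))"
      by (rule integral_gauss_affine[OF s(1)]) measurable
    finally have "(LINT y|gauss. h (c + s *\<^sub>R y) * Herm (\<lambda>i. \<beta> i + a i) y) * ((- 1 / s) ^ mi_size a * s ^ CARD('n))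
      = (LINT z|lborel. gdens ((1 / s) *\<^sub>R (z - c)) / s ^ CARD('n) * (h z * Herm (\<lambda>i. \<beta> i + a i) ((1 / s) *\<^sub>R (z - c))) * ((- 1 / s) ^ mi_size a * s ^ CARD('n)))"
      by (simp only: Bochner_Integration.integral_mult_left_zero)
    also have "\<dots> = (LINT z|lborel. K * (h z * pprod ?\<psi> a z))"
    proof (intro Bochner_Integration.integral_cong refl)
      fix z
      have "gdens ((1 / s) *\<^sub>R (z - c)) / s ^ CARD('n) * (h z * Herm (\<lambda>i. \<beta> i + a i) ((1 / s) *\<^sub>R (z - c))) * ((- 1 / s) ^ mi_size a * s ^ CARD('n))
        = h z * ((- 1 / s) ^ mi_size a * Herm (\<lambda>i. \<beta> i + a i) ((1 / s) *\<^sub>R (z - c)) * gdens ((1 / s) *\<^sub>R (z - c)))"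
        using s by (simp add: field_simps)
      also have "\<dots> = h z * (pprod ?\<psi> a z * K)" unfolding K_def pprod_gherm ..
      finally show "gdens ((1 / s) *\<^sub>R (z - c)) / s ^ CARD('n) * (h z * Herm (\<lambda>i. \<beta> i + a i) ((1 / s) *\<^sub>R (z - c))) * ((- 1 / s) ^ mi_size a * s ^ CARD('n)) = K * (h z * pprod ?\<psi> a z)"
        by (simp only: ac_simps)
    qed
    also have "\<dots> = K * (LINT z|lborel. h z * pprod ?\<psi> a z)" by simp
    finally show ?thesis .
  qed
  have "(LINT x|lborel. f x * pprod ?\<psi> \<kappa> x) = (-1) ^ mi_size \<kappa> * (LINT x|lborel. g x * pprod ?\<psi> (\<lambda>_. 0) x)"
    by (rule weak_deriv_gaussian_type[OF f g w smooth_seq_gherm gherm_dom]) (use s in auto)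
  then have "K * (LINT x|lborel. f x * pprod ?\<psi> \<kappa> x) = (-1) ^ mi_size \<kappa> * (K * (LINT x|lborel. g x * pprod ?\<psi> (\<lambda>_. 0) x))"
    by simp
  also have "K * (LINT x|lborel. g x * pprod ?\<psi> (\<lambda>_. 0) x) = (LINT y|gauss. g (c + s *\<^sub>R y) * Herm \<beta> y) * s ^ CARD('n)"
    using aff[of g "\<lambda>_. 0"] by (simp add: mi_size_def)
  also have "K * (LINT x|lborel. f x * pprod ?\<psi> \<kappa> x) = (LINT y|gauss. f (c + s *\<^sub>R y) * Herm (\<lambda>i. \<beta> i + \<kappa> i) y) * ((- 1 / s) ^ mi_size \<kappa> * s ^ CARD('n))"
    using aff[of f \<kappa>] by simp
  finally have "(LINT y|gauss. f (c + s *\<^sub>R y) * Herm (\<lambda>i. \<beta> i + \<kappa> i) y) * (- 1 / s) ^ mi_size \<kappa>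
     = (-1) ^ mi_size \<kappa> * (LINT y|gauss. g (c + s *\<^sub>R y) * Herm \<beta> y)"
    using s by simp
  moreover have "(- 1 / s) ^ mi_size \<kappa> = (- 1) ^ mi_size \<kappa> * (1 / s) ^ mi_size \<kappa>"
    by (simp add: power_mult_distrib[symmetric])
  ultimately show ?thesis by (simp add: mult.commute)
qed

section \<open>Hermite coefficients\<close>

definition nrm :: "('n::finite \<Rightarrow> nat) \<Rightarrow> real" where "nrm \<alpha> = sqrt (\<Prod>i\<in>UNIV. fact (\<alpha> i))"

text \<open>The coefficient of \<open>f\<close> with respect to the normalized Hermite polynomial of index \<open>\<alpha>\<close>.\<close>

definition coef :: "(real^'n \<Rightarrow> real) \<Rightarrow> ('n::finite \<Rightarrow> nat) \<Rightarrow> real" where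
  "coef f \<alpha> = (LINT x|gauss. f x * Herm \<alpha> x) / nrm \<alpha>"

definition energy :: "(real^'n \<Rightarrow> real) \<Rightarrow> nat \<Rightarrow> real" where
  "energy f m = (\<Sum>\<alpha> | mi_size \<alpha> = m. (coef f \<alpha>)\<^sup>2)"

lemma nrm_pos: "0 < nrm \<alpha>" by (simp add: nrm_def prod_pos)

lemma nrm_sq: "(nrm \<alpha>)\<^sup>2 = (\<Prod>i\<in>UNIV. fact (\<alpha> i))" by (simp add: nrm_def prod_nonneg)

lemma energy_nonneg: "0 \<le> energy f m" by (simp add: energy_def sum_nonneg)

lemma coef_add: "f \<in> L2_gauss \<Longrightarrow> g \<in> L2_gauss \<Longrightarrow> coef (\<lambda>x. f x + g x) \<alpha> = coef f \<alpha> + coef g \<alpha>"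
  by (simp add: coef_def distrib_right L2_prod_integrable Herm_L2 add_divide_distrib)

lemma coef_cmult: "coef (\<lambda>x. c * f x) \<alpha> = c * coef f \<alpha>"
  by (simp add: coef_def mult.assoc)

lemma coef_diff: "f \<in> L2_gauss \<Longrightarrow> g \<in> L2_gauss \<Longrightarrow> coef (\<lambda>x. f x - g x) \<alpha> = coef f \<alpha> - coef g \<alpha>"
  by (simp add: coef_def left_diff_distrib L2_prod_integrable Herm_L2 diff_divide_distrib)

lemma coef_sum:
  assumes "finite S" "\<And>b. b \<in> S \<Longrightarrow> F b \<in> L2_gauss"
  shows "coef (\<lambda>x. \<Sum>b\<in>S. F b x) \<alpha> = (\<Sum>b\<in>S. coef (F b) \<alpha>)"
  using assms
proof (induction S)
  case empty
  then show ?case by (simp add: coef_def)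
next
  case (insert b S)
  then show ?case using coef_add[of "F b" "\<lambda>x. \<Sum>b\<in>S. F b x" \<alpha>] L2_sum[of S F] by simp
qed

lemma coef_cong_AE:
  assumes "f \<in> borel_measurable borel" "g \<in> borel_measurable borel" "AE x in gauss. f x = g x"
  shows "coef f \<alpha> = coef g \<alpha>"
proof -
  have "(LINT x|gauss. f x * Herm \<alpha> x) = (LINT x|gauss. g x * Herm \<alpha> x)"
    using assms by (intro integral_cong_AE) (auto simp: measurable_cong_sets[OF sets_gauss refl])
  then show ?thesis by (simp add: coef_def)
qed

text \<open>The derivatives of a Hermite polynomial; they vanish from order \<open>b + 1\<close> on.\<close>

definition hseq :: "nat \<Rightarrow> nat \<Rightarrow> real \<Rightarrow> real" where
  "hseq b j x = (if j \<le> b then fact b / fact (b - j) else 0) * herm (b - j) x"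

lemma smooth_seq_hseq: "smooth_seq (hseq b)"
  unfolding smooth_seq_def
proof (intro allI)
  fix j and x :: real
  let ?c = "\<lambda>j. (if j \<le> b then fact b / fact (b - j) else 0) :: real"
  have "(hseq b j has_real_derivative ?c j * (real (b - j) * herm (b - j - 1) x)) (at x)"
    unfolding hseq_def[abs_def] by (intro DERIV_cmult has_derivative_herm)
  also have "?c j * (real (b - j) * herm (b - j - 1) x) = hseq b (Suc j) x"
  proof (cases "Suc j \<le> b")
    case True
    then obtain m where m: "b - j = Suc m" by (metis Suc_diff_le diff_Suc_Suc)
    then have "b - Suc j = m" by simp
    then show ?thesis using True m by (simp add: hseq_def field_simps del: of_nat_Suc)
  next
    case False
    then show ?thesis by (auto simp: hseq_def)
  qed
  finally show "(hseq b j has_real_derivative hseq b (Suc j) x) (at x)" .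
qed

lemma pprod_hseq_0: "pprod (\<lambda>i. hseq (\<alpha> i)) (\<lambda>_. 0) = Herm \<alpha>"
  by (auto simp: pprod_def hseq_def Herm_def)

lemma pprod_hseq:
  "pprod (\<lambda>i. hseq (\<alpha> i)) \<kappa> x = (\<Prod>i\<in>UNIV. if \<kappa> i \<le> \<alpha> i then fact (\<alpha> i) / fact (\<alpha> i - \<kappa> i) else 0) * Herm (\<lambda>i. \<alpha> i - \<kappa> i) x"
  by (simp add: pprod_def hseq_def Herm_def prod.distrib)

lemma pprod_hseq_L2: "pprod (\<lambda>i. hseq (\<alpha> i)) \<kappa> \<in> L2_gauss"
  unfolding pprod_hseq[abs_def] by (intro L2_cmult Herm_L2)

lemma Herm_weak_deriv: "has_weak_deriv \<kappa> (Herm \<alpha>) (pprod (\<lambda>i. hseq (\<alpha> i)) \<kappa>)"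
  using smooth_fam_weak_deriv[OF smooth_fam_pprod[OF smooth_seq_hseq], of \<kappa> \<alpha>] by (simp add: pprod_hseq_0)

lemma integral_times_Herm:
  fixes f g :: "real^'n \<Rightarrow> real"
  assumes f: "f \<in> L2_gauss" and g: "g \<in> L2_gauss" and w: "has_weak_deriv \<kappa> f g"
  shows "(LINT y|gauss. f y * Herm (\<lambda>i. \<beta> i + \<kappa> i) y) = (LINT y|gauss. g y * Herm \<beta> y)"
  using weak_deriv_hermite[OF f g w, of 1 0 \<beta>] by simp

lemma measure_gauss_UNIV[simp]: "measure (gauss :: (real^'n) measure) UNIV = 1"
  using gauss.prob_space by simp

lemma Herm_0: "Herm (\<lambda>i. 0) x = 1" by (simp add: Herm_def)

text \<open>Integrating by parts moves \<open>\<beta>\<close> derivatives from the weight to \<open>Herm \<alpha>\<close>, which kills it unless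
\<open>\<beta> \<le> \<alpha>\<close>. By symmetry only \<open>\<alpha> = \<beta>\<close> survives.\<close>

lemma Herm_orthogonal:
  fixes \<alpha> \<beta> :: "'n::finite \<Rightarrow> nat"
  shows "(LINT x|gauss. Herm \<alpha> x * Herm \<beta> x) = (if \<alpha> = \<beta> then (nrm \<alpha>)\<^sup>2 else 0)"
proof -
  have P: "(LINT x|gauss. Herm \<alpha> x * Herm \<beta> x) = (LINT x|gauss. pprod (\<lambda>i. hseq (\<alpha> i)) \<beta> x)" for \<alpha> \<beta> :: "'n \<Rightarrow> nat"
    using integral_times_Herm[OF Herm_L2 pprod_hseq_L2 Herm_weak_deriv, of \<alpha> "\<lambda>_. 0" \<beta>] by (simp add: Herm_0)
  have Z: "(LINT x|gauss. Herm \<alpha> x * Herm \<beta> x) = 0" if "\<alpha> i < \<beta> i" for \<alpha> \<beta> :: "'n \<Rightarrow> nat" and i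
  proof -
    have "(\<Prod>i\<in>UNIV. if \<beta> i \<le> \<alpha> i then fact (\<alpha> i) / fact (\<alpha> i - \<beta> i) else 0 :: real) = 0"
      by (intro prod_zero bexI[of _ i]) (use that in auto)
    then show ?thesis unfolding P pprod_hseq by simp
  qed
  show ?thesis
  proof (cases "\<alpha> = \<beta>")
    case True
    then show ?thesis unfolding P pprod_hseq by (simp add: nrm_sq Herm_0)
  next
    case False
    then obtain i where "\<alpha> i < \<beta> i \<or> \<beta> i < \<alpha> i" by (metis ext nat_neq_iff)
    then show ?thesis using Z[of \<alpha> i \<beta>] Z[of \<beta> i \<alpha>] False by (auto simp: mult.commute)
  qed
qed

lemma coef_Herm: "coef (Herm \<alpha>) \<beta> = (if \<alpha> = \<beta> then nrm \<alpha> else 0)"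
  using nrm_pos[of \<alpha>] by (auto simp: coef_def Herm_orthogonal power2_eq_square)

text \<open>Each derivative shifts the phase by a quarter period.\<close>

lemma smooth_fam_cos:
  fixes v :: "real^'n"
  shows "smooth_fam (\<lambda>a x. (\<Prod>i\<in>UNIV. (v $ i) ^ a i) * cos (v \<bullet> x + (d + real (mi_size a) * (pi / 2))))"
proof -
  let ?U = "\<lambda>(a::'n \<Rightarrow> nat) x. (\<Prod>i\<in>UNIV. (v $ i) ^ a i) * cos (v \<bullet> x + (d + real (mi_size a) * (pi / 2)))"
  have D: "(?U a has_derivative (\<lambda>h. (\<Prod>i\<in>UNIV. (v $ i) ^ a i) * (- sin (v \<bullet> x + (d + real (mi_size a) * (pi / 2))) * (v \<bullet> h)))) (at x)" for a x
    by (auto intro!: derivative_eq_intros)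
  have "partial_deriv k (?U a) x = ?U (a(k := Suc (a k))) x" for k a x
  proof -
    have s: "mi_size (a(k := Suc (a k))) = Suc (mi_size a)"
      unfolding mi_size_def by (subst (1 2) sum.remove[of UNIV k]) (auto intro!: sum.cong)
    have p: "(\<Prod>i\<in>UNIV. (v $ i) ^ (a(k := Suc (a k))) i) = v $ k * (\<Prod>i\<in>UNIV. (v $ i) ^ a i)"
      by (subst (1 2) prod.remove[of UNIV k]) (auto intro!: prod.cong)
    have c: "cos (t + (d + real (Suc m) * (pi / 2))) = - sin (t + (d + real m * (pi / 2)))" for t m
    proof -
      have "t + (d + real (Suc m) * (pi / 2)) = (t + (d + real m * (pi / 2))) + pi / 2" by (simp add: algebra_simps)
      then show ?thesis by (simp only: cos_add) simp
    qed
    have "partial_deriv k (?U a) x = (\<Prod>i\<in>UNIV. (v $ i) ^ a i) * (- sin (v \<bullet> x + (d + real (mi_size a) * (pi / 2))) * (v \<bullet> axis k 1))"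
      by (rule partial_deriv_eq[OF D])
    also have "v \<bullet> axis k 1 = v $ k" by (simp add: inner_axis)
    finally show ?thesis unfolding s p c by simp
  qed
  moreover have "?U a differentiable (at x)" for a x
    using D[of a x] unfolding differentiable_def by blast
  ultimately show ?thesis unfolding smooth_fam_def by (auto simp: differentiable_on_def)
qed

lemma coef_cos:
  fixes v :: "real^'n"
  shows "coef (\<lambda>x. c * cos (v \<bullet> x + d)) \<alpha> = c * ((\<Prod>i\<in>UNIV. (v $ i) ^ \<alpha> i) / nrm \<alpha> * exp (- (norm v)\<^sup>2 / 2) * cos (d + real (mi_size \<alpha>) * (pi / 2)))"
proof -
  let ?U = "\<lambda>(a::'n \<Rightarrow> nat) x. (\<Prod>i\<in>UNIV. (v $ i) ^ a i) * cos (v \<bullet> x + (d + real (mi_size a) * (pi / 2)))"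
  have L2: "?U a \<in> L2_gauss" for a
    by (rule L2_cmult, rule L2_bounded[of _ 1]) auto
  have "(LINT y|gauss. ?U (\<lambda>_. 0) y * Herm (\<lambda>i. 0 + \<alpha> i) y) = (LINT y|gauss. ?U \<alpha> y * Herm (\<lambda>_. 0) y)"
    by (rule integral_times_Herm[OF L2 L2 smooth_fam_weak_deriv[OF smooth_fam_cos]])
  then have "(LINT y|gauss. cos (v \<bullet> y + d) * Herm \<alpha> y) = (\<Prod>i\<in>UNIV. (v $ i) ^ \<alpha> i) * (exp (- (norm v)\<^sup>2 / 2) * cos (d + real (mi_size \<alpha>) * (pi / 2)))"
    by (simp add: Herm_0 mi_size_def integral_gauss_cos)
  then show ?thesis unfolding coef_cmult by (simp add: coef_def)
qed

text \<open>The coefficient of \<open>f\<close> at \<open>\<alpha>\<close> contributes to the energy of the derivative of index \<open>\<kappa>\<close> with the factor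
\<open>\<Prod>i. \<alpha> i choose \<kappa> i\<close>, and these factors sum to \<open>mi_size \<alpha> choose k\<close> by Vandermonde's identity.\<close>

lemma energy_derivs:
  fixes f :: "real^'n \<Rightarrow> real"
  assumes G: "\<And>\<kappa> \<beta>. mi_size \<kappa> = k \<Longrightarrow> (coef (G \<kappa>) \<beta>)\<^sup>2 = (\<Prod>i\<in>UNIV. real ((\<beta> i + \<kappa> i) choose \<kappa> i)) * (coef f (\<lambda>i. \<beta> i + \<kappa> i))\<^sup>2"
  shows "(\<Sum>\<kappa> | mi_size \<kappa> = k. energy (G \<kappa>) l) = real ((l + k) choose k) * energy f (l + k)"
proof -
  have E: "energy (G \<kappa>) l = (\<Sum>\<alpha> | mi_size \<alpha> = l + k. (\<Prod>i\<in>UNIV. real (\<alpha> i choose \<kappa> i)) * (coef f \<alpha>)\<^sup>2)"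
    if \<kappa>: "mi_size \<kappa> = k" for \<kappa> :: "'n \<Rightarrow> nat"
  proof -
    let ?h = "\<lambda>\<alpha>. (\<Prod>i\<in>UNIV. real (\<alpha> i choose \<kappa> i)) * (coef f \<alpha>)\<^sup>2"
    have ms: "mi_size (\<lambda>i. \<beta> i + \<kappa> i) = mi_size \<beta> + k" for \<beta>
      using \<kappa> by (simp add: mi_size_def sum.distrib)
    have "energy (G \<kappa>) l = (\<Sum>\<beta> | mi_size \<beta> = l. ?h (\<lambda>i. \<beta> i + \<kappa> i))"
      unfolding energy_def by (intro sum.cong refl G \<kappa>)
    also have "\<dots> = (\<Sum>\<alpha> | mi_size \<alpha> = l + k \<and> (\<forall>i. \<kappa> i \<le> \<alpha> i). ?h \<alpha>)"
    proof (rule sum.reindex_bij_witness[where i = "\<lambda>\<alpha> i. \<alpha> i - \<kappa> i" and j = "\<lambda>\<beta> i. \<beta> i + \<kappa> i"])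
      fix \<alpha> assume "\<alpha> \<in> {\<alpha>. mi_size \<alpha> = l + k \<and> (\<forall>i. \<kappa> i \<le> \<alpha> i)}"
      then show "(\<lambda>i. \<alpha> i - \<kappa> i) \<in> {\<beta>. mi_size \<beta> = l}" using ms[of "\<lambda>i. \<alpha> i - \<kappa> i"] by auto
    qed (auto simp: ms)
    also have "\<dots> = (\<Sum>\<alpha> | mi_size \<alpha> = l + k. ?h \<alpha>)"
    proof (rule sum.mono_neutral_left[OF finite_mi_size])
      show "\<forall>\<alpha>\<in>{\<alpha>. mi_size \<alpha> = l + k} - {\<alpha>. mi_size \<alpha> = l + k \<and> (\<forall>i. \<kappa> i \<le> \<alpha> i)}. ?h \<alpha> = 0"
        by (auto simp: not_le)
    qed auto
    finally show ?thesis .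
  qed
  have "(\<Sum>\<kappa> | mi_size \<kappa> = k. energy (G \<kappa>) l)
     = (\<Sum>\<kappa> | mi_size \<kappa> = k. \<Sum>\<alpha> | mi_size \<alpha> = l + k. (\<Prod>i\<in>UNIV. real (\<alpha> i choose \<kappa> i)) * (coef f \<alpha>)\<^sup>2)"
    by (intro sum.cong refl E) auto
  also have "\<dots> = (\<Sum>\<alpha> | mi_size \<alpha> = l + k. \<Sum>\<kappa> | mi_size \<kappa> = k. (\<Prod>i\<in>UNIV. real (\<alpha> i choose \<kappa> i)) * (coef f \<alpha>)\<^sup>2)"
    by (rule sum.swap)
  also have "\<dots> = (\<Sum>\<alpha> | mi_size \<alpha> = l + k. real ((l + k) choose k) * (coef f \<alpha>)\<^sup>2)"
    unfolding sum_distrib_right[symmetric] vandermonde_multi by (intro sum.cong) auto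
  finally show ?thesis by (simp add: energy_def sum_distrib_left)
qed

lemma coef_weak_D:
  fixes f :: "real^'n \<Rightarrow> real"
  assumes f: "f \<in> L2_gauss" and g: "g \<in> L2_gauss" and w: "has_weak_deriv \<kappa> f g"
  shows "(coef (\<lambda>x. (\<Prod>i\<in>UNIV. 1 / sqrt (fact (\<kappa> i))) * g x) \<beta>)\<^sup>2 = (\<Prod>i\<in>UNIV. real ((\<beta> i + \<kappa> i) choose \<kappa> i)) * (coef f (\<lambda>i. \<beta> i + \<kappa> i))\<^sup>2"
proof -
  have I: "(LINT y|gauss. g y * Herm \<beta> y) = coef f (\<lambda>i. \<beta> i + \<kappa> i) * nrm (\<lambda>i. \<beta> i + \<kappa> i)"
    using integral_times_Herm[OF f g w, of \<beta>] nrm_pos[of "\<lambda>i. \<beta> i + \<kappa> i"] by (simp add: coef_def)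
  have "(coef (\<lambda>x. (\<Prod>i\<in>UNIV. 1 / sqrt (fact (\<kappa> i))) * g x) \<beta>)\<^sup>2
     = (\<Prod>i\<in>UNIV. 1 / fact (\<kappa> i)) * (coef f (\<lambda>i. \<beta> i + \<kappa> i))\<^sup>2 * ((nrm (\<lambda>i. \<beta> i + \<kappa> i))\<^sup>2 / (nrm \<beta>)\<^sup>2)"
    unfolding coef_cmult
    by (simp add: coef_def[of g] I power_mult_distrib power_divide prod_power_distrib)
  also have "(nrm (\<lambda>i. \<beta> i + \<kappa> i))\<^sup>2 / (nrm \<beta>)\<^sup>2 = (\<Prod>i\<in>UNIV. fact (\<beta> i + \<kappa> i) / fact (\<beta> i))"
    unfolding nrm_sq by (rule prod_dividef[symmetric])
  also have "(\<Prod>i\<in>UNIV. 1 / fact (\<kappa> i)) * c * (\<Prod>i\<in>UNIV. fact (\<beta> i + \<kappa> i) / fact (\<beta> i)) = (\<Prod>i\<in>UNIV. real ((\<beta> i + \<kappa> i) choose \<kappa> i)) * c" for c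
  proof -
    have "(\<Prod>i\<in>UNIV. 1 / fact (\<kappa> i) * (fact (\<beta> i + \<kappa> i) / fact (\<beta> i))) = (\<Prod>i\<in>UNIV. real ((\<beta> i + \<kappa> i) choose \<kappa> i))"
      by (intro prod.cong refl) (simp add: binomial_fact)
    then show ?thesis by (simp only: prod.distrib ac_simps)
  qed
  finally show ?thesis .
qed

section \<open>Trigonometric polynomials\<close>

text \<open>Real trigonometric polynomials with arbitrary frequencies. Random walks, the Gaussian
measure, Hermite coefficients and the Ornstein--Uhlenbeck operators all act on cosines explicitly,
so that identities can be checked on them and extended by density.\<close>

inductive_set trig :: "(real^'n \<Rightarrow> real) set" where
  trig_cos: "(\<lambda>x. c * cos (v \<bullet> x + d)) \<in> trig"
| trig_add: "f \<in> trig \<Longrightarrow> g \<in> trig \<Longrightarrow> (\<lambda>x. f x + g x) \<in> trig"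

lemma trig_const: "(\<lambda>x. c) \<in> trig"
  using trig_cos[of c 0 0] by simp

lemma trig_sin: "(\<lambda>x. sin (v \<bullet> x)) \<in> trig"
  using trig_cos[of 1 v "- pi / 2"] by (simp add: cos_diff)

lemma trig_cmult: "f \<in> trig \<Longrightarrow> (\<lambda>x. a * f x) \<in> trig"
proof (induction rule: trig.induct)
  case (trig_cos c v d)
  then show ?case using trig.trig_cos[of "a * c" v d] by (simp add: mult.assoc)
qed (auto simp: distrib_left intro: trig_add)

lemma trig_mult: "f \<in> trig \<Longrightarrow> g \<in> trig \<Longrightarrow> (\<lambda>x. f x * g x) \<in> trig"
proof (induction rule: trig.induct)
  case (trig_cos c v d)
  from trig_cos show ?case
  proof (induction rule: trig.induct)
    case (trig_cos c' w e)
    have "(\<lambda>x. c * cos (v \<bullet> x + d) * (c' * cos (w \<bullet> x + e))) =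
      (\<lambda>x. c * c' / 2 * cos ((v - w) \<bullet> x + (d - e)) + c * c' / 2 * cos ((v + w) \<bullet> x + (d + e)))"
    proof
      fix x
      have "(v - w) \<bullet> x + (d - e) = (v \<bullet> x + d) - (w \<bullet> x + e)" "(v + w) \<bullet> x + (d + e) = (v \<bullet> x + d) + (w \<bullet> x + e)"
        by (auto simp: inner_diff_left inner_add_left)
      then show "c * cos (v \<bullet> x + d) * (c' * cos (w \<bullet> x + e)) =
        c * c' / 2 * cos ((v - w) \<bullet> x + (d - e)) + c * c' / 2 * cos ((v + w) \<bullet> x + (d + e))"
        by (simp only: cos_add cos_diff) (simp add: algebra_simps)
    qed
    then show ?case by (simp only:) (intro trig.intros)
  qed (auto simp: distrib_left intro: trig_add)
qed (auto simp: distrib_right intro: trig_add)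

lemma trig_sum: "finite S \<Longrightarrow> (\<And>b. b \<in> S \<Longrightarrow> F b \<in> trig) \<Longrightarrow> (\<lambda>x. \<Sum>b\<in>S. F b x) \<in> trig"
  by (induction S rule: finite_induct) (auto intro: trig_const trig_add)

lemma trig_continuous: "f \<in> trig \<Longrightarrow> continuous_on UNIV f"
  by (induction rule: trig.induct) (auto intro!: continuous_intros)

lemma trig_bounded: "f \<in> trig \<Longrightarrow> \<exists>B\<ge>0. \<forall>x. \<bar>f x\<bar> \<le> B"
proof (induction rule: trig.induct)
  case (trig_cos c v d)
  have "\<bar>c * cos (v \<bullet> x + d)\<bar> \<le> \<bar>c\<bar>" for x by (simp add: abs_mult mult_left_le)
  then show ?case by (intro exI[of _ "\<bar>c\<bar>"]) auto
next
  case (trig_add f g)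
  then obtain A B where "A \<ge> 0" "B \<ge> 0" "\<forall>x. \<bar>f x\<bar> \<le> A" "\<forall>x. \<bar>g x\<bar> \<le> B" by blast
  then show ?case by (intro exI[of _ "A + B"]) (auto intro!: order_trans[OF abs_triangle_ineq] add_mono)
qed

lemma trig_meas: "f \<in> trig \<Longrightarrow> f \<in> borel_measurable borel"
  by (intro borel_measurable_continuous_onI trig_continuous)

lemma trig_L2: "f \<in> trig \<Longrightarrow> f \<in> L2_gauss"
  using trig_bounded[of f] trig_meas[of f] by (auto intro: L2_bounded)

lemma trig_poly_comp:
  assumes p: "real_polynomial_function (p :: real \<Rightarrow> real)" and f: "f \<in> trig"
  shows "(\<lambda>x. p (f x)) \<in> trig"
  using p
proof (induction p rule: real_polynomial_function.induct)
  case (linear h)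
  then obtain c where "h = (\<lambda>x. x * c)" unfolding real_bounded_linear by blast
  then show ?case using trig_cmult[OF f, of c] by (simp add: mult.commute)
qed (auto intro: trig_const trig_add trig_mult)

section \<open>Random walks on the cube\<close>

text \<open>The average of \<open>G\<close> over a step \<open>\<plusminus> e\<close> of each argument, where the two signs agree with
probability \<open>(1 + s) / 2\<close>.\<close>

definition step :: "real \<Rightarrow> real^'n \<Rightarrow> (real^'n \<Rightarrow> real^'n \<Rightarrow> real) \<Rightarrow> real^'n \<Rightarrow> real^'n \<Rightarrow> real" where
  "step s e G x y = (1 + s) / 4 * (G (x + e) (y + e) + G (x - e) (y - e))
     + (1 - s) / 4 * (G (x + e) (y - e) + G (x - e) (y + e))"

primrec walk2 :: "real \<Rightarrow> (real^'n) list \<Rightarrow> (real^'n \<Rightarrow> real^'n \<Rightarrow> real) \<Rightarrow> real^'n \<Rightarrow> real^'n \<Rightarrow> real" where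
  "walk2 s [] G = G"
| "walk2 s (e # es) G = step s e (walk2 s es G)"

primrec walk :: "(real^'n) list \<Rightarrow> (real^'n \<Rightarrow> real) \<Rightarrow> real^'n \<Rightarrow> real" where
  "walk [] g = g"
| "walk (e # es) g = (\<lambda>x. (walk es g (x + e) + walk es g (x - e)) / 2)"

lemma walk_mono: "(\<And>x. f x \<le> g x) \<Longrightarrow> walk es f x \<le> walk es g x"
  by (induction es arbitrary: x) (auto intro!: divide_right_mono add_mono)

lemma walk_const: "walk es (\<lambda>x. c) x = c"
  by (induction es arbitrary: x) auto

lemma walk_add: "walk es (\<lambda>x. f x + g x) x = walk es f x + walk es g x"
  by (induction es arbitrary: x) (auto simp: field_simps)

lemma walk_cmult: "walk es (\<lambda>x. c * f x) x = c * walk es f x"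
  by (induction es arbitrary: x) (auto simp: field_simps)

lemma walk_nonneg: "(\<And>x. 0 \<le> f x) \<Longrightarrow> 0 \<le> walk es f x"
  using walk_mono[of "\<lambda>_. 0" f es x] by (simp add: walk_const)

lemma walk2_add: "walk2 s es (\<lambda>x y. F x y + G x y) x y = walk2 s es F x y + walk2 s es G x y"
  by (induction es arbitrary: x y) (auto simp: step_def algebra_simps)

lemma walk2_cmult: "walk2 s es (\<lambda>x y. c * F x y) x y = c * walk2 s es F x y"
  by (induction es arbitrary: x y) (auto simp: step_def algebra_simps)

lemma walk2_diag: "walk2 1 es G x x = walk es (\<lambda>x. G x x) x"
  by (induction es arbitrary: x) (auto simp: step_def algebra_simps)

text \<open>The two-point inequality tensorizes: one step of the correlated walk is a bilinear form with
eigenvalues \<open>1\<close> and \<open>s\<close> in the mean and the difference, Cauchy--Schwarz separates the two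
factors, and the two-point inequality bounds each of them.\<close>

lemma walk2_hypercontractive:
  assumes s: "0 \<le> s" "s \<le> 1"
  shows "walk2 s es (\<lambda>x y. g x * h y) x y \<le> (walk es (\<lambda>x. \<bar>g x\<bar> powr (1 + s)) x) powr (1 / (1 + s)) * (walk es (\<lambda>x. \<bar>h x\<bar> powr (1 + s)) y) powr (1 / (1 + s))"
proof (induction es arbitrary: x y)
  case Nil
  have "g x * h y \<le> \<bar>g x\<bar> * \<bar>h y\<bar>" by (metis abs_ge_self abs_mult)
  then show ?case using s by (simp add: powr_powr)
next
  case (Cons e es)
  let ?r = "1 + s"
  let ?G = "\<lambda>x. (walk es (\<lambda>x. \<bar>g x\<bar> powr ?r) x) powr (1 / ?r)"
  let ?H = "\<lambda>x. (walk es (\<lambda>x. \<bar>h x\<bar> powr ?r) x) powr (1 / ?r)"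
  have st: "step s e F x y \<le> step s e G x y" if "\<And>x y. F x y \<le> G x y" for F G :: "real^'a \<Rightarrow> real^'a \<Rightarrow> real"
    unfolding step_def using that s by (intro add_mono mult_left_mono) auto
  have tp: "(a + b)\<^sup>2 / 4 + s * ((a - b)\<^sup>2 / 4) \<le> ((a powr ?r + b powr ?r) / 2) powr (2 / ?r)" if "0 \<le> a" "0 \<le> b" for a b
  proof -
    have "((a + b) / 2)\<^sup>2 + s * ((a - b) / 2)\<^sup>2 \<le> ((\<bar>(a + b) / 2 + (a - b) / 2\<bar> powr ?r + \<bar>(a + b) / 2 - (a - b) / 2\<bar> powr ?r) / 2) powr (2 / ?r)"
      by (rule two_point[OF s])
    moreover have "(a + b) / 2 + (a - b) / 2 = a" "(a + b) / 2 - (a - b) / 2 = b" by (auto simp: field_simps)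
    ultimately show ?thesis using that by (simp add: power_divide)
  qed
  \<comment> \<open>by monotonicity of a step, the remaining steps may be replaced by their bound\<close>
  have "walk2 s (e # es) (\<lambda>x y. g x * h y) x y \<le> step s e (\<lambda>x y. ?G x * ?H y) x y"
    by (simp only: walk2.simps) (rule st[OF Cons.IH])
  also have "\<dots> = (?G (x + e) + ?G (x - e)) / 2 * ((?H (y + e) + ?H (y - e)) / 2) + s * ((?G (x + e) - ?G (x - e)) / 2 * ((?H (y + e) - ?H (y - e)) / 2))"
    by (simp add: step_def field_simps)
  also have "\<dots> \<le> sqrt (((?G (x + e) + ?G (x - e)) / 2)\<^sup>2 + s * ((?G (x + e) - ?G (x - e)) / 2)\<^sup>2) * sqrt (((?H (y + e) + ?H (y - e)) / 2)\<^sup>2 + s * ((?H (y + e) - ?H (y - e)) / 2)\<^sup>2)"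
  proof -
    have cs: "a * c + s * (b * d) \<le> sqrt (a\<^sup>2 + s * b\<^sup>2) * sqrt (c\<^sup>2 + s * d\<^sup>2)" for a b c d :: real
    proof -
      have "(a * c + s * (b * d))\<^sup>2 \<le> (a\<^sup>2 + s * b\<^sup>2) * (c\<^sup>2 + s * d\<^sup>2)"
      proof -
        have "(a\<^sup>2 + s * b\<^sup>2) * (c\<^sup>2 + s * d\<^sup>2) - (a * c + s * (b * d))\<^sup>2 = s * (a * d - b * c)\<^sup>2"
          by (simp add: power2_eq_square algebra_simps)
        moreover have "0 \<le> s * (a * d - b * c)\<^sup>2" using s by simp
        ultimately show ?thesis by linarith
      qed
      then have "\<bar>a * c + s * (b * d)\<bar> \<le> sqrt ((a\<^sup>2 + s * b\<^sup>2) * (c\<^sup>2 + s * d\<^sup>2))"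
        by (simp add: real_le_rsqrt)
      then show ?thesis by (simp add: real_sqrt_mult)
    qed
    show ?thesis by (rule cs)
  qed
  also have "\<dots> \<le> (walk (e # es) (\<lambda>x. \<bar>g x\<bar> powr ?r) x) powr (1 / ?r) * (walk (e # es) (\<lambda>x. \<bar>h x\<bar> powr ?r) y) powr (1 / ?r)"
  proof -
    have q: "sqrt (((F (z + e) powr (1 / ?r) + F (z - e) powr (1 / ?r)) / 2)\<^sup>2 + s * ((F (z + e) powr (1 / ?r) - F (z - e) powr (1 / ?r)) / 2)\<^sup>2) \<le> ((F (z + e) + F (z - e)) / 2) powr (1 / ?r)"
      if F: "\<And>z. 0 \<le> F z" for F :: "real^'a \<Rightarrow> real" and z
    proof -
      let ?a = "F (z + e) powr (1 / ?r)" and ?b = "F (z - e) powr (1 / ?r)"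
      have ab: "?a powr ?r = F (z + e)" "?b powr ?r = F (z - e)" using F s by (auto simp: powr_powr)
      have "((?a + ?b) / 2)\<^sup>2 + s * ((?a - ?b) / 2)\<^sup>2 \<le> ((F (z + e) + F (z - e)) / 2) powr (2 / ?r)"
        using tp[of ?a ?b] unfolding ab by (simp add: power_divide)
      also have "\<dots> = (((F (z + e) + F (z - e)) / 2) powr (1 / ?r))\<^sup>2"
        using F s by (simp add: power2_eq_square powr_add[symmetric])
      finally show ?thesis by (rule real_le_lsqrt[rotated]) auto
    qed
    show ?thesis unfolding walk.simps
      by (rule mult_mono[OF q q]) (use s in \<open>auto intro!: walk_nonneg add_nonneg_nonneg mult_nonneg_nonneg\<close>)
  qed
  finally show ?case .
qed

text \<open>The factor by which a correlated step multiplies a cosine.\<close>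

definition mult2 :: "real \<Rightarrow> real^'n \<Rightarrow> real^'n \<Rightarrow> real^'n \<Rightarrow> real" where
  "mult2 s v w e = (1 + s) / 2 * cos ((v + w) \<bullet> e) + (1 - s) / 2 * cos ((v - w) \<bullet> e)"

lemma walk2_cos: "walk2 s es (\<lambda>x y. cos (v \<bullet> x + w \<bullet> y + d)) x y = (\<Prod>e\<leftarrow>es. mult2 s v w e) * cos (v \<bullet> x + w \<bullet> y + d)"
proof (induction es arbitrary: x y)
  case (Cons e es)
  have c: "cos (A + p) + cos (A - p) = 2 * cos A * cos p" for A p :: real by (simp add: cos_add cos_diff)
  let ?A = "v \<bullet> x + w \<bullet> y + d"
  have h: "v \<bullet> (x + e) + w \<bullet> (y + e) + d = ?A + (v + w) \<bullet> e" "v \<bullet> (x - e) + w \<bullet> (y - e) + d = ?A - (v + w) \<bullet> e"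
    "v \<bullet> (x + e) + w \<bullet> (y - e) + d = ?A + (v - w) \<bullet> e" "v \<bullet> (x - e) + w \<bullet> (y + e) + d = ?A - (v - w) \<bullet> e"
    by (auto simp: inner_add_left inner_add_right inner_diff_left inner_diff_right)
  have "walk2 s (e # es) (\<lambda>x y. cos (v \<bullet> x + w \<bullet> y + d)) x y = (\<Prod>e\<leftarrow>es. mult2 s v w e) *
     ((1 + s) / 4 * (cos (?A + (v + w) \<bullet> e) + cos (?A - (v + w) \<bullet> e)) + (1 - s) / 4 * (cos (?A + (v - w) \<bullet> e) + cos (?A - (v - w) \<bullet> e)))"
    unfolding walk2.simps step_def Cons.IH h by (simp add: algebra_simps)
  also have "\<dots> = (\<Prod>e\<leftarrow>es. mult2 s v w e) * (mult2 s v w e * cos ?A)"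
  proof -
    have gen: "(1 + s) / 4 * (2 * C * p) + (1 - s) / 4 * (2 * C * q) = ((1 + s) / 2 * p + (1 - s) / 2 * q) * C" for p q C
      by (simp add: field_simps)
    show ?thesis unfolding c gen mult2_def ..
  qed
  finally show ?case by simp
qed simp

lemma walk_cos: "walk es (\<lambda>x. cos (v \<bullet> x + d)) x = (\<Prod>e\<leftarrow>es. cos (v \<bullet> e)) * cos (v \<bullet> x + d)"
proof (induction es arbitrary: x)
  case (Cons e es)
  have "cos (v \<bullet> (x + e) + d) + cos (v \<bullet> (x - e) + d) = 2 * cos (v \<bullet> x + d) * cos (v \<bullet> e)"
  proof -
    have h: "v \<bullet> (x + e) + d = (v \<bullet> x + d) + v \<bullet> e" "v \<bullet> (x - e) + d = (v \<bullet> x + d) - v \<bullet> e"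
      by (auto simp: inner_add_right inner_diff_right)
    show ?thesis unfolding h cos_add[of "v \<bullet> x + d"] cos_diff[of "v \<bullet> x + d"] by simp
  qed
  then show ?case by (simp add: Cons.IH distrib_left[symmetric] add_divide_distrib[symmetric])
qed simp

text \<open>\<open>N\<close> steps of length \<open>1 / sqrt N\<close> along each coordinate axis, so that the walk is Gaussian in the limit.\<close>

definition steps :: "nat \<Rightarrow> (real^'n) list" where
  "steps N = concat (map (\<lambda>i. replicate N (axis i (1 / sqrt (real N)))) (SOME xs. set xs = UNIV \<and> distinct xs))"

lemma prod_steps: "(\<Prod>e\<leftarrow>steps N. F e) = (\<Prod>i\<in>UNIV. F (axis i (1 / sqrt (real N)) :: real^'n) ^ N)" for F :: "real^'n \<Rightarrow> real"
proof -
  define xs where "xs = (SOME xs. set xs = (UNIV :: 'n set) \<and> distinct xs)"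
  have xs: "set xs = UNIV" "distinct xs"
    using someI_ex[OF finite_distinct_list[OF finite[of "UNIV :: 'n set"]]] by (auto simp: xs_def)
  have r: "prod_list (map F (replicate N a)) = F a ^ N" for a by (simp add: prod_list_replicate)
  have "(\<Prod>e\<leftarrow>concat (map (\<lambda>i. replicate N (axis i (1 / sqrt (real N)))) ys). F e) = (\<Prod>i\<leftarrow>ys. F (axis i (1 / sqrt (real N))) ^ N)" for ys :: "'n list"
    by (induction ys) (auto simp: r)
  then have "(\<Prod>e\<leftarrow>steps N. F e) = (\<Prod>i\<leftarrow>xs. F (axis i (1 / sqrt (real N))) ^ N)"
    by (simp add: steps_def xs_def)
  also have "\<dots> = (\<Prod>i\<in>UNIV. F (axis i (1 / sqrt (real N))) ^ N)"
    using prod.distinct_set_conv_list[OF xs(2), of "\<lambda>i. F (axis i (1 / sqrt (real N))) ^ N"] xs(1) by simp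
  finally show ?thesis .
qed

text \<open>From \<open>1 - 1 / z \<le> ln z \<le> z - 1\<close>.\<close>

lemma power_tendsto_exp:
  fixes z :: "nat \<Rightarrow> real"
  assumes "(\<lambda>n. real n * (z n - 1)) \<longlonglongrightarrow> L"
  shows "(\<lambda>n. z n ^ n) \<longlonglongrightarrow> exp L"
proof -
  have z1: "z \<longlonglongrightarrow> 1"
  proof -
    have "(\<lambda>n. inverse (real n) * (real n * (z n - 1)) + 1) \<longlonglongrightarrow> 0 * L + 1"
      by (intro tendsto_intros assms lim_inverse_n)
    then have "(\<lambda>n. inverse (real n) * (real n * (z n - 1)) + 1) \<longlonglongrightarrow> 1" by simp
    then show ?thesis
      by (rule Lim_transform_eventually)
        (auto simp: field_simps eventually_sequentially intro!: exI[of _ 1])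
  qed
  then have pos: "\<forall>\<^sub>F n in sequentially. 0 < z n" by (rule order_tendstoD) simp
  have l: "(\<lambda>n. real n * ln (z n)) \<longlonglongrightarrow> L"
  proof (rule tendsto_sandwich[OF _ _ _ assms])
    have "(\<lambda>n. real n * (z n - 1) / z n) \<longlonglongrightarrow> L / 1" by (intro tendsto_divide assms z1) simp
    then show "(\<lambda>n. real n * (z n - 1) / z n) \<longlonglongrightarrow> L" by simp
    show "\<forall>\<^sub>F n in sequentially. real n * (z n - 1) / z n \<le> real n * ln (z n)"
      using pos
    proof eventually_elim
      case (elim n)
      have "ln (inverse (z n)) \<le> inverse (z n) - 1" using elim by (intro ln_le_minus_one) auto
      then have "1 - inverse (z n) \<le> ln (z n)" using elim by (simp add: ln_inverse)
      moreover have "(z n - 1) / z n = 1 - inverse (z n)" using elim by (simp add: field_simps)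
      ultimately have "(z n - 1) / z n \<le> ln (z n)" by (simp only:)
      then show ?case using mult_left_mono[of "(z n - 1) / z n" "ln (z n)" "real n"] by simp
    qed
    show "\<forall>\<^sub>F n in sequentially. real n * ln (z n) \<le> real n * (z n - 1)"
      using pos by eventually_elim (intro mult_left_mono ln_le_minus_one, auto)
  qed
  have "(\<lambda>n. exp (real n * ln (z n))) \<longlonglongrightarrow> exp L" by (intro tendsto_exp l)
  then show ?thesis
    by (rule Lim_transform_eventually) (use pos in eventually_elim, simp add: exp_of_nat_mult)
qed

lemma cos_scaled_limit: "(\<lambda>n. real n * (cos (a * (1 / sqrt (real n))) - 1)) \<longlonglongrightarrow> - a\<^sup>2 / 2"
proof -
  have s: "((\<lambda>x::real. sin x / x) \<longlongrightarrow> 1) (at 0)" using DERIV_sin[of 0] by (simp add: has_field_derivative_iff)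
  show ?thesis
  proof (cases "a = 0")
    case False
    let ?u = "\<lambda>n. a / 2 * (1 / sqrt (real n))"
    have u0: "?u \<longlonglongrightarrow> 0"
    proof -
      have "(\<lambda>n. inverse (sqrt (real n))) \<longlonglongrightarrow> 0"
        by (intro tendsto_inverse_0_at_top filterlim_compose[OF sqrt_at_top] filterlim_real_sequentially)
      from tendsto_mult_right_zero[OF this, of "a / 2"] show ?thesis by (simp add: inverse_eq_divide)
    qed
    have "filterlim ?u (at 0) sequentially"
      unfolding filterlim_at using u0 False by (auto simp: eventually_sequentially intro!: exI[of _ 1])
    then have "(\<lambda>n. sin (?u n) / ?u n) \<longlonglongrightarrow> 1" by (rule filterlim_compose[OF s])
    then have "(\<lambda>n. - a\<^sup>2 / 2 * (sin (?u n) / ?u n)\<^sup>2) \<longlonglongrightarrow> - a\<^sup>2 / 2 * 1\<^sup>2" by (intro tendsto_intros)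
    then have "(\<lambda>n. - a\<^sup>2 / 2 * (sin (?u n) / ?u n)\<^sup>2) \<longlonglongrightarrow> - a\<^sup>2 / 2" by simp
    then show ?thesis
    proof (rule Lim_transform_eventually)
      show "\<forall>\<^sub>F n in sequentially. - a\<^sup>2 / 2 * (sin (?u n) / ?u n)\<^sup>2 = real n * (cos (a * (1 / sqrt (real n))) - 1)"
      proof (rule eventually_sequentiallyI[of 1])
        fix n :: nat assume n: "1 \<le> n"
        have "cos (a * (1 / sqrt (real n))) = cos (2 * ?u n)" by simp
        also have "\<dots> = 1 - 2 * (sin (?u n))\<^sup>2" by (simp only: cos_double_sin)
        finally have "real n * (cos (a * (1 / sqrt (real n))) - 1) = - 2 * real n * (sin (?u n))\<^sup>2" by simp
        moreover have "(?u n)\<^sup>2 = a\<^sup>2 / (4 * real n)" using n by (simp add: power_divide power_mult_distrib)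
        ultimately show "- a\<^sup>2 / 2 * (sin (?u n) / ?u n)\<^sup>2 = real n * (cos (a * (1 / sqrt (real n))) - 1)"
          using n False by (simp only: power_divide) (simp add: field_simps)
      qed
    qed
  qed simp
qed

lemma mult2_limit:
  fixes v w :: "real^'n"
  shows "(\<lambda>N. \<Prod>e\<leftarrow>steps N. mult2 s v w e) \<longlonglongrightarrow> exp (- ((norm v)\<^sup>2 + 2 * s * (v \<bullet> w) + (norm w)\<^sup>2) / 2)"
proof -
  have "(\<lambda>N. mult2 s v w (axis i (1 / sqrt (real N))) ^ N) \<longlonglongrightarrow> exp (- ((v $ i)\<^sup>2 + 2 * s * (v $ i * w $ i) + (w $ i)\<^sup>2) / 2)" for i
  proof (rule power_tendsto_exp)
    have "(\<lambda>N. (1 + s) / 2 * (real N * (cos ((v $ i + w $ i) * (1 / sqrt (real N))) - 1)) + (1 - s) / 2 * (real N * (cos ((v $ i - w $ i) * (1 / sqrt (real N))) - 1)))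
      \<longlonglongrightarrow> (1 + s) / 2 * (- (v $ i + w $ i)\<^sup>2 / 2) + (1 - s) / 2 * (- (v $ i - w $ i)\<^sup>2 / 2)"
      by (intro tendsto_intros cos_scaled_limit)
    also have "(1 + s) / 2 * (- (v $ i + w $ i)\<^sup>2 / 2) + (1 - s) / 2 * (- (v $ i - w $ i)\<^sup>2 / 2) = - ((v $ i)\<^sup>2 + 2 * s * (v $ i * w $ i) + (w $ i)\<^sup>2) / 2"
      by (simp add: power2_eq_square field_simps)
    finally show "(\<lambda>N. real N * (mult2 s v w (axis i (1 / sqrt (real N))) - 1)) \<longlonglongrightarrow> - ((v $ i)\<^sup>2 + 2 * s * (v $ i * w $ i) + (w $ i)\<^sup>2) / 2"
      by (simp add: mult2_def inner_axis field_simps)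
  qed
  then have "(\<lambda>N. \<Prod>i\<in>UNIV. mult2 s v w (axis i (1 / sqrt (real N))) ^ N) \<longlonglongrightarrow> (\<Prod>i\<in>UNIV. exp (- ((v $ i)\<^sup>2 + 2 * s * (v $ i * w $ i) + (w $ i)\<^sup>2) / 2))"
    by (intro tendsto_prod)
  also have "(\<Prod>i\<in>UNIV. exp (- ((v $ i)\<^sup>2 + 2 * s * (v $ i * w $ i) + (w $ i)\<^sup>2) / 2)) = exp (- ((norm v)\<^sup>2 + 2 * s * (v \<bullet> w) + (norm w)\<^sup>2) / 2)"
    unfolding norm_vec_sq inner_vec_def
    by (simp add: exp_sum[symmetric] sum_negf sum.distrib sum_subtractf sum_divide_distrib[symmetric] sum_distrib_left)
  finally show ?thesis unfolding prod_steps .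
qed

text \<open>The central limit theorem for the walk, read off from the characteristic function.\<close>

lemma walk_limit:
  assumes "f \<in> trig"
  shows "(\<lambda>N. walk (steps N) f 0) \<longlonglongrightarrow> (LINT x|gauss. f x)"
  using assms
proof (induction rule: trig.induct)
  case (trig_cos c v d)
  have "(\<Prod>e\<leftarrow>es. cos (v \<bullet> e)) = (\<Prod>e\<leftarrow>es. mult2 1 v 0 e)" for es :: "(real^'a) list" by (simp add: mult2_def)
  then have "(\<lambda>N. \<Prod>e\<leftarrow>steps N. cos (v \<bullet> e)) \<longlonglongrightarrow> exp (- (norm v)\<^sup>2 / 2)" using mult2_limit[of 1 v 0] by simp
  then have "(\<lambda>N. c * ((\<Prod>e\<leftarrow>steps N. cos (v \<bullet> e)) * cos (v \<bullet> 0 + d))) \<longlonglongrightarrow> c * (exp (- (norm v)\<^sup>2 / 2) * cos (v \<bullet> 0 + d))"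
    by (intro tendsto_intros)
  then show ?case by (simp only: walk_cmult walk_cos) (simp add: integral_gauss_cos)
next
  case (trig_add f g)
  then show ?case
    using tendsto_add[OF trig_add.IH] by (simp add: walk_add trig_L2 L2_integrable)
qed

text \<open>Powers of a trigonometric polynomial are approximated uniformly by polynomials in it, which are
again trigonometric polynomials, for which the limit is known.\<close>

lemma walk_powr_limit:
  fixes f :: "real^'n \<Rightarrow> real"
  assumes f: "f \<in> trig" and r: "0 < r"
  shows "(\<lambda>N. walk (steps N) (\<lambda>x. \<bar>f x\<bar> powr r) 0) \<longlonglongrightarrow> (LINT x|gauss. \<bar>f x\<bar> powr r)"
proof (rule LIMSEQ_I)
  fix e :: real assume e: "0 < e"
  obtain B where B: "B \<ge> 0" "\<And>x. \<bar>f x\<bar> \<le> B" using trig_bounded[OF f] by blast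
  have "continuous_on {-B..B} (\<lambda>y. \<bar>y\<bar> powr r)" using r by (intro continuous_on_powr' continuous_intros) auto
  then obtain p where p: "real_polynomial_function p" "\<And>y. y \<in> {-B..B} \<Longrightarrow> \<bar>\<bar>y\<bar> powr r - p y\<bar> < e / 3"
    using Stone_Weierstrass_real_polynomial_function[of "{-B..B}" "\<lambda>y. \<bar>y\<bar> powr r" "e / 3"] e by auto
  have pf: "(\<lambda>x. p (f x)) \<in> trig" by (rule trig_poly_comp[OF p(1) f])
  have close: "\<bar>\<bar>f x\<bar> powr r - p (f x)\<bar> \<le> e / 3" for x
    using p(2)[of "f x"] B(2)[of x] by (simp add: abs_le_iff minus_le_iff)
  then have c1: "\<bar>f x\<bar> powr r \<le> p (f x) + e / 3" and c2: "p (f x) \<le> \<bar>f x\<bar> powr r + e / 3" for x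
    unfolding abs_diff_le_iff by (auto simp: algebra_simps)
  have [measurable]: "f \<in> borel_measurable borel" by (rule trig_meas[OF f])
  have int1: "integrable gauss (\<lambda>x. \<bar>f x\<bar> powr r)"
    using B r by (intro gauss.integrable_const_bound[of _ "B powr r"]) (auto intro!: powr_mono2 simp: measurable_cong_sets[OF sets_gauss refl])
  have int2: "integrable gauss (\<lambda>x. p (f x))" by (rule L2_integrable[OF trig_L2[OF pf]])
  have lower: "a \<le> b" if "\<And>x. F x \<le> G x" "a = (LINT x|gauss. F x)" "b = (LINT x|gauss. G x)" "integrable gauss F" "integrable gauss G" for a b and F G :: "real^'n \<Rightarrow> real"
    using that integral_mono[of gauss F G] by auto
  have i1: "(LINT x|gauss. \<bar>f x\<bar> powr r) \<le> (LINT x|gauss. p (f x)) + e / 3"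
    by (rule lower[of "\<lambda>x. \<bar>f x\<bar> powr r" "\<lambda>x. p (f x) + e / 3"]) (use c1 c2 int1 int2 in auto)
  have i2: "(LINT x|gauss. p (f x)) \<le> (LINT x|gauss. \<bar>f x\<bar> powr r) + e / 3"
    by (rule lower[of "\<lambda>x. p (f x)" "\<lambda>x. \<bar>f x\<bar> powr r + e / 3"]) (use c1 c2 int1 int2 in auto)
  have w1: "walk es (\<lambda>x. \<bar>f x\<bar> powr r) 0 \<le> walk es (\<lambda>x. p (f x)) 0 + e / 3" for es
    using walk_mono[of "\<lambda>x. \<bar>f x\<bar> powr r" "\<lambda>x. p (f x) + e / 3" es 0] c1 c2 by (simp add: walk_add walk_const)
  have w2: "walk es (\<lambda>x. p (f x)) 0 \<le> walk es (\<lambda>x. \<bar>f x\<bar> powr r) 0 + e / 3" for es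
    using walk_mono[of "\<lambda>x. p (f x)" "\<lambda>x. \<bar>f x\<bar> powr r + e / 3" es 0] c1 c2 by (simp add: walk_add walk_const)
  obtain N0 where N0: "\<And>N. N \<ge> N0 \<Longrightarrow> \<bar>walk (steps N) (\<lambda>x. p (f x)) 0 - (LINT x|gauss. p (f x))\<bar> < e / 3"
    using LIMSEQ_D[OF walk_limit[OF pf], of "e / 3"] e by auto
  show "\<exists>no. \<forall>n\<ge>no. norm (walk (steps n) (\<lambda>x. \<bar>f x\<bar> powr r) 0 - (LINT x|gauss. \<bar>f x\<bar> powr r)) < e"
  proof (intro exI[of _ N0] allI impI)
    fix N assume "N0 \<le> N"
    then show "norm (walk (steps N) (\<lambda>x. \<bar>f x\<bar> powr r) 0 - (LINT x|gauss. \<bar>f x\<bar> powr r)) < e"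
      using N0[of N] i1 i2 w1[of "steps N"] w2[of "steps N"] unfolding real_norm_def by linarith
  qed
qed

section \<open>Mehler's formula on trigonometric polynomials\<close>

lemma cos_shift_prod: "cos (d + real m * (pi / 2)) * cos (e + real m * (pi / 2)) = ((- 1) ^ m * cos (d + e) + cos (d - e)) / 2"
proof -
  have "cos (d + e + real m * pi) = (- 1) ^ m * cos (d + e)" by (simp add: cos_add)
  moreover have "cos (d + real m * (pi / 2)) * cos (e + real m * (pi / 2)) = (cos (d - e) + cos (d + e + real m * pi)) / 2"
    unfolding cos_times_cos by (simp add: algebra_simps)
  ultimately show ?thesis by simp
qed

definition inner_level :: "(real^'n \<Rightarrow> real) \<Rightarrow> (real^'n \<Rightarrow> real) \<Rightarrow> nat \<Rightarrow> real" where
  "inner_level f g m = (\<Sum>\<alpha> | mi_size \<alpha> = m. coef f \<alpha> * coef g \<alpha>)"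

lemma inner_level_self: "inner_level f f m = energy f m"
  by (simp add: inner_level_def energy_def power2_eq_square)

lemma inner_level_add_left: "f \<in> L2_gauss \<Longrightarrow> g \<in> L2_gauss \<Longrightarrow> inner_level (\<lambda>x. f x + g x) h m = inner_level f h m + inner_level g h m"
  by (simp add: inner_level_def coef_add distrib_right sum.distrib)

lemma inner_level_add_right: "f \<in> L2_gauss \<Longrightarrow> g \<in> L2_gauss \<Longrightarrow> inner_level h (\<lambda>x. f x + g x) m = inner_level h f m + inner_level h g m"
  by (simp add: inner_level_def coef_add distrib_left sum.distrib)

text \<open>For two cosines the limit of the correlated walk and the sum of the series are both
computed explicitly and agree; bilinearity does the rest. This is Mehler's formula in the form
\<open>E (f X * g Y) = (\<Sum>m. s ^ m * \<langle>f, g\<rangle>\<^sub>m)\<close> for standard Gaussian vectors \<open>X\<close>, \<open>Y\<close> with correlation \<open>s\<close>.\<close>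

lemma bilinear_limit:
  fixes f g :: "real^'n \<Rightarrow> real"
  assumes f: "f \<in> trig" and g: "g \<in> trig"
  shows "\<exists>L. (\<lambda>N. walk2 s (steps N) (\<lambda>x y. f x * g y) 0 0) \<longlonglongrightarrow> L \<and> (\<lambda>m. s ^ m * inner_level f g m) sums L"
  using f
proof (induction rule: trig.induct)
  case (trig_cos c v d)
  show ?case using g
  proof (induction rule: trig.induct)
    case (trig_cos c' w e)
    define L where "L = c * c' / 2 * (exp (- ((norm v)\<^sup>2 + 2 * s * (v \<bullet> w) + (norm w)\<^sup>2) / 2) * cos (d + e)
      + exp (- ((norm v)\<^sup>2 + 2 * s * (v \<bullet> (- w)) + (norm (- w))\<^sup>2) / 2) * cos (d - e))"
    have "(\<lambda>x y. c * cos (v \<bullet> x + d) * (c' * cos (w \<bullet> y + e)))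
        = (\<lambda>x y. c * c' / 2 * (cos (v \<bullet> x + w \<bullet> y + (d + e)) + cos (v \<bullet> x + (- w) \<bullet> y + (d - e))))"
    proof (intro ext)
      fix x y
      have a: "v \<bullet> x + w \<bullet> y + (d + e) = (v \<bullet> x + d) + (w \<bullet> y + e)" "v \<bullet> x + (- w) \<bullet> y + (d - e) = (v \<bullet> x + d) - (w \<bullet> y + e)"
        by (auto simp: inner_minus_left)
      show "c * cos (v \<bullet> x + d) * (c' * cos (w \<bullet> y + e)) = c * c' / 2 * (cos (v \<bullet> x + w \<bullet> y + (d + e)) + cos (v \<bullet> x + (- w) \<bullet> y + (d - e)))"
        unfolding a cos_add[of "v \<bullet> x + d"] cos_diff[of "v \<bullet> x + d"] by (simp add: algebra_simps)
    qed
    then have w: "walk2 s es (\<lambda>x y. c * cos (v \<bullet> x + d) * (c' * cos (w \<bullet> y + e))) 0 0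
       = c * c' / 2 * ((\<Prod>e\<leftarrow>es. mult2 s v w e) * cos (d + e) + (\<Prod>e\<leftarrow>es. mult2 s v (- w) e) * cos (d - e))" for es
      by (simp only: walk2_cmult walk2_add walk2_cos) simp
    have "(\<lambda>N. walk2 s (steps N) (\<lambda>x y. c * cos (v \<bullet> x + d) * (c' * cos (w \<bullet> y + e))) 0 0) \<longlonglongrightarrow> L"
      unfolding w L_def by (intro tendsto_intros mult2_limit)
    moreover have "(\<lambda>m. s ^ m * inner_level (\<lambda>x. c * cos (v \<bullet> x + d)) (\<lambda>x. c' * cos (w \<bullet> x + e)) m) sums L"
    proof -
      \<comment> \<open>the product of two cosines splits into a cosine of the sum and one of the difference; both series are exponential\<close>
      define E where "E = c * c' / 2 * exp (- (norm v)\<^sup>2 / 2) * exp (- (norm w)\<^sup>2 / 2)"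
      have il: "s ^ m * inner_level (\<lambda>x. c * cos (v \<bullet> x + d)) (\<lambda>x. c' * cos (w \<bullet> x + e)) m
        = E * cos (d + e) * ((- (s * (v \<bullet> w))) ^ m / fact m) + E * cos (d - e) * ((s * (v \<bullet> w)) ^ m / fact m)" for m
      proof -
        have "inner_level (\<lambda>x. c * cos (v \<bullet> x + d)) (\<lambda>x. c' * cos (w \<bullet> x + e)) m
          = (\<Sum>\<alpha> | mi_size \<alpha> = m. (2 * E * (cos (d + real m * (pi / 2)) * cos (e + real m * (pi / 2)))) * (\<Prod>i\<in>UNIV. (v $ i * w $ i) ^ \<alpha> i / fact (\<alpha> i)))"
          unfolding inner_level_def
        proof (intro sum.cong refl)
          fix \<alpha> :: "'n \<Rightarrow> nat" assume "\<alpha> \<in> {\<alpha>. mi_size \<alpha> = m}"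
          then have m: "mi_size \<alpha> = m" by simp
          have "(\<Prod>i\<in>UNIV. (v $ i * w $ i) ^ \<alpha> i / fact (\<alpha> i)) = (\<Prod>i\<in>UNIV. (v $ i) ^ \<alpha> i) * (\<Prod>i\<in>UNIV. (w $ i) ^ \<alpha> i) / (nrm \<alpha>)\<^sup>2"
            by (simp add: nrm_sq prod_dividef power_mult_distrib prod.distrib)
          then show "coef (\<lambda>x. c * cos (v \<bullet> x + d)) \<alpha> * coef (\<lambda>x. c' * cos (w \<bullet> x + e)) \<alpha>
            = (2 * E * (cos (d + real m * (pi / 2)) * cos (e + real m * (pi / 2)))) * (\<Prod>i\<in>UNIV. (v $ i * w $ i) ^ \<alpha> i / fact (\<alpha> i))"
            unfolding coef_cos m by (simp add: E_def power2_eq_square)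
        qed
        also have "\<dots> = (2 * E * (cos (d + real m * (pi / 2)) * cos (e + real m * (pi / 2)))) * ((v \<bullet> w) ^ m / fact m)"
          unfolding sum_distrib_left[symmetric] multinomial_sum by (simp add: inner_vec_def)
        finally show ?thesis unfolding cos_shift_prod
          by (simp add: power_mult_distrib power_minus[of "s * (v \<bullet> w)"] algebra_simps add_divide_distrib)
      qed
      have ex: "(\<lambda>m. x ^ m / fact m) sums exp x" for x :: real
        using exp_converges[of x] by (simp add: divide_inverse mult.commute)
      have "(\<lambda>m. s ^ m * inner_level (\<lambda>x. c * cos (v \<bullet> x + d)) (\<lambda>x. c' * cos (w \<bullet> x + e)) m)
        sums (E * cos (d + e) * exp (- (s * (v \<bullet> w))) + E * cos (d - e) * exp (s * (v \<bullet> w)))"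
        unfolding il by (intro sums_add sums_mult ex)
      also have "E * cos (d + e) * exp (- (s * (v \<bullet> w))) + E * cos (d - e) * exp (s * (v \<bullet> w)) = L"
      proof -
        have e1: "exp (- ((norm v)\<^sup>2 + 2 * s * (v \<bullet> w) + (norm w)\<^sup>2) / 2) = exp (- (norm v)\<^sup>2 / 2) * exp (- (norm w)\<^sup>2 / 2) * exp (- (s * (v \<bullet> w)))"
          unfolding exp_add[symmetric] by (rule arg_cong[where f = exp]) (simp add: field_simps)
        have e2: "exp (- ((norm v)\<^sup>2 + 2 * s * (v \<bullet> (- w)) + (norm (- w))\<^sup>2) / 2) = exp (- (norm v)\<^sup>2 / 2) * exp (- (norm w)\<^sup>2 / 2) * exp (s * (v \<bullet> w))"
          unfolding exp_add[symmetric] by (rule arg_cong[where f = exp]) (simp add: field_simps)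
        show ?thesis unfolding L_def e1 e2 E_def by (simp add: algebra_simps)
      qed
      finally show ?thesis .
    qed
    ultimately show ?case by blast
  next
    case (trig_add g h)
    then obtain L L' where L: "(\<lambda>N. walk2 s (steps N) (\<lambda>x y. c * cos (v \<bullet> x + d) * g y) 0 0) \<longlonglongrightarrow> L"
      "(\<lambda>m. s ^ m * inner_level (\<lambda>x. c * cos (v \<bullet> x + d)) g m) sums L"
      "(\<lambda>N. walk2 s (steps N) (\<lambda>x y. c * cos (v \<bullet> x + d) * h y) 0 0) \<longlonglongrightarrow> L'"
      "(\<lambda>m. s ^ m * inner_level (\<lambda>x. c * cos (v \<bullet> x + d)) h m) sums L'" by blast
    show ?case
    proof (intro exI[of _ "L + L'"] conjI)
      show "(\<lambda>N. walk2 s (steps N) (\<lambda>x y. c * cos (v \<bullet> x + d) * (g y + h y)) 0 0) \<longlonglongrightarrow> L + L'"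
        unfolding distrib_left walk2_add by (intro tendsto_add L)
      show "(\<lambda>m. s ^ m * inner_level (\<lambda>x. c * cos (v \<bullet> x + d)) (\<lambda>x. g x + h x) m) sums (L + L')"
        using sums_add[OF L(2,4)] trig_add by (simp add: inner_level_add_right trig_L2 distrib_left)
    qed
  qed
next
  case (trig_add f1 f2)
  then obtain L L' where L: "(\<lambda>N. walk2 s (steps N) (\<lambda>x y. f1 x * g y) 0 0) \<longlonglongrightarrow> L"
    "(\<lambda>m. s ^ m * inner_level f1 g m) sums L"
    "(\<lambda>N. walk2 s (steps N) (\<lambda>x y. f2 x * g y) 0 0) \<longlonglongrightarrow> L'"
    "(\<lambda>m. s ^ m * inner_level f2 g m) sums L'" by blast
  show ?case
  proof (intro exI[of _ "L + L'"] conjI)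
    show "(\<lambda>N. walk2 s (steps N) (\<lambda>x y. (f1 x + f2 x) * g y) 0 0) \<longlonglongrightarrow> L + L'"
      unfolding distrib_right walk2_add by (intro tendsto_add L)
    show "(\<lambda>m. s ^ m * inner_level (\<lambda>x. f1 x + f2 x) g m) sums (L + L')"
      using sums_add[OF L(2,4)] trig_add by (simp add: inner_level_add_left trig_L2 distrib_left)
  qed
qed

lemma trig_hypercontractive:
  assumes f: "f \<in> trig" and s: "0 \<le> s" "s \<le> 1"
  shows "(\<Sum>m<M. s ^ m * energy f m) \<le> (LINT x|gauss. \<bar>f x\<bar> powr (1 + s)) powr (2 / (1 + s))"
proof -
  obtain L where L: "(\<lambda>N. walk2 s (steps N) (\<lambda>x y. f x * f y) 0 0) \<longlonglongrightarrow> L" "(\<lambda>m. s ^ m * inner_level f f m) sums L"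
    using bilinear_limit[OF f f, of s] by blast
  let ?I = "LINT x|gauss. \<bar>f x\<bar> powr (1 + s)"
  have "(\<lambda>N. (walk (steps N) (\<lambda>x. \<bar>f x\<bar> powr (1 + s)) 0) powr (1 / (1 + s)) * (walk (steps N) (\<lambda>x. \<bar>f x\<bar> powr (1 + s)) 0) powr (1 / (1 + s)))
     \<longlonglongrightarrow> ?I powr (1 / (1 + s)) * ?I powr (1 / (1 + s))"
    using s by (intro tendsto_mult tendsto_powr2 walk_powr_limit f tendsto_const) (auto intro!: always_eventually walk_nonneg)
  then have "L \<le> ?I powr (1 / (1 + s)) * ?I powr (1 / (1 + s))"
    by (rule LIMSEQ_le[OF L(1)]) (auto intro!: walk2_hypercontractive s)
  also have "\<dots> = ?I powr (2 / (1 + s))" by (simp add: powr_add[symmetric])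
  finally have "L \<le> ?I powr (2 / (1 + s))" .
  moreover have "(\<Sum>m<M. s ^ m * energy f m) \<le> L"
    using sum_le_suminf[OF sums_summable[OF L(2)], of "{..<M}"] L(2) s
    by (simp add: inner_level_self sums_iff energy_nonneg)
  ultimately show ?thesis by simp
qed

text \<open>At \<open>s = 1\<close> the two walks coincide.\<close>

lemma trig_parseval:
  assumes f: "f \<in> trig"
  shows "energy f sums (LINT x|gauss. (f x)\<^sup>2)"
proof -
  obtain L where L: "(\<lambda>N. walk2 1 (steps N) (\<lambda>x y. f x * f y) 0 0) \<longlonglongrightarrow> L" "(\<lambda>m. 1 ^ m * inner_level f f m) sums L"
    using bilinear_limit[OF f f, of 1] by blast
  have "(\<lambda>N. walk2 1 (steps N) (\<lambda>x y. f x * f y) 0 0) \<longlonglongrightarrow> (LINT x|gauss. f x * f x)"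
    unfolding walk2_diag by (rule walk_limit[OF trig_mult[OF f f]])
  then have "L = (LINT x|gauss. f x * f x)" using L(1) LIMSEQ_unique by blast
  then show ?thesis using L(2) by (simp add: inner_level_self power2_eq_square)
qed

section \<open>Density of the trigonometric polynomials\<close>

definition trig_approx :: "(real^'n \<Rightarrow> real) \<Rightarrow> bool" where
  "trig_approx f \<longleftrightarrow> (\<forall>e>0. \<exists>\<tau>\<in>trig. (LINT x|gauss. (f x - \<tau> x)\<^sup>2) < e)"

lemma sq_diff_le: "((a::real) - c)\<^sup>2 \<le> 2 * (a - b)\<^sup>2 + 2 * (b - c)\<^sup>2"
proof -
  have "2 * (a - b)\<^sup>2 + 2 * (b - c)\<^sup>2 - (a - c)\<^sup>2 = ((a - b) - (b - c))\<^sup>2" by (simp add: power2_eq_square algebra_simps)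
  then show ?thesis by (metis diff_ge_0_iff_ge zero_le_power2)
qed

lemma trig_approx_limit:
  assumes f: "f \<in> L2_gauss" and F: "\<And>n. F n \<in> L2_gauss" "\<And>n. trig_approx (F n)"
    and lim: "(\<lambda>n. LINT x|gauss. (f x - F n x)\<^sup>2) \<longlonglongrightarrow> 0"
  shows "trig_approx f"
  unfolding trig_approx_def
proof (intro allI impI)
  fix e :: real assume e: "0 < e"
  obtain n where n: "(LINT x|gauss. (f x - F n x)\<^sup>2) < e / 4"
    using order_tendstoD(2)[OF lim, of "e / 4"] e by (auto simp: eventually_sequentially)
  obtain \<tau> where \<tau>: "\<tau> \<in> trig" "(LINT x|gauss. (F n x - \<tau> x)\<^sup>2) < e / 4" using F(2)[of n] e unfolding trig_approx_def by (meson divide_pos_pos zero_less_numeral)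
  have "(LINT x|gauss. (f x - \<tau> x)\<^sup>2) \<le> (LINT x|gauss. 2 * (f x - F n x)\<^sup>2 + 2 * (F n x - \<tau> x)\<^sup>2)"
    using f F(1)[of n] trig_L2[OF \<tau>(1)]
    by (intro integral_mono sq_diff_le Bochner_Integration.integrable_add integrable_mult_right L2_sq L2_diff)
  also have "\<dots> = 2 * (LINT x|gauss. (f x - F n x)\<^sup>2) + 2 * (LINT x|gauss. (F n x - \<tau> x)\<^sup>2)"
    using L2_sq[OF L2_diff[OF f F(1)[of n]]] L2_sq[OF L2_diff[OF F(1)[of n] trig_L2[OF \<tau>(1)]]] by simp
  also have "\<dots> < e" using n \<tau>(2) by simp
  finally show "\<exists>\<tau>\<in>trig. (LINT x|gauss. (f x - \<tau> x)\<^sup>2) < e" using \<tau>(1) by blast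
qed

lemma bounded_limit_L2:
  fixes f :: "real^'n \<Rightarrow> real"
  assumes [measurable]: "f \<in> borel_measurable borel" "\<And>n. F n \<in> borel_measurable borel"
    and B: "\<And>x. \<bar>f x\<bar> \<le> B" "\<And>n x. \<bar>F n x\<bar> \<le> B"
    and lim: "AE x in gauss. (\<lambda>n. F n x) \<longlonglongrightarrow> f x"
  shows "(\<lambda>n. LINT x|gauss. (f x - F n x)\<^sup>2) \<longlonglongrightarrow> 0"
proof -
  have "(\<lambda>n. LINT x|gauss. (f x - F n x)\<^sup>2) \<longlonglongrightarrow> (LINT x|(gauss::(real^'n) measure). 0)"
  proof (rule integral_dominated_convergence[where w = "\<lambda>_. (2 * B)\<^sup>2"])
    show "AE x in gauss. (\<lambda>n. (f x - F n x)\<^sup>2) \<longlonglongrightarrow> 0"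
      using lim
    proof eventually_elim
      case (elim x)
      have "(\<lambda>n. (f x - F n x)\<^sup>2) \<longlonglongrightarrow> (f x - f x)\<^sup>2" by (intro tendsto_intros elim)
      then show ?case by simp
    qed
    show "AE x in gauss. norm ((f x - F n x)\<^sup>2) \<le> (2 * B)\<^sup>2" for n
    proof (rule AE_I2)
      fix x
      have "\<bar>f x - F n x\<bar> \<le> 2 * B" using abs_triangle_ineq4[of "f x" "F n x"] B(1)[of x] B(2)[of n x] by linarith
      then have "\<bar>f x - F n x\<bar> ^ 2 \<le> (2 * B)\<^sup>2" by (intro power_mono) auto
      then show "norm ((f x - F n x)\<^sup>2) \<le> (2 * B)\<^sup>2" by simp
    qed
  qed (auto simp: measurable_cong_sets[OF sets_gauss refl])
  then show ?thesis by simp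
qed

lemma trig_sin_poly:
  assumes p: "real_polynomial_function (p :: real^'n \<Rightarrow> real)"
  shows "(\<lambda>x. p (\<chi> i. sin (c * x $ i))) \<in> trig"
  using p
proof (induction p rule: real_polynomial_function.induct)
  case (linear h)
  have "h (\<chi> i. sin (c * x $ i)) = (\<Sum>i\<in>UNIV. h (axis i 1) * sin ((c *\<^sub>R axis i 1) \<bullet> x))" for x
  proof -
    have "(\<chi> i. sin (c * x $ i)) = (\<Sum>i\<in>UNIV. sin (c * x $ i) *\<^sub>R axis i 1)"
      by (simp add: vec_eq_iff axis_def if_distrib[of "\<lambda>t. _ * t"] cong: if_cong)
    then have "h (\<chi> i. sin (c * x $ i)) = (\<Sum>i\<in>UNIV. sin (c * x $ i) *\<^sub>R h (axis i 1))"
      using linear by (simp add: linear_sum[OF bounded_linear.linear] linear_scale[OF bounded_linear.linear])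
    then show ?thesis by (simp add: inner_axis' mult.commute)
  qed
  then show ?case by (simp only:) (intro trig_sum trig_cmult trig_sin finite)
qed (auto intro: trig_const trig_add trig_mult)

text \<open>On the large cube where \<open>|x $ i| < L\<close>, \<open>x $ i = L * arcsin (sin (x $ i / L))\<close> exhibits \<open>g\<close> as a
continuous function of sines, which Weierstrass approximates uniformly by polynomials in these sines. Outside
the cube the approximation stays bounded, hence is harmless in \<open>L\<^sup>2\<close> as \<open>L\<close> grows.\<close>

lemma trig_approx_continuous:
  fixes g :: "real^'n \<Rightarrow> real"
  assumes g: "continuous_on UNIV g" and B: "\<And>x. \<bar>g x\<bar> \<le> B"
  shows "trig_approx g"
proof -
  let ?L = "\<lambda>n. real (Suc n)"
  have "\<exists>\<tau>\<in>trig. \<forall>x. \<bar>\<tau> x - g (\<chi> i. ?L n * arcsin (sin (x $ i / ?L n)))\<bar> < 1 / ?L n" for n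
  proof -
    let ?G = "\<lambda>s::real^'n. g (\<chi> i. ?L n * arcsin (s $ i))"
    let ?C = "cbox (\<chi> i. -1) (\<chi> i. 1) :: (real^'n) set"
    have "continuous_on ?C ?G"
      by (rule continuous_on_compose2[OF g]) (auto simp: mem_box_cart intro!: continuous_intros continuous_on_vec_lambda)
    then obtain p where p: "real_polynomial_function p" "\<And>s. s \<in> ?C \<Longrightarrow> \<bar>?G s - p s\<bar> < 1 / ?L n"
      using Stone_Weierstrass_real_polynomial_function[of ?C ?G "1 / ?L n"] by auto
    have "\<bar>p (\<chi> i. sin (1 / ?L n * x $ i)) - g (\<chi> i. ?L n * arcsin (sin (x $ i / ?L n)))\<bar> < 1 / ?L n" for x
      using p(2)[of "\<chi> i. sin (1 / ?L n * x $ i)"] by (simp add: mem_box_cart abs_minus_commute)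
    then show ?thesis by (intro bexI[OF _ trig_sin_poly[OF p(1), of "1 / ?L n"]] allI)
  qed
  then have "\<forall>n. \<exists>\<tau>. \<tau> \<in> trig \<and> (\<forall>x. \<bar>\<tau> x - g (\<chi> i. ?L n * arcsin (sin (x $ i / ?L n)))\<bar> < 1 / ?L n)" by blast
  from choice[OF this] obtain \<tau> where \<tau>: "\<And>n. \<tau> n \<in> trig" "\<And>n x. \<bar>\<tau> n x - g (\<chi> i. ?L n * arcsin (sin (x $ i / ?L n)))\<bar> < 1 / ?L n" by blast
  have self: "trig_approx (\<tau> n)" for n unfolding trig_approx_def using \<tau>(1)[of n] by (intro allI impI bexI[of _ "\<tau> n"]) auto
  show ?thesis
  proof (rule trig_approx_limit[OF _ _ self])
    show "g \<in> L2_gauss" by (rule L2_bounded[OF borel_measurable_continuous_onI[OF g] B])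
    show "\<tau> n \<in> L2_gauss" for n by (rule trig_L2[OF \<tau>(1)])
    show "(\<lambda>n. LINT x|gauss. (g x - \<tau> n x)\<^sup>2) \<longlonglongrightarrow> 0"
    proof (rule bounded_limit_L2[where B = "B + 1"])
      show "\<bar>g x\<bar> \<le> B + 1" for x using B[of x] by linarith
      show "\<bar>\<tau> n x\<bar> \<le> B + 1" for n x
      proof -
        have "1 / ?L n \<le> 1" by simp
        then show ?thesis using \<tau>(2)[of n x] B[of "\<chi> i. ?L n * arcsin (sin (x $ i / ?L n))"] by linarith
      qed
      show "AE x in gauss. (\<lambda>n. \<tau> n x) \<longlonglongrightarrow> g x"
      proof (rule AE_I2)
        fix x :: "real^'n"
        obtain N where N: "norm x < real N" using reals_Archimedean2 by blast
        have near: "\<bar>\<tau> n x - g x\<bar> < 1 / ?L n" if n: "n \<ge> N" for n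
        proof -
          have "?L n * arcsin (sin (x $ i / ?L n)) = x $ i" for i
          proof -
            have "\<bar>x $ i\<bar> < ?L n" using component_le_norm_cart[of x i] N n by linarith
            then have "\<bar>x $ i / ?L n\<bar> < 1" by (simp add: abs_divide)
            moreover have "1 < pi / 2" using pi_gt3 by simp
            ultimately have "\<bar>x $ i / ?L n\<bar> < pi / 2" by linarith
            moreover have "arcsin (sin t) = t" if "\<bar>t\<bar> < pi / 2" for t :: real
              using that by (intro arcsin_sin) auto
            ultimately have "arcsin (sin (x $ i / ?L n)) = x $ i / ?L n" by blast
            then show ?thesis by (simp del: of_nat_Suc)
          qed
          then have "(\<chi> i. ?L n * arcsin (sin (x $ i / ?L n))) = x" by (simp add: vec_eq_iff)
          then show ?thesis using \<tau>(2)[of n x] by simp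
        qed
        have "(\<lambda>n. \<tau> n x - g x) \<longlonglongrightarrow> 0"
        proof (rule tendsto_0_le[where K = 1])
          show "(\<lambda>n. 1 / ?L n) \<longlonglongrightarrow> 0" using LIMSEQ_inverse_real_of_nat by (simp add: inverse_eq_divide)
          show "\<forall>\<^sub>F n in sequentially. norm (\<tau> n x - g x) \<le> norm (1 / ?L n) * 1"
            using near by (intro eventually_sequentiallyI[of N]) (simp add: less_imp_le)
        qed
        then show "(\<lambda>n. \<tau> n x) \<longlonglongrightarrow> g x" by (simp add: LIM_zero_iff)
      qed
    qed (use borel_measurable_continuous_onI[OF g] trig_meas[OF \<tau>(1)] in auto)
  qed
qed

lemma trig_approx_bounded:
  fixes f :: "real^'n \<Rightarrow> real"
  assumes f: "f \<in> borel_measurable borel" and B: "\<And>x. \<bar>f x\<bar> \<le> B"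
  shows "trig_approx f"
proof -
  have B0: "B \<ge> 0" using B[of 0] by linarith
  have "f \<in> borel_measurable lebesgue" using f by (intro measurable_completion) simp
  then have "f measurable_on UNIV" by (intro lebesgue_measurable_imp_measurable_on) auto
  then obtain N g where N: "negligible N" and g: "\<And>n. continuous_on UNIV (g n)" "\<And>x. x \<notin> N \<Longrightarrow> (\<lambda>n. g n x) \<longlonglongrightarrow> f x"
    unfolding measurable_on_def by auto
  let ?F = "\<lambda>n x. max (- B) (min B (g n x))"
  have cF: "continuous_on UNIV (?F n)" for n using g(1) by (intro continuous_intros) auto
  have bF: "\<bar>?F n x\<bar> \<le> B" for n x using B0 by auto
  have "AE x in lebesgue. x \<notin> N" using N by (simp add: negligible_iff_null_sets AE_not_in)
  then have "AE x in lborel. x \<notin> N" by (simp add: AE_completion_iff)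
  then have AEN: "AE x in gauss. x \<notin> N" by (rule AE_gauss_lborel)
  show ?thesis
  proof (rule trig_approx_limit[OF L2_bounded[OF f B] _ trig_approx_continuous[OF cF bF]])
    show "?F n \<in> L2_gauss" for n by (rule L2_bounded[OF borel_measurable_continuous_onI[OF cF] bF])
    show "(\<lambda>n. LINT x|gauss. (f x - ?F n x)\<^sup>2) \<longlonglongrightarrow> 0"
    proof (rule bounded_limit_L2[OF f borel_measurable_continuous_onI[OF cF] B bF])
      show "AE x in gauss. (\<lambda>n. ?F n x) \<longlonglongrightarrow> f x"
        using AEN
      proof eventually_elim
        case (elim x)
        have "(\<lambda>n. ?F n x) \<longlonglongrightarrow> max (- B) (min B (f x))" by (intro tendsto_intros g elim)
        moreover have "max (- B) (min B (f x)) = f x" using B[of x] by auto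
        ultimately show ?case by simp
      qed
    qed
  qed
qed

lemma trig_dense:
  fixes f :: "real^'n \<Rightarrow> real"
  assumes f: "f \<in> L2_gauss"
  shows "trig_approx f"
proof -
  note [measurable] = L2_meas[OF f]
  let ?F = "\<lambda>n x. if \<bar>f x\<bar> \<le> real n then f x else 0"
  have m: "?F n \<in> borel_measurable borel" for n by measurable
  have b: "\<bar>?F n x\<bar> \<le> real n" for n x by auto
  show ?thesis
  proof (rule trig_approx_limit[OF f L2_bounded[OF m b] trig_approx_bounded[OF m b]])
    have "(\<lambda>n. LINT x|gauss. (f x - ?F n x)\<^sup>2) \<longlonglongrightarrow> (LINT x|(gauss::(real^'n) measure). 0)"
    proof (rule integral_dominated_convergence[where w = "\<lambda>x. (f x)\<^sup>2"])
      show "integrable gauss (\<lambda>x. (f x)\<^sup>2)" by (rule L2_sq[OF f])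
      show "AE x in gauss. (\<lambda>n. (f x - ?F n x)\<^sup>2) \<longlonglongrightarrow> 0"
      proof (rule AE_I2)
        fix x
        obtain N where N: "\<bar>f x\<bar> \<le> real N" using real_arch_simple by blast
        have "\<forall>\<^sub>F n in sequentially. (f x - ?F n x)\<^sup>2 = 0"
          using N by (intro eventually_sequentiallyI[of N]) (auto intro: order_trans)
        then show "(\<lambda>n. (f x - ?F n x)\<^sup>2) \<longlonglongrightarrow> 0" by (rule tendsto_eventually)
      qed
      show "AE x in gauss. norm ((f x - ?F n x)\<^sup>2) \<le> (f x)\<^sup>2" for n by (rule AE_I2) auto
    qed (auto simp: measurable_cong_sets[OF sets_gauss refl])
    then show "(\<lambda>n. LINT x|gauss. (f x - ?F n x)\<^sup>2) \<longlonglongrightarrow> 0" by simp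
  qed
qed

lemma trig_sequence:
  assumes "f \<in> L2_gauss"
  obtains \<tau> where "\<And>j. \<tau> j \<in> trig" "(\<lambda>j. LINT x|gauss. (f x - \<tau> j x)\<^sup>2) \<longlonglongrightarrow> 0"
proof -
  have "\<forall>j. \<exists>\<tau>. \<tau> \<in> trig \<and> (LINT x|gauss. (f x - \<tau> x)\<^sup>2) < inverse (real (Suc j))"
  proof
    fix j
    have "0 < inverse (real (Suc j))" by simp
    with trig_dense[OF assms] show "\<exists>\<tau>. \<tau> \<in> trig \<and> (LINT x|gauss. (f x - \<tau> x)\<^sup>2) < inverse (real (Suc j))"
      unfolding trig_approx_def by blast
  qed
  from choice[OF this] obtain \<tau> where \<tau>: "\<And>j. \<tau> j \<in> trig" "\<And>j. (LINT x|gauss. (f x - \<tau> j x)\<^sup>2) < inverse (real (Suc j))" by blast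
  have "(\<lambda>j. LINT x|gauss. (f x - \<tau> j x)\<^sup>2) \<longlonglongrightarrow> 0"
  proof (rule tendsto_sandwich[OF _ _ tendsto_const LIMSEQ_inverse_real_of_nat])
    show "\<forall>\<^sub>F j in sequentially. (LINT x|gauss. (f x - \<tau> j x)\<^sup>2) \<le> inverse (real (Suc j))"
      by (intro always_eventually allI less_imp_le \<tau>(2))
  qed simp
  then show ?thesis using that \<tau>(1) by blast
qed

section \<open>Hypercontractivity and the Parseval identity\<close>

lemma coef_sq_le:
  assumes "h \<in> L2_gauss" shows "(coef h \<alpha>)\<^sup>2 \<le> (LINT x|gauss. (h x)\<^sup>2)"
proof -
  have "(LINT x|gauss. h x * Herm \<alpha> x)\<^sup>2 \<le> (LINT x|gauss. (h x)\<^sup>2) * (LINT x|gauss. (Herm \<alpha> x)\<^sup>2)"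
    by (rule cauchy_schwarz_gauss[OF assms Herm_L2])
  also have "(LINT x|gauss. (Herm \<alpha> x)\<^sup>2) = (nrm \<alpha>)\<^sup>2" using Herm_orthogonal[of \<alpha> \<alpha>] by (simp add: power2_eq_square)
  finally show ?thesis using nrm_pos[of \<alpha>] by (simp add: coef_def power_divide pos_divide_le_eq)
qed

lemma coef_tendsto:
  assumes f: "f \<in> L2_gauss" and F: "\<And>j. F j \<in> L2_gauss" and lim: "(\<lambda>j. LINT x|gauss. (f x - F j x)\<^sup>2) \<longlonglongrightarrow> 0"
  shows "(\<lambda>j. coef (F j) \<alpha>) \<longlonglongrightarrow> coef f \<alpha>"
proof -
  have "(\<lambda>j. sqrt (LINT x|gauss. (f x - F j x)\<^sup>2)) \<longlonglongrightarrow> sqrt 0" by (intro tendsto_real_sqrt lim)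
  then have s: "(\<lambda>j. sqrt (LINT x|gauss. (f x - F j x)\<^sup>2)) \<longlonglongrightarrow> 0" by simp
  have "(\<lambda>j. coef (F j) \<alpha> - coef f \<alpha>) \<longlonglongrightarrow> 0"
  proof (rule tendsto_0_le[where K = 1, OF s], intro always_eventually allI)
    fix j
    have "(coef (F j) \<alpha> - coef f \<alpha>)\<^sup>2 = (coef (\<lambda>x. f x - F j x) \<alpha>)\<^sup>2"
      using coef_diff[OF f F[of j], of \<alpha>] by (simp add: power2_commute)
    also have "\<dots> \<le> (LINT x|gauss. (f x - F j x)\<^sup>2)" by (intro coef_sq_le L2_diff f F)
    finally have "\<bar>coef (F j) \<alpha> - coef f \<alpha>\<bar> \<le> sqrt (LINT x|gauss. (f x - F j x)\<^sup>2)" by (rule real_le_rsqrt[of "\<bar>_\<bar>", simplified])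
    then show "norm (coef (F j) \<alpha> - coef f \<alpha>) \<le> norm (sqrt (LINT x|gauss. (f x - F j x)\<^sup>2)) * 1" by simp
  qed
  then show ?thesis by (simp add: LIM_zero_iff)
qed

lemma energy_tendsto:
  assumes f: "f \<in> L2_gauss" and F: "\<And>j. F j \<in> L2_gauss" and lim: "(\<lambda>j. LINT x|gauss. (f x - F j x)\<^sup>2) \<longlonglongrightarrow> 0"
  shows "(\<lambda>j. energy (F j) m) \<longlonglongrightarrow> energy f m"
  unfolding energy_def by (intro tendsto_sum tendsto_power coef_tendsto[OF f F lim])

lemma powr_add_le:
  assumes "0 \<le> a" "0 \<le> b" "0 < r" "r \<le> (1::real)"
  shows "(a + b) powr r \<le> a powr r + b powr r"
proof (cases "a + b = 0")
  case False
  then have ab: "a + b > 0" using assms by simp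
  define u where "u = a / (a + b)"
  have u: "0 \<le> u" "u \<le> 1" "a = (a + b) * u" "b = (a + b) * (1 - u)" using ab assms by (auto simp: u_def field_simps)
  have le: "t \<le> t powr r" if "0 \<le> t" "t \<le> 1" for t
    using powr_mono'[of r 1 t] that assms by simp
  have "(a + b) powr r * 1 \<le> (a + b) powr r * (u powr r + (1 - u) powr r)"
    using le[of u] le[of "1 - u"] u by (intro mult_left_mono) auto
  also have "\<dots> = ((a + b) * u) powr r + ((a + b) * (1 - u)) powr r"
    using powr_mult[of "a + b" u r] powr_mult[of "a + b" "1 - u" r] ab u(1,2) by (simp add: distrib_left)
  finally show ?thesis using u by simp
qed (use assms in auto)

text \<open>Continuity of \<open>u powr \<rho>\<close> in a form that can be integrated: the error is small in \<open>L\<^sup>1\<close> when \<open>b\<close> is bounded and \<open>b - a\<close> is small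
in \<open>L\<^sup>2\<close>, after choosing \<open>\<epsilon>\<close>, then \<open>\<eta>\<close>.\<close>

lemma powr_perturb:
  fixes a b \<epsilon> \<eta> \<rho> :: real
  assumes "0 < \<epsilon>" "0 < \<eta>" "0 < \<rho>" "\<rho> \<le> 1"
  shows "\<bar>a\<bar> powr (2 * \<rho>) \<le> \<bar>b\<bar> powr (2 * \<rho>) + \<epsilon> powr \<rho> + \<epsilon> powr (\<rho> - 1) * (\<eta> * b\<^sup>2 + (1 + 1 / \<eta>) * (b - a)\<^sup>2)"
proof -
  define t where "t = \<eta> * b\<^sup>2 + (1 + 1 / \<eta>) * (b - a)\<^sup>2"
  have t: "0 \<le> t" using assms by (simp add: t_def)
  have "a\<^sup>2 \<le> b\<^sup>2 + t"
  proof -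
    have "0 \<le> (\<eta> * b + (b - a))\<^sup>2 / \<eta>" using assms by simp
    also have "\<dots> = \<eta> * b\<^sup>2 + 2 * b * (b - a) + (b - a)\<^sup>2 / \<eta>"
      using assms by (simp add: power2_eq_square field_simps)
    finally have "- (2 * b * (b - a)) \<le> \<eta> * b\<^sup>2 + (b - a)\<^sup>2 / \<eta>" by simp
    moreover have "a\<^sup>2 = b\<^sup>2 - 2 * b * (b - a) + (b - a)\<^sup>2" by (simp add: power2_eq_square algebra_simps)
    ultimately show ?thesis unfolding t_def by (simp add: distrib_right)
  qed
  have sq: "\<bar>x\<bar> powr (2 * \<rho>) = (x\<^sup>2) powr \<rho>" for x :: real
  proof -
    have "\<bar>x\<bar> powr (2 * \<rho>) = (\<bar>x\<bar> powr 2) powr \<rho>" by (simp only: powr_powr)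
    also have "\<bar>x\<bar> powr 2 = x\<^sup>2" by simp
    finally show ?thesis .
  qed
  have "(a\<^sup>2) powr \<rho> \<le> (b\<^sup>2 + t) powr \<rho>" using \<open>a\<^sup>2 \<le> b\<^sup>2 + t\<close> assms by (intro powr_mono2) auto
  also have "\<dots> \<le> (b\<^sup>2) powr \<rho> + t powr \<rho>" using t assms by (intro powr_add_le) auto
  also have "t powr \<rho> \<le> \<epsilon> powr \<rho> + \<epsilon> powr (\<rho> - 1) * t"
  proof (cases "t \<le> \<epsilon>")
    case True
    then have "t powr \<rho> \<le> \<epsilon> powr \<rho>" using t assms by (intro powr_mono2) auto
    moreover have "0 \<le> \<epsilon> powr (\<rho> - 1) * t" using t by simp
    ultimately show ?thesis by linarith
  next
    case False
    have "t powr \<rho> = t powr (\<rho> - 1) * t" using False assms by (simp add: powr_diff)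
    also have "\<dots> \<le> \<epsilon> powr (\<rho> - 1) * t" using False assms t by (intro mult_right_mono powr_mono2') auto
    finally show ?thesis by (simp add: add_increasing)
  qed
  finally show ?thesis unfolding sq t_def by simp
qed

lemma powr_le_sq: "1 \<le> r \<Longrightarrow> r \<le> 2 \<Longrightarrow> \<bar>x\<bar> powr r \<le> 1 + (x::real)\<^sup>2"
proof (cases "\<bar>x\<bar> \<le> 1")
  case True
  assume "1 \<le> r" "r \<le> 2"
  then have "\<bar>x\<bar> powr r \<le> 1" using True powr_mono2[of r "\<bar>x\<bar>" 1] by simp
  then show ?thesis by (simp add: add_increasing2)
next
  case False
  assume "1 \<le> r" "r \<le> 2"
  then have "\<bar>x\<bar> powr r \<le> \<bar>x\<bar> powr 2" using False by (intro powr_mono) auto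
  also have "\<dots> = x\<^sup>2" using False by (simp add: powr_numeral)
  finally show ?thesis by simp
qed

lemma L2_powr_integrable:
  assumes f: "f \<in> L2_gauss" and r: "1 \<le> r" "r \<le> 2"
  shows "integrable gauss (\<lambda>x. \<bar>f x\<bar> powr r)"
proof (rule Bochner_Integration.integrable_bound)
  show "integrable gauss (\<lambda>x. 1 + (f x)\<^sup>2)" using L2_sq[OF f] by simp
  show "(\<lambda>x. \<bar>f x\<bar> powr r) \<in> borel_measurable gauss" using L2_meas[OF f] by (simp add: measurable_cong_sets[OF sets_gauss refl])
  show "AE x in gauss. norm (\<bar>f x\<bar> powr r) \<le> norm (1 + (f x)\<^sup>2)" using powr_le_sq[OF r] by (intro AE_I2) simp
qed

text \<open>Gaussian hypercontractivity from exponent \<open>1 + s\<close> to exponent \<open>2\<close>, since \<open>s ^ m * energy f m\<close> is the energy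
of the Ornstein--Uhlenbeck operator with parameter \<open>sqrt s\<close>. It passes from trigonometric
polynomials to their \<open>L\<^sup>2\<close> limits because both sides are continuous.\<close>

lemma hypercontractive:
  fixes f :: "real^'n \<Rightarrow> real"
  assumes f: "f \<in> L2_gauss" and s: "0 \<le> s" "s \<le> 1"
  shows "(\<Sum>m<M. s ^ m * energy f m) \<le> (LINT x|gauss. \<bar>f x\<bar> powr (1 + s)) powr (2 / (1 + s))"
proof -
  obtain \<tau> where \<tau>: "\<And>j. \<tau> j \<in> trig" "(\<lambda>j. LINT x|gauss. (f x - \<tau> j x)\<^sup>2) \<longlonglongrightarrow> 0"
    using trig_sequence[OF f] by blast
  have L2: "\<tau> j \<in> L2_gauss" for j by (rule trig_L2[OF \<tau>(1)])
  define \<rho> where "\<rho> = (1 + s) / 2"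
  have \<rho>: "0 < \<rho>" "\<rho> \<le> 1" "2 * \<rho> = 1 + s" using s by (auto simp: \<rho>_def)
  let ?I = "LINT x|gauss. \<bar>f x\<bar> powr (1 + s)"
  let ?S = "LINT x|gauss. (f x)\<^sup>2"
  let ?E = "\<Sum>m<M. s ^ m * energy f m"
  have S0: "0 \<le> ?S" by simp
  have I0: "0 \<le> ?I" by simp
  have step: "?E \<le> (?I + e) powr (2 / (1 + s))" if e: "e > 0" for e
  proof -
    \<comment> \<open>each of the three error terms is made at most \<open>e / 3\<close>\<close>
    define \<epsilon> where "\<epsilon> = (e / 3) powr (1 / \<rho>)"
    have \<epsilon>: "\<epsilon> > 0" "\<epsilon> powr \<rho> = e / 3" using e \<rho> by (auto simp: \<epsilon>_def powr_powr)
    define K where "K = \<epsilon> powr (\<rho> - 1)"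
    have K: "K > 0" using \<epsilon> by (simp add: K_def)
    define \<eta> where "\<eta> = e / (3 * (K * (?S + 1)))"
    have \<eta>: "\<eta> > 0" using e K S0 by (simp add: \<eta>_def add_nonneg_pos)
    have \<eta>S: "K * (\<eta> * ?S) \<le> e / 3"
    proof -
      have "K * (\<eta> * ?S) \<le> K * (\<eta> * (?S + 1))" using K \<eta> by (intro mult_left_mono) auto
      also have "\<dots> = e / 3" using K S0 by (simp add: \<eta>_def add_nonneg_eq_0_iff)
      finally show ?thesis .
    qed
    define c where "c = K * (1 + 1 / \<eta>)"
    have c: "c > 0" using K \<eta> by (simp add: c_def add_pos_pos)
    have ev: "\<forall>\<^sub>F j in sequentially. (\<Sum>m<M. s ^ m * energy (\<tau> j) m) \<le> (?I + e) powr (2 / (1 + s))"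
    proof -
      have "\<forall>\<^sub>F j in sequentially. (LINT x|gauss. (f x - \<tau> j x)\<^sup>2) < e / (3 * c)"
        using order_tendstoD(2)[OF \<tau>(2), of "e / (3 * c)"] e c by simp
      then show ?thesis
      proof eventually_elim
        case (elim j)
        have int: "integrable gauss (\<lambda>x. \<bar>\<tau> j x\<bar> powr (1 + s))" "integrable gauss (\<lambda>x. \<bar>f x\<bar> powr (1 + s))"
          using s by (auto intro!: L2_powr_integrable L2 f)
        note sq = L2_sq[OF f] L2_sq[OF L2_diff[OF f L2[of j]]]
        have "(LINT x|gauss. \<bar>\<tau> j x\<bar> powr (1 + s)) \<le> (LINT x|gauss. \<bar>f x\<bar> powr (1 + s) + e / 3 + K * (\<eta> * (f x)\<^sup>2 + (1 + 1 / \<eta>) * (f x - \<tau> j x)\<^sup>2))"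
          using int sq powr_perturb[OF \<epsilon>(1) \<eta> \<rho>(1,2)] unfolding \<rho>(3) \<epsilon>(2) K_def[symmetric]
          by (intro integral_mono) auto
        also have "\<dots> = ?I + e / 3 + K * (\<eta> * ?S + (1 + 1 / \<eta>) * (LINT x|gauss. (f x - \<tau> j x)\<^sup>2))"
          using int sq by simp
        also have "\<dots> = ?I + e / 3 + K * (\<eta> * ?S) + c * (LINT x|gauss. (f x - \<tau> j x)\<^sup>2)"
          by (simp add: c_def algebra_simps)
        also have "\<dots> \<le> ?I + e / 3 + e / 3 + e / 3"
        proof -
          have "c * (LINT x|gauss. (f x - \<tau> j x)\<^sup>2) \<le> c * (e / (3 * c))" using elim c by (intro mult_left_mono) auto
          also have "\<dots> = e / 3" using c by simp
          finally show ?thesis using \<eta>S by linarith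
        qed
        finally have le: "(LINT x|gauss. \<bar>\<tau> j x\<bar> powr (1 + s)) \<le> ?I + e" by simp
        have "(\<Sum>m<M. s ^ m * energy (\<tau> j) m) \<le> (LINT x|gauss. \<bar>\<tau> j x\<bar> powr (1 + s)) powr (2 / (1 + s))"
          by (rule trig_hypercontractive[OF \<tau>(1) s])
        also have "\<dots> \<le> (?I + e) powr (2 / (1 + s))" using le s by (intro powr_mono2) auto
        finally show ?case .
      qed
    qed
    have "(\<lambda>j. \<Sum>m<M. s ^ m * energy (\<tau> j) m) \<longlonglongrightarrow> ?E"
      by (intro tendsto_sum tendsto_mult tendsto_const energy_tendsto[OF f L2 \<tau>(2)])
    then show ?thesis by (rule tendsto_upperbound[OF _ ev]) simp
  qed
  have "((\<lambda>e. (?I + e) powr (2 / (1 + s))) \<longlongrightarrow> (?I + 0) powr (2 / (1 + s))) (at_right 0)"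
    using s by (intro tendsto_powr2 tendsto_intros) (auto simp: eventually_at_right_field intro!: exI[of _ 1] add_nonneg_nonneg I0)
  then have "?E \<le> (?I + 0) powr (2 / (1 + s))"
    by (rule tendsto_lowerbound) (auto simp: eventually_at_right_field intro!: exI[of _ 1] step)
  then show ?thesis by simp
qed

text \<open>The case \<open>s = 1\<close> of hypercontractivity.\<close>

lemma bessel:
  assumes f: "f \<in> L2_gauss"
  shows "(\<Sum>m<M. energy f m) \<le> (LINT x|gauss. (f x)\<^sup>2)"
  using hypercontractive[OF f, of 1 M] by (simp add: powr_numeral)

lemma energy_le: "f \<in> L2_gauss \<Longrightarrow> energy f m \<le> (LINT x|gauss. (f x)\<^sup>2)"
proof -
  assume "f \<in> L2_gauss"
  then have "(\<Sum>i<m. energy f i) + energy f m \<le> (LINT x|gauss. (f x)\<^sup>2)" using bessel[of f "Suc m"] by simp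
  moreover have "0 \<le> (\<Sum>i<m. energy f i)" by (intro sum_nonneg energy_nonneg)
  ultimately show ?thesis by linarith
qed

lemma summable_energy: "f \<in> L2_gauss \<Longrightarrow> summable (energy f)"
  by (rule summableI_nonneg_bounded[OF energy_nonneg bessel])

lemma suminf_energy_le: "f \<in> L2_gauss \<Longrightarrow> suminf (energy f) \<le> (LINT x|gauss. (f x)\<^sup>2)"
  using bessel[of f] by (intro suminf_le_const summable_energy) auto

lemma sq_add_weighted: "0 < \<eta> \<Longrightarrow> (a + b)\<^sup>2 \<le> (1 + \<eta>) * a\<^sup>2 + (1 + 1 / \<eta>) * (b::real)\<^sup>2"
proof -
  assume \<eta>: "0 < \<eta>"
  have "0 \<le> (\<eta> * a - b)\<^sup>2 / \<eta>" using \<eta> by simp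
  also have "\<dots> = (1 + \<eta>) * a\<^sup>2 + (1 + 1 / \<eta>) * b\<^sup>2 - (a + b)\<^sup>2"
    using \<eta> by (simp add: power2_eq_square field_simps)
  finally show ?thesis by simp
qed

text \<open>Bessel's inequality holds for all of \<open>L\<^sup>2\<close> and Parseval's identity on a dense subset; expanding around
an approximation \<open>\<tau> j\<close> with weights \<open>1 + \<eta>\<close> gives the missing inequality.\<close>

lemma parseval:
  fixes f :: "real^'n \<Rightarrow> real"
  assumes f: "f \<in> L2_gauss"
  shows "energy f sums (LINT x|gauss. (f x)\<^sup>2)"
proof -
  let ?S = "LINT x|gauss. (f x)\<^sup>2" and ?E = "suminf (energy f)"
  have E0: "0 \<le> ?E" by (intro suminf_nonneg summable_energy f energy_nonneg)
  obtain \<tau> where \<tau>: "\<And>j. \<tau> j \<in> trig" "(\<lambda>j. LINT x|gauss. (f x - \<tau> j x)\<^sup>2) \<longlonglongrightarrow> 0"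
    using trig_sequence[OF f] by blast
  have L2: "\<tau> j \<in> L2_gauss" for j by (rule trig_L2[OF \<tau>(1)])
  have bound: "?S \<le> (1 + \<eta>) * ((1 + \<eta>) * ?E)" if \<eta>: "\<eta> > 0" for \<eta>
  proof -
    let ?K = "1 + 1 / \<eta>"
    have K: "0 \<le> ?K" using \<eta> by simp
    have le: "?S \<le> (1 + \<eta>) * ((1 + \<eta>) * ?E + ?K * d) + ?K * d" if d: "d = (LINT x|gauss. (f x - \<tau> j x)\<^sup>2)" for j d
    proof -
      note dL = L2_diff[OF f L2[of j]] L2_diff[OF L2[of j] f]
      have pw: "(f x)\<^sup>2 \<le> (1 + \<eta>) * (\<tau> j x)\<^sup>2 + ?K * (f x - \<tau> j x)\<^sup>2" for x
        using sq_add_weighted[OF \<eta>, of "\<tau> j x" "f x - \<tau> j x"] by simp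
      have "?S \<le> (LINT x|gauss. (1 + \<eta>) * (\<tau> j x)\<^sup>2 + ?K * (f x - \<tau> j x)\<^sup>2)"
        using pw L2_sq[OF f] L2_sq[OF L2[of j]] L2_sq[OF dL(1)]
        by (intro integral_mono Bochner_Integration.integrable_add integrable_mult_right) auto
      also have "\<dots> = (1 + \<eta>) * (LINT x|gauss. (\<tau> j x)\<^sup>2) + ?K * d"
        using L2_sq[OF L2[of j]] L2_sq[OF dL(1)] by (simp add: d)
      also have "(LINT x|gauss. (\<tau> j x)\<^sup>2) = suminf (energy (\<tau> j))"
        using trig_parseval[OF \<tau>(1)] by (simp add: sums_iff)
      also have "suminf (energy (\<tau> j)) \<le> (\<Sum>m. (1 + \<eta>) * energy f m + ?K * energy (\<lambda>x. \<tau> j x - f x) m)"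
      proof (intro suminf_le summable_energy L2 summable_add summable_mult f dL)
        fix m
        have "(coef (\<tau> j) \<alpha>)\<^sup>2 \<le> (1 + \<eta>) * (coef f \<alpha>)\<^sup>2 + ?K * (coef (\<lambda>x. \<tau> j x - f x) \<alpha>)\<^sup>2" for \<alpha>
          using sq_add_weighted[OF \<eta>, of "coef f \<alpha>" "coef (\<lambda>x. \<tau> j x - f x) \<alpha>"] coef_diff[OF L2[of j] f, of \<alpha>] by simp
        then show "energy (\<tau> j) m \<le> (1 + \<eta>) * energy f m + ?K * energy (\<lambda>x. \<tau> j x - f x) m"
          unfolding energy_def sum_distrib_left sum.distrib[symmetric] by (intro sum_mono)
      qed
      also have "\<dots> = (1 + \<eta>) * ?E + ?K * suminf (energy (\<lambda>x. \<tau> j x - f x))"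
        by (simp add: suminf_add[symmetric] suminf_mult summable_mult summable_energy f dL)
      also have "suminf (energy (\<lambda>x. \<tau> j x - f x)) \<le> d"
        using suminf_energy_le[OF dL(2)] by (simp add: d power2_commute)
      finally show ?thesis using \<eta> K by (simp add: mult_left_mono)
    qed
    have "(\<lambda>j. (1 + \<eta>) * ((1 + \<eta>) * ?E + ?K * (LINT x|gauss. (f x - \<tau> j x)\<^sup>2)) + ?K * (LINT x|gauss. (f x - \<tau> j x)\<^sup>2))
      \<longlonglongrightarrow> (1 + \<eta>) * ((1 + \<eta>) * ?E + ?K * 0) + ?K * 0"
      by (intro tendsto_intros \<tau>(2))
    then have "?S \<le> (1 + \<eta>) * ((1 + \<eta>) * ?E + ?K * 0) + ?K * 0"
      by (rule LIMSEQ_le_const) (use le in blast)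
    then show ?thesis by simp
  qed
  have "((\<lambda>\<eta>. (1 + \<eta>) * ((1 + \<eta>) * ?E)) \<longlongrightarrow> (1 + 0) * ((1 + 0) * ?E)) (at_right 0)"
    by (intro tendsto_intros)
  then have "?S \<le> (1 + 0) * ((1 + 0) * ?E)"
    by (rule tendsto_lowerbound) (auto simp: eventually_at_right_field intro!: exI[of _ 1] bound)
  then have "?E = ?S" using suminf_energy_le[OF f] by simp
  then show ?thesis using summable_energy[OF f] by (simp add: sums_iff)
qed

lemma parseval_inner:
  assumes f: "f \<in> L2_gauss" and g: "g \<in> L2_gauss"
  shows "inner_level f g sums (LINT x|gauss. f x * g x)"
proof -
  have "(\<lambda>m. (energy (\<lambda>x. f x + g x) m - energy (\<lambda>x. f x - g x) m) / 4) sums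
     (((LINT x|gauss. (f x + g x)\<^sup>2) - (LINT x|gauss. (f x - g x)\<^sup>2)) / 4)"
    by (intro sums_divide sums_diff parseval L2_add L2_diff f g)
  also have "(\<lambda>m. (energy (\<lambda>x. f x + g x) m - energy (\<lambda>x. f x - g x) m) / 4) = inner_level f g"
  proof
    fix m
    have "energy (\<lambda>x. f x + g x) m - energy (\<lambda>x. f x - g x) m = (\<Sum>\<alpha> | mi_size \<alpha> = m. 4 * (coef f \<alpha> * coef g \<alpha>))"
      unfolding energy_def sum_subtractf[symmetric]
      by (intro sum.cong refl) (simp add: coef_add[OF f g] coef_diff[OF f g] power2_eq_square algebra_simps)
    then show "(energy (\<lambda>x. f x + g x) m - energy (\<lambda>x. f x - g x) m) / 4 = inner_level f g m"
      by (simp add: inner_level_def sum_distrib_left[symmetric])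
  qed
  also have "((LINT x|gauss. (f x + g x)\<^sup>2) - (LINT x|gauss. (f x - g x)\<^sup>2)) / 4 = (LINT x|gauss. f x * g x)"
  proof -
    have "(LINT x|gauss. (f x + g x)\<^sup>2) - (LINT x|gauss. (f x - g x)\<^sup>2) = (LINT x|gauss. (f x + g x)\<^sup>2 - (f x - g x)\<^sup>2)"
      by (intro Bochner_Integration.integral_diff[symmetric] L2_sq L2_add L2_diff f g)
    also have "\<dots> = (LINT x|gauss. 4 * (f x * g x))"
      by (intro Bochner_Integration.integral_cong refl) (simp add: power2_eq_square algebra_simps)
    finally show ?thesis by simp
  qed
  finally show ?thesis .
qed

section \<open>The Ornstein--Uhlenbeck semigroup\<close>

text \<open>The Ornstein--Uhlenbeck semigroup at time \<open>- ln r\<close>, given by Mehler's integral.\<close>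

definition OU :: "real \<Rightarrow> (real^'n \<Rightarrow> real) \<Rightarrow> real^'n \<Rightarrow> real" where
  "OU r f x = (LINT y|gauss. f (r *\<^sub>R x + sqrt (1 - r\<^sup>2) *\<^sub>R y))"

lemma OU_coeffs: "0 \<le> r \<Longrightarrow> r < 1 \<Longrightarrow> r\<^sup>2 + (sqrt (1 - r\<^sup>2))\<^sup>2 = 1 \<and> 0 < sqrt (1 - r\<^sup>2)"
  by (simp add: power_le_one power_less_one_iff abs_square_less_1)

lemma OU_measurable:
  assumes [measurable]: "f \<in> borel_measurable borel"
  shows "OU r f \<in> borel_measurable borel"
proof -
  have "OU r f \<in> borel_measurable gauss"
    unfolding OU_def[abs_def]
    by (rule gauss.borel_measurable_lebesgue_integral) measurable
  then show ?thesis by (simp add: measurable_cong_sets[OF sets_gauss refl])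
qed

text \<open>The Gaussian measure is invariant under the semigroup, by rotation invariance.\<close>

lemma OU_nonneg_facts:
  fixes f :: "real^'n \<Rightarrow> real"
  assumes r: "0 \<le> r" "r < 1" and f[measurable]: "f \<in> borel_measurable borel" and pos: "\<And>x. 0 \<le> f x"
    and int: "integrable gauss f"
  shows "AE x in gauss. integrable gauss (\<lambda>y. f (r *\<^sub>R x + sqrt (1 - r\<^sup>2) *\<^sub>R y))"
    "integrable gauss (OU r f)" "(LINT x|gauss. OU r f x) = (LINT x|gauss. f x)"
proof -
  let ?s = "sqrt (1 - r\<^sup>2)"
  note rs = OU_coeffs[OF r]
  have [measurable]: "(\<lambda>x. \<integral>\<^sup>+ y. ennreal (f (r *\<^sub>R x + ?s *\<^sub>R y)) \<partial>gauss) \<in> borel_measurable gauss"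
    by (rule gauss.borel_measurable_nn_integral) measurable
  have rot: "(\<integral>\<^sup>+ x. (\<integral>\<^sup>+ y. ennreal (f (r *\<^sub>R x + ?s *\<^sub>R y)) \<partial>gauss) \<partial>gauss) = (\<integral>\<^sup>+ x. ennreal (f x) \<partial>gauss)"
    using rs by (intro nn_integral_gauss_rotate) auto
  have eqI: "(\<integral>\<^sup>+ x. ennreal (f x) \<partial>gauss) = ennreal (LINT x|gauss. f x)"
    using int pos by (intro nn_integral_eq_integral) auto
  have "AE x in gauss. (\<integral>\<^sup>+ y. ennreal (f (r *\<^sub>R x + ?s *\<^sub>R y)) \<partial>gauss) \<noteq> \<infinity>"
    by (rule nn_integral_PInf_AE) (auto simp: rot eqI)
  then show ae: "AE x in gauss. integrable gauss (\<lambda>y. f (r *\<^sub>R x + ?s *\<^sub>R y))"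
  proof eventually_elim
    case (elim x)
    show ?case
      by (rule integrableI_nonneg) (use elim pos in \<open>auto simp: measurable_cong_sets[OF sets_gauss refl] less_top\<close>)
  qed
  have OUm: "OU r f \<in> borel_measurable gauss" using OU_measurable[OF f, of r] by (simp add: measurable_cong_sets[OF sets_gauss refl])
  have OUpos: "0 \<le> OU r f x" for x unfolding OU_def using pos by simp
  have "(\<integral>\<^sup>+ x. ennreal (OU r f x) \<partial>gauss) = (\<integral>\<^sup>+ x. (\<integral>\<^sup>+ y. ennreal (f (r *\<^sub>R x + ?s *\<^sub>R y)) \<partial>gauss) \<partial>gauss)"
  proof (rule nn_integral_cong_AE)
    show "AE x in gauss. ennreal (OU r f x) = (\<integral>\<^sup>+ y. ennreal (f (r *\<^sub>R x + ?s *\<^sub>R y)) \<partial>gauss)"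
      using ae
    proof eventually_elim
      case (elim x)
      show ?case unfolding OU_def using elim pos by (intro nn_integral_eq_integral[symmetric]) auto
    qed
  qed
  then have nn: "(\<integral>\<^sup>+ x. ennreal (OU r f x) \<partial>gauss) = ennreal (LINT x|gauss. f x)" unfolding rot eqI .
  show i: "integrable gauss (OU r f)"
    by (rule integrableI_nonneg[OF OUm]) (auto simp: nn OUpos)
  have "ennreal (LINT x|gauss. OU r f x) = ennreal (LINT x|gauss. f x)"
    using nn_integral_eq_integral[OF i] OUpos nn by simp
  then show "(LINT x|gauss. OU r f x) = (LINT x|gauss. f x)"
    using OUpos pos by (subst (asm) ennreal_inj) (auto intro!: integral_nonneg_AE)
qed

lemma OU_integrable_AE:
  fixes f :: "real^'n \<Rightarrow> real"
  assumes r: "0 \<le> r" "r < 1" and f[measurable]: "f \<in> borel_measurable borel" and int: "integrable gauss f"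
  shows "AE x in gauss. integrable gauss (\<lambda>y. f (r *\<^sub>R x + sqrt (1 - r\<^sup>2) *\<^sub>R y))"
proof -
  have "AE x in gauss. integrable gauss (\<lambda>y. \<bar>f (r *\<^sub>R x + sqrt (1 - r\<^sup>2) *\<^sub>R y)\<bar>)"
    using int by (intro OU_nonneg_facts(1)[OF r, of "\<lambda>x. \<bar>f x\<bar>"]) auto
  then show ?thesis
  proof eventually_elim
    case (elim x)
    then show ?case
      by (rule Bochner_Integration.integrable_bound) (auto simp: measurable_cong_sets[OF sets_gauss refl])
  qed
qed

text \<open>By integrating the tangent inequality at the mean of \<open>\<bar>g\<bar>\<close>.\<close>

lemma jensen_abs_powr:
  fixes g :: "real^'n \<Rightarrow> real"
  assumes q: "1 \<le> q" and g: "integrable gauss g" "integrable gauss (\<lambda>x. \<bar>g x\<bar> powr q)"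
  shows "\<bar>LINT x|gauss. g x\<bar> powr q \<le> (LINT x|gauss. \<bar>g x\<bar> powr q)"
proof -
  define c where "c = (LINT x|gauss. \<bar>g x\<bar>)"
  have le: "\<bar>LINT x|gauss. g x\<bar> \<le> c" unfolding c_def by (rule integral_abs_bound)
  show ?thesis
  proof (cases "c = 0")
    case True
    then show ?thesis using le by simp
  next
    case False
    then have c: "c > 0" using le by (simp add: order.strict_iff_order)
    have "c powr q = (LINT x|gauss. c powr q + q * c powr (q - 1) * (\<bar>g x\<bar> - c))"
      using g by (simp add: c_def)
    also have "\<dots> \<le> (LINT x|gauss. \<bar>g x\<bar> powr q)"
      using g powr_ge_tangent[OF q c] by (intro integral_mono) auto
    finally have "c powr q \<le> (LINT x|gauss. \<bar>g x\<bar> powr q)" .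
    moreover have "\<bar>LINT x|gauss. g x\<bar> powr q \<le> c powr q" using le q by (intro powr_mono2) auto
    ultimately show ?thesis by linarith
  qed
qed

lemma OU_powr_le:
  fixes f :: "real^'n \<Rightarrow> real"
  assumes r: "0 \<le> r" "r < 1" and f: "f \<in> L2_gauss" and q: "1 \<le> q" "q \<le> 2"
  shows "AE x in gauss. \<bar>OU r f x\<bar> powr q \<le> OU r (\<lambda>x. \<bar>f x\<bar> powr q) x"
proof -
  note [measurable] = L2_meas[OF f]
  have "AE x in gauss. integrable gauss (\<lambda>y. f (r *\<^sub>R x + sqrt (1 - r\<^sup>2) *\<^sub>R y))"
    by (rule OU_integrable_AE[OF r]) (auto intro: L2_integrable f)
  moreover have "AE x in gauss. integrable gauss (\<lambda>y. \<bar>f (r *\<^sub>R x + sqrt (1 - r\<^sup>2) *\<^sub>R y)\<bar> powr q)"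
    using OU_integrable_AE[OF r, of "\<lambda>x. \<bar>f x\<bar> powr q"] L2_powr_integrable[OF f q] by simp
  ultimately show ?thesis
    by eventually_elim (unfold OU_def, rule jensen_abs_powr[OF q(1)])
qed

lemma OU_Lq:
  fixes f :: "real^'n \<Rightarrow> real"
  assumes r: "0 \<le> r" "r < 1" and f: "f \<in> L2_gauss" and q: "1 \<le> q" "q \<le> 2"
  shows "integrable gauss (\<lambda>x. \<bar>OU r f x\<bar> powr q)" "(LINT x|gauss. \<bar>OU r f x\<bar> powr q) \<le> (LINT x|gauss. \<bar>f x\<bar> powr q)"
proof -
  note [measurable] = L2_meas[OF f]
  have F: "integrable gauss (OU r (\<lambda>x. \<bar>f x\<bar> powr q))" "(LINT x|gauss. OU r (\<lambda>x. \<bar>f x\<bar> powr q) x) = (LINT x|gauss. \<bar>f x\<bar> powr q)"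
    using OU_nonneg_facts(2,3)[OF r, of "\<lambda>x. \<bar>f x\<bar> powr q"] L2_powr_integrable[OF f q] by auto
  have m: "OU r f \<in> borel_measurable borel" by (rule OU_measurable) measurable
  show i: "integrable gauss (\<lambda>x. \<bar>OU r f x\<bar> powr q)"
  proof (rule Bochner_Integration.integrable_bound[OF F(1)])
    show "(\<lambda>x. \<bar>OU r f x\<bar> powr q) \<in> borel_measurable gauss" using m by (simp add: measurable_cong_sets[OF sets_gauss refl])
    show "AE x in gauss. norm (\<bar>OU r f x\<bar> powr q) \<le> norm (OU r (\<lambda>x. \<bar>f x\<bar> powr q) x)"
      using OU_powr_le[OF r f q] by eventually_elim auto
  qed
  show "(LINT x|gauss. \<bar>OU r f x\<bar> powr q) \<le> (LINT x|gauss. \<bar>f x\<bar> powr q)"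
    unfolding F(2)[symmetric] by (rule integral_mono_AE[OF i F(1) OU_powr_le[OF r f q]])
qed

lemma OU_L2:
  fixes f :: "real^'n \<Rightarrow> real"
  assumes r: "0 \<le> r" "r < 1" and f: "f \<in> L2_gauss"
  shows "OU r f \<in> L2_gauss" "(LINT x|gauss. (OU r f x)\<^sup>2) \<le> (LINT x|gauss. (f x)\<^sup>2)"
proof -
  have sq: "\<bar>x\<bar> powr 2 = x\<^sup>2" for x :: real by simp
  show "OU r f \<in> L2_gauss"
    using OU_Lq(1)[OF r f, of 2] OU_measurable[OF L2_meas[OF f], of r] unfolding sq by (intro L2I) auto
  show "(LINT x|gauss. (OU r f x)\<^sup>2) \<le> (LINT x|gauss. (f x)\<^sup>2)"
    using OU_Lq(2)[OF r f, of 2] unfolding sq by simp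
qed

lemma OU_diff:
  fixes f g :: "real^'n \<Rightarrow> real"
  assumes r: "0 \<le> r" "r < 1" and f: "f \<in> L2_gauss" and g: "g \<in> L2_gauss"
  shows "AE x in gauss. OU r (\<lambda>x. f x - g x) x = OU r f x - OU r g x"
proof -
  have "AE x in gauss. integrable gauss (\<lambda>y. f (r *\<^sub>R x + sqrt (1 - r\<^sup>2) *\<^sub>R y))"
    by (rule OU_integrable_AE[OF r L2_meas[OF f] L2_integrable[OF f]])
  moreover have "AE x in gauss. integrable gauss (\<lambda>y. g (r *\<^sub>R x + sqrt (1 - r\<^sup>2) *\<^sub>R y))"
    by (rule OU_integrable_AE[OF r L2_meas[OF g] L2_integrable[OF g]])
  ultimately show ?thesis by eventually_elim (simp add: OU_def)
qed

lemma OU_trig: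
  assumes r: "0 \<le> r" "r < 1" and f: "f \<in> trig"
  shows "OU r f \<in> trig \<and> (\<forall>\<alpha>. coef (OU r f) \<alpha> = r ^ mi_size \<alpha> * coef f \<alpha>)"
  using f
proof (induction rule: trig.induct)
  case (trig_cos c v d)
  let ?s = "sqrt (1 - r\<^sup>2)"
  note rs = OU_coeffs[OF r]
  have E: "OU r (\<lambda>x. c * cos (v \<bullet> x + d)) = (\<lambda>x. (c * exp (- (norm (?s *\<^sub>R v))\<^sup>2 / 2)) * cos ((r *\<^sub>R v) \<bullet> x + d))"
  proof
    fix x
    have "v \<bullet> (r *\<^sub>R x + ?s *\<^sub>R y) + d = (?s *\<^sub>R v) \<bullet> y + ((r *\<^sub>R v) \<bullet> x + d)" for y
      by (simp add: inner_add_right)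
    then have "OU r (\<lambda>x. c * cos (v \<bullet> x + d)) x = (LINT y|gauss. c * cos ((?s *\<^sub>R v) \<bullet> y + ((r *\<^sub>R v) \<bullet> x + d)))"
      unfolding OU_def by (simp only:)
    then show "OU r (\<lambda>x. c * cos (v \<bullet> x + d)) x = (c * exp (- (norm (?s *\<^sub>R v))\<^sup>2 / 2)) * cos ((r *\<^sub>R v) \<bullet> x + d)"
      by (simp only: integral_mult_right_zero integral_gauss_cos mult.assoc)
  qed
  have "coef (OU r (\<lambda>x. c * cos (v \<bullet> x + d))) \<alpha> = r ^ mi_size \<alpha> * coef (\<lambda>x. c * cos (v \<bullet> x + d)) \<alpha>" for \<alpha>
  proof -
    have "exp (- (norm (?s *\<^sub>R v))\<^sup>2 / 2) * exp (- (norm (r *\<^sub>R v))\<^sup>2 / 2) = exp (- (norm v)\<^sup>2 / 2)"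
    proof -
      have "(norm (?s *\<^sub>R v))\<^sup>2 + (norm (r *\<^sub>R v))\<^sup>2 = (r\<^sup>2 + ?s\<^sup>2) * (norm v)\<^sup>2"
        by (simp add: power_mult_distrib algebra_simps del: real_sqrt_pow2)
      then have "(norm (?s *\<^sub>R v))\<^sup>2 + (norm (r *\<^sub>R v))\<^sup>2 = (norm v)\<^sup>2" using rs by simp
      moreover have "- A / 2 + - B / 2 = - C / 2" if "A + B = C" for A B C :: real using that by linarith
      ultimately show ?thesis unfolding exp_add[symmetric] by (intro arg_cong[where f = exp]) blast
    qed
    moreover have "(\<Prod>i\<in>UNIV. ((r *\<^sub>R v) $ i) ^ \<alpha> i) = r ^ mi_size \<alpha> * (\<Prod>i\<in>UNIV. (v $ i) ^ \<alpha> i)"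
      by (simp add: power_mult_distrib prod.distrib power_sum mi_size_def)
    ultimately show ?thesis unfolding E coef_cos by (simp add: ac_simps)
  qed
  moreover have "OU r (\<lambda>x. c * cos (v \<bullet> x + d)) \<in> trig" unfolding E by (rule trig.trig_cos)
  ultimately show ?case by blast
next
  case (trig_add f g)
  have int: "integrable gauss (\<lambda>y. h (r *\<^sub>R x + sqrt (1 - r\<^sup>2) *\<^sub>R y))" if h: "h \<in> trig" for h x
  proof -
    obtain B where "\<And>x. \<bar>h x\<bar> \<le> B" using trig_bounded[OF h] by blast
    then show ?thesis using trig_meas[OF h]
      by (intro gauss.integrable_const_bound[of _ B]) (auto simp: measurable_cong_sets[OF sets_gauss refl])
  qed
  have E: "OU r (\<lambda>x. f x + g x) = (\<lambda>x. OU r f x + OU r g x)"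
    unfolding OU_def[abs_def] by (intro ext Bochner_Integration.integral_add int trig_add)
  have "coef (\<lambda>x. OU r f x + OU r g x) \<alpha> = r ^ mi_size \<alpha> * coef (\<lambda>x. f x + g x) \<alpha>" for \<alpha>
    using trig_add.IH coef_add[OF trig_L2 trig_L2, of "OU r f" "OU r g" \<alpha>]
      coef_add[OF trig_L2[OF trig_add.hyps(1)] trig_L2[OF trig_add.hyps(2)], of \<alpha>] by (simp add: distrib_left)
  moreover have "(\<lambda>x. OU r f x + OU r g x) \<in> trig"
    using trig_add.IH by (intro trig.trig_add) auto
  ultimately show ?case unfolding E by blast
qed

text \<open>By density, since the operator is a contraction of \<open>L\<^sup>2\<close> and the claim is explicit for cosines.\<close>

lemma coef_OU:
  fixes f :: "real^'n \<Rightarrow> real"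
  assumes r: "0 \<le> r" "r < 1" and f: "f \<in> L2_gauss"
  shows "coef (OU r f) \<alpha> = r ^ mi_size \<alpha> * coef f \<alpha>"
proof -
  obtain \<tau> where \<tau>: "\<And>j. \<tau> j \<in> trig" "(\<lambda>j. LINT x|gauss. (f x - \<tau> j x)\<^sup>2) \<longlonglongrightarrow> 0"
    using trig_sequence[OF f] by blast
  have L2: "\<tau> j \<in> L2_gauss" for j by (rule trig_L2[OF \<tau>(1)])
  have OU2: "OU r f \<in> L2_gauss" "\<And>j. OU r (\<tau> j) \<in> L2_gauss" using OU_L2(1)[OF r] f L2 by auto
  have "(\<lambda>j. LINT x|gauss. (OU r f x - OU r (\<tau> j) x)\<^sup>2) \<longlonglongrightarrow> 0"
  proof (rule tendsto_sandwich[OF _ _ tendsto_const \<tau>(2)]; intro always_eventually allI)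
    fix j
    note [measurable] = L2_meas[OF OU2(1)] L2_meas[OF OU2(2)[of j]] L2_meas[OF OU_L2(1)[OF r L2_diff[OF f L2[of j]]]]
    have "(LINT x|gauss. (OU r f x - OU r (\<tau> j) x)\<^sup>2) = (LINT x|gauss. (OU r (\<lambda>x. f x - \<tau> j x) x)\<^sup>2)"
      using OU_diff[OF r f L2[of j]] by (intro integral_cong_AE) (auto simp: measurable_cong_sets[OF sets_gauss refl])
    also have "\<dots> \<le> (LINT x|gauss. (f x - \<tau> j x)\<^sup>2)" by (rule OU_L2(2)[OF r L2_diff[OF f L2]])
    finally show "(LINT x|gauss. (OU r f x - OU r (\<tau> j) x)\<^sup>2) \<le> (LINT x|gauss. (f x - \<tau> j x)\<^sup>2)" .
  qed simp
  from coef_tendsto[OF OU2 this] have "(\<lambda>j. r ^ mi_size \<alpha> * coef (\<tau> j) \<alpha>) \<longlonglongrightarrow> coef (OU r f) \<alpha>"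
    using OU_trig[OF r \<tau>(1)] by simp
  moreover have "(\<lambda>j. r ^ mi_size \<alpha> * coef (\<tau> j) \<alpha>) \<longlonglongrightarrow> r ^ mi_size \<alpha> * coef f \<alpha>"
    by (intro tendsto_intros coef_tendsto[OF f L2 \<tau>(2)])
  ultimately show ?thesis by (rule LIMSEQ_unique)
qed

lemma energy_OU:
  assumes r: "0 \<le> r" "r < 1" and f: "f \<in> L2_gauss"
  shows "energy (OU r f) m = (r\<^sup>2) ^ m * energy f m" "inner_level f (OU r f) m = r ^ m * energy f m"
proof -
  show "energy (OU r f) m = (r\<^sup>2) ^ m * energy f m"
    unfolding energy_def sum_distrib_left
    by (intro sum.cong refl) (auto simp: coef_OU[OF r f] power_mult_distrib power_mult[symmetric] mult.commute)
  show "inner_level f (OU r f) m = r ^ m * energy f m"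
    unfolding inner_level_def energy_def sum_distrib_left
    by (intro sum.cong refl) (auto simp: coef_OU[OF r f] power2_eq_square)
qed

lemma OU_form:
  assumes r: "0 \<le> r" "r < 1" and f: "f \<in> L2_gauss"
  shows "(\<lambda>m. r ^ m * energy f m) sums (LINT x|gauss. f x * OU r f x)"
proof -
  have "inner_level f (OU r f) = (\<lambda>m. r ^ m * energy f m)" by (rule ext) (rule energy_OU(2)[OF r f])
  then show ?thesis using parseval_inner[OF f OU_L2(1)[OF r f]] by simp
qed

section \<open>The null space and the high part\<close>

lemma has_weak_deriv_cmult:
  assumes "has_weak_deriv \<kappa> f g"
  shows "has_weak_deriv \<kappa> (\<lambda>x. c * f x) (\<lambda>x. c * g x)"
proof -
  have li: "locally_integrable (\<lambda>x. c * h x)" if "locally_integrable h" for h :: "real^'a \<Rightarrow> real"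
    using that by (auto simp: locally_integrable_def set_integrable_def mult.left_commute[of _ c])
  show ?thesis using assms li unfolding has_weak_deriv_def by (simp add: mult.assoc)
qed

lemma weak_D_nonzero:
  assumes "\<kappa> \<noteq> (\<lambda>_. 0)"
  shows "weak_D \<kappa> f = (\<lambda>x. (\<Prod>i\<in>UNIV. 1 / sqrt (fact (\<kappa> i))) * (SOME g. has_weak_deriv \<kappa> f g) x)"
  using assms by (simp add: weak_D_def)

lemma prod_fact_pos: "0 < (\<Prod>i\<in>UNIV. 1 / sqrt (fact (\<kappa> (i::'n::finite))) :: real)"
  by (intro prod_pos) simp

lemma sobolev_weak_D:
  fixes f :: "real^'n \<Rightarrow> real"
  assumes f: "f \<in> gauss_sobolev k" and \<kappa>: "mi_size \<kappa> = k" "1 \<le> k"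
  obtains g where "g \<in> L2_gauss" "has_weak_deriv \<kappa> f g" "weak_D \<kappa> f = (\<lambda>x. (\<Prod>i\<in>UNIV. 1 / sqrt (fact (\<kappa> i))) * g x)"
proof -
  let ?c = "\<Prod>i\<in>UNIV. 1 / sqrt (fact (\<kappa> i)) :: real"
  define g where "g = (SOME g. has_weak_deriv \<kappa> f g)"
  have nz: "\<kappa> \<noteq> (\<lambda>_. 0)" using \<kappa> by (auto simp: mi_size_def)
  have w: "weak_D \<kappa> f = (\<lambda>x. ?c * g x)" unfolding g_def by (rule weak_D_nonzero[OF nz])
  have ex: "\<exists>g. has_weak_deriv \<kappa> f g" and wL: "weak_D \<kappa> f \<in> L2_gauss" using f \<kappa> by (auto simp: gauss_sobolev_def)
  have hw: "has_weak_deriv \<kappa> f g" unfolding g_def using ex by (rule someI_ex)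
  have L: "(\<lambda>x. ?c * g x) \<in> L2_gauss" using wL unfolding w .
  have "(\<lambda>x. (1 / ?c) * (?c * g x)) = g" using prod_fact_pos[of \<kappa>] by (auto simp del: prod_dividef)
  then have "g \<in> L2_gauss" using L2_cmult[OF L, of "1 / ?c"] by simp
  then show ?thesis using that hw w by blast
qed

lemma weak_D_L2: "f \<in> gauss_sobolev k \<Longrightarrow> mi_size \<kappa> = k \<Longrightarrow> weak_D \<kappa> f \<in> L2_gauss"
  by (auto simp: gauss_sobolev_def)

text \<open>The link between the derivatives and the levels. It gives both the \<open>L\<^sup>2\<close> norm of the gradient and the
summability that the argument on the levels starts from.\<close>

lemma sobolev_energy:
  fixes f :: "real^'n \<Rightarrow> real"
  assumes f: "f \<in> gauss_sobolev k"
  shows "(\<Sum>\<kappa> | mi_size \<kappa> = k. energy (weak_D \<kappa> f) l) = real ((l + k) choose k) * energy f (l + k)"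
proof (rule energy_derivs)
  fix \<kappa> \<beta> :: "'n \<Rightarrow> nat" assume \<kappa>: "mi_size \<kappa> = k"
  show "(coef (weak_D \<kappa> f) \<beta>)\<^sup>2 = (\<Prod>i\<in>UNIV. real ((\<beta> i + \<kappa> i) choose \<kappa> i)) * (coef f (\<lambda>i. \<beta> i + \<kappa> i))\<^sup>2"
  proof (cases "k = 0")
    case True
    then have "\<kappa> = (\<lambda>_. 0)" using \<kappa> by (auto simp: mi_size_def)
    then show ?thesis by (simp add: weak_D_def)
  next
    case False
    obtain g where g: "g \<in> L2_gauss" "has_weak_deriv \<kappa> f g" "weak_D \<kappa> f = (\<lambda>x. (\<Prod>i\<in>UNIV. 1 / sqrt (fact (\<kappa> i))) * g x)"
      using sobolev_weak_D[OF f \<kappa>] False by auto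
    have "f \<in> L2_gauss" using f by (simp add: gauss_sobolev_def)
    then show ?thesis unfolding g(3) using g by (intro coef_weak_D)
  qed
qed

lemma energy_zero:
  assumes "f \<in> borel_measurable borel" "AE x in gauss. f x = 0" shows "energy f m = 0"
proof -
  have "coef f \<alpha> = coef (\<lambda>_. 0) \<alpha>" for \<alpha> using assms by (intro coef_cong_AE) auto
  moreover have "coef (\<lambda>_. 0) \<alpha> = 0" for \<alpha> :: "'a \<Rightarrow> nat" by (simp add: coef_def)
  ultimately show ?thesis by (simp add: energy_def)
qed

text \<open>All derivatives of order \<open>k\<close> vanish, so their energies do, and these determine the levels from \<open>k\<close> on.\<close>

lemma null_space_coef:
  fixes g :: "real^'n \<Rightarrow> real"
  assumes g: "g \<in> grad_null_space k" and \<alpha>: "k \<le> mi_size \<alpha>"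
  shows "coef g \<alpha> = 0"
proof -
  have gs: "g \<in> gauss_sobolev k" and z: "\<And>\<kappa>. mi_size \<kappa> = k \<Longrightarrow> AE x in gauss. weak_D \<kappa> g x = 0"
    using g by (auto simp: grad_null_space_def)
  define l where "l = mi_size \<alpha> - k"
  have l: "mi_size \<alpha> = l + k" using \<alpha> by (simp add: l_def)
  have "(\<Sum>\<kappa> | mi_size \<kappa> = k. energy (weak_D \<kappa> g) l) = 0"
    using z weak_D_L2[OF gs] by (intro sum.neutral ballI energy_zero) (auto intro: L2_meas)
  then have "energy g (mi_size \<alpha>) = 0" unfolding sobolev_energy[OF gs] l by simp
  then have "\<forall>\<beta>\<in>{\<beta>. mi_size \<beta> = mi_size \<alpha>}. (coef g \<beta>)\<^sup>2 = 0"
    unfolding energy_def by (subst (asm) sum_nonneg_eq_0_iff) (auto simp: finite_mi_size)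
  then show ?thesis by auto
qed

text \<open>The chosen representative of a weak derivative of a polynomial agrees with the classical derivative only
almost everywhere, by uniqueness of weak derivatives.\<close>

lemma poly_null_space:
  fixes c :: "('n::finite \<Rightarrow> nat) \<Rightarrow> real"
  assumes S: "finite S" "\<And>\<alpha>. \<alpha> \<in> S \<Longrightarrow> mi_size \<alpha> < k"
  shows "(\<lambda>x. \<Sum>\<alpha>\<in>S. c \<alpha> * Herm \<alpha> x) \<in> grad_null_space k"
proof -
  let ?U = "\<lambda>x. \<Sum>\<alpha>\<in>S. c \<alpha> * Herm \<alpha> x"
  let ?V = "\<lambda>\<kappa> x. \<Sum>\<alpha>\<in>S. c \<alpha> * pprod (\<lambda>i. hseq (\<alpha> i)) \<kappa> x"
  have UL: "?U \<in> L2_gauss" by (intro L2_sum S(1) L2_cmult Herm_L2)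
  have VL: "?V \<kappa> \<in> L2_gauss" for \<kappa> by (intro L2_sum S(1) L2_cmult pprod_hseq_L2)
  have w: "has_weak_deriv \<kappa> ?U (?V \<kappa>)" for \<kappa>
    by (intro has_weak_deriv_sum S(1) has_weak_deriv_cmult Herm_weak_deriv)
      (rule continuous_on_mult[OF continuous_on_const continuous_Herm]
        continuous_on_mult[OF continuous_on_const smooth_fam_continuous[OF smooth_fam_pprod[OF smooth_seq_hseq]]])+
  have D: "weak_D \<kappa> ?U \<in> L2_gauss \<and> (AE x in gauss. weak_D \<kappa> ?U x = (\<Prod>i\<in>UNIV. 1 / sqrt (fact (\<kappa> i))) * ?V \<kappa> x)"
    if nz: "\<kappa> \<noteq> (\<lambda>_. 0)" for \<kappa>
  proof -
    let ?c = "\<Prod>i\<in>UNIV. 1 / sqrt (fact (\<kappa> i)) :: real"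
    define g where "g = (SOME g. has_weak_deriv \<kappa> ?U g)"
    have hg: "has_weak_deriv \<kappa> ?U g" unfolding g_def by (rule someI[of _ "?V \<kappa>"]) (rule w)
    have e: "weak_D \<kappa> ?U = (\<lambda>x. ?c * g x)" unfolding g_def by (rule weak_D_nonzero[OF nz])
    have "AE x in lborel. g x = ?V \<kappa> x" by (rule weak_deriv_unique[OF hg w])
    then have ae: "AE x in gauss. g x = ?V \<kappa> x" by (rule AE_gauss_lborel)
    have "g \<in> borel_measurable borel" using hg by (auto simp: has_weak_deriv_def locally_integrable_def)
    then have "g \<in> L2_gauss" by (rule L2_cong_AE[OF VL _ ae])
    then have "weak_D \<kappa> ?U \<in> L2_gauss" unfolding e by (rule L2_cmult)
    moreover have "AE x in gauss. weak_D \<kappa> ?U x = ?c * ?V \<kappa> x" unfolding e using ae by eventually_elim simp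
    ultimately show ?thesis by blast
  qed
  have sob: "?U \<in> gauss_sobolev k"
    unfolding gauss_sobolev_def
  proof (intro CollectI conjI UL allI impI)
    fix \<kappa> :: "'n \<Rightarrow> nat"
    show "\<exists>g. has_weak_deriv \<kappa> ?U g" using w by blast
    show "weak_D \<kappa> ?U \<in> L2_gauss"
    proof (cases "\<kappa> = (\<lambda>_. 0)")
      case True
      then show ?thesis using UL by (simp add: weak_D_def)
    qed (use D in blast)
  qed
  moreover have "AE x in gauss. weak_D \<kappa> ?U x = 0" if \<kappa>: "mi_size \<kappa> = k" for \<kappa>
  proof (cases "k = 0")
    case True
    then have "S = {}" using S by auto
    moreover have "\<kappa> = (\<lambda>_. 0)" using \<kappa> True by (auto simp: mi_size_def)
    ultimately show ?thesis by (simp add: weak_D_def)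
  next
    case False
    then have nz: "\<kappa> \<noteq> (\<lambda>_. 0)" using \<kappa> by (auto simp: mi_size_def)
    have "pprod (\<lambda>i. hseq (\<alpha> i)) \<kappa> x = 0" if "\<alpha> \<in> S" for \<alpha> x
    proof -
      have "\<exists>i. \<alpha> i < \<kappa> i"
      proof (rule ccontr)
        assume "\<nexists>i. \<alpha> i < \<kappa> i"
        then have "mi_size \<kappa> \<le> mi_size \<alpha>" unfolding mi_size_def by (intro sum_mono) (simp add: not_less)
        then show False using S(2)[OF that] \<kappa> by simp
      qed
      then obtain i where i: "\<alpha> i < \<kappa> i" by blast
      have "(\<Prod>i\<in>UNIV. if \<kappa> i \<le> \<alpha> i then fact (\<alpha> i) / fact (\<alpha> i - \<kappa> i) else 0 :: real) = 0"
        by (intro prod_zero bexI[of _ i]) (use i in auto)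
      then show ?thesis unfolding pprod_hseq by simp
    qed
    then have "?V \<kappa> x = 0" for x by simp
    then show ?thesis using D[OF nz] by simp
  qed
  ultimately show ?thesis unfolding grad_null_space_def by blast
qed

lemma Herm_null_space: "mi_size \<alpha> < k \<Longrightarrow> Herm \<alpha> \<in> grad_null_space k"
  using poly_null_space[of "{\<alpha>}" k "\<lambda>_. 1"] by simp

lemma finite_mi_less: "finite {\<alpha>::'n::finite \<Rightarrow> nat. mi_size \<alpha> < k}"
proof -
  have "{\<alpha>::'n \<Rightarrow> nat. mi_size \<alpha> < k} = (\<Union>m<k. {\<alpha>. mi_size \<alpha> = m})" by auto
  then show ?thesis by (simp add: finite_mi_size)
qed

text \<open>The choice in the definition of \<^const>\<open>high_part\<close> is justified by subtracting from \<open>f\<close> its Hermite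
expansion below level \<open>k\<close>; conversely the defining properties fix all Hermite coefficients.\<close>

lemma high_part_energy:
  fixes f :: "real^'n \<Rightarrow> real"
  assumes f: "f \<in> L2_gauss"
  shows "high_part k f \<in> L2_gauss" "energy (high_part k f) m = (if k \<le> m then energy f m else 0)"
proof -
  let ?P = "\<lambda>h. h \<in> L2_gauss \<and> (\<lambda>x. f x - h x) \<in> grad_null_space k \<and> (\<forall>g\<in>grad_null_space k. (LINT x|gauss. h x * g x) = 0)"
  let ?S = "{\<alpha>::'n \<Rightarrow> nat. mi_size \<alpha> < k}"
  define U where "U x = (\<Sum>\<alpha>\<in>?S. coef f \<alpha> / nrm \<alpha> * Herm \<alpha> x)" for x
  have Un: "U \<in> grad_null_space k" unfolding U_def[abs_def] by (rule poly_null_space[OF finite_mi_less]) simp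
  have UL: "U \<in> L2_gauss" using Un by (simp add: grad_null_space_def gauss_sobolev_def)
  have cU: "coef U \<beta> = coef f \<beta>" if \<beta>: "mi_size \<beta> < k" for \<beta>
  proof -
    have "coef U \<beta> = (\<Sum>\<alpha>\<in>?S. coef (\<lambda>x. coef f \<alpha> / nrm \<alpha> * Herm \<alpha> x) \<beta>)"
      unfolding U_def[abs_def] by (intro coef_sum finite_mi_less L2_cmult Herm_L2)
    also have "\<dots> = (\<Sum>\<alpha>\<in>?S. if \<alpha> = \<beta> then coef f \<beta> else 0)"
      unfolding coef_cmult coef_Herm using nrm_pos by (intro sum.cong) (auto simp: less_imp_neq[OF nrm_pos, symmetric])
    also have "\<dots> = coef f \<beta>" using \<beta> by (simp add: finite_mi_less)
    finally show ?thesis .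
  qed
  have PU: "?P (\<lambda>x. f x - U x)"
  proof (intro conjI ballI)
    show "(\<lambda>x. f x - U x) \<in> L2_gauss" by (rule L2_diff[OF f UL])
    show "(\<lambda>x. f x - (f x - U x)) \<in> grad_null_space k" using Un by simp
    fix g :: "real^'n \<Rightarrow> real" assume g: "g \<in> grad_null_space k"
    have gL: "g \<in> L2_gauss" using g by (simp add: grad_null_space_def gauss_sobolev_def)
    have Z: "coef (\<lambda>x. f x - U x) \<alpha> * coef g \<alpha> = 0" for \<alpha>
      using cU[of \<alpha>] null_space_coef[OF g, of \<alpha>] coef_diff[OF f UL, of \<alpha>] by (cases "mi_size \<alpha> < k") auto
    have "inner_level (\<lambda>x. f x - U x) g = (\<lambda>_. 0)"
      by (intro ext) (simp only: inner_level_def Z sum.neutral_const)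
    then show "(LINT x|gauss. (f x - U x) * g x) = 0"
      using parseval_inner[OF L2_diff[OF f UL] gL] by (simp add: sums_iff)
  qed
  have P: "?P (high_part k f)" unfolding high_part_def by (rule someI[of ?P, OF PU])
  then show hL: "high_part k f \<in> L2_gauss" by blast
  have "coef (high_part k f) \<alpha> = (if k \<le> mi_size \<alpha> then coef f \<alpha> else 0)" for \<alpha>
  proof (cases "k \<le> mi_size \<alpha>")
    case True
    have "coef (\<lambda>x. f x - high_part k f x) \<alpha> = 0" using null_space_coef P True by blast
    then show ?thesis using coef_diff[OF f hL, of \<alpha>] True by simp
  next
    case False
    then have "(LINT x|gauss. high_part k f x * Herm \<alpha> x) = 0" using P Herm_null_space[of \<alpha> k] by auto
    then show ?thesis using False by (simp add: coef_def)
  qed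
  then show "energy (high_part k f) m = (if k \<le> m then energy f m else 0)"
    by (auto simp: energy_def intro!: sum.neutral)
qed

lemma Lp_norm_2_sq: "(Lp_norm 2 f)\<^sup>2 = (LINT x|gauss. (f x)\<^sup>2)"
proof -
  have I: "(LINT x|gauss. \<bar>f x\<bar> powr 2) = (LINT x|gauss. (f x)\<^sup>2)" by simp
  have "0 \<le> (LINT x|gauss. (f x)\<^sup>2)" by simp
  then show ?thesis unfolding Lp_norm_def I by (simp add: powr_half_sqrt)
qed

lemma high_weight_eq:
  assumes f: "f \<in> L2_gauss"
  shows "high_weight k f = (\<Sum>l. energy f (l + k))"
proof -
  have s: "energy (high_part k f) sums high_weight k f"
    unfolding high_weight_def Lp_norm_2_sq by (rule parseval[OF high_part_energy(1)[OF f]])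
  have "high_weight k f = suminf (energy (high_part k f))" using s by (simp add: sums_iff)
  also have "\<dots> = (\<Sum>l. energy (high_part k f) (l + k)) + (\<Sum>l<k. energy (high_part k f) l)"
    using s by (intro suminf_split_initial_segment) (simp add: sums_iff)
  also have "\<dots> = (\<Sum>l. energy f (l + k))" by (simp add: high_part_energy(2)[OF f])
  finally show ?thesis .
qed

lemma sobolev_level_weights:
  assumes f: "f \<in> gauss_sobolev k" and k: "1 \<le> k"
  shows "level_weights k (\<lambda>l. energy f (l + k))"
proof
  show "1 \<le> k" by (rule k)
  show "0 \<le> energy f (l + k)" for l by (rule energy_nonneg)
  show "summable (\<lambda>l. real ((l + k) choose k) * energy f (l + k))"
    unfolding sobolev_energy[OF f, symmetric]
    by (intro summable_sum summable_energy weak_D_L2[OF f]) simp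
qed

section \<open>Estimates for the derivatives of a Sobolev function\<close>

lemma integral_powr_zero:
  fixes f :: "real^'n \<Rightarrow> real"
  assumes "integrable gauss (\<lambda>x. \<bar>f x\<bar> powr q)" "(LINT x|gauss. \<bar>f x\<bar> powr q) = 0"
  shows "AE x in gauss. f x = 0"
proof -
  have "AE x in gauss. \<bar>f x\<bar> powr q = 0"
    using assms by (subst (asm) integral_nonneg_eq_0_iff_AE) auto
  then show ?thesis by eventually_elim simp
qed

text \<open>Log-convexity of \<open>L\<^sup>p\<close> norms between \<open>q\<close> and \<open>2\<close>, in the shape needed for \<open>rate\<close>. It is proved by
integrating the weighted mean inequality for the normalized integrands.\<close>

lemma lyapunov:
  fixes u :: "real^'n \<Rightarrow> real"
  assumes u: "u \<in> L2_gauss" and q: "1 \<le> q" "q \<le> r" "r \<le> 2" "q < 2"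
  shows "(LINT x|gauss. \<bar>u x\<bar> powr r) powr (2 / r)
    \<le> ((LINT x|gauss. \<bar>u x\<bar> powr q) powr (2 / q)) powr (q * (2 - r) / (r * (2 - q)))
      * (LINT x|gauss. (u x)\<^sup>2) powr (1 - q * (2 - r) / (r * (2 - q)))"
proof -
  let ?X = "LINT x|gauss. \<bar>u x\<bar> powr q" and ?Y = "LINT x|gauss. (u x)\<^sup>2"
  have iq: "integrable gauss (\<lambda>x. \<bar>u x\<bar> powr q)" using q by (intro L2_powr_integrable u) auto
  have ir: "integrable gauss (\<lambda>x. \<bar>u x\<bar> powr r)" using q by (intro L2_powr_integrable u) auto
  have i2: "integrable gauss (\<lambda>x. (u x)\<^sup>2)" by (rule L2_sq[OF u])
  define a where "a = (2 - r) / (2 - q)"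
  have a: "0 \<le> a" "a \<le> 1" using q by (auto simp: a_def)
  have "a * (2 - q) = 2 - r" using q by (simp add: a_def)
  then have ra: "q * a + 2 * (1 - a) = r" by (simp add: algebra_simps)
  have \<theta>: "q * (2 - r) / (r * (2 - q)) = q * a / r" by (simp add: a_def)
  have \<theta>': "1 - q * (2 - r) / (r * (2 - q)) = 2 * (1 - a) / r"
    unfolding \<theta> using q ra by (simp add: field_simps)
  show ?thesis
  proof (cases "?X = 0 \<or> ?Y = 0")
    case True
    have "AE x in gauss. u x = 0"
      using True integral_powr_zero[OF iq] integral_powr_zero[of u 2] i2 by auto
    then have "(LINT x|gauss. \<bar>u x\<bar> powr r) = (LINT x|(gauss::(real^'n) measure). 0)"
      using L2_meas[OF u] by (intro integral_cong_AE) (auto simp: measurable_cong_sets[OF sets_gauss refl])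
    then show ?thesis by simp
  next
    case False
    have "0 \<le> ?X" "0 \<le> ?Y" by auto
    then have X: "0 < ?X" and Y: "0 < ?Y" using False by linarith+
    have pw: "\<bar>u x\<bar> powr r \<le> ?X powr a * ?Y powr (1 - a) * (a * (\<bar>u x\<bar> powr q / ?X) + (1 - a) * ((u x)\<^sup>2 / ?Y))" for x
    proof (cases "u x = 0")
      case False
      have "(\<bar>u x\<bar> powr q / ?X) powr a * ((u x)\<^sup>2 / ?Y) powr (1 - a) \<le> a * (\<bar>u x\<bar> powr q / ?X) + (1 - a) * ((u x)\<^sup>2 / ?Y)"
        using X Y a by (intro weighted_am_gm) auto
      moreover have "(\<bar>u x\<bar> powr q / ?X) powr a * ((u x)\<^sup>2 / ?Y) powr (1 - a) = \<bar>u x\<bar> powr r / (?X powr a * ?Y powr (1 - a))"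
      proof -
        have "(u x)\<^sup>2 = \<bar>u x\<bar> powr 2" by simp
        then have "(\<bar>u x\<bar> powr q / ?X) powr a * ((u x)\<^sup>2 / ?Y) powr (1 - a) = (\<bar>u x\<bar> powr (q * a) * \<bar>u x\<bar> powr (2 * (1 - a))) / (?X powr a * ?Y powr (1 - a))"
          using X Y by (simp only: powr_divide powr_powr) (simp add: powr_divide powr_powr)
        also have "\<bar>u x\<bar> powr (q * a) * \<bar>u x\<bar> powr (2 * (1 - a)) = \<bar>u x\<bar> powr r"
          unfolding powr_add[symmetric] ra ..
        finally show ?thesis .
      qed
      ultimately show ?thesis using X Y by (simp add: field_simps)
    qed (use X Y a in auto)
    have "(LINT x|gauss. \<bar>u x\<bar> powr r) \<le> (LINT x|gauss. ?X powr a * ?Y powr (1 - a) * (a * (\<bar>u x\<bar> powr q / ?X) + (1 - a) * ((u x)\<^sup>2 / ?Y)))"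
      using ir iq i2 pw by (intro integral_mono) auto
    also have "\<dots> = ?X powr a * ?Y powr (1 - a) * (a * (?X / ?X) + (1 - a) * (?Y / ?Y))"
      using iq i2 by simp
    also have "\<dots> = ?X powr a * ?Y powr (1 - a)" using X Y by simp
    finally have "(LINT x|gauss. \<bar>u x\<bar> powr r) powr (2 / r) \<le> (?X powr a * ?Y powr (1 - a)) powr (2 / r)"
      using q by (intro powr_mono2) auto
    also have "\<dots> = ?X powr (a * (2 / r)) * ?Y powr ((1 - a) * (2 / r))"
      by (simp add: powr_mult powr_powr)
    also have "?X powr (a * (2 / r)) = (?X powr (2 / q)) powr (q * a / r)" using q by (simp add: powr_powr mult.commute)
    also have "(1 - a) * (2 / r) = 2 * (1 - a) / r" by simp
    finally show ?thesis unfolding \<theta>' unfolding \<theta> .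
  qed
qed

lemma Lp_norm_sq: "(Lp_norm q f)\<^sup>2 = (LINT x|gauss. \<bar>f x\<bar> powr q) powr (2 / q)"
  by (simp add: Lp_norm_def power2_eq_square powr_add[symmetric])

text \<open>The function \<open>u = OU (sqrt s) g\<close> has energies \<open>s ^ l * energy g l\<close>. Hypercontractivity with parameter \<open>z\<close>
bounds the damped sum by the norm of \<open>u\<close> at exponent \<open>1 + z\<close>, which is interpolated between the exponents
\<open>q\<close> and \<open>2\<close>; the \<open>L\<^sup>q\<close> norm of \<open>u\<close> is at most that of \<open>g\<close>.\<close>

lemma hyper_single:
  fixes g :: "real^'n \<Rightarrow> real"
  assumes g: "g \<in> L2_gauss" and q: "1 \<le> q" "q < 2" and z: "0 < z" "z < 1" and s: "0 < s" "s < 1" and R: "0 < R"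
    and rt: "rate q z \<le> 1"
  shows "(\<Sum>l. (z * s) ^ l * energy g l)
    \<le> R powr (- rate q z) * (rate q z * R * (Lp_norm q g)\<^sup>2 + (1 - rate q z) * (\<Sum>l. s ^ l * energy g l))"
proof -
  define \<theta> where "\<theta> = rate q z"
  have \<theta>0: "0 \<le> \<theta>" "\<theta> \<le> 1" using rt q z by (auto simp: \<theta>_def rate_def)
  define u where "u = OU (sqrt s) g"
  have rs: "0 \<le> sqrt s" "sqrt s < 1" using s by auto
  have uL: "u \<in> L2_gauss" unfolding u_def by (rule OU_L2[OF rs g])
  have eu: "energy u l = s ^ l * energy g l" for l unfolding u_def using energy_OU(1)[OF rs g] s by simp
  let ?r = "1 + z"
  have th: "q * (2 - ?r) / (?r * (2 - q)) = \<theta>" by (simp add: \<theta>_def rate_def mult.commute)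
  have qr: "q \<le> ?r"
  proof -
    have "q * (1 - z) \<le> (2 - q) * (1 + z)" using rt q z by (simp add: rate_def divide_simps)
    then show ?thesis by (simp add: algebra_simps)
  qed
  let ?X = "(LINT x|gauss. \<bar>u x\<bar> powr q) powr (2 / q)" and ?Y = "LINT x|gauss. (u x)\<^sup>2"
  have Y: "?Y = (\<Sum>l. s ^ l * energy g l)" using parseval[OF uL] by (simp add: sums_iff eu[abs_def])
  have X: "?X \<le> (Lp_norm q g)\<^sup>2"
    unfolding Lp_norm_sq u_def using q OU_Lq(2)[OF rs g, of q] by (intro powr_mono2) auto
  have sm: "summable (\<lambda>l. z ^ l * energy u l)"
    by (rule summable_comparison_test'[OF summable_energy[OF uL], of 0])
      (use z energy_nonneg[of u] in \<open>auto intro!: mult_left_le_one_le power_le_one simp: abs_mult\<close>)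
  have "(\<Sum>l. (z * s) ^ l * energy g l) = (\<Sum>l. z ^ l * energy u l)"
    by (simp add: eu power_mult_distrib mult.assoc)
  also have "\<dots> \<le> (LINT x|gauss. \<bar>u x\<bar> powr ?r) powr (2 / ?r)"
    by (rule suminf_le_const[OF sm hypercontractive[OF uL]]) (use z in auto)
  also have "\<dots> \<le> ?X powr \<theta> * ?Y powr (1 - \<theta>)"
    using lyapunov[OF uL q(1) qr _ q(2)] z unfolding th by simp
  also have "\<dots> = R powr (- \<theta>) * ((R * ?X) powr \<theta> * ?Y powr (1 - \<theta>))"
    using R by (simp add: powr_mult powr_minus_divide)
  also have "\<dots> \<le> R powr (- \<theta>) * (\<theta> * (R * ?X) + (1 - \<theta>) * ?Y)"
    using R \<theta>0 by (intro mult_left_mono weighted_am_gm) auto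
  also have "\<dots> \<le> R powr (- \<theta>) * (\<theta> * (R * (Lp_norm q g)\<^sup>2) + (1 - \<theta>) * ?Y)"
    using R \<theta>0 X by (intro mult_left_mono add_right_mono) auto
  finally show ?thesis unfolding Y \<theta>_def by (simp add: mult.assoc)
qed

context
  fixes f :: "real^'n \<Rightarrow> real" and k :: nat
  assumes f: "f \<in> gauss_sobolev k" and k: "1 \<le> k"
begin

interpretation lw: level_weights k "\<lambda>l. energy f (l + k)"
  by (rule sobolev_level_weights[OF f k])

abbreviation (input) idx :: "('n \<Rightarrow> nat) set" where "idx \<equiv> {\<kappa>. mi_size \<kappa> = k}"

abbreviation (input) D :: "('n \<Rightarrow> nat) \<Rightarrow> real^'n \<Rightarrow> real" where "D \<kappa> \<equiv> weak_D \<kappa> f"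

lemma D_L2: "\<kappa> \<in> idx \<Longrightarrow> D \<kappa> \<in> L2_gauss" using weak_D_L2[OF f] by auto

lemma summable_D:
  assumes "\<kappa> \<in> idx" "0 \<le> s" "s \<le> 1"
  shows "summable (\<lambda>l. s ^ l * energy (D \<kappa>) l)"
proof (rule summable_comparison_test'[OF summable_energy[OF D_L2[OF assms(1)]], of 0])
  fix l
  have "s ^ l * energy (D \<kappa>) l \<le> energy (D \<kappa>) l"
    using assms energy_nonneg[of "D \<kappa>" l] by (intro mult_left_le_one_le) (auto simp: power_le_one)
  then show "norm (s ^ l * energy (D \<kappa>) l) \<le> energy (D \<kappa>) l"
    using assms energy_nonneg[of "D \<kappa>" l] by simp
qed

lemma Phi_sum: 
  assumes "0 \<le> s" "s \<le> 1"
  shows "lw.Phi s = (\<Sum>\<kappa>\<in>idx. \<Sum>l. s ^ l * energy (D \<kappa>) l)"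
proof -
  have "lw.Phi s = (\<Sum>l. \<Sum>\<kappa>\<in>idx. s ^ l * energy (D \<kappa>) l)"
    unfolding lw.Phi_def sum_distrib_left[symmetric] sobolev_energy[OF f] by (simp add: ac_simps)
  also have "\<dots> = (\<Sum>\<kappa>\<in>idx. \<Sum>l. s ^ l * energy (D \<kappa>) l)"
    using assms by (intro suminf_sum summable_D) auto
  finally show ?thesis .
qed

lemma grad_norm_sq: "(grad_norm k f x)\<^sup>2 = (\<Sum>\<kappa>\<in>idx. (D \<kappa> x)\<^sup>2)"
  by (simp add: grad_norm_def sum_nonneg)

lemma grad_norm_nonneg: "0 \<le> grad_norm k f x"
  by (simp add: grad_norm_def sum_nonneg)

lemma grad_norm_L2: "grad_norm k f \<in> L2_gauss"
proof (rule L2I)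
  have m: "D \<kappa> \<in> borel_measurable borel" if "\<kappa> \<in> idx" for \<kappa> by (rule L2_meas[OF D_L2[OF that]])
  show "grad_norm k f \<in> borel_measurable borel"
  proof -
    have "(\<lambda>x. \<Sum>\<kappa>\<in>idx. (D \<kappa> x)\<^sup>2) \<in> borel_measurable borel"
      by (rule borel_measurable_sum) (use m in \<open>auto intro: borel_measurable_power\<close>)
    then have "(\<lambda>x. sqrt (\<Sum>\<kappa>\<in>idx. (D \<kappa> x)\<^sup>2)) \<in> borel_measurable borel" by measurable
    then show ?thesis by (simp add: grad_norm_def[abs_def])
  qed
  show "integrable gauss (\<lambda>x. (grad_norm k f x)\<^sup>2)"
    unfolding grad_norm_sq by (intro Bochner_Integration.integrable_sum L2_sq D_L2)
qed

lemma Phi_1: "lw.Phi 1 = (Lp_norm 2 (grad_norm k f))\<^sup>2"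
proof -
  have "lw.Phi 1 = (\<Sum>\<kappa>\<in>idx. \<Sum>l. energy (D \<kappa>) l)" by (subst Phi_sum) auto
  also have "\<dots> = (\<Sum>\<kappa>\<in>idx. LINT x|gauss. (D \<kappa> x)\<^sup>2)"
    using parseval[OF D_L2] by (intro sum.cong) (auto simp: sums_iff)
  also have "\<dots> = (LINT x|gauss. (grad_norm k f x)\<^sup>2)"
    unfolding grad_norm_sq by (intro Bochner_Integration.integral_sum[symmetric] L2_sq D_L2)
  finally show ?thesis by (simp only: Lp_norm_2_sq)
qed

lemma W_eq: "lw.W = high_weight k f"
proof -
  have "f \<in> L2_gauss" using f by (simp add: gauss_sobolev_def)
  then show ?thesis by (simp add: lw.W_def high_weight_eq)
qed

definition deriv_Lq :: "real \<Rightarrow> real" where "deriv_Lq q = (\<Sum>\<kappa>\<in>idx. (Lp_norm q (D \<kappa>))\<^sup>2)"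

lemma deriv_hyper:
  assumes q: "1 \<le> q" "q < 2"
  shows "lw.hyper q (deriv_Lq q)"
  unfolding lw.hyper_def
proof (intro allI impI)
  fix z s R :: real
  assume *: "0 < z" "z < 1" "0 < s" "s < 1" "0 < R" "rate q z \<le> 1"
  have "lw.Phi (z * s) = (\<Sum>\<kappa>\<in>idx. \<Sum>l. (z * s) ^ l * energy (D \<kappa>) l)"
    using * by (intro Phi_sum) (auto intro: mult_le_one)
  also have "\<dots> \<le> (\<Sum>\<kappa>\<in>idx. R powr (- rate q z) * (rate q z * R * (Lp_norm q (D \<kappa>))\<^sup>2 + (1 - rate q z) * (\<Sum>l. s ^ l * energy (D \<kappa>) l)))"
    using * q by (intro sum_mono hyper_single D_L2)
  also have "\<dots> = R powr (- rate q z) * (rate q z * R * deriv_Lq q + (1 - rate q z) * (\<Sum>\<kappa>\<in>idx. \<Sum>l. s ^ l * energy (D \<kappa>) l))"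
    by (simp add: deriv_Lq_def sum_distrib_left[symmetric] sum.distrib)
  also have "(\<Sum>\<kappa>\<in>idx. \<Sum>l. s ^ l * energy (D \<kappa>) l) = lw.Phi s"
    using * by (intro Phi_sum[symmetric]) auto
  finally show "lw.Phi (z * s) \<le> R powr (- rate q z) * (rate q z * R * deriv_Lq q + (1 - rate q z) * lw.Phi s)" .
qed

text \<open>If all derivatives vanish, so do all levels from \<open>k\<close> on.\<close>

lemma deriv_Lq_pos:
  assumes q: "1 \<le> q" "q < 2" and W: "0 < lw.W"
  shows "0 < deriv_Lq q"
proof (rule ccontr)
  assume "\<not> 0 < deriv_Lq q"
  moreover have "0 \<le> deriv_Lq q" by (simp add: deriv_Lq_def sum_nonneg)
  ultimately have "deriv_Lq q = 0" by linarith
  then have "\<forall>\<kappa>\<in>idx. (Lp_norm q (D \<kappa>))\<^sup>2 = 0"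
    unfolding deriv_Lq_def by (subst (asm) sum_nonneg_eq_0_iff) (auto simp: finite_mi_size)
  then have I: "(LINT x|gauss. \<bar>D \<kappa> x\<bar> powr q) = 0" if "\<kappa> \<in> idx" for \<kappa>
    using that unfolding Lp_norm_sq by auto
  have "energy (D \<kappa>) l = 0" if "\<kappa> \<in> idx" for \<kappa> l
    using q L2_meas[OF D_L2[OF that]] by (intro energy_zero integral_powr_zero[OF _ I[OF that]] L2_powr_integrable D_L2 that) auto
  then have "(\<Sum>\<kappa>\<in>idx. energy (D \<kappa>) l) = 0" for l by simp
  then have "energy f (l + k) = 0" for l unfolding sobolev_energy[OF f] by simp
  then have "lw.W = 0" unfolding lw.W_def by simp
  then show False using W by linarith
qed

lemma first_inequality:
  assumes q: "1 \<le> q" "q < 2"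
  shows "high_weight k f * (1 + q / (2 * real k * (2 - q)) * ln_plus (high_weight k f / deriv_Lq q)) ^ k \<le> (Lp_norm 2 (grad_norm k f))\<^sup>2"
proof (cases "lw.W = 0")
  case True
  then show ?thesis by (simp add: W_eq[symmetric])
next
  case False
  then have W: "0 < lw.W" using lw.W_nonneg by simp
  show ?thesis
    using lw.L2_lower_bound[OF deriv_hyper[OF q] q deriv_Lq_pos[OF q W] W] by (simp only: W_eq Phi_1)
qed

text \<open>Minkowski's inequality for the exponent \<open>2 / p\<close>, in dual form: \<open>X \<kappa> powr (2 / p - 1)\<close> are the weights that
are dual to the vector \<open>X\<close> of \<open>p\<close>-th powers of norms, and the pointwise estimate is Hoelder's
inequality for the sum over \<open>\<kappa>\<close>.\<close>

lemma minkowski_grad: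
  assumes p: "1 \<le> p" "p < 2" and Z: "0 < deriv_Lq p"
  shows "deriv_Lq p powr (p / 2) \<le> (LINT x|gauss. \<bar>grad_norm k f x\<bar> powr p)"
proof -
  let ?P = "LINT x|gauss. \<bar>grad_norm k f x\<bar> powr p" and ?Z = "deriv_Lq p"
  define X where "X \<kappa> = (LINT x|gauss. \<bar>D \<kappa> x\<bar> powr p)" for \<kappa>
  have X0: "0 \<le> X \<kappa>" for \<kappa> by (simp add: X_def)
  have Zs: "?Z = (\<Sum>\<kappa>\<in>idx. X \<kappa> powr (2 / p))" by (simp add: deriv_Lq_def Lp_norm_sq X_def)
  have intD: "integrable gauss (\<lambda>x. \<bar>D \<kappa> x\<bar> powr p)" if "\<kappa> \<in> idx" for \<kappa>
    using p by (intro L2_powr_integrable D_L2 that) auto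
  have intG: "integrable gauss (\<lambda>x. \<bar>grad_norm k f x\<bar> powr p)"
    using p by (intro L2_powr_integrable grad_norm_L2) auto
  have pw: "(\<Sum>\<kappa>\<in>idx. X \<kappa> powr (2 / p - 1) * \<bar>D \<kappa> x\<bar> powr p) \<le> ?Z powr (1 - p / 2) * \<bar>grad_norm k f x\<bar> powr p" for x
  proof (cases "grad_norm k f x = 0")
    case True
    then have "(\<Sum>\<kappa>\<in>idx. (D \<kappa> x)\<^sup>2) = 0" using grad_norm_sq[of x] by simp
    then have "\<forall>\<kappa>\<in>idx. D \<kappa> x = 0" by (subst (asm) sum_nonneg_eq_0_iff) (auto simp: finite_mi_size)
    then show ?thesis by (simp add: True)
  next
    case False
    define G where "G = grad_norm k f x"
    have G: "G > 0" using False grad_norm_nonneg[of x] by (simp add: G_def)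
    have "(\<Sum>\<kappa>\<in>idx. X \<kappa> powr (2 / p - 1) * \<bar>D \<kappa> x\<bar> powr p / (?Z powr (1 - p / 2) * G powr p))
      \<le> (\<Sum>\<kappa>\<in>idx. (1 - p / 2) * (X \<kappa> powr (2 / p) / ?Z) + (p / 2) * ((D \<kappa> x)\<^sup>2 / G\<^sup>2))"
    proof (rule sum_mono)
      fix \<kappa> assume "\<kappa> \<in> idx"
      have "(X \<kappa> powr (2 / p) / ?Z) powr (1 - p / 2) * ((D \<kappa> x)\<^sup>2 / G\<^sup>2) powr (1 - (1 - p / 2))
        \<le> (1 - p / 2) * (X \<kappa> powr (2 / p) / ?Z) + (1 - (1 - p / 2)) * ((D \<kappa> x)\<^sup>2 / G\<^sup>2)"
        using Z G p by (intro weighted_am_gm) auto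
      moreover have "(X \<kappa> powr (2 / p) / ?Z) powr (1 - p / 2) = X \<kappa> powr (2 / p - 1) / ?Z powr (1 - p / 2)"
      proof -
        have "2 / p * (1 - p / 2) = 2 / p - 1" using p by (simp add: field_simps)
        then show ?thesis using Z X0 by (simp add: powr_divide powr_powr)
      qed
      moreover have "((D \<kappa> x)\<^sup>2 / G\<^sup>2) powr (1 - (1 - p / 2)) = \<bar>D \<kappa> x\<bar> powr p / G powr p"
      proof -
        have "(D \<kappa> x)\<^sup>2 / G\<^sup>2 = \<bar>D \<kappa> x\<bar> powr 2 / G powr 2" using G by simp
        then show ?thesis using G by (simp only: powr_divide powr_powr) (simp add: powr_divide powr_powr)
      qed
      ultimately show "X \<kappa> powr (2 / p - 1) * \<bar>D \<kappa> x\<bar> powr p / (?Z powr (1 - p / 2) * G powr p)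
        \<le> (1 - p / 2) * (X \<kappa> powr (2 / p) / ?Z) + (p / 2) * ((D \<kappa> x)\<^sup>2 / G\<^sup>2)"
        by (simp add: times_divide_times_eq mult.commute)
    qed
    also have "\<dots> = (1 - p / 2) * ((\<Sum>\<kappa>\<in>idx. X \<kappa> powr (2 / p)) / ?Z) + (p / 2) * ((\<Sum>\<kappa>\<in>idx. (D \<kappa> x)\<^sup>2) / G\<^sup>2)"
      by (simp only: sum.distrib sum_distrib_left[symmetric] sum_divide_distrib[symmetric])
    also have "\<dots> = 1" unfolding Zs[symmetric] G_def grad_norm_sq[symmetric] using Z G by (simp add: G_def)
    finally have "(\<Sum>\<kappa>\<in>idx. X \<kappa> powr (2 / p - 1) * \<bar>D \<kappa> x\<bar> powr p) / (?Z powr (1 - p / 2) * G powr p) \<le> 1"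
      by (simp only: sum_divide_distrib)
    then show ?thesis using Z G by (simp add: G_def[symmetric] pos_divide_le_eq)
  qed
  have "?Z = (\<Sum>\<kappa>\<in>idx. X \<kappa> powr (2 / p - 1) * X \<kappa>)"
    unfolding Zs
  proof (intro sum.cong refl)
    fix \<kappa>
    show "X \<kappa> powr (2 / p) = X \<kappa> powr (2 / p - 1) * X \<kappa>"
    proof (cases "X \<kappa> = 0")
      case False
      then show ?thesis using X0[of \<kappa>] by (simp add: powr_diff)
    qed simp
  qed
  also have "\<dots> = (LINT x|gauss. (\<Sum>\<kappa>\<in>idx. X \<kappa> powr (2 / p - 1) * \<bar>D \<kappa> x\<bar> powr p))"
    using intD by (subst Bochner_Integration.integral_sum) (auto simp: X_def)
  also have "\<dots> \<le> (LINT x|gauss. ?Z powr (1 - p / 2) * \<bar>grad_norm k f x\<bar> powr p)"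
    using intD intG pw by (intro integral_mono) auto
  finally have "?Z \<le> ?Z powr (1 - p / 2) * ?P" by simp
  then have "?Z / ?Z powr (1 - p / 2) \<le> ?P" using Z by (simp add: pos_divide_le_eq mult.commute)
  moreover have "?Z / ?Z powr (1 - p / 2) = ?Z powr (p / 2)"
    using Z powr_diff[of ?Z 1 "1 - p / 2"] by simp
  ultimately show ?thesis by simp
qed

section \<open>Derivatives of bounded functions\<close>

text \<open>Smoothing a derivative is integration against the Gaussian density, so the derivatives can be moved to the
density; what remains is a Hermite coefficient of \<open>f\<close> in the integration variable.\<close>

lemma OU_weak_D:
  assumes \<kappa>: "\<kappa> \<in> idx" and s: "0 < s" "s < 1"
  shows "OU s (D \<kappa>) x = (1 / sqrt (1 - s\<^sup>2)) ^ k * coef (\<lambda>y. f (s *\<^sub>R x + sqrt (1 - s\<^sup>2) *\<^sub>R y)) \<kappa>"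
proof -
  let ?\<sigma> = "sqrt (1 - s\<^sup>2)"
  have \<sigma>: "0 < ?\<sigma>" "?\<sigma> \<le> 1" using s by (auto simp: power_less_one_iff abs_square_less_1)
  have \<kappa>': "mi_size \<kappa> = k" using \<kappa> by simp
  obtain g where g: "g \<in> L2_gauss" "has_weak_deriv \<kappa> f g"
    "D \<kappa> = (\<lambda>x. (\<Prod>i\<in>UNIV. 1 / sqrt (fact (\<kappa> i))) * g x)"
    by (rule sobolev_weak_D[OF f \<kappa>' k])
  have c: "(\<Prod>i\<in>UNIV. 1 / sqrt (fact (\<kappa> i))) = 1 / nrm \<kappa>"
  proof (rule power2_eq_imp_eq)
    show "(\<Prod>i\<in>UNIV. 1 / sqrt (fact (\<kappa> i)))\<^sup>2 = (1 / nrm \<kappa>)\<^sup>2"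
      by (simp add: power_divide nrm_sq prod_power_distrib prod_dividef)
  qed (use nrm_pos[of \<kappa>] in \<open>auto intro!: prod_nonneg\<close>)
  have fL: "f \<in> L2_gauss" using f by (simp add: gauss_sobolev_def)
  have "OU s (D \<kappa>) x = (LINT y|gauss. g (s *\<^sub>R x + ?\<sigma> *\<^sub>R y) * Herm (\<lambda>_. 0) y) / nrm \<kappa>"
    unfolding OU_def g(3) c Herm_0 by simp
  also have "\<dots> = (1 / ?\<sigma>) ^ k * ((LINT y|gauss. f (s *\<^sub>R x + ?\<sigma> *\<^sub>R y) * Herm \<kappa> y) / nrm \<kappa>)"
    unfolding weak_deriv_hermite[OF fL g(1,2) \<sigma>] \<kappa>' by simp
  finally show ?thesis by (simp only: coef_def)
qed

text \<open>By Bessel's inequality on level \<open>k\<close> for the functions \<open>y \<mapsto> f (s *\<^sub>R x + sqrt (1 - s\<^sup>2) *\<^sub>R y)\<close>, which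
are bounded by \<open>1\<close> almost everywhere for almost all \<open>x\<close>.\<close>

lemma OU_grad_bounded:
  assumes b: "AE x in gauss. \<bar>f x\<bar> \<le> 1" and s: "0 < s" "s < 1"
  shows "AE x in gauss. (\<Sum>\<kappa>\<in>idx. (OU s (D \<kappa>) x)\<^sup>2) \<le> (1 / (1 - s\<^sup>2)) ^ k"
proof -
  let ?\<sigma> = "sqrt (1 - s\<^sup>2)"
  have s2: "0 < 1 - s\<^sup>2" using s by (simp add: power_less_one_iff abs_square_less_1)
  have s': "0 \<le> s" "s < 1" using s by auto
  have fL: "f \<in> L2_gauss" using f by (simp add: gauss_sobolev_def)
  note [measurable] = L2_meas[OF fL]
  \<comment> \<open>a null function; invariance of the measure makes \<open>OU s ?\<phi>\<close> null too, which transfers the bound on \<open>f\<close> to almost all slices\<close>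
  let ?\<phi> = "\<lambda>x. max 0 ((f x)\<^sup>2 - 1)"
  have "AE x in gauss. ?\<phi> x = 0" using b by eventually_elim (simp add: abs_square_le_1)
  then have \<phi>0: "(LINT x|gauss. ?\<phi> x) = 0"
    by (subst integral_cong_AE[where g = "\<lambda>_. 0"]) (auto simp: measurable_cong_sets[OF sets_gauss refl])
  have \<phi>i: "integrable gauss ?\<phi>"
    using L2_sq[OF fL] by (intro Bochner_Integration.integrable_max) auto
  have O: "integrable gauss (OU s ?\<phi>)" "(LINT x|gauss. OU s ?\<phi> x) = 0"
    using OU_nonneg_facts(2,3)[OF s' _ _ \<phi>i] \<phi>0 by auto
  have On: "0 \<le> OU s ?\<phi> x" for x unfolding OU_def by (intro integral_nonneg_AE) auto
  have A1: "AE x in gauss. OU s ?\<phi> x = 0"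
    using O(2) by (subst (asm) integral_nonneg_eq_0_iff_AE[OF O(1)]) (auto simp: On)
  have A2: "AE x in gauss. integrable gauss (\<lambda>y. ?\<phi> (s *\<^sub>R x + ?\<sigma> *\<^sub>R y))"
    using OU_nonneg_facts(1)[OF s' _ _ \<phi>i] by auto
  have A3: "AE x in gauss. integrable gauss (\<lambda>y. (f (s *\<^sub>R x + ?\<sigma> *\<^sub>R y))\<^sup>2)"
    using OU_nonneg_facts(1)[OF s' _ _ L2_sq[OF fL]] by auto
  show ?thesis
    using A1 A2 A3
  proof eventually_elim
    case (elim x)
    let ?F = "\<lambda>y. f (s *\<^sub>R x + ?\<sigma> *\<^sub>R y)"
    have FL: "?F \<in> L2_gauss" using elim(3) by (intro L2I) auto
    have "(LINT y|gauss. (?F y)\<^sup>2) \<le> (LINT y|gauss. ?\<phi> (s *\<^sub>R x + ?\<sigma> *\<^sub>R y) + 1)"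
      using elim(2,3) by (intro integral_mono) auto
    also have "\<dots> = 1" using elim(1,2) by (simp add: OU_def)
    finally have F1: "(LINT y|gauss. (?F y)\<^sup>2) \<le> 1" .
    have "(\<Sum>\<kappa>\<in>idx. (OU s (D \<kappa>) x)\<^sup>2) = (\<Sum>\<kappa>\<in>idx. (1 / (1 - s\<^sup>2)) ^ k * (coef ?F \<kappa>)\<^sup>2)"
    proof (intro sum.cong refl)
      fix \<kappa> assume "\<kappa> \<in> idx"
      have "((1 / ?\<sigma>) ^ k)\<^sup>2 = (1 / (1 - s\<^sup>2)) ^ k"
        using s2 by (simp add: power_mult[symmetric] mult.commute[of k] power_mult power_divide)
      then show "(OU s (D \<kappa>) x)\<^sup>2 = (1 / (1 - s\<^sup>2)) ^ k * (coef ?F \<kappa>)\<^sup>2"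
        unfolding OU_weak_D[OF \<open>\<kappa> \<in> idx\<close> s] power_mult_distrib by simp
    qed
    also have "\<dots> = (1 / (1 - s\<^sup>2)) ^ k * energy ?F k" by (simp add: energy_def sum_distrib_left)
    also have "\<dots> \<le> (1 / (1 - s\<^sup>2)) ^ k * 1"
      using s2 energy_le[OF FL, of k] F1 by (intro mult_left_mono) auto
    finally show ?case by simp
  qed
qed

text \<open>The norm of an average is at most the average of the norm; proved by duality with the averaged vector itself.\<close>

lemma OU_grad_le:
  assumes s: "0 < s" "s < 1"
  shows "AE x in gauss. sqrt (\<Sum>\<kappa>\<in>idx. (OU s (D \<kappa>) x)\<^sup>2) \<le> OU s (grad_norm k f) x"
proof -
  let ?\<sigma> = "sqrt (1 - s\<^sup>2)"
  have s': "0 \<le> s" "s < 1" using s by auto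
  have "AE x in gauss. integrable gauss (\<lambda>y. D \<kappa> (s *\<^sub>R x + ?\<sigma> *\<^sub>R y))" if "\<kappa> \<in> idx" for \<kappa>
    by (rule OU_integrable_AE[OF s' L2_meas L2_integrable]) (rule D_L2[OF that])+
  then have A: "AE x in gauss. \<forall>\<kappa>\<in>idx. integrable gauss (\<lambda>y. D \<kappa> (s *\<^sub>R x + ?\<sigma> *\<^sub>R y))"
    by (intro AE_finite_allI finite_mi_size)
  have B: "AE x in gauss. integrable gauss (\<lambda>y. grad_norm k f (s *\<^sub>R x + ?\<sigma> *\<^sub>R y))"
    by (rule OU_integrable_AE[OF s' L2_meas L2_integrable]) (rule grad_norm_L2)+
  show ?thesis
    using A B
  proof eventually_elim
    case (elim x)
    let ?G = "\<lambda>y. grad_norm k f (s *\<^sub>R x + ?\<sigma> *\<^sub>R y)"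
    define a where "a \<kappa> = OU s (D \<kappa>) x" for \<kappa>
    define A where "A = sqrt (\<Sum>\<kappa>\<in>idx. (a \<kappa>)\<^sup>2)"
    have A0: "0 \<le> A" by (simp add: A_def sum_nonneg)
    have A2: "A * A = (\<Sum>\<kappa>\<in>idx. (a \<kappa>)\<^sup>2)" by (simp add: A_def sum_nonneg)
    have "A * A = (LINT y|gauss. (\<Sum>\<kappa>\<in>idx. a \<kappa> * D \<kappa> (s *\<^sub>R x + ?\<sigma> *\<^sub>R y)))"
      unfolding A2 using elim(1) by (subst Bochner_Integration.integral_sum) (auto simp: a_def OU_def power2_eq_square)
    also have "\<dots> \<le> (LINT y|gauss. A * ?G y)"
    proof (rule integral_mono)
      show "integrable gauss (\<lambda>y. \<Sum>\<kappa>\<in>idx. a \<kappa> * D \<kappa> (s *\<^sub>R x + ?\<sigma> *\<^sub>R y))" using elim(1) by auto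
      show "integrable gauss (\<lambda>y. A * ?G y)" using elim(2) by simp
      fix y
      have "(\<Sum>\<kappa>\<in>idx. a \<kappa> * D \<kappa> (s *\<^sub>R x + ?\<sigma> *\<^sub>R y)) \<le> L2_set a idx * L2_set (\<lambda>\<kappa>. D \<kappa> (s *\<^sub>R x + ?\<sigma> *\<^sub>R y)) idx"
        by (rule order_trans[OF sum_mono L2_set_mult_ineq]) (simp add: abs_mult[symmetric])
      then show "(\<Sum>\<kappa>\<in>idx. a \<kappa> * D \<kappa> (s *\<^sub>R x + ?\<sigma> *\<^sub>R y)) \<le> A * ?G y"
        by (simp add: L2_set_def A_def grad_norm_def)
    qed
    also have "\<dots> = A * OU s (grad_norm k f) x" by (simp add: OU_def)
    finally have "A * A \<le> A * OU s (grad_norm k f) x" .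
    moreover have "0 \<le> OU s (grad_norm k f) x" unfolding OU_def by (intro integral_nonneg_AE) (auto simp: grad_norm_nonneg)
    ultimately have "A \<le> OU s (grad_norm k f) x"
      using A0 by (cases "A = 0") auto
    then show ?case by (simp add: A_def a_def)
  qed
qed

text \<open>\<open>Phi s\<close> is the integral of the inner product of the gradient with its smoothing. The norm of the smoothing is at most \<open>b\<close> and at most \<open>T\<close>, the
smoothed norm of the gradient, so it is at most \<open>b powr (2 - p) * T powr (p - 1)\<close>; then Young's inequality applies with the
exponent \<open>p\<close>, and smoothing is a contraction of \<open>L\<^sup>p\<close>.\<close>

lemma Phi_bound:
  assumes b: "AE x in gauss. \<bar>f x\<bar> \<le> 1" and p: "1 \<le> p" "p < 2" and s: "0 < s" "s < 1"
  shows "lw.Phi s \<le> (LINT x|gauss. \<bar>grad_norm k f x\<bar> powr p) * (1 - s\<^sup>2) powr (- (real k * (1 - p / 2)))"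
proof -
  let ?G = "grad_norm k f"
  let ?P = "LINT x|gauss. \<bar>?G x\<bar> powr p"
  have s2: "0 < 1 - s\<^sup>2" using s by (simp add: power_less_one_iff abs_square_less_1)
  have s': "0 \<le> s" "s < 1" using s by auto
  define b where "b = (1 - s\<^sup>2) powr (- (real k / 2))"
  have b0: "0 < b" using s2 by (simp add: b_def)
  have bb: "(1 / (1 - s\<^sup>2)) ^ k = b\<^sup>2"
    using s2 by (simp add: b_def power2_eq_square powr_add[symmetric] powr_minus powr_realpow power_one_over inverse_eq_divide)
  have b2p: "b powr (2 - p) = (1 - s\<^sup>2) powr (- (real k * (1 - p / 2)))"
  proof -
    have "- (real k / 2) * (2 - p) = - (real k * (1 - p / 2))" by (simp add: field_simps)
    then show ?thesis by (simp only: b_def powr_powr)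
  qed
  define T where "T x = OU s ?G x" for x
  have iP: "integrable gauss (\<lambda>x. \<bar>?G x\<bar> powr p)" using p by (intro L2_powr_integrable grad_norm_L2) auto
  have iT: "integrable gauss (\<lambda>x. \<bar>T x\<bar> powr p)" "(LINT x|gauss. \<bar>T x\<bar> powr p) \<le> ?P"
    unfolding T_def using p by (auto intro!: OU_Lq[OF s' grad_norm_L2])
  have iD: "integrable gauss (\<lambda>x. D \<kappa> x * OU s (D \<kappa>) x)" if "\<kappa> \<in> idx" for \<kappa>
    by (intro L2_prod_integrable D_L2[OF that] OU_L2(1)[OF s'])
  have "lw.Phi s = (\<Sum>\<kappa>\<in>idx. \<Sum>l. s ^ l * energy (D \<kappa>) l)" using s by (intro Phi_sum) auto
  also have "\<dots> = (\<Sum>\<kappa>\<in>idx. LINT x|gauss. D \<kappa> x * OU s (D \<kappa>) x)"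
    using OU_form[OF s' D_L2] by (intro sum.cong refl) (simp add: sums_iff)
  also have "\<dots> = (LINT x|gauss. (\<Sum>\<kappa>\<in>idx. D \<kappa> x * OU s (D \<kappa>) x))"
    using iD by (intro Bochner_Integration.integral_sum[symmetric])
  also have "\<dots> \<le> (LINT x|gauss. b powr (2 - p) * (1 / p * \<bar>?G x\<bar> powr p + (1 - 1 / p) * \<bar>T x\<bar> powr p))"
  proof (rule integral_mono_AE)
    show "integrable gauss (\<lambda>x. \<Sum>\<kappa>\<in>idx. D \<kappa> x * OU s (D \<kappa>) x)" using iD by auto
    show "integrable gauss (\<lambda>x. b powr (2 - p) * (1 / p * \<bar>?G x\<bar> powr p + (1 - 1 / p) * \<bar>T x\<bar> powr p))"
      using iP iT by simp
    show "AE x in gauss. (\<Sum>\<kappa>\<in>idx. D \<kappa> x * OU s (D \<kappa>) x) \<le> b powr (2 - p) * (1 / p * \<bar>?G x\<bar> powr p + (1 - 1 / p) * \<bar>T x\<bar> powr p)"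
      using OU_grad_bounded[OF assms(1) s] OU_grad_le[OF s]
    proof eventually_elim
      case (elim x)
      define A where "A = sqrt (\<Sum>\<kappa>\<in>idx. (OU s (D \<kappa>) x)\<^sup>2)"
      have A: "0 \<le> A" "A \<le> T x" using elim(2) by (auto simp: A_def T_def sum_nonneg)
      have "A \<le> sqrt (b\<^sup>2)" unfolding A_def using elim(1) by (simp only: bb real_sqrt_le_iff)
      then have Ab: "A \<le> b" using b0 by simp
      have AA: "A \<le> b powr (2 - p) * \<bar>T x\<bar> powr (p - 1)"
      proof (cases "A = 0")
        case False
        then have "A = A powr (2 - p) * A powr (p - 1)" using A by (simp add: powr_add[symmetric])
        also have "\<dots> \<le> b powr (2 - p) * \<bar>T x\<bar> powr (p - 1)"
          using A Ab p by (intro mult_mono powr_mono2) auto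
        finally show ?thesis .
      qed simp
      have "(\<Sum>\<kappa>\<in>idx. D \<kappa> x * OU s (D \<kappa>) x) \<le> L2_set (\<lambda>\<kappa>. D \<kappa> x) idx * L2_set (\<lambda>\<kappa>. OU s (D \<kappa>) x) idx"
        by (rule order_trans[OF sum_mono L2_set_mult_ineq]) (simp add: abs_mult[symmetric])
      also have "\<dots> = ?G x * A" by (simp add: L2_set_def A_def grad_norm_def)
      also have "\<dots> \<le> ?G x * (b powr (2 - p) * \<bar>T x\<bar> powr (p - 1))"
        by (intro mult_left_mono AA grad_norm_nonneg)
      also have "\<dots> = b powr (2 - p) * ((\<bar>?G x\<bar> powr p) powr (1 / p) * (\<bar>T x\<bar> powr p) powr (1 - 1 / p))"
      proof -
        have "p * (1 - 1 / p) = p - 1" using p by (simp add: field_simps)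
        then show ?thesis using p grad_norm_nonneg[of x] by (simp add: powr_powr)
      qed
      also have "\<dots> \<le> b powr (2 - p) * (1 / p * \<bar>?G x\<bar> powr p + (1 - 1 / p) * \<bar>T x\<bar> powr p)"
        using p by (intro mult_left_mono weighted_am_gm) auto
      finally show ?case .
    qed
  qed
  also have "\<dots> = b powr (2 - p) * (1 / p * ?P + (1 - 1 / p) * (LINT x|gauss. \<bar>T x\<bar> powr p))"
    using iP iT by simp
  also have "\<dots> \<le> b powr (2 - p) * (1 / p * ?P + (1 - 1 / p) * ?P)"
    using p iT by (intro mult_left_mono add_left_mono) auto
  also have "\<dots> = ?P * b powr (2 - p)" by (simp add: algebra_simps)
  finally show ?thesis unfolding b2p .
qed

lemma second_inequality:
  assumes b: "AE x in gauss. \<bar>f x\<bar> \<le> 1" and q: "1 \<le> q" "q \<le> p" "p < 2"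
  shows "C_const p q ^ k * high_weight k f * (1 + q / (2 * real k * (2 - q)) * ln_plus (1 / deriv_Lq q)) powr (real k * p / 2)
    \<le> Lp_norm p (grad_norm k f) powr p"
proof -
  let ?P = "LINT x|gauss. \<bar>grad_norm k f x\<bar> powr p"
  have p: "1 \<le> p" "p < 2" and q2: "q < 2" using q by auto
  have PL: "Lp_norm p (grad_norm k f) powr p = ?P"
    using p by (simp add: Lp_norm_def powr_powr)
  show ?thesis
  proof (cases "lw.W = 0")
    case False
    then have W: "0 < lw.W" using lw.W_nonneg by simp
    note Z = deriv_Lq_pos[OF p W]
    note QP = minkowski_grad[OF p Z]
    have "0 < ?P" by (rule less_le_trans[OF _ QP]) (use Z in simp)
    from lw.Lp_lower_bound[OF deriv_hyper[OF q(1) q2] deriv_hyper[OF p] q deriv_Lq_pos[OF q(1) q2 W] Z W this QP Phi_bound[OF b p]]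
    show ?thesis unfolding PL W_eq .
  qed (simp add: W_eq[symmetric])
qed

lemmas sobolev_inequalities = first_inequality[unfolded deriv_Lq_def] second_inequality[unfolded deriv_Lq_def]

end

section \<open>The inequalities\<close>

lemma mi_size_0_iff: "mi_size \<kappa> = 0 \<longleftrightarrow> \<kappa> = (\<lambda>_. 0)"
  by (auto simp: mi_size_def)

lemma grad_norm_0: "grad_norm 0 f x = \<bar>f x\<bar>"
  by (simp add: grad_norm_def mi_size_0_iff weak_D_def)

lemma high_weight_0:
  assumes "f \<in> L2_gauss" shows "high_weight 0 f = (LINT x|gauss. (f x)\<^sup>2)"
  using parseval[OF assms] by (simp add: high_weight_eq[OF assms] sums_iff)

theorem theorem1p10:
  "(\<forall>(k::nat) (f::real^'n \<Rightarrow> real) (q::real).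
      f \<in> gauss_sobolev k \<longrightarrow> 1 \<le> q \<longrightarrow> q < 2 \<longrightarrow>
      (Lp_norm 2 (grad_norm k f))\<^sup>2 \<ge>
        high_weight k f *
        (1 + q / (2 * real k * (2 - q)) *
          ln_plus (high_weight k f / (\<Sum>\<kappa> | mi_size \<kappa> = k. (Lp_norm q (weak_D \<kappa> f))\<^sup>2))) ^ k \<and>
      (\<forall>p::real. (AE x in gauss. \<bar>f x\<bar> \<le> 1) \<longrightarrow> q \<le> p \<longrightarrow> p < 2 \<longrightarrow>
        Lp_norm p (grad_norm k f) powr p \<ge>
          C_const p q ^ k * high_weight k f *
          (1 + q / (2 * real k * (2 - q)) *
            ln_plus (1 / (\<Sum>\<kappa> | mi_size \<kappa> = k. (Lp_norm q (weak_D \<kappa> f))\<^sup>2)))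
          powr (real k * p / 2))) \<and>
   (\<exists>c::real. c > 0 \<and>
      (\<forall>p q. 1 \<le> q \<longrightarrow> q \<le> p \<longrightarrow> p < 2 \<longrightarrow> C_const p q \<ge> c * (2 - p) * (2 - q)))"
proof (intro conjI allI impI)
  show "\<exists>c::real. c > 0 \<and> (\<forall>p q. 1 \<le> q \<longrightarrow> q \<le> p \<longrightarrow> p < 2 \<longrightarrow> C_const p q \<ge> c * (2 - p) * (2 - q))"
    using C_const_lower_bound by (intro exI[of _ "1 / 33"]) auto
next
  fix k :: nat and f :: "real^'n \<Rightarrow> real" and q :: real
  assume f: "f \<in> gauss_sobolev k" and q: "1 \<le> q" "q < 2"
  show "high_weight k f *
      (1 + q / (2 * real k * (2 - q)) *
        ln_plus (high_weight k f / (\<Sum>\<kappa> | mi_size \<kappa> = k. (Lp_norm q (weak_D \<kappa> f))\<^sup>2))) ^ k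
    \<le> (Lp_norm 2 (grad_norm k f))\<^sup>2"
  proof (cases "k = 0")
    case True
    have "f \<in> L2_gauss" using f by (simp add: gauss_sobolev_def)
    then show ?thesis unfolding Lp_norm_2_sq by (simp add: True high_weight_0 grad_norm_0)
  next
    case False
    then show ?thesis by (intro sobolev_inequalities(1)[OF f _ q]) simp
  qed
next
  fix k :: nat and f :: "real^'n \<Rightarrow> real" and q p :: real
  assume f: "f \<in> gauss_sobolev k" and q: "1 \<le> q" "q < 2" and b: "AE x in gauss. \<bar>f x\<bar> \<le> 1"
    and p: "q \<le> p" "p < 2"
  show "C_const p q ^ k * high_weight k f *
      (1 + q / (2 * real k * (2 - q)) *
        ln_plus (1 / (\<Sum>\<kappa> | mi_size \<kappa> = k. (Lp_norm q (weak_D \<kappa> f))\<^sup>2)))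
      powr (real k * p / 2)
    \<le> Lp_norm p (grad_norm k f) powr p"
  proof (cases "k = 0")
    case True
    have fL: "f \<in> L2_gauss" using f by (simp add: gauss_sobolev_def)
    \<comment> \<open>without derivatives the bracket disappears, and \<open>f\<^sup>2 \<le> \<bar>f\<bar> powr p\<close> because \<open>\<bar>f\<bar> \<le> 1\<close>\<close>
    have "(LINT x|gauss. (f x)\<^sup>2) \<le> (LINT x|gauss. \<bar>f x\<bar> powr p)"
    proof (rule integral_mono_AE[OF L2_sq[OF fL] L2_powr_integrable[OF fL]])
      show "AE x in gauss. (f x)\<^sup>2 \<le> \<bar>f x\<bar> powr p"
        using b
      proof eventually_elim
        case (elim x)
        have "(f x)\<^sup>2 = \<bar>f x\<bar> powr 2" by simp
        also have "\<dots> \<le> \<bar>f x\<bar> powr p" using elim p by (intro powr_mono') auto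
        finally show ?case .
      qed
    qed (use q p in auto)
    moreover have "Lp_norm p (grad_norm k f) powr p = (LINT x|gauss. \<bar>f x\<bar> powr p)"
      using q p by (simp add: True Lp_norm_def powr_powr grad_norm_0)
    ultimately show ?thesis by (simp add: True high_weight_0[OF fL])
  next
    case False
    then show ?thesis by (intro sobolev_inequalities(2)[OF f _ b q(1) p]) simp
  qed
qed

end
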